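(* Let $\varphi_1,\dots,\varphi_n\in H^\infty(\mathbb G_2)$ and let $\epsilon>0$. Then the following are equivalent: (1) there exist $f_1,\dots,f_n\in H^\infty(\mathbb G_2)$ such that $\sup_{z\in\mathbb G_2}\big[|f_1(z)|^2+\dots+|f_n(z)|^2\big]\le\frac1{\epsilon^2}$ and $\sum_{i=1}^n\varphi_if_i=1$; (2) the map $(z,w)\mapsto\Big(\sum_{j=1}^n\varphi_j(z^{(2)},z^{(3)})\overline{\varphi_j(w^{(2)},w^{(3)})}-\epsilon^2\Big)k(z,w)$ on $\mathbb P\times\mathbb P$ is positive semi-definite for every $k\in AK(\mathbb P)$; (3) there exist positive kernels $\xi,\nabla:\mathbb P\times\mathbb P\to C(\overline{\mathbb D})^*$ and a weak kernel $\delta:\mathbb P\times\mathbb P\to\mathbb C$ such that for all $z,w\in\mathbb P$, $$\sum_{j=1}^n\varphi_j(z^{(2)},z^{(3)})\overline{\varphi_j(w^{(2)},w^{(3)})}-\epsilon^2=\xi(z,w)\big(1-\mathrm J(z)\overline{\mathrm J(w)}\big)+\nabla(z,w)\big(1-\mathrm j(z)\overline{\mathrm j(w)}\big)+\Big(1-\frac{z^{(2)}\overline{w}^{(2)}}{4}\Big)\delta(z,w).$$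
   Context: $\mathbb D$ is the open unit disc in $\mathbb C$, $\overline{\mathbb D}$ its closure, and $C(\overline{\mathbb D})$ is the space of continuous complex functions on $\overline{\mathbb D}$ with dual $C(\overline{\mathbb D})^*$. $H^\infty(\Omega)$ is the algebra of bounded holomorphic functions on $\Omega$. The symmetrized bidisc is $\mathbb G_2=\{(\lambda_1+\lambda_2,\lambda_1\lambda_2):\lambda_1,\lambda_2\in\mathbb D\}\subset\mathbb C^2$. The pentablock is $\mathbb P=\{(a_{21},\operatorname{tr}A,\det A)\in\mathbb C^3: A=[a_{ij}]\in M_2(\mathbb C),\ \|A\|<1\}$; points are written $z=(z^{(1)},z^{(2)},z^{(3)})$. If $z\in\mathbb P$ then $(z^{(2)},z^{(3)})\in\mathbb G_2$. For $\alpha\in\overline{\mathbb D}$ put $$\Phi_\alpha(z^{(2)},z^{(3)})=\frac{2\alpha z^{(3)}-z^{(2)}}{2-\alpha z^{(2)}},\qquad \psi_\alpha(z^{(1)},z^{(2)},z^{(3)})=\frac{(1-|\alpha|^2)z^{(1)}}{1-\alpha z^{(2)}+\alpha^2z^{(3)}}.$$ For $z\in\mathbb P$ define the continuous functions $\mathrm J(z),\mathrm j(z)\in C(\overline{\mathbb D})$ by $\mathrm J(z)(\alpha)=\psi_\alpha(z)$ and $\mathrm j(z)(\alpha)=\Phi_\alpha(z^{(2)},z^{(3)})$; both have supremum norm $<1$. A function $k:\mathbb P\times\mathbb P\to\mathbb C$ is positive semi-definite (a weak kernel) if $\sum_{i,j=1}^N k(z_i,z_j)c_j\overline{c_i}\ge0$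 for all $N$, $z_1,\dots,z_N\in\mathbb P$, $c_1,\dots,c_N\in\mathbb C$; it is a kernel if moreover $k(z,z)\ne0$ for all $z$. $AK(\mathbb P)$ is the set of (scalar) admissible kernels: kernels $k$ on $\mathbb P$ such that for all $\alpha\in\overline{\mathbb D}$ the functions $(1-\tfrac{z^{(2)}\overline{w}^{(2)}}{4})k(z,w)$, $(1-\Phi_\alpha(z^{(2)},z^{(3)})\overline{\Phi_\alpha(w^{(2)},w^{(3)})})k(z,w)$ and $(1-\psi_\alpha(z)\overline{\psi_\alpha(w)})k(z,w)$ are positive semi-definite in $(z,w)$. A positive kernel is a map $\xi:\mathbb P\times\mathbb P\to C(\overline{\mathbb D})^*$ such that $\sum_{i,j=1}^N\xi(z_i,z_j)(h_i\overline{h_j})c_j\overline{c_i}\ge0$ for all $N$, $z_i\in\mathbb P$, $h_i\in C(\overline{\mathbb D})$, $c_i\in\mathbb C$. *)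

theory Defs
  imports "HOL-Analysis.Analysis"
begin

text \<open>
  Functions on a domain are total functions of which only the values on the domain are constrained.
  A point of the pentablock is a triple \<open>z = (z1, z2, z3)\<close>; thus \<open>snd z = (z2, z3)\<close>
  is the corresponding point of the symmetrized bidisc.
\<close>

text \<open>Complex differentiability: the Frechet derivative at each point is complex linear.\<close>

definition holomorphic_on_C2 :: "(complex \<times> complex \<Rightarrow> complex) \<Rightarrow> (complex \<times> complex) set \<Rightarrow> bool" where
  "holomorphic_on_C2 f \<Omega> \<longleftrightarrow>
     (\<forall>p\<in>\<Omega>. \<exists>a b. (f has_derivative (\<lambda>(u, v). a * u + b * v)) (at p within \<Omega>))"

definition H_infinity :: "(complex \<times> complex) set \<Rightarrow> (complex \<times> complex \<Rightarrow> complex) set" where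
  "H_infinity \<Omega> = {f. holomorphic_on_C2 f \<Omega> \<and> bounded (f ` \<Omega>)}"

definition sym_bidisc :: "(complex \<times> complex) set" where
  "sym_bidisc = {(l1 + l2, l1 * l2) | l1 l2. l1 \<in> ball 0 1 \<and> l2 \<in> ball 0 1}"

text \<open>The norm on \<open>complex ^ 2\<close> is Euclidean, so \<open>onorm\<close> is the usual operator norm.\<close>

definition pentablock :: "(complex \<times> complex \<times> complex) set" where
  "pentablock = {(A $ 2 $ 1, trace A, det A) | A :: complex ^ 2 ^ 2. onorm ((*v) A) < 1}"

definition Phi :: "complex \<Rightarrow> complex \<times> complex \<Rightarrow> complex" where
  "Phi \<alpha> = (\<lambda>(z2, z3). (2 * \<alpha> * z3 - z2) / (2 - \<alpha> * z2))"

definition psi :: "complex \<Rightarrow> complex \<times> complex \<times> complex \<Rightarrow> complex" where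
  "psi \<alpha> = (\<lambda>(z1, z2, z3).
     of_real (1 - (cmod \<alpha>)\<^sup>2) * z1 / (1 - \<alpha> * z2 + \<alpha>\<^sup>2 * z3))"

definition JJ :: "complex \<times> complex \<times> complex \<Rightarrow> complex \<Rightarrow> complex" where
  "JJ z = (\<lambda>\<alpha>. psi \<alpha> z)"

definition jj :: "complex \<times> complex \<times> complex \<Rightarrow> complex \<Rightarrow> complex" where
  "jj z = (\<lambda>\<alpha>. Phi \<alpha> (snd z))"

definition psd_on :: "'a set \<Rightarrow> ('a \<Rightarrow> 'a \<Rightarrow> complex) \<Rightarrow> bool" where
  "psd_on X k \<longleftrightarrow>
     (\<forall>(N::nat) (z :: nat \<Rightarrow> 'a) (c :: nat \<Rightarrow> complex).
        (\<forall>i\<in>{1..N}. z i \<in> X) \<longrightarrow>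
        (\<Sum>i=1..N. \<Sum>j=1..N. k (z i) (z j) * c j * cnj (c i)) \<in> \<real>\<^sub>\<ge>\<^sub>0)"

definition kernel_on :: "'a set \<Rightarrow> ('a \<Rightarrow> 'a \<Rightarrow> complex) \<Rightarrow> bool" where
  "kernel_on X k \<longleftrightarrow> psd_on X k \<and> (\<forall>z\<in>X. k z z \<noteq> 0)"

definition AK :: "(complex \<times> complex \<times> complex \<Rightarrow> complex \<times> complex \<times> complex \<Rightarrow> complex) set" where
  "AK = {k. kernel_on pentablock k \<and>
     (\<forall>\<alpha>\<in>cball 0 1.
        psd_on pentablock (\<lambda>z w. (1 - fst (snd z) * cnj (fst (snd w)) / 4) * k z w) \<and>
        psd_on pentablock (\<lambda>z w. (1 - Phi \<alpha> (snd z) * cnj (Phi \<alpha> (snd w))) * k z w) \<and>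
        psd_on pentablock (\<lambda>z w. (1 - psi \<alpha> z * cnj (psi \<alpha> w)) * k z w))}"

definition C_disc :: "(complex \<Rightarrow> complex) set" where
  "C_disc = {h. continuous_on (cball 0 1) h}"

text \<open>
  The dual of the continuous functions on the closed disc: bounded complex-linear functionals.
  Linearity and the norm bound force \<open>L h\<close> to depend only on the values of \<open>h\<close> on the
  closed disc; values of \<open>L\<close> outside \<^term>\<open>C_disc\<close> are irrelevant.
\<close>

definition C_disc_dual :: "((complex \<Rightarrow> complex) \<Rightarrow> complex) set" where
  "C_disc_dual = {L.
     (\<forall>g\<in>C_disc. \<forall>h\<in>C_disc. L (\<lambda>\<alpha>. g \<alpha> + h \<alpha>) = L g + L h) \<and>
     (\<forall>c. \<forall>h\<in>C_disc. L (\<lambda>\<alpha>. c * h \<alpha>) = c * L h) \<and>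
     (\<exists>B. \<forall>h\<in>C_disc. cmod (L h) \<le> B * (SUP \<alpha>\<in>cball 0 1. cmod (h \<alpha>)))}"

definition positive_kernel_on :: "'a set \<Rightarrow> ('a \<Rightarrow> 'a \<Rightarrow> (complex \<Rightarrow> complex) \<Rightarrow> complex) \<Rightarrow> bool" where
  "positive_kernel_on X \<xi> \<longleftrightarrow>
     (\<forall>z\<in>X. \<forall>w\<in>X. \<xi> z w \<in> C_disc_dual) \<and>
     (\<forall>(N::nat) (z :: nat \<Rightarrow> 'a) (h :: nat \<Rightarrow> complex \<Rightarrow> complex) (c :: nat \<Rightarrow> complex).
        (\<forall>i\<in>{1..N}. z i \<in> X \<and> h i \<in> C_disc) \<longrightarrow>
        (\<Sum>i=1..N. \<Sum>j=1..N.
           \<xi> (z i) (z j) (\<lambda>\<alpha>. h i \<alpha> * cnj (h j \<alpha>)) * c j * cnj (c i)) \<in> \<real>\<^sub>\<ge>\<^sub>0)"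

end

theory Submission
  imports Defs "HOL-Complex_Analysis.Complex_Analysis"
begin

text \<open>
  (3) implies (2): a positive kernel with values in the dual of the continuous functions, applied to a matrix
  of functions that is pointwise positive, gives a positive matrix (Schur complements), so \<open>\<xi>\<close> and \<open>\<nabla>\<close> may be
  multiplied by an admissible kernel.

  (2) implies (1) and (3): on a finite subset of the symmetrized bidisc the matrix
  \<open>\<Sum> \<phi>\<^sub>j(x) cnj (\<phi>\<^sub>j(y)) - \<epsilon>\<^sup>2\<close>, perturbed by \<open>\<eta>\<close> on the diagonal, lies in the cone generated by the matrices
  \<open>(1 - \<Phi>\<^sub>\<alpha>(x) cnj (\<Phi>\<^sub>\<alpha>(y))) v\<^sub>x cnj v\<^sub>y\<close>; otherwise a separating functional yields an admissible kernel,
  supported on points with first coordinate 0 where all \<open>\<psi>\<^sub>\<alpha>\<close> vanish, which contradicts (2). A lurking isometry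
  turns each such finite decomposition into a contractive transfer function, and Tychonoff compactness produces
  global solutions, both for the corona problem and for the Agler decomposition.

  (1) implies (2): an admissible kernel \<open>K\<close>, restricted to a finite set, is realised in a Hardy space with fibre
  inner product \<open>(1 - p\<^sub>i cnj (p\<^sub>j)) K\<^sub>i\<^sub>j\<close>, where multiplication by \<open>(s, p)\<close> becomes a compression of a pencil
  \<open>s + t (\<eta> - p)\<close> and the scalar \<open>\<eta>\<close>. On the unit circle the pencil is a unimodular scalar times a selfadjoint
  operator of norm at most 2, so polynomials in it are controlled by their values on the symmetrized torus. Dilation
  and interpolation approximate the \<open>f\<^sub>i\<close> by such polynomials.
\<close>

section \<open>Hermitian forms on finite sets\<close>

text \<open>All operator theory is done with finite matrices. One tool, simultaneous diagonalization
  of two hermitian forms, supplies square roots, dual bases, isometries and spectral decompositions.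
  It asks for a definite first form, so small multiples of the identity are added at each stage and
  disappear only in a limit. The cone of finite decompositions is not known to be closed; the
  diagonal \<eta> absorbs the approximation error, and in the lurking isometry it also makes the
  Gram matrix invertible. Tychonoff needs a priori bounds that do not depend on the finite set. For
  the functionals they come from the diagonal of the decomposition, because the tests stay uniformly
  away from modulus 1 at a fixed point. For the corona solutions they are Cauchy estimates. In (1)
  implies (2) the bound concerns the whole row of functions, so a scalar von Neumann inequality
  would not suffice. At each point of the circle one eigenbasis of the pencil serves all entries of
  the row, and the row bound is applied at each joint eigenvalue.\<close>

lemma compact_dependent_product:
  fixes K :: "'a \<Rightarrow> ('b::topological_space) set"
  assumes "\<And>x. compact (K x)"
  shows "compact {f. \<forall>x. f x \<in> K x}"
proof -
  have "compactin (product_topology (\<lambda>i. euclidean) UNIV) (PiE UNIV K)"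
    using assms by (simp add: compactin_PiE)
  then show ?thesis
    by (simp add: euclidean_product_topology PiE_UNIV_domain Pi_def)
qed

lemma continuous_on_coordinate [continuous_intros]:
  fixes A :: "('a \<Rightarrow> 'b::topological_space) set"
  shows "continuous_on A (\<lambda>f. f x)"
  by (rule continuous_on_subset[OF continuous_on_product_coordinates]) auto

text \<open>The vector enters unconjugated in the first index. The quadratic form of
  \<open>psd_on\<close> with coefficients c is therefore \<open>hform\<close> at the conjugate of
  c.\<close>

definition hform :: "'a set \<Rightarrow> ('a \<Rightarrow> 'a \<Rightarrow> complex) \<Rightarrow> ('a \<Rightarrow> complex) \<Rightarrow> ('a \<Rightarrow> complex) \<Rightarrow> complex" where
  "hform S L x y = (\<Sum>i\<in>S. \<Sum>j\<in>S. L i j * x i * cnj (y j))"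

definition hermitian_on :: "'a set \<Rightarrow> ('a \<Rightarrow> 'a \<Rightarrow> complex) \<Rightarrow> bool" where
  "hermitian_on S L \<longleftrightarrow> (\<forall>i\<in>S. \<forall>j\<in>S. L j i = cnj (L i j))"

definition pos_on :: "'a set \<Rightarrow> ('a \<Rightarrow> 'a \<Rightarrow> complex) \<Rightarrow> bool" where
  "pos_on S L \<longleftrightarrow> (\<forall>x. hform S L x x \<in> \<real>\<^sub>\<ge>\<^sub>0)"

lemma hform_add_left: "hform S L (\<lambda>i. x i + x' i) y = hform S L x y + hform S L x' y"
  by (simp add: hform_def algebra_simps sum.distrib)

lemma hform_add_right: "hform S L x (\<lambda>i. y i + y' i) = hform S L x y + hform S L x y'"
  by (simp add: hform_def algebra_simps sum.distrib)

lemma hform_scale_left: "hform S L (\<lambda>i. c * x i) y = c * hform S L x y"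
  by (simp add: hform_def sum_distrib_left mult_ac)

lemma hform_scale_right: "hform S L x (\<lambda>i. c * y i) = cnj c * hform S L x y"
  by (simp add: hform_def sum_distrib_left mult_ac)

lemma hform_diff_left: "hform S L (\<lambda>i. x i - x' i) y = hform S L x y - hform S L x' y"
  by (simp add: hform_def algebra_simps sum_subtractf)

lemma hform_diff_right: "hform S L x (\<lambda>i. y i - y' i) = hform S L x y - hform S L x y'"
  by (simp add: hform_def algebra_simps sum_subtractf)

lemma hform_matrix_add: "hform S (\<lambda>i j. L i j + M i j) x y = hform S L x y + hform S M x y"
  by (simp add: hform_def algebra_simps sum.distrib)

lemma hform_matrix_diff: "hform S (\<lambda>i j. L i j - M i j) x y = hform S L x y - hform S M x y"
  by (simp add: hform_def algebra_simps sum_subtractf)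

lemma hform_matrix_scale: "hform S (\<lambda>i j. c * L i j) x y = c * hform S L x y"
  by (simp add: hform_def sum_distrib_left mult_ac)

lemma hform_rank_one:
  "hform S (\<lambda>i j. v i * cnj (w j)) x y = (\<Sum>i\<in>S. v i * x i) * cnj (\<Sum>j\<in>S. w j * y j)"
proof -
  have "hform S (\<lambda>i j. v i * cnj (w j)) x y = (\<Sum>i\<in>S. \<Sum>j\<in>S. (v i * x i) * cnj (w j * y j))"
    by (simp add: hform_def mult_ac)
  then show ?thesis by (simp add: sum_product)
qed

lemma hform_cong:
  assumes "\<And>i j. i \<in> S \<Longrightarrow> j \<in> S \<Longrightarrow> L i j = M i j"
    and "\<And>i. i \<in> S \<Longrightarrow> x i = x' i" and "\<And>i. i \<in> S \<Longrightarrow> y i = y' i"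
  shows "hform S L x y = hform S M x' y'"
  using assms by (auto simp: hform_def intro!: sum.cong)

lemma hermitian_on_diff:
  assumes "hermitian_on S A" "hermitian_on S B"
  shows "hermitian_on S (\<lambda>i j. A i j - B i j)"
  using assms unfolding hermitian_on_def by (metis complex_cnj_diff)

lemma hermitian_on_add:
  assumes "hermitian_on S A" "hermitian_on S B"
  shows "hermitian_on S (\<lambda>i j. A i j + B i j)"
  using assms unfolding hermitian_on_def by (metis complex_cnj_add)

lemma hermitian_on_scale:
  assumes "hermitian_on S A"
  shows "hermitian_on S (\<lambda>i j. of_real c * A i j)"
  using assms unfolding hermitian_on_def by (metis complex_cnj_mult complex_cnj_complex_of_real)

lemma hermitian_on_rank_one: "hermitian_on S (\<lambda>i j. of_real c * (w i * cnj (w j)))"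
  unfolding hermitian_on_def by (simp add: mult_ac)

lemma hermitian_on_subset: "hermitian_on S A \<Longrightarrow> T \<subseteq> S \<Longrightarrow> hermitian_on T A"
  unfolding hermitian_on_def by blast

lemma hform_hermitian:
  assumes "hermitian_on S L"
  shows "hform S L y x = cnj (hform S L x y)"
proof -
  have "hform S L y x = (\<Sum>i\<in>S. \<Sum>j\<in>S. cnj (L j i * x j * cnj (y i)))"
    unfolding hform_def
  proof (intro sum.cong refl)
    fix i j assume "i \<in> S" "j \<in> S"
    then have "L i j = cnj (L j i)" using assms unfolding hermitian_on_def by blast
    then show "L i j * y i * cnj (x j) = cnj (L j i * x j * cnj (y i))" by simp
  qed
  also have "\<dots> = (\<Sum>j\<in>S. \<Sum>i\<in>S. cnj (L j i * x j * cnj (y i)))"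
    by (rule sum.swap)
  finally show ?thesis by (simp add: hform_def)
qed

lemma hform_hermitian_real:
  assumes "hermitian_on S L"
  shows "hform S L x x = of_real (Re (hform S L x x))"
  using arg_cong[OF hform_hermitian[OF assms, of x x], of Im] by (simp add: complex_eq_iff)

lemma hform_mono_supp:
  assumes "finite S" "T \<subseteq> S" "\<And>i. i \<in> S - T \<Longrightarrow> x i = 0"
  shows "hform S L x x = hform T L x x"
proof -
  have "hform S L x x = (\<Sum>i\<in>T. \<Sum>j\<in>S. L i j * x i * cnj (x j))"
    unfolding hform_def using assms
    by (intro sum.mono_neutral_right) auto
  also have "\<dots> = (\<Sum>i\<in>T. \<Sum>j\<in>T. L i j * x i * cnj (x j))"
    using assms by (intro sum.cong refl sum.mono_neutral_right) auto
  finally show ?thesis by (simp add: hform_def)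
qed

lemma sum_delta_mult:
  fixes f :: "'a \<Rightarrow> complex"
  assumes "finite S"
  shows "(\<Sum>i\<in>S. f i * (if i = a then c else 0)) = (if a \<in> S then f a * c else 0)"
proof -
  have "(\<Sum>i\<in>S. f i * (if i = a then c else 0)) = (\<Sum>i\<in>S. if i = a then f i * c else 0)"
    by (intro sum.cong) auto
  then show ?thesis using assms by (simp add: sum.delta)
qed

lemma hform_unit_left:
  assumes "finite S" "a \<in> S"
  shows "hform S L (\<lambda>i. if i = a then 1 else 0) y = (\<Sum>j\<in>S. L a j * cnj (y j))"
proof -
  have "hform S L (\<lambda>i. if i = a then 1 else 0) y =
     (\<Sum>i\<in>S. if i = a then (\<Sum>j\<in>S. L i j * cnj (y j)) else 0)"
    unfolding hform_def by (intro sum.cong refl) simp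
  also have "\<dots> = (\<Sum>j\<in>S. L a j * cnj (y j))"
    unfolding sum.delta[OF assms(1)] using assms(2) by simp
  finally show ?thesis .
qed

lemma hform_unit_right:
  assumes "finite S" "b \<in> S"
  shows "hform S L x (\<lambda>j. if j = b then 1 else 0) = (\<Sum>i\<in>S. L i b * x i)"
  unfolding hform_def
proof (intro sum.cong refl)
  fix i
  have "(\<Sum>j\<in>S. L i j * x i * cnj (if j = b then 1 else 0)) = (\<Sum>j\<in>S. if j = b then L i j * x i else 0)"
    by (intro sum.cong refl) simp
  also have "\<dots> = L i b * x i"
    unfolding sum.delta[OF assms(1)] using assms(2) by simp
  finally show "(\<Sum>j\<in>S. L i j * x i * cnj (if j = b then 1 else 0)) = L i b * x i" .
qed

lemma hform_unit_unit:
  assumes "finite S" "a \<in> S" "b \<in> S"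
  shows "hform S L (\<lambda>i. if i = a then 1 else 0) (\<lambda>j. if j = b then 1 else 0) = L a b"
  unfolding hform_unit_right[OF assms(1,3)] sum_delta_mult[OF assms(1)] using assms by simp

text \<open>Polarization: reality of the form at e_a + c e_b for c = 0, 1, -1, \<i> forces the two
  off-diagonal entries to be conjugate. Positivity thus supplies the symmetry that diagonalization
  asks for.\<close>

lemma pos_on_imp_hermitian:
  assumes "finite S" "pos_on S L"
  shows "hermitian_on S L"
  unfolding hermitian_on_def
proof (intro ballI)
  fix a b assume ab: "a \<in> S" "b \<in> S"
  define ea where "ea = (\<lambda>i. if i = a then 1 else 0 :: complex)"
  define eb where "eb = (\<lambda>i. if i = b then 1 else 0 :: complex)"
  have L: "hform S L ea ea = L a a" "hform S L eb eb = L b b" "hform S L ea eb = L a b"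
    "hform S L eb ea = L b a"
    unfolding ea_def eb_def using ab assms by (simp_all add: hform_unit_unit)
  have *: "Im (L a a + c * L b a + cnj c * (L a b + c * L b b)) = 0" for c
  proof -
    have "hform S L (\<lambda>i. ea i + c * eb i) (\<lambda>i. ea i + c * eb i) \<in> \<real>\<^sub>\<ge>\<^sub>0"
      using assms by (simp add: pos_on_def)
    then show ?thesis
      by (simp add: hform_add_left hform_add_right hform_scale_left hform_scale_right L
          complex_nonneg_Reals_iff algebra_simps)
  qed
  have "Im (L a a) = 0" using *[of 0] by simp
  moreover have "Im (L b b) = 0"
    using *[of 1] *[of "-1"] \<open>Im (L a a) = 0\<close> by simp
  ultimately show "L b a = cnj (L a b)"
    using *[of 1] *[of "\<i>"] by (simp add: complex_eq_iff)
qed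

lemma pos_on_Re_iff:
  assumes "hermitian_on S L"
  shows "pos_on S L \<longleftrightarrow> (\<forall>x. 0 \<le> Re (hform S L x x))"
proof -
  have "Im (hform S L x x) = 0" for x
    using arg_cong[OF hform_hermitian_real[OF assms, of x], of Im] by simp
  then show ?thesis by (simp add: pos_on_def complex_nonneg_Reals_iff)
qed

text \<open>\<open>psd_on\<close> runs over finite sequences, possibly with repeated points. Adding
  the coefficients of equal points reduces it to finite sets, where matrix arguments apply.\<close>

lemma psd_on_iff: "psd_on X k \<longleftrightarrow> (\<forall>S. finite S \<and> S \<subseteq> X \<longrightarrow> pos_on S k)"
proof
  assume k: "psd_on X k"
  show "\<forall>S. finite S \<and> S \<subseteq> X \<longrightarrow> pos_on S k"
  proof (intro allI impI)
    fix S assume S: "finite S \<and> S \<subseteq> X"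
    obtain z where z: "bij_betw z {1..card S} S"
      using S ex_bij_betw_nat_finite_1 by blast
    show "pos_on S k"
      unfolding pos_on_def
    proof
      fix x
      have "\<forall>i\<in>{1..card S}. z i \<in> X"
        using z S by (auto simp: bij_betw_def)
      then have "(\<Sum>i=1..card S. \<Sum>j=1..card S. k (z i) (z j) * cnj (x (z j)) * cnj (cnj (x (z i)))) \<in> \<real>\<^sub>\<ge>\<^sub>0"
        using k unfolding psd_on_def by (elim allE[of _ "card S"] allE[of _ z] allE[of _ "\<lambda>i. cnj (x (z i))"]) auto
      also have "(\<Sum>i=1..card S. \<Sum>j=1..card S. k (z i) (z j) * cnj (x (z j)) * cnj (cnj (x (z i))))
         = (\<Sum>i=1..card S. \<Sum>j\<in>S. k (z i) j * cnj (x j) * cnj (cnj (x (z i))))"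
        by (intro sum.cong refl sum.reindex_bij_betw[OF z])
      also have "\<dots> = (\<Sum>i\<in>S. \<Sum>j\<in>S. k i j * cnj (x j) * cnj (cnj (x i)))"
        by (rule sum.reindex_bij_betw[OF z])
      also have "\<dots> = hform S k x x"
        by (simp add: hform_def mult_ac)
      finally show "hform S k x x \<in> \<real>\<^sub>\<ge>\<^sub>0" .
    qed
  qed
next
  assume k: "\<forall>S. finite S \<and> S \<subseteq> X \<longrightarrow> pos_on S k"
  show "psd_on X k"
    unfolding psd_on_def
  proof (intro allI impI)
    fix N :: nat and z and c :: "nat \<Rightarrow> complex"
    assume z: "\<forall>i\<in>{1..N}. z i \<in> X"
    define S where "S = z ` {1..N}"
    define x where "x = (\<lambda>p. \<Sum>i\<in>{i\<in>{1..N}. z i = p}. cnj (c i))"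
    have S: "finite S" "S \<subseteq> X" using z by (auto simp: S_def)
    have grp: "(\<Sum>i=1..N. g (z i) * h i) = (\<Sum>p\<in>S. g p * (\<Sum>i\<in>{i\<in>{1..N}. z i = p}. h i))"
      for g h :: "_ \<Rightarrow> complex"
    proof -
      have "(\<Sum>i=1..N. g (z i) * h i) = (\<Sum>p\<in>S. \<Sum>i\<in>{i\<in>{1..N}. z i = p}. g (z i) * h i)"
        unfolding S_def by (rule sum.image_gen) simp
      also have "\<dots> = (\<Sum>p\<in>S. g p * (\<Sum>i\<in>{i\<in>{1..N}. z i = p}. h i))"
        by (auto simp: sum_distrib_left intro!: sum.cong)
      finally show ?thesis .
    qed
    have "(\<Sum>i=1..N. \<Sum>j=1..N. k (z i) (z j) * c j * cnj (c i))
       = (\<Sum>i=1..N. (\<Sum>q\<in>S. k (z i) q * cnj (x q)) * cnj (c i))"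
      by (intro sum.cong refl) (simp only: sum_distrib_right[symmetric] grp x_def cnj_sum complex_cnj_cnj)
    also have "\<dots> = (\<Sum>p\<in>S. (\<Sum>q\<in>S. k p q * cnj (x q)) * x p)"
      by (subst grp) (simp add: x_def)
    also have "\<dots> = hform S k x x"
      by (simp add: hform_def sum_distrib_right sum_distrib_left mult_ac)
    finally show "(\<Sum>i=1..N. \<Sum>j=1..N. k (z i) (z j) * c j * cnj (c i)) \<in> \<real>\<^sub>\<ge>\<^sub>0"
      using k S by (simp add: pos_on_def)
  qed
qed

section \<open>Relative eigenvectors and simultaneous diagonalization\<close>

lemma hform_null_vector:
  assumes "hermitian_on S N" "\<And>x. 0 \<le> Re (hform S N x x)" "hform S N u u = 0"
  shows "hform S N u z = 0"
proof (rule ccontr)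
  assume nz: "hform S N u z \<noteq> 0"
  define b where "b = hform S N u z"
  define q where "q = Re (hform S N z z)"
  have q: "hform S N z z = of_real q" unfolding q_def by (rule hform_hermitian_real[OF assms(1)])
  have zu: "hform S N z u = cnj b" unfolding b_def by (rule hform_hermitian[OF assms(1)])
  have *: "0 \<le> (cmod b)\<^sup>2 * (t\<^sup>2 * q - 2 * t)" for t :: real
  proof -
    \<comment> \<open>Degenerate Cauchy-Schwarz: moving from u along - b z changes the form to first
      order by -2 t |b|^2, which the second-order term t^2 |b|^2 q cannot compensate for small t; t
      = 1 / (q + 1) is small enough.\<close>
    define c where "c = - of_real t * b"
    have "0 \<le> Re (hform S N (\<lambda>i. u i + c * z i) (\<lambda>i. u i + c * z i))" by (rule assms(2))
    also have "hform S N (\<lambda>i. u i + c * z i) (\<lambda>i. u i + c * z i) = c * cnj b + cnj c * (b + c * of_real q)"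
      by (simp add: hform_add_left hform_add_right hform_scale_left hform_scale_right assms(3) q zu b_def[symmetric] algebra_simps)
    also have "\<dots> = of_real ((cmod b)\<^sup>2 * (t\<^sup>2 * q - 2 * t))"
    proof -
      have "c * cnj b + cnj c * (b + c * of_real q) = (b * cnj b) * (of_real t * of_real t * of_real q - 2 * of_real t)"
        unfolding c_def by (simp add: algebra_simps)
      also have "b * cnj b = of_real ((cmod b)\<^sup>2)" by (simp only: complex_norm_square)
      finally show ?thesis by (simp add: power2_eq_square)
    qed
    finally show ?thesis by simp
  qed
  have q0: "0 \<le> q" using assms(2) by (simp add: q_def)
  define t where "t = 1 / (q + 1)"
  have "t > 0" "t * q < 1" using q0 by (auto simp: t_def)
  then have "t * (t * q - 2) < 0" by (intro mult_pos_neg) auto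
  then have "t\<^sup>2 * q - 2 * t < 0" by (simp add: power2_eq_square algebra_simps)
  moreover have "0 < (cmod b)\<^sup>2" using nz by (simp add: b_def)
  ultimately have "(cmod b)\<^sup>2 * (t\<^sup>2 * q - 2 * t) < 0" by (intro mult_pos_neg)
  with *[of t] show False by simp
qed

text \<open>The Rayleigh quotient of Y relative to L attains its maximum on the compact unit sphere.
  The maximizer, normalized with respect to L, is the eigenvector split off in the
  diagonalization.\<close>

lemma rayleigh_maximizer:
  assumes S: "finite S" "S \<noteq> {}"
    and L: "hermitian_on S L" "\<And>x. \<exists>i\<in>S. x i \<noteq> 0 \<Longrightarrow> 0 < Re (hform S L x x)"
    and Y: "hermitian_on S Y"
  obtains u y where "hform S L u u = 1" "\<exists>i\<in>S. u i \<noteq> 0" "\<And>x. Re (hform S Y x x) \<le> y * Re (hform S L x x)"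
    "Re (hform S Y u u) = y"
proof -
  \<comment> \<open>Vectors are total functions; freezing the coordinates outside S at 0 is what
    makes the sphere compact in the product topology.\<close>
  define B where "B = {x. \<forall>i. x i \<in> (if i \<in> S then cball 0 1 else {0::complex})}"
  define A where "A = B \<inter> {x. (\<Sum>i\<in>S. (cmod (x i))\<^sup>2) = 1}"
  have "compact B" unfolding B_def by (rule compact_dependent_product) auto
  moreover have "closed {x :: 'a \<Rightarrow> complex. (\<Sum>i\<in>S. (cmod (x i))\<^sup>2) = 1}"
    by (intro closed_Collect_eq continuous_intros)
  ultimately have "compact A" unfolding A_def by (rule compact_Int_closed)
  obtain a where a: "a \<in> S" using S by blast
  have "(\<lambda>i. if i = a then 1 else 0) \<in> A"
    using S a by (auto simp: A_def B_def if_distrib[of "\<lambda>x. (cmod x)\<^sup>2"] cong: if_cong)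
  then have "A \<noteq> {}" by blast
  have Apos: "0 < Re (hform S L x x)" if "x \<in> A" for x
  proof (rule L(2), rule ccontr)
    assume "\<not> (\<exists>i\<in>S. x i \<noteq> 0)"
    with that show False by (simp add: A_def)
  qed
  have form_cont: "continuous_on A (\<lambda>x. Re (hform S M x x))" for M
    unfolding hform_def by (intro continuous_intros)
  define q where "q = (\<lambda>x. Re (hform S Y x x) / Re (hform S L x x))"
  have "continuous_on A q"
    unfolding q_def using Apos by (intro continuous_on_divide form_cont) fastforce
  from continuous_attains_sup[OF \<open>compact A\<close> \<open>A \<noteq> {}\<close> this]
  obtain v where v: "v \<in> A" "\<And>x. x \<in> A \<Longrightarrow> q x \<le> q v" by blast
  define y where "y = Re (hform S Y v v) / Re (hform S L v v)"
  define r where "r = Re (hform S L v v)"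
  have r: "r > 0" unfolding r_def by (rule Apos[OF v(1)])
  have le: "Re (hform S Y x x) \<le> y * Re (hform S L x x)" for x
  proof (cases "\<exists>i\<in>S. x i \<noteq> 0")
    case False
    then have "hform S Y x x = 0" "hform S L x x = 0" by (auto simp: hform_def)
    then show ?thesis by simp
  next
    case True
    define s where "s = sqrt (\<Sum>i\<in>S. (cmod (x i))\<^sup>2)"
    have sp: "0 < (\<Sum>i\<in>S. (cmod (x i))\<^sup>2)"
      using True S by (auto intro!: sum_pos2)
    then have s: "s > 0" "s\<^sup>2 = (\<Sum>i\<in>S. (cmod (x i))\<^sup>2)" by (simp_all add: s_def)
    define x' where "x' = (\<lambda>i. if i \<in> S then of_real (1/s) * x i else 0)"
    have "(\<Sum>i\<in>S. (cmod (x' i))\<^sup>2) = 1"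
    proof -
      have "(\<Sum>i\<in>S. (cmod (x' i))\<^sup>2) = (\<Sum>i\<in>S. (1/s)\<^sup>2 * (cmod (x i))\<^sup>2)"
        using s(1) by (intro sum.cong) (auto simp: x'_def norm_mult power_mult_distrib norm_divide power_divide)
      also have "\<dots> = (1/s)\<^sup>2 * s\<^sup>2"
        by (simp only: sum_distrib_left s(2))
      finally show ?thesis using s(1) by (simp add: power_divide)
    qed
    moreover have "cmod (x' i) \<le> 1" if "i \<in> S" for i
    proof -
      have "(cmod (x' i))\<^sup>2 \<le> (\<Sum>i\<in>S. (cmod (x' i))\<^sup>2)"
        using that S by (intro member_le_sum) auto
      then have "(cmod (x' i))\<^sup>2 \<le> 1\<^sup>2" using calculation by simp
      then show ?thesis by (rule power2_le_imp_le) simp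
    qed
    ultimately have "x' \<in> A" by (auto simp: A_def B_def x'_def)
    have sc: "hform S M x' x' = of_real (1/s^2) * hform S M x x" for M
    proof -
      have "hform S M x' x' = hform S M (\<lambda>i. of_real (1/s) * x i) (\<lambda>i. of_real (1/s) * x i)"
        by (rule hform_cong) (auto simp: x'_def)
      also have "\<dots> = of_real (1/s^2) * hform S M x x"
        unfolding hform_scale_left hform_scale_right by (simp add: power2_eq_square)
      finally show ?thesis .
    qed
    have Re_sc: "Re (of_real c * w) = c * Re w" for c w by simp
    have "Re (hform S Y x' x') / Re (hform S L x' x') \<le> y"
      using v(2)[OF \<open>x' \<in> A\<close>] by (simp add: y_def q_def)
    then have "Re (hform S Y x x) / Re (hform S L x x) \<le> y"
      unfolding sc Re_sc using s(1) by simp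
    then show ?thesis
      using L(2)[OF True] by (simp add: pos_divide_le_eq)
  qed
  define c where "c = complex_of_real (1 / sqrt r)"
  have cc: "c * cnj c = of_real (1 / r)" unfolding c_def using r by (simp add: of_real_mult[symmetric] del: of_real_mult of_real_divide)
  have sc: "hform S M (\<lambda>i. c * v i) (\<lambda>i. c * v i) = of_real (1/r) * hform S M v v" for M
    unfolding hform_scale_left hform_scale_right by (simp only: mult.assoc[symmetric] cc)
  show thesis
  proof
    have "hform S L v v = of_real r" unfolding r_def by (rule hform_hermitian_real[OF L(1)])
    then show one: "hform S L (\<lambda>i. c * v i) (\<lambda>i. c * v i) = 1"
      using r by (simp add: sc)
    show "\<exists>i\<in>S. c * v i \<noteq> 0"
    proof (rule ccontr)
      assume "\<not> (\<exists>i\<in>S. c * v i \<noteq> 0)"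
      then have "hform S L (\<lambda>i. c * v i) (\<lambda>i. c * v i) = 0" by (auto simp: hform_def)
      with one show False by simp
    qed
    show "\<And>x. Re (hform S Y x x) \<le> y * Re (hform S L x x)" by (rule le)
    show "Re (hform S Y (\<lambda>i. c * v i) (\<lambda>i. c * v i)) = y"
      by (simp add: sc y_def r_def[symmetric])
  qed
qed

text \<open>Since u a is nonzero, the equation for the null vector recovers row a from the other
  rows, and hermitian symmetry recovers column a. The minor without a therefore determines the
  matrix.\<close>

lemma matrix_eq_from_null_vector:
  assumes S: "finite S" "a \<in> S" "u a \<noteq> 0"
    and A: "hermitian_on S A" "\<And>j. j \<in> S \<Longrightarrow> (\<Sum>i\<in>S. A i j * u i) = 0"
    and B: "hermitian_on S B" "\<And>j. j \<in> S \<Longrightarrow> (\<Sum>i\<in>S. B i j * u i) = 0"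
    and eq: "\<And>i j. i \<in> S - {a} \<Longrightarrow> j \<in> S - {a} \<Longrightarrow> A i j = B i j"
    and ij: "i \<in> S" "j \<in> S"
  shows "A i j = B i j"
proof -
  define D where "D = (\<lambda>i j. A i j - B i j)"
  have D0: "D i j = 0" if "i \<in> S - {a}" "j \<in> S - {a}" for i j
    using eq[OF that] by (simp add: D_def)
  have D1: "(\<Sum>i\<in>S. D i j * u i) = 0" if "j \<in> S" for j
    using A(2)[OF that] B(2)[OF that] by (simp add: D_def left_diff_distrib sum_subtractf)
  have D2: "D j i = cnj (D i j)" if "i \<in> S" "j \<in> S" for i j
    using hermitian_on_diff[OF A(1) B(1)] that unfolding hermitian_on_def D_def by blast
  have split: "(\<Sum>i\<in>S. D i j * u i) = D a j * u a + (\<Sum>i\<in>S-{a}. D i j * u i)" for j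
    using S by (simp add: sum.remove)
  have Da: "D a j = 0" if "j \<in> S - {a}" for j
  proof -
    have "(\<Sum>i\<in>S-{a}. D i j * u i) = 0" using D0 that by (intro sum.neutral) auto
    then show ?thesis using D1[of j] split[of j] that S(3) by simp
  qed
  have Da': "D j a = 0" if "j \<in> S - {a}" for j
  proof -
    have "D j a = cnj (D a j)" using that S(2) by (intro D2) auto
    then show ?thesis using Da[OF that] by simp
  qed
  have "(\<Sum>i\<in>S-{a}. D i a * u i) = 0" using Da' by (intro sum.neutral) auto
  then have "D a a = 0" using D1[of a] split[of a] S by simp
  then have "D i j = 0" using D0 Da Da' ij by (cases "i = a"; cases "j = a") auto
  then show ?thesis by (simp add: D_def)
qed

text \<open>Reading w and e as square matrices, e is the transposed inverse of w. Both orders of the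
  product are recorded because both are used: one as biorthogonality, the other as
  completeness.\<close>

definition simdiag :: "'a set \<Rightarrow> ('a \<Rightarrow> 'a \<Rightarrow> complex) \<Rightarrow> ('a \<Rightarrow> 'a \<Rightarrow> complex) \<Rightarrow>
    ('a \<Rightarrow> 'a \<Rightarrow> complex) \<Rightarrow> ('a \<Rightarrow> 'a \<Rightarrow> complex) \<Rightarrow> ('a \<Rightarrow> real) \<Rightarrow> bool" where
  "simdiag S L Y w e y \<longleftrightarrow>
     (\<forall>i\<in>S. \<forall>j\<in>S. L i j = (\<Sum>k\<in>S. w k i * cnj (w k j))) \<and>
     (\<forall>i\<in>S. \<forall>j\<in>S. Y i j = (\<Sum>k\<in>S. of_real (y k) * (w k i * cnj (w k j)))) \<and>
     (\<forall>k\<in>S. \<forall>m\<in>S. (\<Sum>i\<in>S. w k i * e m i) = (if k = m then 1 else 0)) \<and>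
     (\<forall>i\<in>S. \<forall>j\<in>S. (\<Sum>k\<in>S. w k i * e k j) = (if i = j then 1 else 0))"

text \<open>Deflation: subtracting the rank-one parts belonging to the top eigenvector u leaves two
  matrices that kill u. They are determined by the minor without one index a in the support of u,
  and on this minor the deflated L is still definite, so induction on the size applies.\<close>

lemma simultaneous_diagonalization:
  assumes "finite S" "hermitian_on S L" "hermitian_on S Y"
    and "\<And>x. \<exists>i\<in>S. x i \<noteq> 0 \<Longrightarrow> 0 < Re (hform S L x x)"
  shows "\<exists>w e y. simdiag S L Y w e y"
  using assms
proof (induction "card S" arbitrary: S L Y)
  case 0
  then show ?case by (auto simp: simdiag_def)
next
  case (Suc n)
  note fin = Suc.prems(1) and hL = Suc.prems(2) and hY = Suc.prems(3) and pd = Suc.prems(4)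
  from Suc.hyps have "S \<noteq> {}" by auto
  then obtain u \<mu> where u1: "hform S L u u = 1" and unz: "\<exists>i\<in>S. u i \<noteq> 0"
    and ule: "\<And>x. Re (hform S Y x x) \<le> \<mu> * Re (hform S L x x)" and uY: "Re (hform S Y u u) = \<mu>"
    using rayleigh_maximizer[OF fin _ hL pd hY] by blast
  obtain a where a: "a \<in> S" "u a \<noteq> 0" using unz by blast
  define S' where "S' = S - {a}"
  have S': "finite S'" "n = card S'" "S = insert a S'" "a \<notin> S'" "S' \<subseteq> S"
    using fin a Suc.hyps by (auto simp: S'_def)
  \<comment> \<open>\<mu> L - Y is positive semidefinite and vanishes at u. A null vector of a
    semidefinite form lies in its kernel, which is the eigenvalue equation Y u = \<mu> L u.\<close>
  define N where "N = (\<lambda>i j. of_real \<mu> * L i j - Y i j)"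
  have hN: "hermitian_on S N" unfolding N_def by (intro hermitian_on_diff hermitian_on_scale hL hY)
  have Nf: "hform S N x z = of_real \<mu> * hform S L x z - hform S Y x z" for x z
    unfolding N_def by (simp add: hform_matrix_diff hform_matrix_scale)
  have Npos: "0 \<le> Re (hform S N x x)" for x
    using ule[of x] by (simp add: Nf)
  have "hform S Y u u = of_real \<mu>" using hform_hermitian_real[OF hY, of u] uY by simp
  then have "hform S N u u = 0" by (simp add: Nf u1)
  from hform_null_vector[OF hN Npos this] have Yu: "hform S Y u z = of_real \<mu> * hform S L u z" for z
    by (simp add: Nf)
  \<comment> \<open>The covector of u with respect to L. It has value 1 at u, so L' and Y'
    annihilate u.\<close>
  define W where "W = (\<lambda>i. \<Sum>j\<in>S. L i j * cnj (u j))"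
  have Wx: "(\<Sum>i\<in>S. W i * x i) = hform S L x u" for x
    by (simp add: W_def hform_def sum_distrib_right sum_distrib_left mult_ac)
  have Wu: "(\<Sum>i\<in>S. W i * u i) = 1" by (simp add: Wx u1)
  have uW: "hform S L u (\<lambda>i. if i = j then 1 else 0) = cnj (W j)" if "j \<in> S" for j
  proof -
    have "hform S L u (\<lambda>i. if i = j then 1 else 0) = cnj (hform S L (\<lambda>i. if i = j then 1 else 0) u)"
      by (rule hform_hermitian[OF hL])
    also have "hform S L (\<lambda>i. if i = j then 1 else 0) u = W j"
      unfolding hform_unit_left[OF fin that] W_def ..
    finally show ?thesis .
  qed
  have Lu: "(\<Sum>i\<in>S. L i j * u i) = cnj (W j)" if "j \<in> S" for j
    using uW[OF that] unfolding hform_unit_right[OF fin that] .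
  have Yu': "(\<Sum>i\<in>S. Y i j * u i) = of_real \<mu> * cnj (W j)" if "j \<in> S" for j
    using Yu[of "\<lambda>i. if i = j then 1 else 0"] uW[OF that]
    unfolding hform_unit_right[OF fin that] by simp
  define L' where "L' = (\<lambda>i j. L i j - W i * cnj (W j))"
  define Y' where "Y' = (\<lambda>i j. Y i j - of_real \<mu> * (W i * cnj (W j)))"
  have hL': "hermitian_on S L'" unfolding L'_def using hermitian_on_diff[OF hL hermitian_on_rank_one[of S 1 W]] by simp
  have hY': "hermitian_on S Y'" unfolding Y'_def by (intro hermitian_on_diff hermitian_on_rank_one hY)
  have L'u: "(\<Sum>i\<in>S. L' i j * u i) = 0" if "j \<in> S" for j
  proof -
    have "(\<Sum>i\<in>S. L' i j * u i) = (\<Sum>i\<in>S. L i j * u i) - cnj (W j) * (\<Sum>i\<in>S. W i * u i)"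
      by (simp add: L'_def algebra_simps sum_subtractf sum_distrib_left)
    then show ?thesis using Lu[OF that] Wu by simp
  qed
  have Y'u: "(\<Sum>i\<in>S. Y' i j * u i) = 0" if "j \<in> S" for j
  proof -
    have "(\<Sum>i\<in>S. Y' i j * u i) = (\<Sum>i\<in>S. Y i j * u i) - of_real \<mu> * cnj (W j) * (\<Sum>i\<in>S. W i * u i)"
      by (simp add: Y'_def algebra_simps sum_subtractf sum_distrib_left)
    then show ?thesis using Yu'[OF that] Wu by simp
  qed
  have pd': "0 < Re (hform S' L' x x)" if nz: "\<exists>i\<in>S'. x i \<noteq> 0" for x
  proof -
    define x' where "x' = (\<lambda>i. if i \<in> S' then x i else 0)"
    define c where "c = hform S L x' u"
    have "hform S' L' x x = hform S' L' x' x'" by (rule hform_cong) (auto simp: x'_def)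
    also have "\<dots> = hform S L' x' x'"
      by (rule hform_mono_supp[symmetric]) (use S' fin in \<open>auto simp: x'_def\<close>)
    also have "\<dots> = hform S L x' x' - c * cnj c"
      unfolding L'_def hform_matrix_diff hform_rank_one Wx c_def ..
    \<comment> \<open>L' measures the squared L-distance from the line through u. A nonzero vector
      supported off a is not on this line, since u does not vanish at a.\<close>
    also have "\<dots> = hform S L (\<lambda>i. x' i - c * u i) (\<lambda>i. x' i - c * u i)"
    proof -
      have "hform S L u x' = cnj c" unfolding c_def by (rule hform_hermitian[OF hL])
      then show ?thesis
        by (simp add: hform_diff_left hform_diff_right hform_scale_left hform_scale_right u1 c_def[symmetric])
    qed
    finally have eq: "hform S' L' x x = hform S L (\<lambda>i. x' i - c * u i) (\<lambda>i. x' i - c * u i)" .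
    have "\<exists>i\<in>S. x' i - c * u i \<noteq> 0"
    proof (cases "c = 0")
      case True
      then show ?thesis using nz S' by (auto simp: x'_def)
    next
      case False
      then show ?thesis using a S' by (intro bexI[of _ a]) (auto simp: x'_def)
    qed
    then show ?thesis unfolding eq by (rule pd)
  qed
  have sub: "hermitian_on S' L'" "hermitian_on S' Y'"
    using hL' hY' S'(5) by (auto intro: hermitian_on_subset)
  from Suc.hyps(1)[OF S'(2) S'(1) sub pd'] obtain w' e' y' where IH: "simdiag S' L' Y' w' e' y'"
    by blast
  \<comment> \<open>The value at a is forced by the requirement that the new covectors annihilate
    u.\<close>
  define w where "w = (\<lambda>k. if k = a then W else (w' k)(a := - (\<Sum>i\<in>S'. w' k i * u i) / u a))"
  define e0 where "e0 = (\<lambda>k. (e' k)(a := 0))"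
  \<comment> \<open>The multiple of u is subtracted to make the vector orthogonal to W; the pairings
    with the other covectors do not change, because those annihilate u.\<close>
  define e where "e = (\<lambda>k. if k = a then u else (\<lambda>i. e0 k i - (\<Sum>j\<in>S. W j * e0 k j) * u i))"
  define y where "y = (\<lambda>k. if k = a then \<mu> else y' k)"
  have wu: "(\<Sum>i\<in>S. w k i * u i) = 0" if "k \<in> S'" for k
  proof -
    have "k \<noteq> a" using that S' by auto
    moreover have "(\<Sum>i\<in>S'. w k i * u i) = (\<Sum>i\<in>S'. w' k i * u i)"
      using \<open>k \<noteq> a\<close> S'(4) by (intro sum.cong refl) (auto simp: w_def)
    ultimately show ?thesis using S' a by (simp add: w_def)
  qed
  have wk: "w k i = w' k i" if "k \<in> S'" "i \<in> S'" for k i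
    using that S'(4) by (auto simp: w_def)
  have splitS: "(\<Sum>k\<in>S. f k) = f a + (\<Sum>k\<in>S'. f k)" for f :: "'a \<Rightarrow> complex"
    using S' by simp
  have main: "M i j = of_real m * (W i * cnj (W j)) + (\<Sum>k\<in>S'. of_real (z k) * (w k i * cnj (w k j)))"
    if M': "hermitian_on S (\<lambda>i j. M i j - of_real m * (W i * cnj (W j)))"
      "\<And>j. j \<in> S \<Longrightarrow> (\<Sum>i\<in>S. (M i j - of_real m * (W i * cnj (W j))) * u i) = 0"
      and eq: "\<And>i j. i \<in> S' \<Longrightarrow> j \<in> S' \<Longrightarrow> M i j - of_real m * (W i * cnj (W j))
          = (\<Sum>k\<in>S'. of_real (z k) * (w' k i * cnj (w' k j)))"
      and ij: "i \<in> S" "j \<in> S" for M m z i j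
  proof -
    have "M i j - of_real m * (W i * cnj (W j)) = (\<Sum>k\<in>S'. of_real (z k) * (w k i * cnj (w k j)))"
    proof (rule matrix_eq_from_null_vector[OF fin a M'])
      show "hermitian_on S (\<lambda>i j. \<Sum>k\<in>S'. of_real (z k) * (w k i * cnj (w k j)))"
        unfolding hermitian_on_def by (simp add: mult_ac)
      show "(\<Sum>i\<in>S. (\<Sum>k\<in>S'. of_real (z k) * (w k i * cnj (w k j))) * u i) = 0" for j
      proof -
        have "(\<Sum>i\<in>S. (\<Sum>k\<in>S'. of_real (z k) * (w k i * cnj (w k j))) * u i)
          = (\<Sum>k\<in>S'. \<Sum>i\<in>S. of_real (z k) * cnj (w k j) * (w k i * u i))"
          unfolding sum_distrib_right by (subst sum.swap) (intro sum.cong refl, simp only: mult_ac)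
        also have "\<dots> = (\<Sum>k\<in>S'. of_real (z k) * cnj (w k j) * (\<Sum>i\<in>S. w k i * u i))"
          by (simp only: sum_distrib_left)
        also have "\<dots> = 0" by (simp add: wu)
        finally show ?thesis .
      qed
      show "M i j - of_real m * (W i * cnj (W j)) = (\<Sum>k\<in>S'. of_real (z k) * (w k i * cnj (w k j)))"
        if "i \<in> S - {a}" "j \<in> S - {a}" for i j
      proof -
        have ij': "i \<in> S'" "j \<in> S'" using that by (auto simp: S'_def)
        have "(\<Sum>k\<in>S'. of_real (z k) * (w' k i * cnj (w' k j))) = (\<Sum>k\<in>S'. of_real (z k) * (w k i * cnj (w k j)))"
          by (intro sum.cong refl) (simp add: wk ij')
        then show ?thesis using eq[OF ij'] by simp
      qed
    qed (use ij in auto)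
    then show ?thesis by (simp add: algebra_simps)
  qed
  have e0S: "(\<Sum>j\<in>S. x j * e0 k j) = (\<Sum>j\<in>S'. x j * e' k j)" for x :: "'a \<Rightarrow> complex" and k
  proof -
    have "(\<Sum>j\<in>S'. x j * e0 k j) = (\<Sum>j\<in>S'. x j * e' k j)"
      using S'(4) by (intro sum.cong refl) (auto simp: e0_def)
    then show ?thesis by (simp add: splitS e0_def)
  qed
  have dual: "(\<Sum>i\<in>S. w k i * e m i) = (if k = m then 1 else 0)" if km: "k \<in> S" "m \<in> S" for k m
  proof (cases "m = a")
    case True
    show ?thesis
    proof (cases "k = a")
      case True
      then show ?thesis using \<open>m = a\<close> Wu by (simp add: e_def w_def)
    next
      case False
      then have "k \<in> S'" using km by (simp add: S'_def)
      then show ?thesis using \<open>m = a\<close> wu[of k] False by (simp add: e_def)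
    qed
  next
    case False
    then have m: "m \<in> S'" using km by (simp add: S'_def)
    have *: "(\<Sum>i\<in>S. w k i * e m i) = (\<Sum>i\<in>S. w k i * e0 m i) - (\<Sum>j\<in>S. W j * e0 m j) * (\<Sum>i\<in>S. w k i * u i)"
      using False by (simp add: e_def algebra_simps sum_subtractf sum_distrib_left)
    show ?thesis
    proof (cases "k = a")
      case True
      then show ?thesis using False unfolding * by (simp add: w_def Wu)
    next
      case kf: False
      then have k: "k \<in> S'" using km by (simp add: S'_def)
      have "(\<Sum>i\<in>S. w k i * e m i) = (\<Sum>i\<in>S'. w' k i * e' m i)"
        unfolding * wu[OF k] e0S by (simp add: wk k)
      then show ?thesis using IH k m by (simp add: simdiag_def)
    qed
  qed
  \<comment> \<open>The sum is the oblique projection along u onto the vectors that vanish at a,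
    which is the origin of the correction u j / u a in row a.\<close>
  have compl': "(\<Sum>k\<in>S'. w k i * e0 k j) = (if i = j then 1 else 0) - (if i = a then u j / u a else 0)"
    if ij: "i \<in> S" "j \<in> S" for i j
  proof (cases "j = a")
    case True
    then show ?thesis using a by (auto simp: e0_def)
  next
    case False
    then have j: "j \<in> S'" using ij by (simp add: S'_def)
    have e': "e0 k j = e' k j" for k using False by (simp add: e0_def)
    show ?thesis
    proof (cases "i = a")
      case False
      then have i: "i \<in> S'" using ij by (simp add: S'_def)
      have "(\<Sum>k\<in>S'. w k i * e0 k j) = (\<Sum>k\<in>S'. w' k i * e' k j)"
        by (intro sum.cong refl) (simp add: wk i e')
      then show ?thesis using IH i j False by (simp add: simdiag_def)
    next
      case True
      have wa: "w k a = - (\<Sum>l\<in>S'. w' k l * u l) / u a" if "k \<in> S'" for k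
        using that S'(4) by (auto simp: w_def)
      have "(\<Sum>k\<in>S'. w k i * e0 k j) = (\<Sum>k\<in>S'. \<Sum>l\<in>S'. - (w' k l * e' k j) * (u l / u a))"
        unfolding True
        by (intro sum.cong refl) (simp add: wa e' sum_distrib_right sum_distrib_left sum_divide_distrib sum_negf mult_ac)
      also have "\<dots> = (\<Sum>l\<in>S'. \<Sum>k\<in>S'. - (w' k l * e' k j) * (u l / u a))" by (rule sum.swap)
      also have "\<dots> = (\<Sum>l\<in>S'. - (\<Sum>k\<in>S'. w' k l * e' k j) * (u l / u a))"
        by (simp add: sum_distrib_right sum_negf sum_divide_distrib)
      also have "\<dots> = (\<Sum>l\<in>S'. if l = j then - (u l / u a) else 0)"
        using IH j by (intro sum.cong refl) (simp add: simdiag_def)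
      also have "\<dots> = - (u j / u a)" unfolding sum.delta[OF S'(1)] using j by simp
      finally show ?thesis using True False by simp
    qed
  qed
  have compl: "(\<Sum>k\<in>S. w k i * e k j) = (if i = j then 1 else 0)" if ij: "i \<in> S" "j \<in> S" for i j
  proof -
    define G where "G = (\<lambda>i j. \<Sum>k\<in>S'. w k i * e0 k j)"
    have "(\<Sum>k\<in>S. w k i * e k j) = W i * u j + (\<Sum>k\<in>S'. w k i * (e0 k j - (\<Sum>l\<in>S. W l * e0 k l) * u j))"
      using S'(4) by (subst splitS) (auto simp: w_def e_def intro!: sum.cong)
    also have "(\<Sum>k\<in>S'. w k i * (e0 k j - (\<Sum>l\<in>S. W l * e0 k l) * u j))
       = G i j - (\<Sum>k\<in>S'. \<Sum>l\<in>S. w k i * e0 k l * (W l * u j))"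
      by (simp add: G_def algebra_simps sum_subtractf sum_distrib_left sum_distrib_right)
    also have "(\<Sum>k\<in>S'. \<Sum>l\<in>S. w k i * e0 k l * (W l * u j)) = (\<Sum>l\<in>S. \<Sum>k\<in>S'. w k i * e0 k l * (W l * u j))"
      by (rule sum.swap)
    also have "\<dots> = (\<Sum>l\<in>S. G i l * (W l * u j))"
      by (simp add: G_def sum_distrib_right)
    also have "\<dots> = (\<Sum>l\<in>S. (if l = i then W l * u j else 0)) - (if i = a then u j / u a else 0) * (\<Sum>l\<in>S. W l * u l)"
      unfolding sum_distrib_left sum_subtractf[symmetric]
    proof (intro sum.cong refl)
      fix l assume l: "l \<in> S"
      have Gil: "G i l = (if i = l then 1 else 0) - (if i = a then u l / u a else 0)"
        unfolding G_def by (rule compl'[OF ij(1) l])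
      show "G i l * (W l * u j) = (if l = i then W l * u j else 0) - (if i = a then u j / u a else 0) * (W l * u l)"
        unfolding Gil by (cases "i = l"; cases "i = a") (simp_all add: left_diff_distrib)
    qed
    also have "\<dots> = W i * u j - (if i = a then u j / u a else 0)"
      unfolding sum.delta[OF fin] Wu using ij by simp
    finally show ?thesis using compl'[OF ij] by (simp add: G_def)
  qed
  have IHL: "L' i j = (\<Sum>k\<in>S'. w' k i * cnj (w' k j))" if "i \<in> S'" "j \<in> S'" for i j
    using IH that unfolding simdiag_def by blast
  have IHY: "Y' i j = (\<Sum>k\<in>S'. of_real (y' k) * (w' k i * cnj (w' k j)))" if "i \<in> S'" "j \<in> S'" for i j
    using IH that unfolding simdiag_def by blast
  have ya: "(\<Sum>k\<in>S'. of_real (y k) * (w k i * cnj (w k j))) = (\<Sum>k\<in>S'. of_real (y' k) * (w k i * cnj (w k j)))" for i j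
    using S'(4) by (intro sum.cong refl) (auto simp: y_def)
  have Leq: "L i j = (\<Sum>k\<in>S. w k i * cnj (w k j))" if "i \<in> S" "j \<in> S" for i j
  proof -
    have "L i j = of_real 1 * (W i * cnj (W j)) + (\<Sum>k\<in>S'. of_real ((\<lambda>_. 1) k) * (w k i * cnj (w k j)))"
      by (rule main) (use hL' L'u IHL that in \<open>simp_all add: L'_def\<close>)
    then show ?thesis unfolding splitS by (simp add: w_def)
  qed
  have Yeq: "Y i j = (\<Sum>k\<in>S. of_real (y k) * (w k i * cnj (w k j)))" if "i \<in> S" "j \<in> S" for i j
  proof -
    have "Y i j = of_real \<mu> * (W i * cnj (W j)) + (\<Sum>k\<in>S'. of_real (y' k) * (w k i * cnj (w k j)))"
      by (rule main) (use hY' Y'u IHY that in \<open>simp_all add: Y'_def\<close>)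
    then show ?thesis unfolding splitS ya by (simp add: w_def y_def)
  qed
  show ?case
    unfolding simdiag_def using Leq Yeq dual compl by blast
qed

section \<open>Separation from a convex cone\<close>

text \<open>First-variation principle: if moving a little in an admissible direction never decreases
  a quadratic function, its linear coefficient is nonnegative.\<close>

lemma nonneg_from_quadratic:
  fixes a b :: real
  assumes "\<And>t. 0 < t \<Longrightarrow> t \<le> 1 \<Longrightarrow> 0 \<le> 2 * t * a + t\<^sup>2 * b" "0 \<le> b"
  shows "0 \<le> a"
proof (rule ccontr)
  assume "\<not> 0 \<le> a"
  then have a: "a < 0" by simp
  define t where "t = min 1 (- a / (b + 1))"
  have t: "0 < t" "t \<le> 1" using a assms(2) by (auto simp: t_def divide_neg_pos)
  have "t * b \<le> - a / (b + 1) * b" using assms(2) by (intro mult_right_mono) (auto simp: t_def)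
  also have "\<dots> \<le> - a" using a assms(2) by (simp add: field_simps)
  finally have "2 * a + t * b < 0" using a by linarith
  then have "t * (2 * a + t * b) < 0" using t by (intro mult_pos_neg)
  then have "2 * t * a + t\<^sup>2 * b < 0" by (simp add: algebra_simps power2_eq_square)
  with assms(1)[OF t] show False by simp
qed

text \<open>Residuals of a minimizing sequence are Cauchy by the parallelogram law, so the cone need not be closed.\<close>

lemma convex_cone_approximation_or_separation:
  fixes C :: "('i \<Rightarrow> complex) set"
  assumes I: "finite I" and C0: "(\<lambda>_. 0) \<in> C"
    and add: "\<And>x y. x \<in> C \<Longrightarrow> y \<in> C \<Longrightarrow> (\<lambda>i. x i + y i) \<in> C"
    and sc: "\<And>t x. 0 \<le> t \<Longrightarrow> x \<in> C \<Longrightarrow> (\<lambda>i. of_real t * x i) \<in> C"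
  shows "(\<forall>\<eta>>0. \<exists>c\<in>C. (\<Sum>i\<in>I. (cmod (m i - c i))\<^sup>2) < \<eta>) \<or>
    (\<exists>R. (\<forall>c\<in>C. Re (\<Sum>i\<in>I. c i * cnj (R i)) \<le> 0) \<and> 0 < Re (\<Sum>i\<in>I. m i * cnj (R i)))"
proof -
  define N where "N = (\<lambda>x :: 'i \<Rightarrow> complex. \<Sum>i\<in>I. (cmod (x i))\<^sup>2)"
  define ip where "ip = (\<lambda>x y :: 'i \<Rightarrow> complex. Re (\<Sum>i\<in>I. x i * cnj (y i)))"
  define d where "d = (INF c\<in>C. N (\<lambda>i. m i - c i))"
  have N0: "0 \<le> N x" for x unfolding N_def by (intro sum_nonneg) auto
  have bdd: "bdd_below ((\<lambda>c. N (\<lambda>i. m i - c i)) ` C)" using N0 by (intro bdd_belowI[of _ 0]) auto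
  have dle: "d \<le> N (\<lambda>i. m i - c i)" if "c \<in> C" for c
    unfolding d_def using bdd that by (rule cINF_lower)
  have dlt: "\<exists>c\<in>C. N (\<lambda>i. m i - c i) < d + \<eta>" if "0 < \<eta>" for \<eta>
  proof -
    have "(INF c\<in>C. N (\<lambda>i. m i - c i)) < d + \<eta>" using that by (simp add: d_def)
    then show ?thesis using C0 by (subst (asm) cINF_less_iff[OF _ bdd]) auto
  qed
  show ?thesis
  proof (cases "d \<le> 0")
    case True
    have "\<exists>c\<in>C. (\<Sum>i\<in>I. (cmod (m i - c i))\<^sup>2) < \<eta>" if "\<eta> > 0" for \<eta>
      using dlt[OF that] True unfolding N_def by (meson add_le_same_cancel2 less_le_trans)
    then show ?thesis by blast
  next
    case False
    have "\<forall>n. \<exists>c\<in>C. N (\<lambda>i. m i - c i) < d + inverse (real (Suc n))"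
      by (intro allI dlt) simp
    then obtain c where c: "\<And>n. c n \<in> C" "\<And>n. N (\<lambda>i. m i - c n i) < d + inverse (real (Suc n))"
      by metis
    define r where "r = (\<lambda>n i. m i - c n i)"
    have par: "N (\<lambda>i. x i - y i) = 2 * N x + 2 * N y - 4 * N (\<lambda>i. (x i + y i) / 2)" for x y
    proof -
      have "(cmod (x i - y i))\<^sup>2 = 2 * (cmod (x i))\<^sup>2 + 2 * (cmod (y i))\<^sup>2 - 4 * (cmod ((x i + y i) / 2))\<^sup>2" for i
        unfolding cmod_power2 by (simp add: power2_eq_square field_simps)
      then show ?thesis unfolding N_def by (simp add: sum.distrib sum_subtractf sum_distrib_left)
    qed
    have Nexp: "N (\<lambda>i. x i + of_real t * y i) = N x + 2 * t * ip x y + t\<^sup>2 * N y" for x y t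
    proof -
      have "(cmod (x i + of_real t * y i))\<^sup>2 = (cmod (x i))\<^sup>2 + 2 * t * Re (x i * cnj (y i)) + t\<^sup>2 * (cmod (y i))\<^sup>2" for i
        unfolding cmod_power2 by (simp add: power2_eq_square algebra_simps)
      then show ?thesis unfolding N_def ip_def Re_sum by (simp only: sum.distrib sum_distrib_left)
    qed
    have diff: "N (\<lambda>i. r n i - r k i) \<le> 2 * inverse (real (Suc n)) + 2 * inverse (real (Suc k))" for n k
    proof -
      have "(\<lambda>i. of_real (1/2) * (c n i + c k i)) \<in> C" using c add by (intro sc) auto
      then have "d \<le> N (\<lambda>i. m i - of_real (1/2) * (c n i + c k i))" by (rule dle)
      also have "(\<lambda>i. m i - of_real (1/2) * (c n i + c k i)) = (\<lambda>i. (r n i + r k i) / 2)"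
        by (auto simp: r_def field_simps)
      finally show ?thesis
        unfolding par using c(2)[of n] c(2)[of k] by (simp add: r_def)
    qed
    have "Cauchy (\<lambda>n. r n i)" if "i \<in> I" for i
    proof (rule metric_CauchyI)
      fix e :: real assume "e > 0"
      then obtain M where M: "inverse (real (Suc M)) < e\<^sup>2 / 4"
        using reals_Archimedean[of "e\<^sup>2 / 4"] by auto
      show "\<exists>M. \<forall>n\<ge>M. \<forall>k\<ge>M. dist (r n i) (r k i) < e"
      proof (intro exI[of _ M] allI impI)
        fix n k assume nk: "M \<le> n" "M \<le> k"
        have "(cmod (r n i - r k i))\<^sup>2 \<le> N (\<lambda>i. r n i - r k i)"
          unfolding N_def using I that by (intro member_le_sum) auto
        also have "\<dots> \<le> 2 * inverse (real (Suc n)) + 2 * inverse (real (Suc k))" by (rule diff)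
        also have "\<dots> \<le> 2 * inverse (real (Suc M)) + 2 * inverse (real (Suc M))"
          using nk by (intro add_mono mult_left_mono le_imp_inverse_le) auto
        also have "\<dots> < e\<^sup>2" using M by simp
        finally show "dist (r n i) (r k i) < e"
          using \<open>e > 0\<close> by (simp add: dist_norm power2_less_imp_less)
      qed
    qed
    then have "\<forall>i\<in>I. \<exists>l. (\<lambda>n. r n i) \<longlonglongrightarrow> l" by (auto simp: Cauchy_convergent_iff convergent_def)
    then obtain R where R: "\<And>i. i \<in> I \<Longrightarrow> (\<lambda>n. r n i) \<longlonglongrightarrow> R i" by metis
    have NR: "N R = d"
    proof (rule LIMSEQ_unique[of "\<lambda>n. N (r n)"])
      show "(\<lambda>n. N (r n)) \<longlonglongrightarrow> N R" unfolding N_def by (intro tendsto_intros R)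
      show "(\<lambda>n. N (r n)) \<longlonglongrightarrow> d"
      proof (rule tendsto_sandwich[of "\<lambda>_. d" _ _ "\<lambda>n. d + inverse (real (Suc n))"])
        show "(\<lambda>n. d + inverse (real (Suc n))) \<longlonglongrightarrow> d"
          using tendsto_add[OF tendsto_const[of d] LIMSEQ_inverse_real_of_nat] by simp
        show "\<forall>\<^sub>F n in sequentially. d \<le> N (r n)" using dle c by (simp add: r_def)
        show "\<forall>\<^sub>F n in sequentially. N (r n) \<le> d + inverse (real (Suc n))"
          using c(2) by (auto simp: r_def intro!: always_eventually less_imp_le)
      qed simp
    qed
    have neg: "ip R x \<le> 0" if x: "x \<in> C" for x
    proof -
      have "0 \<le> 2 * t * (- ip R x) + t\<^sup>2 * N x" if t: "0 < t" "t \<le> 1" for t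
      proof -
        have "d \<le> N (\<lambda>i. r n i + of_real (- t) * x i)" for n
        proof -
          have "(\<lambda>i. c n i + of_real t * x i) \<in> C" using t x c by (intro add sc) auto
          from dle[OF this] show ?thesis by (simp add: r_def algebra_simps)
        qed
        moreover have "(\<lambda>n. N (\<lambda>i. r n i + of_real (- t) * x i)) \<longlonglongrightarrow> N (\<lambda>i. R i + of_real (- t) * x i)"
          unfolding N_def by (intro tendsto_intros R)
        ultimately have "d \<le> N (\<lambda>i. R i + of_real (- t) * x i)" by (intro LIMSEQ_le_const) auto
        then show ?thesis unfolding Nexp NR by simp
      qed
      from nonneg_from_quadratic[OF this N0] show ?thesis by simp
    qed
    \<comment> \<open>The nearest point m - R need not belong to the cone, so homogeneity is used
      along the minimizing sequence: replacing c by (1 - t) c stays in the cone. The outcome is <R,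
      m> \<ge> N R = d > 0.\<close>
    have pos: "0 \<le> ip R (\<lambda>i. m i - R i)"
    proof -
      have "0 \<le> 2 * t * ip R (\<lambda>i. m i - R i) + t\<^sup>2 * N (\<lambda>i. m i - R i)" if t: "0 < t" "t \<le> 1" for t
      proof -
        have "d \<le> N (\<lambda>i. r n i + of_real t * (m i - r n i))" for n
        proof -
          have "(\<lambda>i. of_real (1 - t) * c n i) \<in> C" using t c by (intro sc) auto
          from dle[OF this] show ?thesis by (simp add: r_def algebra_simps)
        qed
        moreover have "(\<lambda>n. N (\<lambda>i. r n i + of_real t * (m i - r n i))) \<longlonglongrightarrow> N (\<lambda>i. R i + of_real t * (m i - R i))"
          unfolding N_def by (intro tendsto_intros R)
        ultimately have "d \<le> N (\<lambda>i. R i + of_real t * (m i - R i))" by (intro LIMSEQ_le_const) auto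
        then show ?thesis unfolding Nexp NR by simp
      qed
      from nonneg_from_quadratic[OF this N0] show ?thesis .
    qed
    have sym: "Re (\<Sum>i\<in>I. x i * cnj (y i)) = ip y x" for x y
      unfolding ip_def Re_sum by (intro sum.cong refl) (simp add: mult.commute)
    have "ip R m = ip R (\<lambda>i. m i - R i) + N R"
      unfolding ip_def N_def Re_sum cmod_power2 sum.distrib[symmetric]
      by (intro sum.cong refl) (simp add: algebra_simps power2_eq_square)
    then have "0 < ip R m" using pos NR False by simp
    then show ?thesis unfolding sym using neg by blast
  qed
qed

section \<open>The symmetrized bidisc and the pentablock\<close>

lemma mult_lt_one:
  fixes a b :: real
  assumes "0 \<le> a" "a < 1" "0 \<le> b" "b < 1"
  shows "a * b < 1"
proof -
  have "a * b \<le> 1 * b" using assms by (intro mult_right_mono) auto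
  then show ?thesis using assms by simp
qed

text \<open>With root moduli a, b the vector s - cnj s p equals l1 (1 - b^2) + l2 (1 - a^2), and 1 -
  (a b)^2 - a (1 - b^2) - b (1 - a^2) = (1 - a b) (1 - a) (1 - b). For a \<ge> 1 > b the lower
  triangle inequality reverses the conclusion. This description no longer mentions the
  roots.\<close>

lemma mem_sym_bidisc_iff: "(s, p) \<in> sym_bidisc \<longleftrightarrow> cmod (s - cnj s * p) + (cmod p)\<^sup>2 < 1"
proof
  assume "(s, p) \<in> sym_bidisc"
  then obtain l1 l2 where l: "s = l1 + l2" "p = l1 * l2" "cmod l1 < 1" "cmod l2 < 1"
    by (auto simp: sym_bidisc_def)
  define a b where "a = cmod l1" and "b = cmod l2"
  have ab: "0 \<le> a" "a < 1" "0 \<le> b" "b < 1" using l by (auto simp: a_def b_def)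
  have "s - cnj s * p = l1 * of_real (1 - b\<^sup>2) + l2 * of_real (1 - a\<^sup>2)"
    unfolding l a_def b_def of_real_diff complex_norm_square by (simp add: algebra_simps)
  then have "cmod (s - cnj s * p) \<le> cmod (l1 * of_real (1 - b\<^sup>2)) + cmod (l2 * of_real (1 - a\<^sup>2))"
    by (simp only: norm_triangle_ineq)
  also have "\<dots> = a * \<bar>1 - b\<^sup>2\<bar> + b * \<bar>1 - a\<^sup>2\<bar>"
    unfolding norm_mult norm_of_real a_def b_def ..
  also have "\<dots> = a * (1 - b\<^sup>2) + b * (1 - a\<^sup>2)"
    using ab by (simp add: abs_square_le_1)
  also have "\<dots> = 1 - (a * b)\<^sup>2 - (1 - a * b) * ((1 - a) * (1 - b))"
    by (simp add: algebra_simps power2_eq_square)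
  also have "\<dots> < 1 - (a * b)\<^sup>2"
    using ab mult_lt_one[OF ab] by simp
  finally show "cmod (s - cnj s * p) + (cmod p)\<^sup>2 < 1"
    by (simp add: l a_def b_def norm_mult)
next
  assume *: "cmod (s - cnj s * p) + (cmod p)\<^sup>2 < 1"
  define D where "D = csqrt (s\<^sup>2 - 4 * p)"
  define l1 l2 where "l1 = (s + D) / 2" and "l2 = (s - D) / 2"
  have D2: "D * D = s\<^sup>2 - 4 * p" unfolding D_def by (metis power2_csqrt power2_eq_square)
  have l: "s = l1 + l2" "p = l1 * l2"
    by (auto simp: l1_def l2_def field_simps D2 power2_eq_square)
  have "(cmod p)\<^sup>2 < 1\<^sup>2" using * norm_ge_zero[of "s - cnj s * p"] unfolding one_power2 by linarith
  then have p1: "cmod p < 1" by (rule power2_less_imp_less) simp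
  have key: "cmod x < 1" if sp: "s = x + y" "p = x * y" for x y
  proof (rule ccontr)
    assume "\<not> cmod x < 1"
    define a b where "a = cmod x" and "b = cmod y"
    have a: "1 \<le> a" "0 \<le> b" using \<open>\<not> cmod x < 1\<close> by (auto simp: a_def b_def)
    have ab: "a * b < 1" using p1 by (simp add: sp norm_mult a_def b_def)
    have "1 * b \<le> a * b" using a by (intro mult_right_mono)
    then have b: "b < 1" using ab by simp
    have eq: "s - cnj s * p = x * of_real (1 - b\<^sup>2) - y * of_real (a\<^sup>2 - 1)"
      unfolding sp a_def b_def of_real_diff complex_norm_square by (simp add: algebra_simps)
    have "cmod (x * of_real (1 - b\<^sup>2)) - cmod (y * of_real (a\<^sup>2 - 1)) \<le> cmod (s - cnj s * p)"
      unfolding eq by (rule norm_triangle_ineq2)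
    then have "a * \<bar>1 - b\<^sup>2\<bar> - b * \<bar>a\<^sup>2 - 1\<bar> \<le> cmod (s - cnj s * p)"
      unfolding norm_mult norm_of_real a_def b_def .
    moreover have "\<bar>1 - b\<^sup>2\<bar> = 1 - b\<^sup>2" "\<bar>a\<^sup>2 - 1\<bar> = a\<^sup>2 - 1"
      using a b by (simp_all add: abs_square_le_1)
    ultimately have "a * (1 - b\<^sup>2) - b * (a\<^sup>2 - 1) \<le> cmod (s - cnj s * p)" by simp
    moreover have "a * (1 - b\<^sup>2) - b * (a\<^sup>2 - 1) = 1 - (a * b)\<^sup>2 + (1 - a * b) * ((a - 1) * (1 - b))"
      by (simp add: algebra_simps power2_eq_square)
    moreover have "0 \<le> (1 - a * b) * ((a - 1) * (1 - b))" using a b ab by simp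
    ultimately have "1 - (a * b)\<^sup>2 \<le> cmod (s - cnj s * p)" by linarith
    with * show False by (simp add: sp norm_mult a_def b_def)
  qed
  have "cmod l1 < 1" "cmod l2 < 1" using key[of l1 l2] key[of l2 l1] l by (auto simp: ac_simps)
  then show "(s, p) \<in> sym_bidisc" using l by (auto simp: sym_bidisc_def)
qed

lemma open_sym_bidisc: "open sym_bidisc"
proof -
  have "sym_bidisc = {x. cmod (fst x - cnj (fst x) * snd x) + (cmod (snd x))\<^sup>2 < 1}"
    using mem_sym_bidisc_iff by auto
  moreover have "open {x :: complex \<times> complex. cmod (fst x - cnj (fst x) * snd x) + (cmod (snd x))\<^sup>2 < 1}"
    by (intro open_Collect_less continuous_intros)
  ultimately show ?thesis by simp
qed

lemma sym_bidisc_bounds: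
  assumes "(s, p) \<in> sym_bidisc"
  shows "cmod s < 2" "cmod p < 1"
proof -
  obtain l1 l2 where l: "s = l1 + l2" "p = l1 * l2" "cmod l1 < 1" "cmod l2 < 1"
    using assms by (auto simp: sym_bidisc_def)
  show "cmod s < 2" using norm_triangle_ineq[of l1 l2] l by simp
  show "cmod p < 1" using l mult_lt_one by (simp add: norm_mult)
qed

lemma Phi_denominator_nonzero:
  assumes "(s, p) \<in> sym_bidisc" "cmod \<alpha> \<le> 1"
  shows "2 - \<alpha> * s \<noteq> 0"
proof
  assume "2 - \<alpha> * s = 0"
  then have "cmod (\<alpha> * s) = 2" by simp
  moreover have "cmod \<alpha> * cmod s \<le> 1 * cmod s" using assms by (intro mult_right_mono) auto
  ultimately show False using sym_bidisc_bounds[OF assms(1)] by (simp add: norm_mult)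
qed

text \<open>The difference of the squared moduli of denominator and numerator is computed
  explicitly. For |\<alpha>| = 1 it is at least 4 (1 - P^2 - B) > 0. For r = |\<alpha>| < 1 there is
  an additional summand with factor 1 - r, whose sign is governed by S^2 - 4 P^2 \<le> 2 B.\<close>

lemma Phi_norm_less_one:
  assumes "x \<in> sym_bidisc" "cmod \<alpha> \<le> 1"
  shows "cmod (Phi \<alpha> x) < 1"
proof -
  obtain s p where x: "x = (s, p)" by (cases x)
  define B S P r where "B = cmod (s - cnj s * p)" and "S = cmod s" and "P = cmod p" and "r = cmod \<alpha>"
  have mem: "(s, p) \<in> sym_bidisc" using assms x by simp
  have B: "B < 1 - P\<^sup>2" using mem unfolding mem_sym_bidisc_iff B_def P_def by linarith
  have P: "0 \<le> P" "P < 1" using sym_bidisc_bounds[OF mem] by (auto simp: P_def)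
  have S0: "0 \<le> S" by (simp add: S_def)
  have r: "0 \<le> r" "r \<le> 1" using assms by (auto simp: r_def)
  have SB: "S * (1 - P) \<le> B"
    using norm_triangle_ineq2[of s "cnj s * p"] by (simp add: B_def S_def P_def norm_mult algebra_simps)
  have "S * (1 - P) < (1 + P) * (1 - P)"
    using SB B by (simp add: algebra_simps power2_eq_square)
  then have S1: "S < 1 + P" using P by simp
  \<comment> \<open>From S (1 - P) \<le> B it suffices that S (2 - 2 P - S) + 4 P^2 \<ge> 0. If the
    bracket is negative, both factors are estimated at S = 1 + P, where the expression becomes (1 -
    P)^2.\<close>
  have key: "S\<^sup>2 - 4 * P\<^sup>2 \<le> 2 * B"
  proof -
    have "0 \<le> S * (2 - 2 * P - S) + 4 * P\<^sup>2"
    proof (cases "0 \<le> 2 - 2 * P - S")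
      case True
      then show ?thesis using S0 by simp
    next
      case False
      have "(1 + P) * (1 - 3 * P) \<le> (1 + P) * (2 - 2 * P - S)" using S1 P by (intro mult_left_mono) auto
      also have "\<dots> \<le> S * (2 - 2 * P - S)" using False S1 by (intro mult_right_mono_neg) auto
      finally have "(1 + P) * (1 - 3 * P) + 4 * P\<^sup>2 \<le> S * (2 - 2 * P - S) + 4 * P\<^sup>2" by simp
      moreover have "(1 + P) * (1 - 3 * P) + 4 * P\<^sup>2 = (1 - P)\<^sup>2" by (simp add: algebra_simps power2_eq_square)
      ultimately show ?thesis by (metis order_trans zero_le_power2)
    qed
    moreover have "S * (2 - 2 * P - S) = 2 * (S * (1 - P)) - S\<^sup>2" by (simp add: algebra_simps power2_eq_square)
    ultimately show ?thesis using SB by linarith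
  qed
  have id: "(cmod (2 - \<alpha> * s))\<^sup>2 - (cmod (2 * \<alpha> * p - s))\<^sup>2
     = (4 - S\<^sup>2) - 4 * Re (\<alpha> * (s - cnj s * p)) + r\<^sup>2 * (S\<^sup>2 - 4 * P\<^sup>2)"
    unfolding S_def P_def r_def cmod_power2 by (simp add: power2_eq_square algebra_simps)
  have "Re (\<alpha> * (s - cnj s * p)) \<le> r * B"
    using complex_Re_le_cmod[of "\<alpha> * (s - cnj s * p)"] by (simp add: norm_mult r_def B_def)
  moreover have "0 < (4 - S\<^sup>2) - 4 * (r * B) + r\<^sup>2 * (S\<^sup>2 - 4 * P\<^sup>2)"
  proof -
    have "(1 + r) * (S\<^sup>2 - 4 * P\<^sup>2) \<le> 4 * B"
    proof (cases "S\<^sup>2 - 4 * P\<^sup>2 \<le> 0")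
      case True
      then have "(1 + r) * (S\<^sup>2 - 4 * P\<^sup>2) \<le> 0" using r by (intro mult_nonneg_nonpos) auto
      then show ?thesis by (smt (verit) B_def norm_ge_zero)
    next
      case False
      then have "(1 + r) * (S\<^sup>2 - 4 * P\<^sup>2) \<le> 2 * (S\<^sup>2 - 4 * P\<^sup>2)" using r by (intro mult_right_mono) auto
      also have "\<dots> \<le> 2 * (2 * B)" using key by (intro mult_left_mono) auto
      finally show ?thesis by simp
    qed
    then have "0 \<le> (1 - r) * (4 * B - (1 + r) * (S\<^sup>2 - 4 * P\<^sup>2))" using r by simp
    moreover have "(4 - S\<^sup>2) - 4 * (r * B) + r\<^sup>2 * (S\<^sup>2 - 4 * P\<^sup>2) =
       (1 - r) * (4 * B - (1 + r) * (S\<^sup>2 - 4 * P\<^sup>2)) + (4 * (1 - P\<^sup>2) - 4 * B)"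
      by (simp add: algebra_simps power2_eq_square)
    moreover have "0 < 4 * (1 - P\<^sup>2) - 4 * B" using mult_strict_left_mono[OF B, of 4] by simp
    ultimately show ?thesis by (simp only: add_nonneg_pos)
  qed
  ultimately have "(cmod (2 * \<alpha> * p - s))\<^sup>2 < (cmod (2 - \<alpha> * s))\<^sup>2" using id by linarith
  then have "cmod (2 * \<alpha> * p - s) < cmod (2 - \<alpha> * s)" by (rule power2_less_imp_less) simp
  then show ?thesis using Phi_denominator_nonzero[OF mem assms(2)]
    by (simp add: x Phi_def norm_divide divide_less_eq)
qed

lemma continuous_on_Phi:
  assumes "x \<in> sym_bidisc"
  shows "continuous_on (cball 0 1) (\<lambda>\<alpha>. Phi \<alpha> x)"
proof -
  obtain s p where x: "x = (s, p)" by (cases x)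
  have "2 - \<alpha> * s \<noteq> 0" if "\<alpha> \<in> cball 0 1" for \<alpha>
    using Phi_denominator_nonzero assms that by (simp add: x)
  then show ?thesis unfolding x Phi_def by (auto intro!: continuous_intros)
qed

text \<open>Compactness in \<alpha> turns the strict bound into a gap that depends on the point
  only. This gap bounds the total mass of the functionals in the compactness argument.\<close>

lemma Phi_uniform_bound:
  assumes "x \<in> sym_bidisc"
  obtains \<gamma> where "0 \<le> \<gamma>" "\<gamma> < 1" "\<And>\<alpha>. cmod \<alpha> \<le> 1 \<Longrightarrow> cmod (Phi \<alpha> x) \<le> \<gamma>"
proof -
  have "continuous_on (cball 0 1) (\<lambda>\<alpha>. cmod (Phi \<alpha> x))"
    by (intro continuous_intros continuous_on_Phi assms)
  from continuous_attains_sup[OF _ _ this]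
  obtain \<beta> where \<beta>: "\<beta> \<in> cball 0 1" "\<forall>\<alpha>\<in>cball 0 1. cmod (Phi \<alpha> x) \<le> cmod (Phi \<beta> x)" by auto
  show thesis
    by (rule that[of "cmod (Phi \<beta> x)"]) (use \<beta> Phi_norm_less_one[OF assms, of \<beta>] in auto)
qed

lemma Phi_zero: "Phi 0 x = - fst x / 2"
  by (cases x) (simp add: Phi_def)

section \<open>Contractive matrices and points of the pentablock\<close>

lemma matrix_2_contraction:
  fixes A :: "complex ^ 2 ^ 2"
  assumes "onorm ((*v) A) < 1"
  shows "(cmod (A $ 1 $ 1 * x + A $ 1 $ 2 * y))\<^sup>2 + (cmod (A $ 2 $ 1 * x + A $ 2 $ 2 * y))\<^sup>2
     \<le> (cmod x)\<^sup>2 + (cmod y)\<^sup>2"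
    and "x \<noteq> 0 \<or> y \<noteq> 0 \<Longrightarrow> (cmod (A $ 1 $ 1 * x + A $ 1 $ 2 * y))\<^sup>2 + (cmod (A $ 2 $ 1 * x + A $ 2 $ 2 * y))\<^sup>2
     < (cmod x)\<^sup>2 + (cmod y)\<^sup>2"
proof -
  define v :: "complex ^ 2" where "v = vector [x, y]"
  have n2: "(norm (u :: complex ^ 2))\<^sup>2 = (cmod (u $ 1))\<^sup>2 + (cmod (u $ 2))\<^sup>2" for u
    by (simp add: norm_vec_def L2_set_def sum_2)
  have v: "(norm v)\<^sup>2 = (cmod x)\<^sup>2 + (cmod y)\<^sup>2" by (simp add: n2 v_def)
  have Av: "(norm (A *v v))\<^sup>2 = (cmod (A $ 1 $ 1 * x + A $ 1 $ 2 * y))\<^sup>2 + (cmod (A $ 2 $ 1 * x + A $ 2 $ 2 * y))\<^sup>2"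
    by (simp add: n2 v_def matrix_vector_mult_def sum_2)
  have on: "norm (A *v v) \<le> onorm ((*v) A) * norm v"
    by (rule onorm) (rule matrix_vector_mul_bounded_linear)
  also have le: "\<dots> \<le> 1 * norm v" using assms by (intro mult_right_mono) auto
  finally have "(norm (A *v v))\<^sup>2 \<le> (norm v)\<^sup>2" by (intro power_mono) auto
  then show "(cmod (A $ 1 $ 1 * x + A $ 1 $ 2 * y))\<^sup>2 + (cmod (A $ 2 $ 1 * x + A $ 2 $ 2 * y))\<^sup>2
     \<le> (cmod x)\<^sup>2 + (cmod y)\<^sup>2" by (simp only: v Av)
  assume "x \<noteq> 0 \<or> y \<noteq> 0"
  then have "0 < (norm v)\<^sup>2" unfolding v by (auto simp: sum_power2_gt_zero_iff)
  then have "0 < norm v" by simp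
  then have "onorm ((*v) A) * norm v < 1 * norm v" using assms by (intro mult_strict_right_mono)
  with on have "norm (A *v v) < norm v" by simp
  then have "(norm (A *v v))\<^sup>2 < (norm v)\<^sup>2" by (intro power_strict_mono) auto
  then show "(cmod (A $ 1 $ 1 * x + A $ 1 $ 2 * y))\<^sup>2 + (cmod (A $ 2 $ 1 * x + A $ 2 $ 2 * y))\<^sup>2
     < (cmod x)\<^sup>2 + (cmod y)\<^sup>2" by (simp only: v Av)
qed

text \<open>Trace and determinant are the symmetric functions of the eigenvalues, and an eigenvector
  shows that each eigenvalue has modulus below the operator norm bound 1.\<close>

lemma snd_pentablock:
  assumes "z \<in> pentablock"
  shows "snd z \<in> sym_bidisc"
proof -
  obtain A :: "complex ^ 2 ^ 2" where A: "z = (A $ 2 $ 1, trace A, det A)" "onorm ((*v) A) < 1"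
    using assms by (auto simp: pentablock_def)
  define s p where "s = trace A" and "p = det A"
  have sp: "s = A$1$1 + A$2$2" "p = A$1$1 * A$2$2 - A$1$2 * A$2$1"
    by (auto simp: s_def p_def trace_def sum_2 det_2)
  have root: "cmod l < 1" if "l * l - s * l + p = 0" for l
  proof -
    have d: "(A$1$1 - l) * (A$2$2 - l) = A$1$2 * A$2$1" using that by (simp add: sp algebra_simps)
    \<comment> \<open>Columns of the adjugate of A - l are eigenvectors unless they vanish; if both
      vanish, A is the scalar matrix l and any vector serves.\<close>
    obtain x y where xy: "x \<noteq> 0 \<or> y \<noteq> 0" "A$1$1 * x + A$1$2 * y = l * x" "A$2$1 * x + A$2$2 * y = l * y"
    proof (cases "A$1$2 = 0 \<and> A$1$1 - l = 0")
      case False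
      show thesis
        by (rule that[of "A$1$2" "- (A$1$1 - l)"]) (use False d in \<open>auto simp: algebra_simps\<close>)
    next
      case T: True
      show thesis
      proof (cases "A$2$2 - l = 0 \<and> A$2$1 = 0")
        case False
        show thesis
          by (rule that[of "A$2$2 - l" "- A$2$1"]) (use T False d in \<open>auto simp: algebra_simps\<close>)
      next
        case True
        show thesis by (rule that[of 1 0]) (use T True in auto)
      qed
    qed
    have "(cmod (l * x))\<^sup>2 + (cmod (l * y))\<^sup>2 < (cmod x)\<^sup>2 + (cmod y)\<^sup>2"
      using matrix_2_contraction(2)[OF A(2) xy(1)] unfolding xy(2,3) .
    then have "(cmod l)\<^sup>2 * ((cmod x)\<^sup>2 + (cmod y)\<^sup>2) < 1 * ((cmod x)\<^sup>2 + (cmod y)\<^sup>2)"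
      by (simp add: norm_mult power_mult_distrib algebra_simps)
    then have "(cmod l)\<^sup>2 < 1\<^sup>2"
      using mult_less_cancel_right_disj by (metis add_nonneg_nonneg not_less one_power2 zero_le_power2)
    then show ?thesis by (rule power2_less_imp_less) simp
  qed
  define D where "D = csqrt (s\<^sup>2 - 4 * p)"
  define l1 l2 where "l1 = (s + D) / 2" and "l2 = (s - D) / 2"
  have D2: "D * D = s\<^sup>2 - 4 * p" unfolding D_def by (metis power2_csqrt power2_eq_square)
  have l: "s = l1 + l2" "p = l1 * l2"
    by (auto simp: l1_def l2_def field_simps D2 power2_eq_square)
  have "cmod l1 < 1" "cmod l2 < 1" by (auto intro!: root simp: l algebra_simps)
  then have "(s, p) \<in> sym_bidisc" using l by (auto simp: sym_bidisc_def)
  then show ?thesis by (simp add: A(1) s_def p_def)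
qed

text \<open>The matrix diag(l1, l2) lifts a point of the symmetrized bidisc. Condition (2) can
  thereby be tested on arbitrary finite sets of such points.\<close>

lemma zero_pentablock:
  assumes "x \<in> sym_bidisc"
  shows "(0, x) \<in> pentablock"
proof -
  obtain l1 l2 where l: "x = (l1 + l2, l1 * l2)" "cmod l1 < 1" "cmod l2 < 1"
    using assms by (auto simp: sym_bidisc_def)
  define A :: "complex ^ 2 ^ 2" where "A = vector [vector [l1, 0], vector [0, l2]]"
  define m where "m = max (cmod l1) (cmod l2)"
  have m: "0 \<le> m" "m < 1" "cmod l1 \<le> m" "cmod l2 \<le> m" using l by (auto simp: m_def max_def)
  have n2: "(norm (u :: complex ^ 2))\<^sup>2 = (cmod (u $ 1))\<^sup>2 + (cmod (u $ 2))\<^sup>2" for u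
    by (simp add: norm_vec_def L2_set_def sum_2)
  have "onorm ((*v) A) \<le> m"
  proof (rule onorm_bound[OF m(1)])
    fix v :: "complex ^ 2"
    have "(norm (A *v v))\<^sup>2 = (cmod l1)\<^sup>2 * (cmod (v$1))\<^sup>2 + (cmod l2)\<^sup>2 * (cmod (v$2))\<^sup>2"
      by (simp add: n2 A_def matrix_vector_mult_def sum_2 norm_mult power_mult_distrib)
    also have "\<dots> \<le> m\<^sup>2 * (cmod (v$1))\<^sup>2 + m\<^sup>2 * (cmod (v$2))\<^sup>2"
      using m by (intro add_mono mult_right_mono power_mono) auto
    also have "\<dots> = (m * norm v)\<^sup>2" by (simp add: n2 power_mult_distrib algebra_simps)
    finally show "norm (A *v v) \<le> m * norm v"
      by (rule power2_le_imp_le) (use m in auto)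
  qed
  then have "onorm ((*v) A) < 1" using m by linarith
  moreover have "(0, x) = (A $ 2 $ 1, trace A, det A)"
    by (simp add: A_def l trace_def sum_2 det_2)
  ultimately show ?thesis unfolding pentablock_def by blast
qed

text \<open>\<open>psi \<alpha>\<close> is the (2,1) entry of the Moebius transform (A - cnj
  \<alpha>) (1 - \<alpha> A)^(-1), which is again a contraction because |y - \<alpha> w|^2 - |w -
  cnj \<alpha> y|^2 = (1 - |\<alpha>|^2) (|y|^2 - |w|^2) componentwise with w = A y.\<close>

lemma psi_norm_le_one:
  assumes "z \<in> pentablock" "cmod \<alpha> \<le> 1"
  shows "cmod (psi \<alpha> z) \<le> 1"
proof -
  obtain A :: "complex ^ 2 ^ 2" where A: "z = (A $ 2 $ 1, trace A, det A)" "onorm ((*v) A) < 1"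
    using assms by (auto simp: pentablock_def)
  \<comment> \<open>First column of the adjugate of 1 - \<alpha> A; applying 1 - \<alpha> A to it
    gives (D, 0), so the inverse matrix is avoided.\<close>
  define y1 y2 where "y1 = 1 - \<alpha> * A$2$2" and "y2 = \<alpha> * A$2$1"
  define w1 w2 where "w1 = A$1$1 * y1 + A$1$2 * y2" and "w2 = A$2$1 * y1 + A$2$2 * y2"
  define D where "D = 1 - \<alpha> * trace A + \<alpha>\<^sup>2 * det A"
  have le: "(cmod w1)\<^sup>2 + (cmod w2)\<^sup>2 \<le> (cmod y1)\<^sup>2 + (cmod y2)\<^sup>2"
    unfolding w1_def w2_def by (rule matrix_2_contraction(1)[OF A(2)])
  have id: "(cmod (y - \<alpha> * w))\<^sup>2 - (cmod (w - cnj \<alpha> * y))\<^sup>2 = (1 - (cmod \<alpha>)\<^sup>2) * ((cmod y)\<^sup>2 - (cmod w)\<^sup>2)" for y w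
    unfolding cmod_power2 by (simp add: power2_eq_square algebra_simps)
  have "0 \<le> (1 - (cmod \<alpha>)\<^sup>2) * (((cmod y1)\<^sup>2 + (cmod y2)\<^sup>2) - ((cmod w1)\<^sup>2 + (cmod w2)\<^sup>2))"
    using le assms(2) by (intro mult_nonneg_nonneg) (auto simp: abs_square_le_1)
  then have "(cmod (w1 - cnj \<alpha> * y1))\<^sup>2 + (cmod (w2 - cnj \<alpha> * y2))\<^sup>2
     \<le> (cmod (y1 - \<alpha> * w1))\<^sup>2 + (cmod (y2 - \<alpha> * w2))\<^sup>2"
    using id[of y1 w1] id[of y2 w2] by (simp add: algebra_simps)
  moreover have "y1 - \<alpha> * w1 = D" "y2 - \<alpha> * w2 = 0"
    by (simp_all add: D_def w1_def w2_def y1_def y2_def trace_def sum_2 det_2 algebra_simps power2_eq_square)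
  moreover have "w2 - cnj \<alpha> * y2 = of_real (1 - (cmod \<alpha>)\<^sup>2) * A$2$1"
    unfolding of_real_diff complex_norm_square by (simp add: w2_def y1_def y2_def algebra_simps)
  ultimately have "(cmod (of_real (1 - (cmod \<alpha>)\<^sup>2) * A$2$1))\<^sup>2 \<le> (cmod D)\<^sup>2"
    by (smt (verit) norm_zero zero_le_power2 zero_power2)
  then have "cmod (of_real (1 - (cmod \<alpha>)\<^sup>2) * A$2$1) \<le> cmod D" by (rule power2_le_imp_le) simp
  then have "cmod (of_real (1 - (cmod \<alpha>)\<^sup>2) * A$2$1 / D) \<le> 1"
    unfolding norm_divide by (simp add: divide_le_eq_1)
  then show ?thesis by (simp add: A(1) psi_def D_def)
qed

lemma continuous_on_psi:
  assumes "z \<in> pentablock"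
  shows "continuous_on (cball 0 1) (\<lambda>\<alpha>. psi \<alpha> z)"
proof -
  obtain z1 s p where z: "z = (z1, s, p)" by (cases z)
  have "(s, p) \<in> sym_bidisc" using snd_pentablock[OF assms] by (simp add: z)
  then obtain l1 l2 where l: "s = l1 + l2" "p = l1 * l2" "cmod l1 < 1" "cmod l2 < 1"
    by (auto simp: sym_bidisc_def)
  have ne: "1 - \<alpha> * l \<noteq> 0" if "\<alpha> \<in> cball 0 1" "cmod l < 1" for \<alpha> l
  proof
    assume "1 - \<alpha> * l = 0"
    then have "cmod (\<alpha> * l) = 1" by simp
    moreover have "cmod \<alpha> * cmod l \<le> 1 * cmod l" using that by (intro mult_right_mono) auto
    ultimately show False using that by (simp add: norm_mult)
  qed
  have "1 - \<alpha> * s + \<alpha>\<^sup>2 * p \<noteq> 0" if "\<alpha> \<in> cball 0 1" for \<alpha>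
  proof -
    have "1 - \<alpha> * s + \<alpha>\<^sup>2 * p = (1 - \<alpha> * l1) * (1 - \<alpha> * l2)" by (simp add: l algebra_simps power2_eq_square)
    then show ?thesis using ne that l by simp
  qed
  then show ?thesis unfolding z psi_def by (auto intro!: continuous_intros)
qed

section \<open>Positive matrices of functionals\<close>

lemma C_disc_dual_add:
  "L \<in> C_disc_dual \<Longrightarrow> g \<in> C_disc \<Longrightarrow> h \<in> C_disc \<Longrightarrow> L (\<lambda>\<alpha>. g \<alpha> + h \<alpha>) = L g + L h"
  by (simp add: C_disc_dual_def)

lemma C_disc_dual_scale:
  "L \<in> C_disc_dual \<Longrightarrow> h \<in> C_disc \<Longrightarrow> L (\<lambda>\<alpha>. c * h \<alpha>) = c * L h"
  by (simp add: C_disc_dual_def)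

text \<open>Elements of \<open>C_disc\<close> are total functions. The norm bound is what makes a
  functional blind to their values outside the closed disc.\<close>

lemma C_disc_dual_zero:
  assumes "L \<in> C_disc_dual" "h \<in> C_disc" "\<And>\<alpha>. \<alpha> \<in> cball 0 1 \<Longrightarrow> h \<alpha> = 0"
  shows "L h = 0"
proof -
  obtain B where "cmod (L h) \<le> B * (SUP \<alpha>\<in>cball 0 1. cmod (h \<alpha>))"
    using assms by (auto simp: C_disc_dual_def)
  moreover have "(SUP \<alpha>\<in>cball 0 1. cmod (h \<alpha>)) = (SUP \<alpha>\<in>cball (0::complex) 1. 0 :: real)"
    using assms(3) by (intro SUP_cong) auto
  ultimately show ?thesis by simp
qed

text \<open>The nonnegative reals are closed, so a diagonal perturbation with a positive coefficient
  can be removed afterwards.\<close>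

lemma nonneg_Reals_limit:
  fixes t u :: complex
  assumes "\<And>\<eta>. 0 < \<eta> \<Longrightarrow> t + of_real \<eta> * u \<in> \<real>\<^sub>\<ge>\<^sub>0"
  shows "t \<in> \<real>\<^sub>\<ge>\<^sub>0"
proof -
  have "(\<lambda>n. t + of_real (inverse (real (Suc n))) * u) \<longlonglongrightarrow> t + of_real 0 * u"
    by (intro tendsto_intros LIMSEQ_inverse_real_of_nat)
  moreover have "\<forall>\<^sub>F n in sequentially. t + of_real (inverse (real (Suc n))) * u \<in> \<real>\<^sub>\<ge>\<^sub>0"
    by (intro always_eventually allI assms) simp
  ultimately have "t + of_real 0 * u \<in> \<real>\<^sub>\<ge>\<^sub>0"
    by (intro Lim_in_closed_set[OF closed_nonneg_Reals_complex]) auto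
  then show ?thesis by simp
qed

lemma positive_kernel_on_finite:
  assumes "positive_kernel_on X \<xi>" "finite T" "T \<subseteq> X" "\<And>i. i \<in> T \<Longrightarrow> h i \<in> C_disc"
  shows "(\<Sum>i\<in>T. \<Sum>j\<in>T. \<xi> i j (\<lambda>\<alpha>. h i \<alpha> * cnj (h j \<alpha>)) * c j * cnj (c i)) \<in> \<real>\<^sub>\<ge>\<^sub>0"
proof -
  obtain z where z: "bij_betw z {1..card T} T"
    using assms(2) ex_bij_betw_nat_finite_1 by blast
  define F where "F = (\<lambda>i j. \<xi> i j (\<lambda>\<alpha>. h i \<alpha> * cnj (h j \<alpha>)) * c j * cnj (c i))"
  have "\<forall>i\<in>{1..card T}. z i \<in> T" using z by (auto simp: bij_betw_def)
  then have "\<forall>i\<in>{1..card T}. z i \<in> X \<and> h (z i) \<in> C_disc" using assms by blast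
  then have "(\<Sum>i=1..card T. \<Sum>j=1..card T. F (z i) (z j)) \<in> \<real>\<^sub>\<ge>\<^sub>0"
    using assms(1) unfolding positive_kernel_on_def F_def
    by (elim conjE allE[of _ "card T"] allE[of _ z] allE[of _ "\<lambda>i. h (z i)"] allE[of _ "\<lambda>i. c (z i)"]) blast
  also have "(\<Sum>i=1..card T. \<Sum>j=1..card T. F (z i) (z j)) = (\<Sum>i=1..card T. \<Sum>j\<in>T. F (z i) j)"
    by (intro sum.cong refl sum.reindex_bij_betw[OF z])
  also have "\<dots> = (\<Sum>i\<in>T. \<Sum>j\<in>T. F i j)"
    by (rule sum.reindex_bij_betw[OF z])
  finally show ?thesis by (simp add: F_def)
qed

text \<open>Induction by Schur complements: the functions \<open>G i a / sqrt (G a a)\<close> are continuous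
  because \<open>G a a\<close> is bounded below.\<close>

lemma positive_functionals_definite_matrix:
  assumes "finite S" "S \<subseteq> X" "0 < \<eta>"
    and dual: "\<And>z w. z \<in> X \<Longrightarrow> w \<in> X \<Longrightarrow> \<xi> z w \<in> C_disc_dual"
    and pos: "\<And>T h. finite T \<Longrightarrow> T \<subseteq> X \<Longrightarrow> (\<And>i. i \<in> T \<Longrightarrow> h i \<in> C_disc) \<Longrightarrow>
        (\<Sum>i\<in>T. \<Sum>j\<in>T. \<xi> i j (\<lambda>\<alpha>. h i \<alpha> * cnj (h j \<alpha>)) * c j * cnj (c i)) \<in> \<real>\<^sub>\<ge>\<^sub>0"
    and "\<And>i j. i \<in> S \<Longrightarrow> j \<in> S \<Longrightarrow> G i j \<in> C_disc"
    and "\<And>\<alpha>. \<alpha> \<in> cball 0 1 \<Longrightarrow> hermitian_on S (\<lambda>i j. G i j \<alpha>)"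
    and "\<And>\<alpha> x. \<alpha> \<in> cball 0 1 \<Longrightarrow> \<eta> * (\<Sum>i\<in>S. (cmod (x i))\<^sup>2) \<le> Re (hform S (\<lambda>i j. G i j \<alpha>) x x)"
  shows "(\<Sum>i\<in>S. \<Sum>j\<in>S. \<xi> i j (G i j) * c j * cnj (c i)) \<in> \<real>\<^sub>\<ge>\<^sub>0"
  using assms(1,2,6-)
proof (induction S arbitrary: G rule: finite_induct)
  case empty
  then show ?case by simp
next
  case (insert a S)
  let ?T = "insert a S"
  note GC = insert.prems(2) and hG = insert.prems(3) and pd = insert.prems(4)
  have finT: "finite ?T" using insert by simp
  define g where "g = (\<lambda>\<alpha>. Re (G a a \<alpha>))"
  define h where "h = (\<lambda>i \<alpha>. G i a \<alpha> / of_real (sqrt (g \<alpha>)))"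
  \<comment> \<open>The Schur complement of the entry at a: G splits into a rank-one matrix of
    continuous functions, to which positivity of \<xi> applies directly, and H, whose row and column
    at a vanish on the disc.\<close>
  define H where "H = (\<lambda>i j \<alpha>. G i j \<alpha> - h i \<alpha> * cnj (h j \<alpha>))"
  have g: "\<eta> \<le> g \<alpha>" "G a a \<alpha> = of_real (g \<alpha>)" if \<alpha>: "\<alpha> \<in> cball 0 1" for \<alpha>
  proof -
    let ?e = "\<lambda>i. if i = a then 1 else 0 :: complex"
    have "\<eta> * (\<Sum>i\<in>?T. (cmod (?e i))\<^sup>2) \<le> Re (hform ?T (\<lambda>i j. G i j \<alpha>) ?e ?e)" by (rule pd[OF \<alpha>])
    moreover have "(\<Sum>i\<in>?T. (cmod (?e i))\<^sup>2) = (\<Sum>i\<in>?T. if i = a then 1 else 0)"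
      by (intro sum.cong refl) simp
    moreover have "\<dots> = (1::real)" unfolding sum.delta[OF finT] by simp
    moreover have "hform ?T (\<lambda>i j. G i j \<alpha>) ?e ?e = G a a \<alpha>"
      by (rule hform_unit_unit[OF finT]) auto
    ultimately show "\<eta> \<le> g \<alpha>" by (simp add: g_def)
    have "G a a \<alpha> = cnj (G a a \<alpha>)" using hG[OF \<alpha>] unfolding hermitian_on_def by blast
    then have "Im (G a a \<alpha>) = Im (cnj (G a a \<alpha>))" by (rule arg_cong)
    then show "G a a \<alpha> = of_real (g \<alpha>)" by (simp add: complex_eq_iff g_def)
  qed
  have hC: "h i \<in> C_disc" if "i \<in> ?T" for i
  proof -
    have "continuous_on (cball 0 1) (G i a)" "continuous_on (cball 0 1) (G a a)"
      using GC that by (auto simp: C_disc_def)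
    moreover have "of_real (sqrt (g \<alpha>)) \<noteq> (0 :: complex)" if "\<alpha> \<in> cball 0 1" for \<alpha>
      using g(1)[OF that] \<open>0 < \<eta>\<close> by simp
    ultimately show ?thesis unfolding h_def C_disc_def g_def
      by (auto intro!: continuous_intros)
  qed
  have hhC: "(\<lambda>\<alpha>. h i \<alpha> * cnj (h j \<alpha>)) \<in> C_disc" if "i \<in> ?T" "j \<in> ?T" for i j
    using hC that unfolding C_disc_def by (auto intro!: continuous_intros)
  have HC: "H i j \<in> C_disc" if "i \<in> ?T" "j \<in> ?T" for i j
    using GC[OF that] hhC[OF that] unfolding C_disc_def H_def by (auto intro!: continuous_intros)
  have ha: "h a \<alpha> = of_real (sqrt (g \<alpha>))" if "\<alpha> \<in> cball 0 1" for \<alpha>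
  proof -
    have "g \<alpha> > 0" using g(1)[OF that] \<open>0 < \<eta>\<close> by simp
    then show ?thesis unfolding h_def g(2)[OF that] of_real_divide[symmetric] by (simp add: real_div_sqrt)
  qed
  have H0: "H i a \<alpha> = 0" "H a i \<alpha> = 0" if "\<alpha> \<in> cball 0 1" "i \<in> ?T" for i \<alpha>
  proof -
    have gp: "g \<alpha> > 0" using g(1)[OF that(1)] \<open>0 < \<eta>\<close> by simp
    then show 1: "H i a \<alpha> = 0" unfolding H_def ha[OF that(1)] by (simp add: h_def)
    have "G a i \<alpha> = cnj (G i a \<alpha>)" using hG[OF that(1)] that(2) unfolding hermitian_on_def by blast
    then show "H a i \<alpha> = 0" unfolding H_def ha[OF that(1)] using gp by (simp add: h_def)
  qed
  have hH: "hermitian_on ?T (\<lambda>i j. H i j \<alpha>)" if "\<alpha> \<in> cball 0 1" for \<alpha>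
    unfolding H_def using hermitian_on_diff[OF hG[OF that] hermitian_on_rank_one[of _ 1 "\<lambda>i. h i \<alpha>"]] by simp
  have IH: "(\<Sum>i\<in>S. \<Sum>j\<in>S. \<xi> i j (H i j) * c j * cnj (c i)) \<in> \<real>\<^sub>\<ge>\<^sub>0"
  proof (rule insert.IH)
    show "S \<subseteq> X" using insert.prems(1) by blast
    show "\<And>i j. i \<in> S \<Longrightarrow> j \<in> S \<Longrightarrow> H i j \<in> C_disc" using HC by blast
    show "hermitian_on S (\<lambda>i j. H i j \<alpha>)" if "\<alpha> \<in> cball 0 1" for \<alpha>
      using hH[OF that] by (rule hermitian_on_subset) blast
    fix \<alpha> :: complex and x :: "'a \<Rightarrow> complex"
    assume \<alpha>: "\<alpha> \<in> cball 0 1"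
    have gp: "g \<alpha> > 0" using g(1)[OF \<alpha>] \<open>0 < \<eta>\<close> by simp
    \<comment> \<open>The coordinate at a is chosen to annihilate the rank-one part, so the forms of
      G and H agree at y. The lower bound \<eta> is thus inherited with the same constant.\<close>
    define y where "y = (\<lambda>i. if i = a then - (\<Sum>i\<in>S. h i \<alpha> * x i) / h a \<alpha> else x i)"
    have hy: "(\<Sum>i\<in>?T. h i \<alpha> * y i) = 0"
    proof -
      have "(\<Sum>i\<in>S. h i \<alpha> * y i) = (\<Sum>i\<in>S. h i \<alpha> * x i)"
        using insert.hyps by (intro sum.cong refl) (auto simp: y_def)
      then show ?thesis using insert.hyps gp by (simp add: y_def ha[OF \<alpha>])
    qed
    have "\<eta> * (\<Sum>i\<in>S. (cmod (x i))\<^sup>2) = \<eta> * (\<Sum>i\<in>S. (cmod (y i))\<^sup>2)"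
      using insert.hyps by (intro arg_cong[where f = "\<lambda>x. \<eta> * x"] sum.cong refl) (auto simp: y_def)
    also have "\<dots> \<le> \<eta> * (\<Sum>i\<in>?T. (cmod (y i))\<^sup>2)"
      using insert.hyps \<open>0 < \<eta>\<close> by simp
    also have "\<dots> \<le> Re (hform ?T (\<lambda>i j. G i j \<alpha>) y y)" by (rule pd[OF \<alpha>])
    also have "hform ?T (\<lambda>i j. G i j \<alpha>) y y = hform ?T (\<lambda>i j. H i j \<alpha>) y y"
      unfolding H_def hform_matrix_diff hform_rank_one hy by simp
    also have "\<dots> = hform S (\<lambda>i j. H i j \<alpha>) x x"
    proof -
      have "hform ?T (\<lambda>i j. H i j \<alpha>) y y = hform ?T (\<lambda>i j. H i j \<alpha>) (\<lambda>i. if i = a then 0 else x i) (\<lambda>i. if i = a then 0 else x i)"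
        unfolding hform_def using H0[OF \<alpha>] by (intro sum.cong refl) (auto simp: y_def)
      also have "\<dots> = hform S (\<lambda>i j. H i j \<alpha>) (\<lambda>i. if i = a then 0 else x i) (\<lambda>i. if i = a then 0 else x i)"
        by (rule hform_mono_supp) (use insert.hyps in auto)
      also have "\<dots> = hform S (\<lambda>i j. H i j \<alpha>) x x"
        by (rule hform_cong) (use insert.hyps in auto)
      finally show ?thesis .
    qed
    finally show "\<eta> * (\<Sum>i\<in>S. (cmod (x i))\<^sup>2) \<le> Re (hform S (\<lambda>i j. H i j \<alpha>) x x)" .
  qed
  have dec: "\<xi> i j (G i j) = \<xi> i j (\<lambda>\<alpha>. h i \<alpha> * cnj (h j \<alpha>)) + \<xi> i j (H i j)" if ij: "i \<in> ?T" "j \<in> ?T" for i j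
  proof -
    have "\<xi> i j \<in> C_disc_dual" using ij insert.prems(1) by (intro dual) auto
    from C_disc_dual_add[OF this hhC[OF ij] HC[OF ij]] show ?thesis by (simp add: H_def)
  qed
  \<comment> \<open>H i a and H a i vanish only on the closed disc, not as functions.\<close>
  have \<xi>0: "\<xi> i a (H i a) = 0" "\<xi> a i (H a i) = 0" if "i \<in> ?T" for i
  proof -
    have "i \<in> X" "a \<in> X" using that insert.prems(1) by auto
    then have d: "\<xi> i a \<in> C_disc_dual" "\<xi> a i \<in> C_disc_dual" by (auto intro: dual)
    have "H i a \<in> C_disc" "H a i \<in> C_disc" using that by (auto intro: HC)
    then show "\<xi> i a (H i a) = 0" "\<xi> a i (H a i) = 0"
      using C_disc_dual_zero[OF d(1)] C_disc_dual_zero[OF d(2)] H0[OF _ that] by auto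
  qed
  have inner: "(\<Sum>j\<in>?T. \<xi> i j (H i j) * c j * cnj (c i)) = (\<Sum>j\<in>S. \<xi> i j (H i j) * c j * cnj (c i))" if "i \<in> ?T" for i
    unfolding sum.insert[OF insert.hyps] \<xi>0(1)[OF that] by simp
  have "(\<Sum>i\<in>?T. \<Sum>j\<in>?T. \<xi> i j (H i j) * c j * cnj (c i)) = (\<Sum>i\<in>?T. \<Sum>j\<in>S. \<xi> i j (H i j) * c j * cnj (c i))"
    by (intro sum.cong refl inner)
  also have "\<dots> = (\<Sum>i\<in>S. \<Sum>j\<in>S. \<xi> i j (H i j) * c j * cnj (c i))"
    using \<xi>0(2) by (subst sum.insert[OF insert.hyps]) simp
  finally have eq: "(\<Sum>i\<in>?T. \<Sum>j\<in>?T. \<xi> i j (H i j) * c j * cnj (c i)) = (\<Sum>i\<in>S. \<Sum>j\<in>S. \<xi> i j (H i j) * c j * cnj (c i))" .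
  have "(\<Sum>i\<in>?T. \<Sum>j\<in>?T. \<xi> i j (G i j) * c j * cnj (c i)) =
     (\<Sum>i\<in>?T. \<Sum>j\<in>?T. \<xi> i j (\<lambda>\<alpha>. h i \<alpha> * cnj (h j \<alpha>)) * c j * cnj (c i) + \<xi> i j (H i j) * c j * cnj (c i))"
    by (intro sum.cong refl) (simp only: dec distrib_right)
  also have "\<dots> = (\<Sum>i\<in>?T. \<Sum>j\<in>?T. \<xi> i j (\<lambda>\<alpha>. h i \<alpha> * cnj (h j \<alpha>)) * c j * cnj (c i)) +
     (\<Sum>i\<in>S. \<Sum>j\<in>S. \<xi> i j (H i j) * c j * cnj (c i))"
    unfolding sum.distrib eq ..
  also have "\<dots> \<in> \<real>\<^sub>\<ge>\<^sub>0"
    by (intro nonneg_Reals_add_I IH pos finT insert.prems(1) hC)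
  finally show ?case .
qed

text \<open>A pointwise positive matrix may degenerate at some \<alpha>, where the pivot has no
  usable square root. Adding \<eta> times the identity keeps pivots away from 0; linearity of the
  functionals makes the result affine in \<eta>.\<close>

lemma positive_functionals_matrix:
  fixes X :: "'a set"
  assumes S: "finite S" "S \<subseteq> X"
    and dual: "\<And>z w. z \<in> X \<Longrightarrow> w \<in> X \<Longrightarrow> \<xi> z w \<in> C_disc_dual"
    and pos: "\<And>T h. finite T \<Longrightarrow> T \<subseteq> X \<Longrightarrow> (\<And>i. i \<in> T \<Longrightarrow> h i \<in> C_disc) \<Longrightarrow>
        (\<Sum>i\<in>T. \<Sum>j\<in>T. \<xi> i j (\<lambda>\<alpha>. h i \<alpha> * cnj (h j \<alpha>)) * c j * cnj (c i)) \<in> \<real>\<^sub>\<ge>\<^sub>0"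
    and GC: "\<And>i j. i \<in> S \<Longrightarrow> j \<in> S \<Longrightarrow> G i j \<in> C_disc"
    and G: "\<And>\<alpha>. \<alpha> \<in> cball 0 1 \<Longrightarrow> pos_on S (\<lambda>i j. G i j \<alpha>)"
  shows "(\<Sum>i\<in>S. \<Sum>j\<in>S. \<xi> i j (G i j) * c j * cnj (c i)) \<in> \<real>\<^sub>\<ge>\<^sub>0"
proof (rule nonneg_Reals_limit)
  fix \<eta> :: real assume \<eta>: "0 < \<eta>"
  define K where "K = (\<lambda>(i::'a) j (\<alpha>::complex). if i = j then 1 else 0 :: complex)"
  define G' where "G' = (\<lambda>i j \<alpha>. G i j \<alpha> + of_real \<eta> * K i j \<alpha>)"
  have KC: "K i j \<in> C_disc" for i j unfolding K_def C_disc_def by (auto intro!: continuous_intros)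
  have sKC: "(\<lambda>\<alpha>. of_real \<eta> * K i j \<alpha>) \<in> C_disc" for i j
    using KC unfolding C_disc_def by (auto intro!: continuous_intros)
  have hK: "hform S (\<lambda>i j. K i j \<alpha>) x x = of_real (\<Sum>i\<in>S. (cmod (x i))\<^sup>2)" for \<alpha> x
  proof -
    have "(\<Sum>j\<in>S. K i j \<alpha> * x i * cnj (x j)) = (\<Sum>j\<in>S. if j = i then x i * cnj (x j) else 0)" for i
      by (intro sum.cong refl) (simp add: K_def)
    then show ?thesis
      unfolding hform_def sum.delta[OF S(1)] of_real_sum complex_norm_square by simp
  qed
  have hermK: "hermitian_on S (\<lambda>i j. K i j \<alpha>)" for \<alpha>
    by (auto simp: hermitian_on_def K_def)
  have "(\<Sum>i\<in>S. \<Sum>j\<in>S. \<xi> i j (G' i j) * c j * cnj (c i)) \<in> \<real>\<^sub>\<ge>\<^sub>0"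
  proof (rule positive_functionals_definite_matrix[OF S \<eta> dual pos])
    show "G' i j \<in> C_disc" if "i \<in> S" "j \<in> S" for i j
      using GC[OF that] sKC[of i j] unfolding C_disc_def G'_def mem_Collect_eq by (rule continuous_on_add)
    show "hermitian_on S (\<lambda>i j. G' i j \<alpha>)" if "\<alpha> \<in> cball 0 1" for \<alpha>
      unfolding G'_def by (intro hermitian_on_add hermitian_on_scale hermK pos_on_imp_hermitian[OF S(1)] G that)
    show "\<eta> * (\<Sum>i\<in>S. (cmod (x i))\<^sup>2) \<le> Re (hform S (\<lambda>i j. G' i j \<alpha>) x x)" if "\<alpha> \<in> cball 0 1" for \<alpha> x
    proof -
      have "hform S (\<lambda>i j. G i j \<alpha>) x x \<in> \<real>\<^sub>\<ge>\<^sub>0" using G[OF that] by (simp add: pos_on_def)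
      then show ?thesis unfolding G'_def hform_matrix_add hform_matrix_scale hK
        by (simp add: complex_nonneg_Reals_iff)
    qed
  qed auto
  also have "(\<Sum>i\<in>S. \<Sum>j\<in>S. \<xi> i j (G' i j) * c j * cnj (c i)) =
     (\<Sum>i\<in>S. \<Sum>j\<in>S. \<xi> i j (G i j) * c j * cnj (c i)) + of_real \<eta> * (\<Sum>i\<in>S. \<Sum>j\<in>S. \<xi> i j (K i j) * c j * cnj (c i))"
    unfolding sum_distrib_left sum.distrib[symmetric]
  proof (intro sum.cong refl)
    fix i j assume ij: "i \<in> S" "j \<in> S"
    then have d: "\<xi> i j \<in> C_disc_dual" using S by (intro dual) auto
    show "\<xi> i j (G' i j) * c j * cnj (c i) = \<xi> i j (G i j) * c j * cnj (c i) + of_real \<eta> * (\<xi> i j (K i j) * c j * cnj (c i))"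
      unfolding G'_def C_disc_dual_add[OF d GC[OF ij] sKC] C_disc_dual_scale[OF d KC]
      by (simp add: algebra_simps)
  qed
  finally show "(\<Sum>i\<in>S. \<Sum>j\<in>S. \<xi> i j (G i j) * c j * cnj (c i)) +
     of_real \<eta> * (\<Sum>i\<in>S. \<Sum>j\<in>S. \<xi> i j (K i j) * c j * cnj (c i)) \<in> \<real>\<^sub>\<ge>\<^sub>0" .
qed

text \<open>By linearity the scalar k i j moves inside the functional, so only positivity of the
  products F i j \<alpha> * k i j at each \<alpha> is required. These are exactly the products
  controlled by admissibility.\<close>

lemma pos_on_functional_product:
  assumes S: "finite S" "S \<subseteq> X" and \<xi>: "positive_kernel_on X \<xi>"
    and FC: "\<And>i j. i \<in> S \<Longrightarrow> j \<in> S \<Longrightarrow> F i j \<in> C_disc"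
    and F: "\<And>\<alpha>. \<alpha> \<in> cball 0 1 \<Longrightarrow> pos_on S (\<lambda>i j. F i j \<alpha> * k i j)"
  shows "pos_on S (\<lambda>i j. \<xi> i j (F i j) * k i j)"
  unfolding pos_on_def
proof
  fix x
  have dual: "\<xi> z w \<in> C_disc_dual" if "z \<in> X" "w \<in> X" for z w
    using \<xi> that by (auto simp: positive_kernel_on_def)
  have "(\<Sum>i\<in>S. \<Sum>j\<in>S. \<xi> i j (\<lambda>\<alpha>. k i j * F i j \<alpha>) * cnj (x j) * cnj (cnj (x i))) \<in> \<real>\<^sub>\<ge>\<^sub>0"
  proof (rule positive_functionals_matrix[OF S dual positive_kernel_on_finite[OF \<xi>]])
    show "(\<lambda>\<alpha>. k i j * F i j \<alpha>) \<in> C_disc" if "i \<in> S" "j \<in> S" for i j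
      using FC[OF that] unfolding C_disc_def by (auto intro!: continuous_intros)
    show "pos_on S (\<lambda>i j. k i j * F i j \<alpha>)" if "\<alpha> \<in> cball 0 1" for \<alpha>
      using F[OF that] by (simp add: mult.commute)
  qed auto
  also have "(\<Sum>i\<in>S. \<Sum>j\<in>S. \<xi> i j (\<lambda>\<alpha>. k i j * F i j \<alpha>) * cnj (x j) * cnj (cnj (x i)))
     = hform S (\<lambda>i j. \<xi> i j (F i j) * k i j) x x"
    unfolding hform_def
  proof (intro sum.cong refl)
    fix i j assume ij: "i \<in> S" "j \<in> S"
    then have d: "\<xi> i j \<in> C_disc_dual" using S by (intro dual) auto
    show "\<xi> i j (\<lambda>\<alpha>. k i j * F i j \<alpha>) * cnj (x j) * cnj (cnj (x i)) = \<xi> i j (F i j) * k i j * x i * cnj (x j)"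
      unfolding C_disc_dual_scale[OF d FC[OF ij]] by (simp add: mult_ac)
  qed
  finally show "hform S (\<lambda>i j. \<xi> i j (F i j) * k i j) x x \<in> \<real>\<^sub>\<ge>\<^sub>0" .
qed

text \<open>Evaluation at the origin turns a positive matrix into a positive functional matrix.\<close>

lemma schur_product:
  assumes S: "finite S" and A: "pos_on S A" and B: "pos_on S B"
  shows "pos_on S (\<lambda>i j. A i j * B i j)"
proof -
  define \<xi> where "\<xi> = (\<lambda>i j (h :: complex \<Rightarrow> complex). A i j * h 0)"
  have "pos_on S (\<lambda>i j. \<xi> i j (\<lambda>\<alpha>. B i j))"
    unfolding pos_on_def
  proof
    fix x
    have "(\<Sum>i\<in>S. \<Sum>j\<in>S. \<xi> i j (\<lambda>\<alpha>. B i j) * cnj (x j) * cnj (cnj (x i))) \<in> \<real>\<^sub>\<ge>\<^sub>0"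
    proof (rule positive_functionals_matrix[where X = S and \<xi> = \<xi> and G = "\<lambda>i j \<alpha>. B i j" and c = "\<lambda>i. cnj (x i)", OF S order_refl])
      fix z w assume "z \<in> S" "w \<in> S"
      have "cmod (h 0) \<le> (SUP \<alpha>\<in>cball 0 1. cmod (h \<alpha>))" if "h \<in> C_disc" for h
      proof (rule cSUP_upper)
        have "compact ((\<lambda>\<alpha>. cmod (h \<alpha>)) ` cball 0 1)"
          using that by (intro compact_continuous_image continuous_intros) (auto simp: C_disc_def)
        then show "bdd_above ((\<lambda>\<alpha>. cmod (h \<alpha>)) ` cball 0 1)"
          by (intro bounded_imp_bdd_above compact_imp_bounded)
      qed simp
      then have "\<forall>h\<in>C_disc. cmod (\<xi> z w h) \<le> cmod (A z w) * (SUP \<alpha>\<in>cball 0 1. cmod (h \<alpha>))"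
        by (auto simp: \<xi>_def norm_mult intro!: mult_left_mono)
      then show "\<xi> z w \<in> C_disc_dual"
        unfolding C_disc_dual_def by (auto simp: \<xi>_def algebra_simps)
    next
      fix T and h :: "'a \<Rightarrow> complex \<Rightarrow> complex" assume T: "finite T" "T \<subseteq> S"
      define y where "y = (\<lambda>i. if i \<in> T then h i 0 * x i else 0)"
      have "(\<Sum>i\<in>T. \<Sum>j\<in>T. \<xi> i j (\<lambda>\<alpha>. h i \<alpha> * cnj (h j \<alpha>)) * cnj (x j) * cnj (cnj (x i))) = hform T A y y"
        unfolding hform_def by (intro sum.cong refl) (auto simp: \<xi>_def y_def)
      also have "\<dots> = hform S A y y"
        by (rule hform_mono_supp[symmetric]) (use S T in \<open>auto simp: y_def\<close>)
      also have "\<dots> \<in> \<real>\<^sub>\<ge>\<^sub>0" using A by (simp add: pos_on_def)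
      finally show "(\<Sum>i\<in>T. \<Sum>j\<in>T. \<xi> i j (\<lambda>\<alpha>. h i \<alpha> * cnj (h j \<alpha>)) * cnj (x j) * cnj (cnj (x i))) \<in> \<real>\<^sub>\<ge>\<^sub>0" .
    qed (use B in \<open>auto simp: C_disc_def\<close>)
    then show "hform S (\<lambda>i j. \<xi> i j (\<lambda>\<alpha>. B i j)) x x \<in> \<real>\<^sub>\<ge>\<^sub>0"
      by (simp add: hform_def mult_ac)
  qed
  then show ?thesis by (simp add: \<xi>_def)
qed

section \<open>Operations that preserve positive semidefinite kernels\<close>

lemma psd_on_add:
  assumes "psd_on X k" "psd_on X l"
  shows "psd_on X (\<lambda>z w. k z w + l z w)"
  unfolding psd_on_iff
proof (intro allI impI)
  fix S assume S: "finite S \<and> S \<subseteq> X"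
  then have "pos_on S k" "pos_on S l" using assms unfolding psd_on_iff by blast+
  then show "pos_on S (\<lambda>z w. k z w + l z w)"
    unfolding pos_on_def hform_matrix_add by (blast intro: nonneg_Reals_add_I)
qed

lemma psd_on_cong:
  assumes "psd_on X k" "\<And>z w. z \<in> X \<Longrightarrow> w \<in> X \<Longrightarrow> k z w = l z w"
  shows "psd_on X l"
  unfolding psd_on_iff pos_on_def
proof (intro allI impI)
  fix S x assume S: "finite S \<and> S \<subseteq> X"
  have "hform S k x x = hform S l x x"
    by (rule hform_cong) (use assms(2) S in blast)+
  moreover have "hform S k x x \<in> \<real>\<^sub>\<ge>\<^sub>0" using assms(1) S unfolding psd_on_iff pos_on_def by blast
  ultimately show "hform S l x x \<in> \<real>\<^sub>\<ge>\<^sub>0" by simp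
qed

lemma psd_on_pullback:
  assumes "psd_on X k" "\<And>z. z \<in> Y \<Longrightarrow> f z \<in> X"
  shows "psd_on Y (\<lambda>z w. k (f z) (f w))"
  unfolding psd_on_def
proof (intro allI impI)
  fix N :: nat and z and c :: "nat \<Rightarrow> complex"
  assume "\<forall>i\<in>{1..N}. z i \<in> Y"
  then have "\<forall>i\<in>{1..N}. f (z i) \<in> X" using assms(2) by blast
  then show "(\<Sum>i=1..N. \<Sum>j=1..N. k (f (z i)) (f (z j)) * c j * cnj (c i)) \<in> \<real>\<^sub>\<ge>\<^sub>0"
    using assms(1)[unfolded psd_on_def, rule_format, of N "\<lambda>i. f (z i)" c] by simp
qed

lemma pos_on_congruence:
  assumes "pos_on S k"
  shows "pos_on S (\<lambda>z w. u z * cnj (u w) * k z w)"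
proof -
  have "hform S (\<lambda>z w. u z * cnj (u w) * k z w) x x = hform S k (\<lambda>z. u z * x z) (\<lambda>z. u z * x z)" for x
    by (simp add: hform_def mult_ac)
  then show ?thesis using assms by (simp add: pos_on_def)
qed

lemma psd_on_congruence:
  assumes "psd_on X k"
  shows "psd_on X (\<lambda>z w. u z * cnj (u w) * k z w)"
  using assms unfolding psd_on_iff by (blast intro: pos_on_congruence)

lemma hform_diagonal:
  assumes "finite S"
  shows "hform S (\<lambda>z w. if z = w then d z else 0) x x = (\<Sum>z\<in>S. d z * of_real ((cmod (x z))\<^sup>2))"
  unfolding hform_def
proof (intro sum.cong refl)
  fix z assume "z \<in> S"
  have "(\<Sum>w\<in>S. (if z = w then d z else 0) * x z * cnj (x w)) = (\<Sum>w\<in>S. if w = z then d z * x z * cnj (x w) else 0)"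
    by (intro sum.cong refl) auto
  then show "(\<Sum>w\<in>S. (if z = w then d z else 0) * x z * cnj (x w)) = d z * of_real ((cmod (x z))\<^sup>2)"
    unfolding sum.delta[OF assms] complex_norm_square using \<open>z \<in> S\<close> by (simp add: mult_ac)
qed

lemma psd_on_diagonal:
  assumes "\<And>z. z \<in> X \<Longrightarrow> 0 \<le> d z"
  shows "psd_on X (\<lambda>z w. if z = w then of_real (d z) else 0)"
  unfolding psd_on_iff
proof (intro allI impI)
  fix S assume S: "finite S \<and> S \<subseteq> X"
  then have form: "hform S (\<lambda>z w. if z = w then of_real (d z) else 0) x x = of_real (\<Sum>z\<in>S. d z * (cmod (x z))\<^sup>2)" for x
    by (simp add: hform_diagonal)
  have "0 \<le> (\<Sum>z\<in>S. d z * (cmod (x z))\<^sup>2)" for x :: "'a \<Rightarrow> complex"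
    using S assms by (intro sum_nonneg) auto
  then show "pos_on S (\<lambda>z w. if z = w then of_real (d z) else 0)"
    unfolding pos_on_def form nonneg_Reals_of_real_iff by blast
qed

lemma psd_on_UNIV_extension:
  assumes "finite S" "pos_on S k" "\<And>x y. \<not> (x \<in> S \<and> y \<in> S) \<Longrightarrow> k x y = 0"
  shows "psd_on UNIV k"
  unfolding psd_on_iff
proof (intro allI impI)
  fix T :: "'a set" assume T: "finite T \<and> T \<subseteq> UNIV"
  show "pos_on T k"
    unfolding pos_on_def
  proof
    fix x :: "'a \<Rightarrow> complex"
    define y where "y = (\<lambda>i. if i \<in> T \<inter> S then x i else 0)"
    have "hform T k x x = hform T k y y"
      unfolding hform_def using assms(3) by (intro sum.cong refl) (auto simp: y_def)
    also have "\<dots> = hform (T \<inter> S) k y y"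
      by (rule hform_mono_supp) (use T in \<open>auto simp: y_def\<close>)
    also have "\<dots> = hform S k y y"
      by (rule hform_mono_supp[symmetric]) (use assms in \<open>auto simp: y_def\<close>)
    finally show "hform T k x x \<in> \<real>\<^sub>\<ge>\<^sub>0" using assms(2) by (simp add: pos_on_def)
  qed
qed

section \<open>Finite Agler decompositions\<close>

text \<open>The tests are the functions \<open>Phi \<alpha>\<close> and the zero function. The latter is indexed by
  \<open>\<alpha> = 1\<close> because \<open>psi 1 = 0\<close>.\<close>

definition tests :: "(bool \<times> complex) set" where
  "tests = insert (False, 1) ({True} \<times> cball 0 1)"

definition test_fun :: "bool \<times> complex \<Rightarrow> complex \<times> complex \<Rightarrow> complex" where
  "test_fun t x = (if fst t then Phi (snd t) x else 0)"

text \<open>Lists allow the same test to occur several times with different vectors, so addition in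
  the cone is concatenation.\<close>

definition agler_sum ::
  "((bool \<times> complex) \<times> (complex \<times> complex \<Rightarrow> complex)) list \<Rightarrow> complex \<times> complex \<Rightarrow> complex \<times> complex \<Rightarrow> complex" where
  "agler_sum ps x y = (\<Sum>(t, v)\<leftarrow>ps. (1 - test_fun t x * cnj (test_fun t y)) * (v x * cnj (v y)))"

lemma test_fun_norm_less_one:
  assumes "t \<in> tests" "x \<in> sym_bidisc"
  shows "cmod (test_fun t x) < 1"
  using assms(1) Phi_norm_less_one[OF assms(2)] by (auto simp: tests_def test_fun_def)

lemma agler_sum_append: "agler_sum (ps @ qs) x y = agler_sum ps x y + agler_sum qs x y"
  by (simp add: agler_sum_def)

lemma agler_sum_hermitian: "agler_sum ps y x = cnj (agler_sum ps x y)"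
  by (induction ps) (auto simp: agler_sum_def mult_ac)

lemma agler_sum_scale:
  assumes "0 \<le> c"
  shows "agler_sum (map (\<lambda>(t, v). (t, \<lambda>x. of_real (sqrt c) * v x)) ps) x y = of_real c * agler_sum ps x y"
proof (induction ps)
  case Nil
  then show ?case by (simp add: agler_sum_def)
next
  case (Cons p ps)
  have "complex_of_real (sqrt c) * complex_of_real (sqrt c) = of_real c"
    using assms by (simp add: of_real_mult[symmetric] del: of_real_mult)
  then have sq: "a * (of_real (sqrt c) * b * cnj (of_real (sqrt c) * d)) = of_real c * (a * (b * cnj d))" for a b d :: complex
    by (metis complex_cnj_complex_of_real complex_cnj_mult mult.assoc mult.left_commute)
  obtain t v where p: "p = (t, v)" by (cases p)
  show ?case using Cons sq[of "1 - test_fun t x * cnj (test_fun t y)" "v x" "v y"]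
    unfolding p agler_sum_def by (simp only: list.map sum_list.Cons prod.case distrib_left)
qed

text \<open>The zero test contributes plain rank-one matrices. Any matrix already diagonalized into
  a sum of them therefore lies in the cone.\<close>

lemma finite_agler_decomposition_rank_one:
  assumes "finite S"
  obtains ps where "fst ` set ps \<subseteq> tests"
    "\<And>x y. agler_sum ps x y = (\<Sum>k\<in>S. w k x * cnj (w k y))"
proof -
  obtain xs where xs: "set xs = S" "distinct xs" using finite_distinct_list[OF assms] by blast
  show thesis
  proof
    show "fst ` set (map (\<lambda>k. ((False, 1), w k)) xs) \<subseteq> tests" by (auto simp: tests_def)
    fix x y
    have "agler_sum (map (\<lambda>k. ((False, 1), w k)) xs) x y = (\<Sum>k\<leftarrow>xs. w k x * cnj (w k y))"
      by (simp add: agler_sum_def comp_def test_fun_def)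
    also have "\<dots> = (\<Sum>k\<in>S. w k x * cnj (w k y))"
      using xs by (simp add: sum_list_distinct_conv_sum_set)
    finally show "agler_sum (map (\<lambda>k. ((False, 1), w k)) xs) x y = (\<Sum>k\<in>S. w k x * cnj (w k y))" .
  qed
qed

text \<open>The bound |x_i x_j| \<le> (|x_i|^2 + |x_j|^2) / 2 shows that entries of size \<delta>
  change the form by at most \<delta> card S times the squared length.\<close>

lemma diagonally_dominated_positive_definite:
  assumes S: "finite S" and E: "\<And>i j. i \<in> S \<Longrightarrow> j \<in> S \<Longrightarrow> cmod (E i j) \<le> \<delta>"
    and \<delta>: "0 \<le> \<delta>" "\<delta> * real (card S) < r" and nz: "\<exists>i\<in>S. x i \<noteq> 0"
  shows "0 < Re (hform S (\<lambda>i j. E i j + (if i = j then of_real r else 0)) x x)"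
proof -
  define Q where "Q = (\<Sum>i\<in>S. (cmod (x i))\<^sup>2)"
  have Q: "Q > 0" unfolding Q_def using S nz by (auto intro!: sum_pos2)
  have "cmod (hform S E x x) \<le> (\<Sum>i\<in>S. \<Sum>j\<in>S. cmod (E i j * x i * cnj (x j)))"
    unfolding hform_def by (intro sum_norm_le order_refl)
  also have "\<dots> \<le> (\<Sum>i\<in>S. \<Sum>j\<in>S. \<delta> * (((cmod (x i))\<^sup>2 + (cmod (x j))\<^sup>2) / 2))"
  proof (intro sum_mono)
    fix i j assume ij: "i \<in> S" "j \<in> S"
    have "2 * cmod (x i) * cmod (x j) \<le> (cmod (x i))\<^sup>2 + (cmod (x j))\<^sup>2"
      by (rule sum_squares_bound)
    then have "cmod (E i j) * (cmod (x i) * cmod (x j)) \<le> \<delta> * (((cmod (x i))\<^sup>2 + (cmod (x j))\<^sup>2) / 2)"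
      using E[OF ij] \<delta> by (intro mult_mono) auto
    then show "cmod (E i j * x i * cnj (x j)) \<le> \<delta> * (((cmod (x i))\<^sup>2 + (cmod (x j))\<^sup>2) / 2)"
      by (simp add: norm_mult mult.assoc)
  qed
  also have "\<dots> = \<delta> * (real (card S) * Q)"
    unfolding sum_distrib_left[symmetric] sum_divide_distrib[symmetric] sum.distrib sum_constant Q_def[symmetric]
    by (simp add: Q_def[symmetric])
  also have "\<dots> < r * Q" using \<delta>(2) Q by (simp add: mult.assoc[symmetric])
  finally have "cmod (hform S E x x) < r * Q" .
  then have "- (r * Q) < Re (hform S E x x)"
    using abs_Re_le_cmod[of "hform S E x x"] by linarith
  moreover have "hform S (\<lambda>i j. E i j + (if i = j then of_real r else 0)) x x = hform S E x x + of_real (r * Q)"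
    unfolding hform_matrix_add hform_diagonal[OF S] by (simp add: Q_def sum_distrib_left)
  ultimately show ?thesis by simp
qed

text \<open>The finite kernel is placed on the slice with first coordinate 0. The multiple \<tau> of
  the identity makes every diagonal value nonzero, as a kernel requires, and it passes every test
  because the tests have modulus at most 1.\<close>

lemma AK_point_masses:
  assumes S: "finite S" "S \<subseteq> sym_bidisc" and \<tau>: "0 < \<tau>"
    and k: "\<And>x y. \<not> (x \<in> S \<and> y \<in> S) \<Longrightarrow> k x y = 0"
    and pos: "\<And>t. t \<in> tests \<Longrightarrow> pos_on S (\<lambda>x y. (1 - test_fun t x * cnj (test_fun t y)) * k x y)"
  shows "(\<lambda>z w. (if fst z = 0 \<and> fst w = 0 then k (snd z) (snd w) else 0) + (if z = w then of_real \<tau> else 0)) \<in> AK"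
proof -
  define \<kappa> where "\<kappa> = (\<lambda>z :: complex \<times> complex \<times> complex. if fst z = 0 then 1 else 0 :: complex)"
  define K where "K = (\<lambda>z w. \<kappa> z * cnj (\<kappa> w) * k (snd z) (snd w) + (if z = w then of_real \<tau> else 0))"
  have K_eq: "K = (\<lambda>z w. (if fst z = 0 \<and> fst w = 0 then k (snd z) (snd w) else 0) + (if z = w then of_real \<tau> else 0))"
    by (auto simp: K_def \<kappa>_def fun_eq_iff)
  have main: "psd_on pentablock (\<lambda>z w. (1 - u z * cnj (u w)) * K z w)"
    if t: "t \<in> tests" and u1: "\<And>z. z \<in> pentablock \<Longrightarrow> cmod (u z) \<le> 1"
      and ut: "\<And>z. z \<in> pentablock \<Longrightarrow> \<kappa> z * u z = \<kappa> z * test_fun t (snd z)" for u t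
  proof -
    have "psd_on UNIV (\<lambda>x y. (1 - test_fun t x * cnj (test_fun t y)) * k x y)"
      by (rule psd_on_UNIV_extension[OF S(1) pos[OF t]]) (simp add: k)
    then have "psd_on pentablock (\<lambda>z w. (1 - test_fun t (snd z) * cnj (test_fun t (snd w))) * k (snd z) (snd w))"
      by (rule psd_on_pullback) simp
    then have 1: "psd_on pentablock (\<lambda>z w. \<kappa> z * cnj (\<kappa> w) * ((1 - test_fun t (snd z) * cnj (test_fun t (snd w))) * k (snd z) (snd w)))"
      by (rule psd_on_congruence)
    have 2: "psd_on pentablock (\<lambda>z w. if z = w then of_real (\<tau> * (1 - (cmod (u z))\<^sup>2)) else 0)"
      using u1 \<tau> by (intro psd_on_diagonal) (simp add: abs_square_le_1)
    have "psd_on pentablock (\<lambda>z w. \<kappa> z * cnj (\<kappa> w) * ((1 - test_fun t (snd z) * cnj (test_fun t (snd w))) * k (snd z) (snd w))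
        + (if z = w then of_real (\<tau> * (1 - (cmod (u z))\<^sup>2)) else 0))" (is "psd_on _ ?L")
      by (rule psd_on_add[OF 1 2])
    moreover have "?L z w = (1 - u z * cnj (u w)) * K z w" if zw: "z \<in> pentablock" "w \<in> pentablock" for z w
    proof -
      have a: "\<kappa> z * cnj (\<kappa> w) * (test_fun t (snd z) * cnj (test_fun t (snd w))) = \<kappa> z * cnj (\<kappa> w) * (u z * cnj (u w))"
      proof -
        have "\<kappa> z * cnj (\<kappa> w) * (test_fun t (snd z) * cnj (test_fun t (snd w)))
           = (\<kappa> z * test_fun t (snd z)) * cnj (\<kappa> w * test_fun t (snd w))" by simp
        also have "\<dots> = (\<kappa> z * u z) * cnj (\<kappa> w * u w)" unfolding zw[THEN ut] ..
        finally show ?thesis by simp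
      qed
      have b: "(if z = w then of_real (\<tau> * (1 - (cmod (u z))\<^sup>2)) else 0) = (1 - u z * cnj (u w)) * (if z = w then of_real \<tau> else 0)"
        unfolding of_real_mult of_real_diff complex_norm_square by simp
      have alg: "c * T = c * U \<Longrightarrow> D' = (1 - U) * D \<Longrightarrow> c * ((1 - T) * l) + D' = (1 - U) * (c * l + D)"
        for c T U D D' l :: complex by algebra
      show ?thesis unfolding K_def by (rule alg[OF a b])
    qed
    ultimately show ?thesis by (rule psd_on_cong)
  qed
  have mem: "(False, 1) \<in> tests" "\<And>\<alpha>. cmod \<alpha> \<le> 1 \<Longrightarrow> (True, \<alpha>) \<in> tests" by (auto simp: tests_def)
  have "psd_on pentablock (\<lambda>z w. (1 - 0 * cnj 0) * K z w)"
    using main[of "(False, 1)" "\<lambda>_. 0"] mem by (simp add: test_fun_def)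
  then have "psd_on pentablock K" by simp
  moreover have "K z z \<noteq> 0" for z
  proof -
    have "0 \<le> Re (k x x)" for x
    proof (cases "x \<in> S")
      case True
      have "hform S (\<lambda>x y. (1 - test_fun (False, 1) x * cnj (test_fun (False, 1) y)) * k x y)
         (\<lambda>i. if i = x then 1 else 0) (\<lambda>i. if i = x then 1 else 0) \<in> \<real>\<^sub>\<ge>\<^sub>0"
        using pos[OF mem(1)] unfolding pos_on_def by blast
      then have "k x x \<in> \<real>\<^sub>\<ge>\<^sub>0" unfolding hform_unit_unit[OF S(1) True True] by (simp add: test_fun_def)
      then show ?thesis by (simp add: complex_nonneg_Reals_iff)
    qed (simp add: k)
    then have "0 < Re (K z z)" using \<tau> by (simp add: K_def \<kappa>_def add_nonneg_pos)
    then show ?thesis by auto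
  qed
  moreover have "psd_on pentablock (\<lambda>z w. (1 - Phi \<alpha> (snd z) * cnj (Phi \<alpha> (snd w))) * K z w)" if "cmod \<alpha> \<le> 1" for \<alpha>
    by (rule main[OF mem(2)[OF that]])
      (use that in \<open>auto simp: test_fun_def intro!: less_imp_le Phi_norm_less_one snd_pentablock\<close>)
  \<comment> \<open>On the slice \<open>psi \<alpha>\<close> agrees with the zero test; off the
    slice the factor \<kappa> is 0, and only the diagonal term sees
    \<open>psi \<alpha>\<close>.\<close>
  moreover have "psd_on pentablock (\<lambda>z w. (1 - psi \<alpha> z * cnj (psi \<alpha> w)) * K z w)" if "cmod \<alpha> \<le> 1" for \<alpha>
    by (rule main[OF mem(1) psi_norm_le_one[OF _ that]]) (auto simp: test_fun_def \<kappa>_def psi_def)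
  \<comment> \<open>This is the test at \<alpha> = 0, since \<open>Phi 0\<close> is minus one half
    of the first coordinate.\<close>
  moreover have "psd_on pentablock (\<lambda>z w. (1 - fst (snd z) * cnj (fst (snd w)) / 4) * K z w)"
    using calculation(3)[of 0] by (simp add: Phi_zero)
  ultimately show ?thesis
    unfolding AK_def kernel_on_def K_eq[symmetric] by auto
qed

text \<open>If the matrix can be approximated from the cone, the small error is made positive by the
  diagonal and joins the cone through the zero test. Otherwise the separating functional, made
  hermitian, is a kernel that passes all tests and pairs negatively with M, contrary to
  \<open>adm\<close>.\<close>

lemma finite_agler_decomposition:
  assumes M: "\<And>x y. M y x = cnj (M x y)"
    and adm: "\<And>k. k \<in> AK \<Longrightarrow> psd_on pentablock (\<lambda>z w. M (snd z) (snd w) * k z w)"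
    and S: "finite S" "S \<subseteq> sym_bidisc" and \<eta>: "0 < \<eta>"
  obtains ps where "fst ` set ps \<subseteq> tests"
    "\<And>x y. x \<in> S \<Longrightarrow> y \<in> S \<Longrightarrow> M x y + (if x = y then of_real \<eta> else 0) = agler_sum ps x y"
proof -
  define C where "C = {X. \<exists>ps. fst ` set ps \<subseteq> tests \<and> (\<forall>x\<in>S. \<forall>y\<in>S. X (x, y) = agler_sum ps x y)}"
  \<comment> \<open>Half of \<eta> goes into the matrix to be approximated; the other half is
    reserved for the approximation error.\<close>
  define m where "m = (\<lambda>(x, y). M x y + (if x = y then of_real (\<eta> / 2) else 0))"
  have mh: "m (y, x) = cnj (m (x, y))" for x y
  proof -
    have "m (y, x) = M y x + (if x = y then of_real (\<eta> / 2) else 0)" by (simp add: m_def)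
    also have "M y x = cnj (M x y)" by (rule M)
    finally show ?thesis by (simp add: m_def)
  qed
  have C0: "(\<lambda>_. 0) \<in> C" unfolding C_def
    by (rule CollectI, rule exI[of _ "[]"]) (simp add: agler_sum_def)
  have Cadd: "(\<lambda>i. X i + Y i) \<in> C" if XY: "X \<in> C" "Y \<in> C" for X Y
  proof -
    obtain ps where "fst ` set ps \<subseteq> tests" "\<forall>x\<in>S. \<forall>y\<in>S. X (x, y) = agler_sum ps x y"
      using XY(1) unfolding C_def mem_Collect_eq by (elim exE conjE) (rule that)
    moreover obtain qs where "fst ` set qs \<subseteq> tests" "\<forall>x\<in>S. \<forall>y\<in>S. Y (x, y) = agler_sum qs x y"
      using XY(2) unfolding C_def mem_Collect_eq by (elim exE conjE) (rule that)
    ultimately show ?thesis unfolding C_def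
      by (intro CollectI exI[of _ "ps @ qs"]) (auto simp: agler_sum_append)
  qed
  have Csc: "(\<lambda>i. of_real c * X i) \<in> C" if c: "0 \<le> c" and X: "X \<in> C" for c X
  proof -
    obtain ps where ps: "fst ` set ps \<subseteq> tests" "\<forall>x\<in>S. \<forall>y\<in>S. X (x, y) = agler_sum ps x y"
      using X unfolding C_def mem_Collect_eq by (elim exE conjE) (rule that)
    show ?thesis unfolding C_def
      by (rule CollectI, rule exI[of _ "map (\<lambda>(t, v). (t, \<lambda>x. of_real (sqrt c) * v x)) ps"])
        (use ps in \<open>auto simp: agler_sum_scale[OF c]\<close>)
  qed
  have "(\<forall>\<eta>>0. \<exists>c\<in>C. (\<Sum>i\<in>S \<times> S. (cmod (m i - c i))\<^sup>2) < \<eta>) \<or>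
    (\<exists>R. (\<forall>c\<in>C. Re (\<Sum>i\<in>S \<times> S. c i * cnj (R i)) \<le> 0) \<and> 0 < Re (\<Sum>i\<in>S \<times> S. m i * cnj (R i)))"
    by (rule convex_cone_approximation_or_separation) (use S C0 Cadd Csc in auto)
  then show thesis
  proof
    assume near: "\<forall>\<eta>>0. \<exists>c\<in>C. (\<Sum>i\<in>S \<times> S. (cmod (m i - c i))\<^sup>2) < \<eta>"
    \<comment> \<open>Chosen with \<delta> card S < \<eta> / 2, the condition under which an error
      of size \<delta> per entry is dominated by the reserved half.\<close>
    define \<delta> where "\<delta> = \<eta> / (2 * (real (card S) + 1))"
    have \<delta>: "0 < \<delta>" "\<delta> * real (card S) < \<eta> / 2" using \<eta> by (auto simp: \<delta>_def field_simps)
    obtain X where X: "X \<in> C" "(\<Sum>i\<in>S \<times> S. (cmod (m i - X i))\<^sup>2) < \<delta>\<^sup>2"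
      using near \<delta>(1) by (meson zero_less_power)
    obtain ps where ps: "fst ` set ps \<subseteq> tests" "\<forall>x\<in>S. \<forall>y\<in>S. X (x, y) = agler_sum ps x y"
      using X(1) unfolding C_def mem_Collect_eq by (elim exE conjE) (rule that)
    define E where "E = (\<lambda>x y. m (x, y) - agler_sum ps x y)"
    have E: "cmod (E x y) \<le> \<delta>" if "x \<in> S" "y \<in> S" for x y
    proof -
      have "(cmod (m (x, y) - X (x, y)))\<^sup>2 \<le> (\<Sum>i\<in>S \<times> S. (cmod (m i - X i))\<^sup>2)"
        using S that by (intro member_le_sum) auto
      then have "(cmod (E x y))\<^sup>2 \<le> \<delta>\<^sup>2" using X(2) ps that by (simp add: E_def)
      then show ?thesis by (rule power2_le_imp_le) (use \<delta> in simp)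
    qed
    define L where "L = (\<lambda>x y. E x y + (if x = y then of_real (\<eta> / 2) else 0))"
    have Eh: "E y x = cnj (E x y)" for x y
      unfolding E_def mh[of y x] agler_sum_hermitian[of ps y x] by simp
    have hL: "hermitian_on S L"
      unfolding hermitian_on_def
    proof (intro ballI)
      fix x y show "L y x = cnj (L x y)" unfolding L_def Eh[of y x] by simp
    qed
    have pd: "0 < Re (hform S L x x)" if "\<exists>i\<in>S. x i \<noteq> 0" for x
      unfolding L_def by (rule diagonally_dominated_positive_definite[OF S(1) E]) (use \<delta> that in auto)
    have "hermitian_on S (\<lambda>_ _. 0)" by (simp add: hermitian_on_def)
    from simultaneous_diagonalization[OF S(1) hL this pd]
    obtain w e y where "simdiag S L (\<lambda>_ _. 0) w e y" by blast
    then have Lw: "\<And>i j. i \<in> S \<Longrightarrow> j \<in> S \<Longrightarrow> L i j = (\<Sum>k\<in>S. w k i * cnj (w k j))"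
      unfolding simdiag_def by blast
    obtain qs where qs: "fst ` set qs \<subseteq> tests" "\<And>x y. agler_sum qs x y = (\<Sum>k\<in>S. w k x * cnj (w k y))"
      using finite_agler_decomposition_rank_one[OF S(1)] by blast
    show thesis
    proof (rule that[of "ps @ qs"])
      show "fst ` set (ps @ qs) \<subseteq> tests" using ps(1) qs(1) by auto
      fix x y assume xy: "x \<in> S" "y \<in> S"
      have "agler_sum (ps @ qs) x y = agler_sum ps x y + L x y"
        unfolding agler_sum_append qs(2) Lw[OF xy] ..
      also have "\<dots> = M x y + (if x = y then of_real \<eta> else 0)"
        by (simp add: L_def E_def m_def)
      finally show "M x y + (if x = y then of_real \<eta> else 0) = agler_sum (ps @ qs) x y" ..
    qed
  next
    assume "\<exists>R. (\<forall>c\<in>C. Re (\<Sum>i\<in>S \<times> S. c i * cnj (R i)) \<le> 0) \<and> 0 < Re (\<Sum>i\<in>S \<times> S. m i * cnj (R i))"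
    then obtain R where R: "\<And>c. c \<in> C \<Longrightarrow> Re (\<Sum>i\<in>S \<times> S. c i * cnj (R i)) \<le> 0"
      and Rm: "0 < Re (\<Sum>i\<in>S \<times> S. m i * cnj (R i))" by blast
    \<comment> \<open>The sign is reversed because R is nonpositive on the cone. Only the hermitian
      part matters, since the matrices paired with it are hermitian and the real part of the pairing
      is compared.\<close>
    define k where "k = (\<lambda>x y. if x \<in> S \<and> y \<in> S then - (cnj (R (x, y)) + R (y, x)) / 2 else 0)"
    have kh: "k y x = cnj (k x y)" for x y by (simp add: k_def)
    have pair: "Re (\<Sum>x\<in>S. \<Sum>y\<in>S. Z x y * k x y) = - Re (\<Sum>i\<in>S \<times> S. (case i of (x, y) \<Rightarrow> Z x y) * cnj (R i))"
      if Z: "\<And>x y. Z y x = cnj (Z x y)" for Z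
    proof -
      define A where "A = (\<Sum>x\<in>S. \<Sum>y\<in>S. Z x y * cnj (R (x, y)))"
      have "(\<Sum>x\<in>S. \<Sum>y\<in>S. Z x y * R (y, x)) = (\<Sum>y\<in>S. \<Sum>x\<in>S. Z x y * R (y, x))" by (rule sum.swap)
      also have "\<dots> = (\<Sum>y\<in>S. \<Sum>x\<in>S. cnj (Z y x * cnj (R (y, x))))"
      proof (intro sum.cong refl)
        fix x y show "Z x y * R (y, x) = cnj (Z y x * cnj (R (y, x)))" unfolding Z[of x y] by simp
      qed
      also have "\<dots> = cnj A" by (simp add: A_def)
      finally have B: "(\<Sum>x\<in>S. \<Sum>y\<in>S. Z x y * R (y, x)) = cnj A" .
      have "(\<Sum>x\<in>S. \<Sum>y\<in>S. Z x y * k x y) = (\<Sum>x\<in>S. \<Sum>y\<in>S. - (1/2) * (Z x y * cnj (R (x, y))) - (1/2) * (Z x y * R (y, x)))"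
        by (intro sum.cong refl) (simp add: k_def field_simps)
      also have "\<dots> = - (1/2) * A - (1/2) * cnj A"
        unfolding sum_subtractf sum_distrib_left[symmetric] B A_def ..
      finally have "Re (\<Sum>x\<in>S. \<Sum>y\<in>S. Z x y * k x y) = - Re A" by simp
      also have "A = (\<Sum>i\<in>S \<times> S. (case i of (x, y) \<Rightarrow> Z x y) * cnj (R i))"
        unfolding A_def sum.cartesian_product by (intro sum.cong refl) auto
      finally show ?thesis .
    qed
    have kpos: "pos_on S (\<lambda>x y. (1 - test_fun t x * cnj (test_fun t y)) * k x y)" if t: "t \<in> tests" for t
    proof -
      have h: "hermitian_on S (\<lambda>x y. (1 - test_fun t x * cnj (test_fun t y)) * k x y)"
        unfolding hermitian_on_def
      proof (intro ballI)
        fix x y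
        show "(1 - test_fun t y * cnj (test_fun t x)) * k y x = cnj ((1 - test_fun t x * cnj (test_fun t y)) * k x y)"
          unfolding kh[of y x] by simp
      qed
      have "0 \<le> Re (hform S (\<lambda>x y. (1 - test_fun t x * cnj (test_fun t y)) * k x y) v v)" for v
      proof -
        \<comment> \<open>Pairing with a single generator of the cone is the quadratic form of the
          tested kernel at v, so nonpositivity of R on generators is admissibility of k.\<close>
        have "(\<lambda>(x, y). agler_sum [(t, v)] x y) \<in> C"
          unfolding C_def using t by (intro CollectI exI[of _ "[(t, v)]"]) auto
        from R[OF this] have "0 \<le> Re (\<Sum>x\<in>S. \<Sum>y\<in>S. agler_sum [(t, v)] x y * k x y)"
          by (subst pair[OF agler_sum_hermitian]) (simp add: case_prod_beta)
        then show ?thesis by (simp add: hform_def agler_sum_def mult_ac)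
      qed
      then show ?thesis unfolding pos_on_Re_iff[OF h] by blast
    qed
    have sumMk: "(\<Sum>x\<in>S. \<Sum>y\<in>S. M x y * k x y) \<in> \<real>\<^sub>\<ge>\<^sub>0"
    proof (rule nonneg_Reals_limit)
      fix \<tau> :: real assume \<tau>: "0 < \<tau>"
      define K where "K = (\<lambda>z w :: complex \<times> complex \<times> complex. (if fst z = 0 \<and> fst w = 0 then k (snd z) (snd w) else 0)
          + (if z = w then of_real \<tau> else 0))"
      have "K \<in> AK" unfolding K_def
        by (rule AK_point_masses[OF S \<tau> _ kpos]) (auto simp: k_def)
      from psd_on_pullback[OF adm[OF this], of S "Pair 0"]
      have "psd_on S (\<lambda>x y. M x y * K (0, x) (0, y))" using S zero_pentablock by auto
      then have "pos_on S (\<lambda>x y. M x y * K (0, x) (0, y))" using S(1) unfolding psd_on_iff by blast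
      \<comment> \<open>At the vector of ones the form of the entrywise product is the pairing of
        the two matrices.\<close>
      then have "hform S (\<lambda>x y. M x y * K (0, x) (0, y)) (\<lambda>_. 1) (\<lambda>_. 1) \<in> \<real>\<^sub>\<ge>\<^sub>0"
        unfolding pos_on_def by blast
      also have "hform S (\<lambda>x y. M x y * K (0, x) (0, y)) (\<lambda>_. 1) (\<lambda>_. 1) =
         (\<Sum>x\<in>S. \<Sum>y\<in>S. M x y * k x y) + of_real \<tau> * (\<Sum>x\<in>S. \<Sum>y\<in>S. M x y * (if x = y then 1 else 0))"
        unfolding hform_def sum_distrib_left sum.distrib[symmetric]
        by (intro sum.cong refl) (simp add: K_def algebra_simps)
      finally show "(\<Sum>x\<in>S. \<Sum>y\<in>S. M x y * k x y) + of_real \<tau> * (\<Sum>x\<in>S. \<Sum>y\<in>S. M x y * (if x = y then 1 else 0)) \<in> \<real>\<^sub>\<ge>\<^sub>0" .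
    qed
    have kd: "0 \<le> Re (k x x)" if "x \<in> S" for x
    proof -
      have "(False, 1) \<in> tests" by (simp add: tests_def)
      from kpos[OF this] have "hform S (\<lambda>x y. (1 - test_fun (False, 1) x * cnj (test_fun (False, 1) y)) * k x y)
         (\<lambda>i. if i = x then 1 else 0) (\<lambda>i. if i = x then 1 else 0) \<in> \<real>\<^sub>\<ge>\<^sub>0"
        unfolding pos_on_def by blast
      then have "k x x \<in> \<real>\<^sub>\<ge>\<^sub>0" unfolding hform_unit_unit[OF S(1) that that] by (simp add: test_fun_def)
      then show ?thesis by (simp add: complex_nonneg_Reals_iff)
    qed
    have "(\<Sum>x\<in>S. \<Sum>y\<in>S. m (x, y) * k x y) = (\<Sum>x\<in>S. \<Sum>y\<in>S. M x y * k x y) + of_real (\<eta> / 2) * (\<Sum>x\<in>S. \<Sum>y\<in>S. if y = x then k x y else 0)"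
      unfolding sum_distrib_left sum.distrib[symmetric]
      by (intro sum.cong refl) (simp add: m_def algebra_simps)
    also have "(\<Sum>x\<in>S. \<Sum>y\<in>S. if y = x then k x y else 0) = (\<Sum>x\<in>S. k x x)"
      unfolding sum.delta[OF S(1)] by (intro sum.cong refl) simp
    finally have "Re (\<Sum>x\<in>S. \<Sum>y\<in>S. m (x, y) * k x y) = Re (\<Sum>x\<in>S. \<Sum>y\<in>S. M x y * k x y) + \<eta> / 2 * (\<Sum>x\<in>S. Re (k x x))"
      by simp
    moreover have "0 \<le> Re (\<Sum>x\<in>S. \<Sum>y\<in>S. M x y * k x y)" using sumMk by (simp add: complex_nonneg_Reals_iff)
    moreover have "0 \<le> (\<Sum>x\<in>S. Re (k x x))" using kd by (intro sum_nonneg)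
    ultimately have "0 \<le> Re (\<Sum>x\<in>S. \<Sum>y\<in>S. m (x, y) * k x y)" using \<eta> by simp
    moreover have "Re (\<Sum>x\<in>S. \<Sum>y\<in>S. m (x, y) * k x y) = - Re (\<Sum>i\<in>S \<times> S. m i * cnj (R i))"
      by (subst pair[of "\<lambda>x y. m (x, y)", OF mh]) (simp add: case_prod_beta)
    ultimately show thesis using Rm by simp
  qed
qed

section \<open>Passage from finite sets to the pentablock\<close>

lemma closed_Collect_all_imp:
  assumes "\<And>p. Q p \<Longrightarrow> closed {D. R p D}"
  shows "closed {D. \<forall>p. Q p \<longrightarrow> R p D}"
proof -
  have "{D. \<forall>p. Q p \<longrightarrow> R p D} = (\<Inter>p\<in>{p. Q p}. {D. R p D})" by auto
  then show ?thesis using assms by auto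
qed

lemma C_disc_cnj_mult:
  assumes "g \<in> C_disc" "h \<in> C_disc"
  shows "(\<lambda>\<alpha>. g \<alpha> * cnj (h \<alpha>)) \<in> C_disc"
  using assms unfolding C_disc_def by (auto intro!: continuous_intros)

lemma C_disc_add: "g \<in> C_disc \<Longrightarrow> h \<in> C_disc \<Longrightarrow> (\<lambda>\<alpha>. g \<alpha> + h \<alpha>) \<in> C_disc"
  unfolding C_disc_def by (auto intro!: continuous_intros)

lemma C_disc_scale: "h \<in> C_disc \<Longrightarrow> (\<lambda>\<alpha>. c * h \<alpha>) \<in> C_disc"
  unfolding C_disc_def by (auto intro!: continuous_intros)

lemma C_disc_one_minus:
  assumes "g \<in> C_disc" "h \<in> C_disc"
  shows "(\<lambda>\<alpha>. 1 - g \<alpha> * cnj (h \<alpha>)) \<in> C_disc"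
  using assms unfolding C_disc_def by (auto intro!: continuous_intros)

lemma JJ_C_disc: "z \<in> pentablock \<Longrightarrow> JJ z \<in> C_disc"
  using continuous_on_psi by (simp add: JJ_def C_disc_def)

lemma jj_C_disc: "z \<in> pentablock \<Longrightarrow> jj z \<in> C_disc"
  using continuous_on_Phi snd_pentablock by (simp add: jj_def C_disc_def)

lemma C_disc_norm_le_SUP:
  assumes "h \<in> C_disc" "cmod \<beta> \<le> 1"
  shows "cmod (h \<beta>) \<le> (SUP \<alpha>\<in>cball 0 1. cmod (h \<alpha>))"
proof (rule cSUP_upper)
  have "compact ((\<lambda>\<alpha>. cmod (h \<alpha>)) ` cball 0 1)"
    using assms by (intro compact_continuous_image continuous_intros) (auto simp: C_disc_def)
  then show "bdd_above ((\<lambda>\<alpha>. cmod (h \<alpha>)) ` cball 0 1)"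
    by (intro bounded_imp_bdd_above compact_imp_bounded)
qed (use assms in auto)

text \<open>A finite combination of point evaluations at the test parameters with rank-one weights.
  The flag b separates the part destined for nabla (\<open>True\<close>, tests \<open>Phi\<close>)
  from the part destined for \<xi> (\<open>False\<close>, evaluation at 1).\<close>

definition disc_kernel ::
  "((bool \<times> complex) \<times> (complex \<times> complex \<Rightarrow> complex)) list \<Rightarrow> bool \<Rightarrow> complex \<times> complex \<Rightarrow> complex \<times> complex
    \<Rightarrow> (complex \<Rightarrow> complex) \<Rightarrow> complex" where
  "disc_kernel ps b x y h = (\<Sum>(t, v)\<leftarrow>ps. if fst t = b then v x * cnj (v y) * h (snd t) else 0)"

lemma disc_kernel_Nil: "disc_kernel [] b x y h = 0"
  by (simp add: disc_kernel_def)

lemma disc_kernel_Cons: "disc_kernel ((t, v) # ps) b x y h =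
    (if fst t = b then v x * cnj (v y) * h (snd t) else 0) + disc_kernel ps b x y h"
  by (simp add: disc_kernel_def)

lemma disc_kernel_add: "disc_kernel ps b x y (\<lambda>\<alpha>. g \<alpha> + h \<alpha>) = disc_kernel ps b x y g + disc_kernel ps b x y h"
  by (induction ps) (auto simp: disc_kernel_Nil disc_kernel_Cons algebra_simps)

lemma disc_kernel_scale: "disc_kernel ps b x y (\<lambda>\<alpha>. c * h \<alpha>) = c * disc_kernel ps b x y h"
  by (induction ps) (auto simp: disc_kernel_Nil disc_kernel_Cons algebra_simps)

lemma disc_kernel_positive:
  "(\<Sum>i\<in>A. \<Sum>j\<in>A. disc_kernel ps b (x i) (x j) (\<lambda>\<alpha>. h i \<alpha> * cnj (h j \<alpha>)) * c j * cnj (c i)) \<in> \<real>\<^sub>\<ge>\<^sub>0"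
proof (induction ps)
  case Nil
  then show ?case by (simp add: disc_kernel_Nil)
next
  case (Cons p ps)
  obtain t v where p: "p = (t, v)" by (cases p)
  define s where "s = (\<Sum>i\<in>A. v (x i) * h i (snd t) * cnj (c i))"
  define q where "q = (if fst t = b then (cmod s)\<^sup>2 else 0)"
  have "(\<Sum>i\<in>A. \<Sum>j\<in>A. disc_kernel (p # ps) b (x i) (x j) (\<lambda>\<alpha>. h i \<alpha> * cnj (h j \<alpha>)) * c j * cnj (c i))
    = (if fst t = b then s * cnj s else 0) +
      (\<Sum>i\<in>A. \<Sum>j\<in>A. disc_kernel ps b (x i) (x j) (\<lambda>\<alpha>. h i \<alpha> * cnj (h j \<alpha>)) * c j * cnj (c i))"
  proof (cases "fst t = b")
    case True
    have "s * cnj s = (\<Sum>i\<in>A. \<Sum>j\<in>A. v (x i) * cnj (v (x j)) * (h i (snd t) * cnj (h j (snd t))) * c j * cnj (c i))"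
      unfolding s_def cnj_sum sum_product by (intro sum.cong refl) (simp add: mult_ac)
    then show ?thesis using True
      by (simp add: p disc_kernel_Cons distrib_right sum.distrib)
  next
    case False
    then show ?thesis by (simp add: p disc_kernel_Cons)
  qed
  also have "(if fst t = b then s * cnj s else 0) = of_real q"
    unfolding q_def by (simp only: if_distrib[of complex_of_real] complex_norm_square of_real_0)
  finally show ?case using Cons
    by (simp only:) (intro nonneg_Reals_add_I, auto simp: q_def)
qed

text \<open>The product of two vector entries is estimated by the sum of their squares, so
  off-diagonal norms are bounded by diagonal masses, however long the list is.\<close>

lemma disc_kernel_bound:
  assumes "fst ` set ps \<subseteq> tests" "h \<in> C_disc"
  shows "cmod (disc_kernel ps b x y h) \<le>
    ((\<Sum>(t, v)\<leftarrow>ps. (cmod (v x))\<^sup>2) + (\<Sum>(t, v)\<leftarrow>ps. (cmod (v y))\<^sup>2)) * (SUP \<alpha>\<in>cball 0 1. cmod (h \<alpha>))"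
  using assms(1)
proof (induction ps)
  case Nil
  then show ?case by (simp add: disc_kernel_Nil)
next
  case (Cons p ps)
  obtain t v where p: "p = (t, v)" by (cases p)
  define H where "H = (SUP \<alpha>\<in>cball 0 1. cmod (h \<alpha>))"
  have "cmod (snd t) \<le> 1" using Cons.prems by (auto simp: p tests_def)
  then have h: "cmod (h (snd t)) \<le> H" unfolding H_def by (rule C_disc_norm_le_SUP[OF assms(2)])
  have H0: "0 \<le> H" using h norm_ge_zero order_trans by blast
  have "2 * cmod (v x) * cmod (v y) \<le> (cmod (v x))\<^sup>2 + (cmod (v y))\<^sup>2"
    by (rule sum_squares_bound)
  moreover have "0 \<le> cmod (v x) * cmod (v y)" by simp
  ultimately have "cmod (v x) * cmod (v y) \<le> (cmod (v x))\<^sup>2 + (cmod (v y))\<^sup>2" by linarith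
  then have "cmod (v x) * cmod (v y) * cmod (h (snd t)) \<le> ((cmod (v x))\<^sup>2 + (cmod (v y))\<^sup>2) * H"
    using h by (intro mult_mono) auto
  then have 1: "cmod (if fst t = b then v x * cnj (v y) * h (snd t) else 0) \<le> ((cmod (v x))\<^sup>2 + (cmod (v y))\<^sup>2) * H"
    using H0 by (auto simp: norm_mult)
  have "cmod (disc_kernel ps b x y h) \<le> ((\<Sum>(t, v)\<leftarrow>ps. (cmod (v x))\<^sup>2) + (\<Sum>(t, v)\<leftarrow>ps. (cmod (v y))\<^sup>2)) * H"
    using Cons unfolding H_def by auto
  then have "cmod (disc_kernel (p # ps) b x y h) \<le> ((cmod (v x))\<^sup>2 + (cmod (v y))\<^sup>2) * H
     + ((\<Sum>(t, v)\<leftarrow>ps. (cmod (v x))\<^sup>2) + (\<Sum>(t, v)\<leftarrow>ps. (cmod (v y))\<^sup>2)) * H"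
    unfolding p disc_kernel_Cons using norm_triangle_mono[OF 1] by blast
  then show ?case unfolding H_def[symmetric] by (simp add: p algebra_simps)
qed

lemma disc_kernel_agler_sum:
  assumes "fst ` set ps \<subseteq> tests"
  shows "disc_kernel ps False (snd z) (snd w) (\<lambda>\<alpha>. 1 - JJ z \<alpha> * cnj (JJ w \<alpha>))
     + disc_kernel ps True (snd z) (snd w) (\<lambda>\<alpha>. 1 - jj z \<alpha> * cnj (jj w \<alpha>)) = agler_sum ps (snd z) (snd w)"
  using assms
proof (induction ps)
  case Nil
  then show ?case by (simp add: disc_kernel_Nil agler_sum_def)
next
  case (Cons p ps)
  obtain t v where p: "p = (t, v)" by (cases p)
  have JJ1: "JJ u 1 = 0" for u by (simp add: JJ_def psi_def case_prod_beta)
  have cons: "agler_sum ((t, v) # ps) (snd z) (snd w) =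
     (1 - test_fun t (snd z) * cnj (test_fun t (snd w))) * (v (snd z) * cnj (v (snd w))) + agler_sum ps (snd z) (snd w)"
    by (simp add: agler_sum_def p)
  have "t = (False, 1) \<or> (\<exists>\<alpha>. t = (True, \<alpha>))" using Cons.prems by (auto simp: p tests_def)
  then show ?case
  proof (elim disjE exE)
    assume t: "t = (False, 1)"
    show ?thesis using Cons unfolding cons p disc_kernel_Cons by (simp add: t test_fun_def JJ1 add.assoc)
  next
    fix \<alpha> assume t: "t = (True, \<alpha>)"
    show ?thesis using Cons unfolding cons p disc_kernel_Cons by (simp add: t test_fun_def jj_def mult_ac add_ac)
  qed
qed

text \<open>Each diagonal summand carries a factor 1 - |test|^2 \<ge> 1 - \<gamma>^2. The diagonal
  of the decomposed matrix therefore bounds the total mass at x.\<close>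

lemma agler_sum_diagonal_bound:
  assumes "fst ` set ps \<subseteq> tests" "\<gamma> < 1" "0 \<le> \<gamma>" "\<And>t. t \<in> tests \<Longrightarrow> cmod (test_fun t x) \<le> \<gamma>"
  shows "(1 - \<gamma>\<^sup>2) * (\<Sum>(t, v)\<leftarrow>ps. (cmod (v x))\<^sup>2) \<le> Re (agler_sum ps x x)"
  using assms(1)
proof (induction ps)
  case Nil
  then show ?case by (simp add: agler_sum_def)
next
  case (Cons p ps)
  obtain t v where p: "p = (t, v)" by (cases p)
  have "(cmod (test_fun t x))\<^sup>2 \<le> \<gamma>\<^sup>2"
    using Cons.prems assms(4)[of t] by (intro power_mono) (auto simp: p)
  then have "(1 - \<gamma>\<^sup>2) * (cmod (v x))\<^sup>2 \<le> (1 - (cmod (test_fun t x))\<^sup>2) * (cmod (v x))\<^sup>2"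
    by (intro mult_right_mono) auto
  also have "\<dots> = Re ((1 - test_fun t x * cnj (test_fun t x)) * (v x * cnj (v x)))"
    unfolding complex_norm_square[symmetric] by simp
  finally have "(1 - \<gamma>\<^sup>2) * (cmod (v x))\<^sup>2 \<le> Re ((1 - test_fun t x * cnj (test_fun t x)) * (v x * cnj (v x)))" .
  moreover have "agler_sum (p # ps) x x = (1 - test_fun t x * cnj (test_fun t x)) * (v x * cnj (v x)) + agler_sum ps x x"
    by (simp add: agler_sum_def p)
  ultimately show ?case using Cons by (simp add: p distrib_left)
qed

text \<open>Both functional kernels are one function D of (b, z, w, h). Additivity, homogeneity,
  positivity and the identity each involve finitely many coordinates and are closed conditions on a
  product of discs, so the finite intersection property reduces everything to finite sets.\<close>

lemma agler_decomposition_on_pentablock: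
  assumes fin: "\<And>S \<eta>. finite S \<Longrightarrow> S \<subseteq> sym_bidisc \<Longrightarrow> 0 < \<eta> \<Longrightarrow> \<exists>ps. fst ` set ps \<subseteq> tests \<and>
      (\<forall>x\<in>S. \<forall>y\<in>S. M x y + (if x = y then of_real \<eta> else 0) = agler_sum ps x y)"
  shows "\<exists>\<xi> nabla. positive_kernel_on pentablock \<xi> \<and> positive_kernel_on pentablock nabla \<and>
    (\<forall>z\<in>pentablock. \<forall>w\<in>pentablock. M (snd z) (snd w) =
       \<xi> z w (\<lambda>\<alpha>. 1 - JJ z \<alpha> * cnj (JJ w \<alpha>)) + nabla z w (\<lambda>\<alpha>. 1 - jj z \<alpha> * cnj (jj w \<alpha>)))"
proof -
  let ?P = pentablock
  have "\<forall>x\<in>sym_bidisc. \<exists>\<gamma>. 0 \<le> \<gamma> \<and> \<gamma> < 1 \<and> (\<forall>t\<in>tests. cmod (test_fun t x) \<le> \<gamma>)"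
  proof
    fix x assume "x \<in> sym_bidisc"
    then obtain \<gamma> where "0 \<le> \<gamma>" "\<gamma> < 1" "\<And>\<alpha>. cmod \<alpha> \<le> 1 \<Longrightarrow> cmod (Phi \<alpha> x) \<le> \<gamma>"
      using Phi_uniform_bound by blast
    then show "\<exists>\<gamma>. 0 \<le> \<gamma> \<and> \<gamma> < 1 \<and> (\<forall>t\<in>tests. cmod (test_fun t x) \<le> \<gamma>)"
      by (intro exI[of _ \<gamma>]) (auto simp: tests_def test_fun_def)
  qed
  then obtain \<gamma> where \<gamma>: "\<And>x. x \<in> sym_bidisc \<Longrightarrow> 0 \<le> \<gamma> x" "\<And>x. x \<in> sym_bidisc \<Longrightarrow> \<gamma> x < (1::real)"
    "\<And>x t. x \<in> sym_bidisc \<Longrightarrow> t \<in> tests \<Longrightarrow> cmod (test_fun t x) \<le> \<gamma> x" by metis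
  \<comment> \<open>The mass bound from the diagonal identity: + 1 allows every tolerance \<eta>
    \<le> 1, and the maximum with 0 covers points outside the finite set under
    consideration.\<close>
  define B where "B = (\<lambda>z :: complex \<times> complex \<times> complex. max 0 ((Re (M (snd z) (snd z)) + 1) / (1 - (\<gamma> (snd z))\<^sup>2)))"
  define ok where "ok = (\<lambda>(b::bool, z, w, h). z \<in> ?P \<and> w \<in> ?P \<and> h \<in> C_disc)"
  \<comment> \<open>Coordinates with invalid arguments are frozen at 0, so that every factor of the
    product is compact.\<close>
  define Box where "Box = {D. \<forall>q. D q \<in> (if ok q then (case q of (b, z, w, h) \<Rightarrow>
      cball 0 ((B z + B w) * (SUP \<alpha>\<in>cball 0 1. cmod (h \<alpha>)))) else {0 :: complex})}"
  define Add where "Add = {D :: bool \<times> (complex \<times> complex \<times> complex) \<times> (complex \<times> complex \<times> complex) \<times> (complex \<Rightarrow> complex) \<Rightarrow> complex.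
     \<forall>q. (case q of (b, z, w, g, h) \<Rightarrow> z \<in> ?P \<and> w \<in> ?P \<and> g \<in> C_disc \<and> h \<in> C_disc) \<longrightarrow>
       (case q of (b, z, w, g, h) \<Rightarrow> D (b, z, w, \<lambda>\<alpha>. g \<alpha> + h \<alpha>) = D (b, z, w, g) + D (b, z, w, h))}"
  define Scale where "Scale = {D :: bool \<times> (complex \<times> complex \<times> complex) \<times> (complex \<times> complex \<times> complex) \<times> (complex \<Rightarrow> complex) \<Rightarrow> complex.
     \<forall>q. (case q of (b, z, w, c, h) \<Rightarrow> z \<in> ?P \<and> w \<in> ?P \<and> h \<in> C_disc) \<longrightarrow>
       (case q of (b, z, w, c, h) \<Rightarrow> D (b, z, w, \<lambda>\<alpha>. c * h \<alpha>) = c * D (b, z, w, h))}"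
  define Pos where "Pos = {D :: bool \<times> (complex \<times> complex \<times> complex) \<times> (complex \<times> complex \<times> complex) \<times> (complex \<Rightarrow> complex) \<Rightarrow> complex.
     \<forall>q. (case q of (b, N::nat, z, h, c) \<Rightarrow> \<forall>i\<in>{1..N}. z i \<in> ?P \<and> h i \<in> C_disc) \<longrightarrow>
       (case q of (b, N, z, h, c) \<Rightarrow> (\<Sum>i=1..N. \<Sum>j=1..N. D (b, z i, z j, \<lambda>\<alpha>. h i \<alpha> * cnj (h j \<alpha>)) * c j * cnj (c i)) \<in> \<real>\<^sub>\<ge>\<^sub>0)}"
  \<comment> \<open>A finite decomposition reproduces M only up to \<eta> on the diagonal. The
    relaxed identity is imposed for every positive tolerance, and the intersection is exact.\<close>
  define Eq where "Eq = (\<lambda>(z, w, \<eta>::real). {D :: bool \<times> (complex \<times> complex \<times> complex) \<times> (complex \<times> complex \<times> complex) \<times> (complex \<Rightarrow> complex) \<Rightarrow> complex.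
     cmod (D (False, z, w, \<lambda>\<alpha>. 1 - JJ z \<alpha> * cnj (JJ w \<alpha>)) + D (True, z, w, \<lambda>\<alpha>. 1 - jj z \<alpha> * cnj (jj w \<alpha>)) - M (snd z) (snd w)) \<le> \<eta>})"
  define K where "K = Box \<inter> Add \<inter> Scale \<inter> Pos"
  have "compact Box" unfolding Box_def
    by (rule compact_dependent_product) (auto split: prod.split)
  moreover have "closed Add" unfolding Add_def
    by (rule closed_Collect_all_imp) (auto simp: case_prod_beta intro!: closed_Collect_eq continuous_intros)
  moreover have "closed Scale" unfolding Scale_def
    by (rule closed_Collect_all_imp) (auto simp: case_prod_beta intro!: closed_Collect_eq continuous_intros)
  moreover have "closed Pos" unfolding Pos_def
  proof (rule closed_Collect_all_imp)
    fix q :: "bool \<times> nat \<times> (nat \<Rightarrow> complex \<times> complex \<times> complex) \<times> (nat \<Rightarrow> complex \<Rightarrow> complex) \<times> (nat \<Rightarrow> complex)"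
    obtain b N z h c where q: "q = (b, N, z, h, c)" by (cases q)
    define f where "f = (\<lambda>D :: bool \<times> (complex \<times> complex \<times> complex) \<times> (complex \<times> complex \<times> complex) \<times> (complex \<Rightarrow> complex) \<Rightarrow> complex.
      \<Sum>i=1..N. \<Sum>j=1..N. D (b, z i, z j, \<lambda>\<alpha>. h i \<alpha> * cnj (h j \<alpha>)) * c j * cnj (c i))"
    have "continuous_on UNIV f" unfolding f_def by (intro continuous_intros)
    then have "closed (f -` \<real>\<^sub>\<ge>\<^sub>0)"
      by (rule closed_vimage[OF closed_nonneg_Reals_complex])
    then show "closed {D :: bool \<times> (complex \<times> complex \<times> complex) \<times> (complex \<times> complex \<times> complex) \<times> (complex \<Rightarrow> complex) \<Rightarrow> complex.
        case q of (b, N, z, h, c) \<Rightarrow> (\<Sum>i=1..N. \<Sum>j=1..N. D (b, z i, z j, \<lambda>\<alpha>. h i \<alpha> * cnj (h j \<alpha>)) * c j * cnj (c i)) \<in> \<real>\<^sub>\<ge>\<^sub>0}"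
      by (simp add: q f_def vimage_def)
  qed
  ultimately have "compact K" unfolding K_def by (intro compact_Int_closed)
  have EqD: "D \<in> Eq (z, w, \<eta>) \<longleftrightarrow> cmod (D (False, z, w, \<lambda>\<alpha>. 1 - JJ z \<alpha> * cnj (JJ w \<alpha>)) +
      D (True, z, w, \<lambda>\<alpha>. 1 - jj z \<alpha> * cnj (jj w \<alpha>)) - M (snd z) (snd w)) \<le> \<eta>" for D z w \<eta>
    by (simp add: Eq_def)
  define I where "I = ?P \<times> ?P \<times> {0 :: real<..}"
  have "K \<inter> (\<Inter>i\<in>I. Eq i) \<noteq> {}"
  proof (rule compact_imp_fip_image[OF \<open>compact K\<close>])
    fix i assume "i \<in> I"
    show "closed (Eq i)" unfolding Eq_def
      by (cases i) (auto intro!: closed_Collect_le continuous_intros)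
  next
    fix J assume J: "finite J" "J \<subseteq> I"
    define T where "T = fst ` J \<union> (fst \<circ> snd) ` J"
    define S where "S = snd ` T"
    define \<eta> where "\<eta> = Min (insert 1 ((snd \<circ> snd) ` J))"
    have TP: "T \<subseteq> ?P" using J by (auto simp: T_def I_def)
    have S: "finite S" "S \<subseteq> sym_bidisc" using J TP snd_pentablock by (auto simp: S_def T_def)
    have "\<forall>e\<in>insert 1 ((snd \<circ> snd) ` J). 0 < e" using J by (auto simp: I_def)
    then have \<eta>0: "0 < \<eta>" using J(1) unfolding \<eta>_def by (subst Min_gr_iff) auto
    have \<eta>1: "\<eta> \<le> 1" unfolding \<eta>_def using J(1) by (intro Min_le) auto
    have \<eta>J: "\<eta> \<le> e" if "(z, w, e) \<in> J" for z w e
      unfolding \<eta>_def using J(1) that by (intro Min_le) force+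
    obtain ps0 where ps0: "fst ` set ps0 \<subseteq> tests"
      "\<And>x y. x \<in> S \<Longrightarrow> y \<in> S \<Longrightarrow> M x y + (if x = y then of_real \<eta> else 0) = agler_sum ps0 x y"
      using fin[OF S \<eta>0] by blast
    \<comment> \<open>The vectors are cut off outside S because the bound of \<open>Box\<close> is
      demanded at all points, whereas the decomposition controls only those in S.\<close>
    define ps where "ps = map (\<lambda>(t, v). (t, \<lambda>x. if x \<in> S then v x else 0)) ps0"
    have ps: "fst ` set ps \<subseteq> tests" using ps0(1) by (force simp: ps_def)
    have psM: "M x y + (if x = y then of_real \<eta> else 0) = agler_sum ps x y" if "x \<in> S" "y \<in> S" for x y
    proof -
      have "agler_sum ps x y = agler_sum ps0 x y"
        unfolding agler_sum_def ps_def map_map comp_def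
        by (rule arg_cong[of _ _ sum_list], rule map_cong) (use that in auto)
      then show ?thesis using ps0(2)[OF that] by simp
    qed
    have norms: "(\<Sum>(t, v)\<leftarrow>ps. (cmod (v (snd z)))\<^sup>2) \<le> B z" if z: "z \<in> ?P" for z
    proof (cases "snd z \<in> S")
      case False
      then have "(\<Sum>(t, v)\<leftarrow>ps. (cmod (v (snd z)))\<^sup>2) = 0"
        unfolding ps_def by (induction ps0) auto
      then show ?thesis by (simp add: B_def)
    next
      case True
      have G: "snd z \<in> sym_bidisc" using z by (rule snd_pentablock)
      have g: "0 < 1 - (\<gamma> (snd z))\<^sup>2" using \<gamma>(1,2)[OF G] by (simp add: power_less_one_iff)
      have "(1 - (\<gamma> (snd z))\<^sup>2) * (\<Sum>(t, v)\<leftarrow>ps. (cmod (v (snd z)))\<^sup>2) \<le> Re (agler_sum ps (snd z) (snd z))"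
        by (rule agler_sum_diagonal_bound[OF ps \<gamma>(2,1,3)]) (use G in auto)
      also have "\<dots> = Re (M (snd z) (snd z)) + \<eta>" using arg_cong[OF psM[OF True True], of Re] by simp
      also have "\<dots> \<le> Re (M (snd z) (snd z)) + 1" using \<eta>1 by simp
      finally have "(\<Sum>(t, v)\<leftarrow>ps. (cmod (v (snd z)))\<^sup>2) \<le> (Re (M (snd z) (snd z)) + 1) / (1 - (\<gamma> (snd z))\<^sup>2)"
        using g by (simp add: pos_le_divide_eq mult.commute)
      then show ?thesis by (simp add: B_def)
    qed
    define D where "D = (\<lambda>q. if ok q then (case q of (b, z, w, h) \<Rightarrow> disc_kernel ps b (snd z) (snd w) h) else 0)"
    have DD: "D (b, z, w, h) = disc_kernel ps b (snd z) (snd w) h" if "z \<in> ?P" "w \<in> ?P" "h \<in> C_disc" for b z w h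
      using that by (simp add: D_def ok_def)
    have "D q \<in> (if ok q then (case q of (b, z, w, h) \<Rightarrow>
      cball 0 ((B z + B w) * (SUP \<alpha>\<in>cball 0 1. cmod (h \<alpha>)))) else {0 :: complex})" for q
    proof (cases "ok q")
      case False
      then show ?thesis by (simp add: D_def)
    next
      case True
      obtain b z w h where q: "q = (b, z, w, h)" by (cases q)
      have zwh: "z \<in> ?P" "w \<in> ?P" "h \<in> C_disc" using True by (auto simp: q ok_def)
      have "0 \<le> (SUP \<alpha>\<in>cball 0 1. cmod (h \<alpha>))"
        using order_trans[OF norm_ge_zero C_disc_norm_le_SUP[OF zwh(3), of 0]] by simp
      then have "cmod (disc_kernel ps b (snd z) (snd w) h) \<le> (B z + B w) * (SUP \<alpha>\<in>cball 0 1. cmod (h \<alpha>))"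
        using disc_kernel_bound[OF ps zwh(3), of b "snd z" "snd w"] norms[OF zwh(1)] norms[OF zwh(2)]
        by (meson add_mono mult_right_mono order_trans)
      then show ?thesis using True by (simp add: q DD[OF zwh])
    qed
    then have "D \<in> Box" unfolding Box_def by blast
    moreover have "D \<in> Add" unfolding Add_def
      by (auto simp: DD C_disc_add disc_kernel_add)
    moreover have "D \<in> Scale" unfolding Scale_def
      by (auto simp: DD C_disc_scale disc_kernel_scale)
    moreover have "D \<in> Pos" unfolding Pos_def
    proof (rule CollectI, intro allI impI)
      fix q :: "bool \<times> nat \<times> (nat \<Rightarrow> complex \<times> complex \<times> complex) \<times> (nat \<Rightarrow> complex \<Rightarrow> complex) \<times> (nat \<Rightarrow> complex)"
      obtain b N z h c where q: "q = (b, N, z, h, c)" by (cases q)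
      assume "case q of (b, N::nat, z, h, c) \<Rightarrow> \<forall>i\<in>{1..N}. z i \<in> ?P \<and> h i \<in> C_disc"
      then have zh: "\<And>i. i \<in> {1..N} \<Longrightarrow> z i \<in> ?P" "\<And>i. i \<in> {1..N} \<Longrightarrow> h i \<in> C_disc" by (auto simp: q)
      have "(\<Sum>i=1..N. \<Sum>j=1..N. D (b, z i, z j, \<lambda>\<alpha>. h i \<alpha> * cnj (h j \<alpha>)) * c j * cnj (c i)) =
        (\<Sum>i=1..N. \<Sum>j=1..N. disc_kernel ps b (snd (z i)) (snd (z j)) (\<lambda>\<alpha>. h i \<alpha> * cnj (h j \<alpha>)) * c j * cnj (c i))"
        by (intro sum.cong refl) (simp only: DD zh C_disc_cnj_mult)
      then show "case q of (b, N, z, h, c) \<Rightarrow> (\<Sum>i=1..N. \<Sum>j=1..N. D (b, z i, z j, \<lambda>\<alpha>. h i \<alpha> * cnj (h j \<alpha>)) * c j * cnj (c i)) \<in> \<real>\<^sub>\<ge>\<^sub>0"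
        using disc_kernel_positive[of ps b "\<lambda>i. snd (z i)" h c "{1..N}"] by (simp add: q)
    qed
    ultimately have "D \<in> K" by (simp add: K_def)
    moreover have "D \<in> Eq i" if i: "i \<in> J" for i
    proof -
      obtain z w e where ie: "i = (z, w, e)" by (cases i)
      have zT: "z \<in> T" "w \<in> T" using i unfolding T_def ie by force+
      have zP: "z \<in> ?P" "w \<in> ?P" using zT TP by auto
      have zS: "snd z \<in> S" "snd w \<in> S" using zT by (auto simp: S_def)
      have "D (False, z, w, \<lambda>\<alpha>. 1 - JJ z \<alpha> * cnj (JJ w \<alpha>)) + D (True, z, w, \<lambda>\<alpha>. 1 - jj z \<alpha> * cnj (jj w \<alpha>))
         = agler_sum ps (snd z) (snd w)"
        using disc_kernel_agler_sum[OF ps, of z w] zP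
        by (simp add: DD C_disc_one_minus JJ_C_disc jj_C_disc)
      then show ?thesis unfolding ie EqD
        using psM[OF zS, symmetric] \<eta>0 \<eta>J[of z w e] i ie by simp
    qed
    ultimately show "K \<inter> (\<Inter>i\<in>J. Eq i) \<noteq> {}" by blast
  qed
  then obtain D where D: "D \<in> K" "\<And>i. i \<in> I \<Longrightarrow> D \<in> Eq i" by blast
  have pk: "positive_kernel_on ?P (\<lambda>z w h. D (b, z, w, h))" for b
    unfolding positive_kernel_on_def
  proof (intro conjI ballI allI impI)
    fix z w assume zw: "z \<in> ?P" "w \<in> ?P"
    have "cmod (D (b, z, w, h)) \<le> (B z + B w) * (SUP \<alpha>\<in>cball 0 1. cmod (h \<alpha>))" if "h \<in> C_disc" for h
    proof -
      have "D (b, z, w, h) \<in> (if ok (b, z, w, h) then (case (b, z, w, h) of (b, z, w, h) \<Rightarrow>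
        cball 0 ((B z + B w) * (SUP \<alpha>\<in>cball 0 1. cmod (h \<alpha>)))) else {0})"
        using D(1) unfolding K_def Box_def by blast
      then show ?thesis using zw that by (simp add: ok_def)
    qed
    moreover have "D (b, z, w, \<lambda>\<alpha>. g \<alpha> + h \<alpha>) = D (b, z, w, g) + D (b, z, w, h)" if "g \<in> C_disc" "h \<in> C_disc" for g h
    proof -
      have "\<forall>q. (case q of (b, z, w, g, h) \<Rightarrow> z \<in> ?P \<and> w \<in> ?P \<and> g \<in> C_disc \<and> h \<in> C_disc) \<longrightarrow>
         (case q of (b, z, w, g, h) \<Rightarrow> D (b, z, w, \<lambda>\<alpha>. g \<alpha> + h \<alpha>) = D (b, z, w, g) + D (b, z, w, h))"
        using D(1) unfolding K_def Add_def by blast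
      from spec[OF this, of "(b, z, w, g, h)"] show ?thesis using zw that by simp
    qed
    moreover have "D (b, z, w, \<lambda>\<alpha>. c * h \<alpha>) = c * D (b, z, w, h)" if "h \<in> C_disc" for c h
    proof -
      have "\<forall>q. (case q of (b, z, w, c, h) \<Rightarrow> z \<in> ?P \<and> w \<in> ?P \<and> h \<in> C_disc) \<longrightarrow>
         (case q of (b, z, w, c, h) \<Rightarrow> D (b, z, w, \<lambda>\<alpha>. c * h \<alpha>) = c * D (b, z, w, h))"
        using D(1) unfolding K_def Scale_def by blast
      from spec[OF this, of "(b, z, w, c, h)"] show ?thesis using zw that by simp
    qed
    ultimately show "(\<lambda>h. D (b, z, w, h)) \<in> C_disc_dual" unfolding C_disc_dual_def by blast
  next
    fix N :: nat and z h c
    assume zh: "\<forall>i\<in>{1..N}. z i \<in> ?P \<and> h i \<in> C_disc"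
    have "\<forall>q. (case q of (b, N::nat, z, h, c) \<Rightarrow> \<forall>i\<in>{1..N}. z i \<in> ?P \<and> h i \<in> C_disc) \<longrightarrow>
       (case q of (b, N, z, h, c) \<Rightarrow> (\<Sum>i=1..N. \<Sum>j=1..N. D (b, z i, z j, \<lambda>\<alpha>. h i \<alpha> * cnj (h j \<alpha>)) * c j * cnj (c i)) \<in> \<real>\<^sub>\<ge>\<^sub>0)"
      using D(1) unfolding K_def Pos_def by blast
    from spec[OF this, of "(b, N, z, h, c)"] zh
    show "(\<Sum>i=1..N. \<Sum>j=1..N. D (b, z i, z j, \<lambda>\<alpha>. h i \<alpha> * cnj (h j \<alpha>)) * c j * cnj (c i)) \<in> \<real>\<^sub>\<ge>\<^sub>0"
      by simp
  qed
  have "M (snd z) (snd w) = D (False, z, w, \<lambda>\<alpha>. 1 - JJ z \<alpha> * cnj (JJ w \<alpha>)) + D (True, z, w, \<lambda>\<alpha>. 1 - jj z \<alpha> * cnj (jj w \<alpha>))"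
    if zw: "z \<in> ?P" "w \<in> ?P" for z w
  proof -
    have "cmod (D (False, z, w, \<lambda>\<alpha>. 1 - JJ z \<alpha> * cnj (JJ w \<alpha>)) + D (True, z, w, \<lambda>\<alpha>. 1 - jj z \<alpha> * cnj (jj w \<alpha>)) - M (snd z) (snd w)) \<le> 0"
    proof (rule field_le_epsilon)
      fix e :: real assume "0 < e"
      then have "D \<in> Eq (z, w, e)" using zw by (intro D(2)) (auto simp: I_def)
      then show "cmod (D (False, z, w, \<lambda>\<alpha>. 1 - JJ z \<alpha> * cnj (JJ w \<alpha>)) + D (True, z, w, \<lambda>\<alpha>. 1 - jj z \<alpha> * cnj (jj w \<alpha>)) - M (snd z) (snd w)) \<le> 0 + e"
        unfolding EqD by simp
    qed
    then show ?thesis by simp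
  qed
  then show ?thesis using pk by blast
qed

section \<open>Holomorphic functions of two variables\<close>

lemma holomorphic_on_C2D:
  assumes "holomorphic_on_C2 f \<Omega>" "open \<Omega>" "p \<in> \<Omega>"
  obtains a b where "(f has_derivative (\<lambda>(u, v). a * u + b * v)) (at p)"
  using assms unfolding holomorphic_on_C2_def by (metis at_within_open)

lemma holomorphic_on_C2I:
  assumes "\<And>p. p \<in> \<Omega> \<Longrightarrow> \<exists>a b. (f has_derivative (\<lambda>(u, v). a * u + b * v)) (at p)"
  shows "holomorphic_on_C2 f \<Omega>"
  using assms unfolding holomorphic_on_C2_def by (meson has_derivative_at_withinI)

lemma holomorphic_on_C2_const: "holomorphic_on_C2 (\<lambda>_. c) \<Omega>"
proof (rule holomorphic_on_C2I)
  fix p :: "complex \<times> complex"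
  have "((\<lambda>_. c) has_derivative (\<lambda>(u, v). 0 * u + 0 * v)) (at p)"
    by (rule has_derivative_eq_rhs[OF has_derivative_const]) auto
  then show "\<exists>a b. ((\<lambda>_. c) has_derivative (\<lambda>(u, v). a * u + b * v)) (at p)" by blast
qed

lemma holomorphic_on_C2_fst: "holomorphic_on_C2 fst \<Omega>"
proof (rule holomorphic_on_C2I)
  fix p :: "complex \<times> complex"
  have "(fst has_derivative (\<lambda>(u, v). 1 * u + 0 * v)) (at p)"
    by (rule has_derivative_eq_rhs[OF has_derivative_fst[OF has_derivative_ident]]) auto
  then show "\<exists>a b. (fst has_derivative (\<lambda>(u, v). a * u + b * v)) (at p)" by blast
qed

lemma holomorphic_on_C2_snd: "holomorphic_on_C2 snd \<Omega>"
proof (rule holomorphic_on_C2I)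
  fix p :: "complex \<times> complex"
  have "(snd has_derivative (\<lambda>(u, v). 0 * u + 1 * v)) (at p)"
    by (rule has_derivative_eq_rhs[OF has_derivative_snd[OF has_derivative_ident]]) auto
  then show "\<exists>a b. (snd has_derivative (\<lambda>(u, v). a * u + b * v)) (at p)" by blast
qed

lemma holomorphic_on_C2_add:
  assumes "holomorphic_on_C2 f \<Omega>" "holomorphic_on_C2 g \<Omega>" "open \<Omega>"
  shows "holomorphic_on_C2 (\<lambda>x. f x + g x) \<Omega>"
proof (rule holomorphic_on_C2I)
  fix p assume p: "p \<in> \<Omega>"
  obtain a b c d where "(f has_derivative (\<lambda>(u, v). a * u + b * v)) (at p)"
    "(g has_derivative (\<lambda>(u, v). c * u + d * v)) (at p)"
    using holomorphic_on_C2D[OF assms(1,3) p] holomorphic_on_C2D[OF assms(2,3) p] by metis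
  then have "((\<lambda>x. f x + g x) has_derivative (\<lambda>(u, v). (a + c) * u + (b + d) * v)) (at p)"
    by (rule has_derivative_eq_rhs[OF has_derivative_add]) (auto simp: algebra_simps)
  then show "\<exists>a b. ((\<lambda>x. f x + g x) has_derivative (\<lambda>(u, v). a * u + b * v)) (at p)" by blast
qed

lemma holomorphic_on_C2_mult:
  assumes "holomorphic_on_C2 f \<Omega>" "holomorphic_on_C2 g \<Omega>" "open \<Omega>"
  shows "holomorphic_on_C2 (\<lambda>x. f x * g x) \<Omega>"
proof (rule holomorphic_on_C2I)
  fix p assume p: "p \<in> \<Omega>"
  obtain a b c d where "(f has_derivative (\<lambda>(u, v). a * u + b * v)) (at p)"
    "(g has_derivative (\<lambda>(u, v). c * u + d * v)) (at p)"
    using holomorphic_on_C2D[OF assms(1,3) p] holomorphic_on_C2D[OF assms(2,3) p] by metis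
  then have "((\<lambda>x. f x * g x) has_derivative (\<lambda>(u, v). (f p * c + a * g p) * u + (f p * d + b * g p) * v)) (at p)"
    by (rule has_derivative_eq_rhs[OF has_derivative_mult]) (auto simp: algebra_simps)
  then show "\<exists>a b. ((\<lambda>x. f x * g x) has_derivative (\<lambda>(u, v). a * u + b * v)) (at p)" by blast
qed

lemma holomorphic_on_C2_inverse:
  assumes "holomorphic_on_C2 f \<Omega>" "open \<Omega>" "\<And>x. x \<in> \<Omega> \<Longrightarrow> f x \<noteq> 0"
  shows "holomorphic_on_C2 (\<lambda>x. inverse (f x)) \<Omega>"
proof (rule holomorphic_on_C2I)
  fix p assume p: "p \<in> \<Omega>"
  obtain a b where "(f has_derivative (\<lambda>(u, v). a * u + b * v)) (at p)"
    using holomorphic_on_C2D[OF assms(1,2) p] by metis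
  then have "((\<lambda>x. inverse (f x)) has_derivative (\<lambda>(u, v). (- (inverse (f p) * a * inverse (f p))) * u + (- (inverse (f p) * b * inverse (f p))) * v)) (at p)"
    by (rule has_derivative_eq_rhs[OF Deriv.has_derivative_inverse[where f = f and x = p, OF assms(3)[OF p]]]) (auto simp: algebra_simps)
  then show "\<exists>a b. ((\<lambda>x. inverse (f x)) has_derivative (\<lambda>(u, v). a * u + b * v)) (at p)" by blast
qed

lemma holomorphic_on_C2_sum:
  assumes "\<And>i. i \<in> A \<Longrightarrow> holomorphic_on_C2 (f i) \<Omega>" "open \<Omega>"
  shows "holomorphic_on_C2 (\<lambda>x. \<Sum>i\<in>A. f i x) \<Omega>"
  using assms(1)
  by (induction A rule: infinite_finite_induct)
    (auto intro: holomorphic_on_C2_const holomorphic_on_C2_add[OF _ _ assms(2)])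

lemma holomorphic_on_C2_continuous:
  assumes "holomorphic_on_C2 f \<Omega>" "open \<Omega>"
  shows "continuous_on \<Omega> f"
  using holomorphic_on_C2D[OF assms] has_derivative_continuous continuous_at_imp_continuous_on by metis

section \<open>Complex lines and second-order estimates\<close>

lemma holomorphic_on_C2_line:
  assumes f: "(f has_derivative (\<lambda>(u, v). a * u + b * v)) (at (fst p + t * fst q, snd p + t * snd q))"
  shows "((\<lambda>t. f (fst p + t * fst q, snd p + t * snd q)) has_field_derivative (a * fst q + b * snd q)) (at t)"
proof -
  have "((\<lambda>t. (fst p + t * fst q, snd p + t * snd q)) has_derivative (\<lambda>h. (h * fst q, h * snd q))) (at t)"
    by (auto intro!: derivative_eq_intros)
  from has_derivative_compose[OF this f]
  have "((\<lambda>t. f (fst p + t * fst q, snd p + t * snd q)) has_derivative (\<lambda>h. a * (h * fst q) + b * (h * snd q))) (at t)"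
    by simp
  moreover have "(\<lambda>h. a * (h * fst q) + b * (h * snd q)) = (*) (a * fst q + b * snd q)"
    by (auto simp: algebra_simps)
  ultimately show ?thesis by (simp add: has_field_derivative_def)
qed

text \<open>Cauchy estimates on circles of radius r / 4 centred in |x| \<le> r / 2 stay inside the
  disc of radius r. They give C / (r / 4) = 4 C / r for the first derivative and 2 C / (r / 4)^2 =
  32 C / r^2 for the second.\<close>

lemma bounded_holomorphic_second_order:
  assumes u: "u holomorphic_on ball 0 r" and r: "0 < r" and C: "\<And>t. t \<in> ball 0 r \<Longrightarrow> cmod (u t) \<le> C"
  shows "cmod (deriv u 0) \<le> 4 * C / r"
    and "cmod t < r / 2 \<Longrightarrow> cmod (u t - u 0 - deriv u 0 * t) \<le> 32 * C / r\<^sup>2 * (cmod t)\<^sup>2"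
proof -
  have sub: "cball x (r / 4) \<subseteq> ball 0 r" if "cmod x \<le> r / 2" for x
  proof
    fix y assume "y \<in> cball x (r / 4)"
    then have "cmod (y - x) \<le> r / 4" by (simp add: dist_norm norm_minus_commute)
    then have "cmod y \<le> r / 2 + r / 4" using norm_triangle_ineq[of x "y - x"] that by simp
    then show "y \<in> ball 0 r" using r by simp
  qed
  have bd: "cmod ((deriv ^^ n) u x) \<le> fact n * C / (r / 4) ^ n" if x: "cmod x \<le> r / 2" for n x
  proof (rule Cauchy_inequality)
    show "u holomorphic_on ball x (r / 4)"
      using u sub[OF x] by (meson ball_subset_cball holomorphic_on_subset)
    show "continuous_on (cball x (r / 4)) u" using u sub[OF x]
      by (meson continuous_on_subset holomorphic_on_imp_continuous_on)
    show "norm (u y) \<le> C" if "norm (x - y) = r / 4" for y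
      using sub[OF x] that by (intro C) (auto simp: dist_norm)
  qed (use r in auto)
  from bd[of 0 1] show "cmod (deriv u 0) \<le> 4 * C / r" using r by (simp add: mult.commute)
  assume t: "cmod t < r / 2"
  have "cmod ((deriv ^^ 0) u t - (\<Sum>i\<le>1. (deriv ^^ i) u 0 * (t - 0) ^ i / fact i))
     \<le> (32 * C / r\<^sup>2) * cmod (t - 0) ^ Suc 1 / fact 1"
  proof (rule complex_Taylor[of "ball 0 (r / 2)"])
    show "((deriv ^^ i) u has_field_derivative (deriv ^^ Suc i) u x) (at x within ball 0 (r / 2))"
      if x: "x \<in> ball 0 (r / 2)" for i x
    proof -
      have "(deriv ^^ i) u holomorphic_on ball 0 r"
        by (rule holomorphic_higher_deriv[OF u open_ball])
      then have "(deriv ^^ i) u field_differentiable at x"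
        using x r by (intro holomorphic_on_imp_differentiable_at[of _ "ball 0 r"]) auto
      then show ?thesis
        by (simp add: DERIV_deriv_iff_field_differentiable has_field_derivative_at_within)
    qed
    show "cmod ((deriv ^^ Suc 1) u x) \<le> 32 * C / r\<^sup>2" if "x \<in> ball 0 (r / 2)" for x
    proof -
      have "cmod ((deriv ^^ 2) u x) \<le> fact 2 * C / (r / 4) ^ 2" by (rule bd) (use that in auto)
      also have "\<dots> = 32 * C / r\<^sup>2" by (simp add: power_divide fact_2)
      finally show ?thesis by (simp add: numeral_2_eq_2)
    qed
  qed (use t r in auto)
  then show "cmod (u t - u 0 - deriv u 0 * t) \<le> 32 * C / r\<^sup>2 * (cmod t)\<^sup>2"
    by (simp add: power2_eq_square algebra_simps)
qed

text \<open>A second-order estimate with explicit constants characterises holomorphy of bounded functions,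
  and it survives pointwise limits.\<close>

definition quadratic_at :: "(complex \<times> complex \<Rightarrow> complex) \<Rightarrow> complex \<times> complex \<Rightarrow> real \<Rightarrow> real \<Rightarrow> complex \<Rightarrow> complex \<Rightarrow> bool" where
  "quadratic_at f p r C a b \<longleftrightarrow>
     (\<forall>h. norm h < r / 2 \<longrightarrow> cmod (f (p + h) - f p - (a * fst h + b * snd h)) \<le> 32 * C / r\<^sup>2 * (norm h)\<^sup>2)"

lemma quadratic_at_imp_has_derivative:
  assumes "quadratic_at f p r C a b" "0 < r" "0 \<le> C"
  shows "(f has_derivative (\<lambda>(u, v). a * u + b * v)) (at p)"
  unfolding has_derivative_at
proof
  show "bounded_linear (\<lambda>(u, v). a * u + b * v)"
    unfolding case_prod_beta
    by (intro bounded_linear_add bounded_linear_compose[OF bounded_linear_mult_right] bounded_linear_fst bounded_linear_snd)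
  have "((\<lambda>h :: complex \<times> complex. 32 * C / r\<^sup>2 * norm h) \<longlongrightarrow> 32 * C / r\<^sup>2 * norm (0 :: complex \<times> complex)) (at 0)"
    by (rule tendsto_mult_left[OF tendsto_norm[OF tendsto_ident_at]])
  then have lim: "((\<lambda>h :: complex \<times> complex. 32 * C / r\<^sup>2 * norm h) \<longlongrightarrow> 0) (at 0)" by simp
  show "(\<lambda>h. norm (f (p + h) - f p - (case h of (u, v) \<Rightarrow> a * u + b * v)) / norm h) \<midarrow>0\<rightarrow> 0"
  proof (rule Lim_null_comparison[OF _ lim])
    have "\<forall>\<^sub>F h in at (0 :: complex \<times> complex). norm h < r / 2 \<and> h \<noteq> 0"
      using assms(2) by (auto simp: eventually_at intro!: exI[of _ "r / 2"])
    then show "\<forall>\<^sub>F h in at 0. norm (norm (f (p + h) - f p - (case h of (u, v) \<Rightarrow> a * u + b * v)) / norm h) \<le> 32 * C / r\<^sup>2 * norm h"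
    proof eventually_elim
      case (elim h)
      have "cmod (f (p + h) - f p - (a * fst h + b * snd h)) \<le> 32 * C / r\<^sup>2 * (norm h)\<^sup>2"
        using assms(1) elim unfolding quadratic_at_def by blast
      then have "cmod (f (p + h) - f p - (a * fst h + b * snd h)) / norm h \<le> 32 * C / r\<^sup>2 * norm h"
        using elim by (simp add: pos_divide_le_eq power2_eq_square mult.assoc)
      then show ?case by (simp add: case_prod_beta)
    qed
  qed
qed

text \<open>The one-variable estimate is applied on the complex line through p in each unit
  direction. Its constants do not depend on the direction, and the derivative along the line is the
  complex linear differential.\<close>

lemma holomorphic_on_C2_imp_quadratic_at:
  assumes f: "holomorphic_on_C2 f \<Omega>" "open \<Omega>" and r: "0 < r" "ball p r \<subseteq> \<Omega>"
    and C: "\<And>x. x \<in> ball p r \<Longrightarrow> cmod (f x) \<le> C"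
  obtains a b where "cmod a \<le> 4 * C / r" "cmod b \<le> 4 * C / r" "quadratic_at f p r C a b"
proof -
  obtain a b where ab: "(f has_derivative (\<lambda>(u, v). a * u + b * v)) (at p)"
  proof (rule holomorphic_on_C2D[OF f])
    show "p \<in> \<Omega>" using r by auto
  qed
  define u where "u = (\<lambda>q t. f (fst p + t * fst q, snd p + t * snd q))"
  have in_ball: "(fst p + t * fst q, snd p + t * snd q) \<in> ball p r" if "norm q = 1" "t \<in> ball 0 r" for q t
  proof -
    have "(fst p + t * fst q, snd p + t * snd q) - p = (t * fst q, t * snd q)" by (simp add: prod_eq_iff)
    moreover have "norm (t * fst q, t * snd q) = cmod t * norm q"
      by (simp add: norm_prod_def norm_mult power_mult_distrib distrib_left[symmetric] real_sqrt_mult)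
    moreover have "dist p x = norm (x - p)" for x by (simp add: dist_norm norm_minus_commute)
    ultimately show ?thesis using that by simp
  qed
  have hol: "u q holomorphic_on ball 0 r" if q: "norm q = 1" for q
    unfolding holomorphic_on_def
  proof
    fix t :: complex assume t: "t \<in> ball 0 r"
    have "(fst p + t * fst q, snd p + t * snd q) \<in> \<Omega>" using in_ball[OF q t] r by blast
    then obtain a' b' where "(f has_derivative (\<lambda>(u, v). a' * u + b' * v)) (at (fst p + t * fst q, snd p + t * snd q))"
      using holomorphic_on_C2D[OF f] by metis
    from holomorphic_on_C2_line[OF this] show "u q field_differentiable at t within ball 0 r"
      unfolding u_def field_differentiable_def by (meson has_field_derivative_at_within)
  qed
  have bd: "cmod (u q t) \<le> C" if "norm q = 1" "t \<in> ball 0 r" for q t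
    unfolding u_def by (rule C[OF in_ball[OF that]])
  have der: "deriv (u q) 0 = a * fst q + b * snd q" for q
  proof -
    have "(f has_derivative (\<lambda>(u, v). a * u + b * v)) (at (fst p + 0 * fst q, snd p + 0 * snd q))"
      using ab by simp
    from holomorphic_on_C2_line[OF this] show ?thesis unfolding u_def by (rule DERIV_imp_deriv)
  qed
  show thesis
  proof
    show "cmod a \<le> 4 * C / r"
      using bounded_holomorphic_second_order(1)[OF hol r(1) bd, of "(1, 0)"] der[of "(1, 0)"] by (simp add: norm_prod_def)
    show "cmod b \<le> 4 * C / r"
      using bounded_holomorphic_second_order(1)[OF hol r(1) bd, of "(0, 1)"] der[of "(0, 1)"] by (simp add: norm_prod_def)
    show "quadratic_at f p r C a b"
      unfolding quadratic_at_def
    proof (intro allI impI)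
      fix h :: "complex \<times> complex" assume h: "norm h < r / 2"
      show "cmod (f (p + h) - f p - (a * fst h + b * snd h)) \<le> 32 * C / r\<^sup>2 * (norm h)\<^sup>2"
      proof (cases "h = 0")
        case True
        then show ?thesis by simp
      next
        case False
        define q where "q = (fst h / of_real (norm h), snd h / of_real (norm h))"
        have "q = (1 / norm h) *\<^sub>R h" by (simp add: q_def prod_eq_iff scaleR_conv_of_real)
        then have q: "norm q = 1" using False by simp
        have hq: "of_real (norm h) * fst q = fst h" "of_real (norm h) * snd q = snd h"
          using False by (auto simp: q_def)
        have "cmod (u q (of_real (norm h)) - u q 0 - deriv (u q) 0 * of_real (norm h)) \<le> 32 * C / r\<^sup>2 * (cmod (of_real (norm h)))\<^sup>2"
          by (rule bounded_holomorphic_second_order(2)[OF hol[OF q] r(1) bd[OF q]]) (use h in auto)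
        moreover have "u q (of_real (norm h)) = f (p + h)" unfolding u_def hq
          by (rule arg_cong[of _ _ f]) (simp add: prod_eq_iff)
        moreover have "u q 0 = f p" by (simp add: u_def)
        moreover have "deriv (u q) 0 * of_real (norm h) = a * fst h + b * snd h"
          unfolding der hq[symmetric] by (simp add: algebra_simps)
        ultimately show ?thesis by simp
      qed
    qed
  qed
qed

text \<open>Local bounds confine the partial derivatives at p to a compact set. Along a subsequence
  they converge, and the quadratic estimate with fixed constants passes to the limit, so the limit
  of the derivatives is a derivative of g.\<close>

lemma holomorphic_on_C2_pointwise_limit:
  assumes f: "\<And>n. holomorphic_on_C2 (f n) \<Omega>" and op: "open \<Omega>"
    and lim: "\<And>x. x \<in> \<Omega> \<Longrightarrow> (\<lambda>n. f n x) \<longlonglongrightarrow> g x"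
    and bd: "\<And>p. p \<in> \<Omega> \<Longrightarrow> \<exists>r>0. \<exists>C. ball p r \<subseteq> \<Omega> \<and> (\<forall>x\<in>ball p r. \<forall>n. cmod (f n x) \<le> C)"
  shows "holomorphic_on_C2 g \<Omega>"
proof (rule holomorphic_on_C2I)
  fix p assume p: "p \<in> \<Omega>"
  then obtain r C where r: "0 < r" "ball p r \<subseteq> \<Omega>" "\<And>x n. x \<in> ball p r \<Longrightarrow> cmod (f n x) \<le> C"
    using bd by blast
  have C0: "0 \<le> C" using order_trans[OF norm_ge_zero r(3)[of p 0]] r(1) by simp
  have "\<forall>n. \<exists>a b. cmod a \<le> 4 * C / r \<and> cmod b \<le> 4 * C / r \<and> quadratic_at (f n) p r C a b"
  proof
    fix n
    obtain a b where "cmod a \<le> 4 * C / r" "cmod b \<le> 4 * C / r" "quadratic_at (f n) p r C a b"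
      by (rule holomorphic_on_C2_imp_quadratic_at[OF f op r(1,2), of n C]) (use r(3) in auto)
    then show "\<exists>a b. cmod a \<le> 4 * C / r \<and> cmod b \<le> 4 * C / r \<and> quadratic_at (f n) p r C a b"
      by blast
  qed
  then obtain a b where ab: "\<And>n. cmod (a n) \<le> 4 * C / r" "\<And>n. cmod (b n) \<le> 4 * C / r"
    "\<And>n. quadratic_at (f n) p r C (a n) (b n)" by metis
  have "\<forall>n. (a n, b n) \<in> cball 0 (4 * C / r) \<times> cball 0 (4 * C / r)" using ab by simp
  moreover have "compact (cball (0::complex) (4 * C / r) \<times> cball (0::complex) (4 * C / r))" by (intro compact_Times) auto
  ultimately obtain l s where s: "strict_mono s" "((\<lambda>n. (a n, b n)) \<circ> s) \<longlonglongrightarrow> l"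
    unfolding compact_eq_seq_compact_metric
    using seq_compactE[of "cball (0::complex) (4 * C / r) \<times> cball (0::complex) (4 * C / r)" "\<lambda>n. (a n, b n)"] by blast
  have la: "(\<lambda>n. a (s n)) \<longlonglongrightarrow> fst l" "(\<lambda>n. b (s n)) \<longlonglongrightarrow> snd l"
    using tendsto_fst[OF s(2)] tendsto_snd[OF s(2)] by (auto simp: comp_def)
  have "quadratic_at g p r C (fst l) (snd l)"
    unfolding quadratic_at_def
  proof (intro allI impI)
    fix h :: "complex \<times> complex" assume h: "norm h < r / 2"
    have "p + h \<in> ball p r" using h r(1) by (simp add: dist_norm)
    then have mem: "p + h \<in> \<Omega>" using r by blast
    have gl: "(\<lambda>n. f (s n) x) \<longlonglongrightarrow> g x" if "x \<in> \<Omega>" for x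
      using LIMSEQ_subseq_LIMSEQ[OF lim[OF that] s(1)] by (simp add: comp_def)
    have "(\<lambda>n. cmod (f (s n) (p + h) - f (s n) p - (a (s n) * fst h + b (s n) * snd h)))
       \<longlonglongrightarrow> cmod (g (p + h) - g p - (fst l * fst h + snd l * snd h))"
      by (intro tendsto_intros gl mem p la)
    moreover have "cmod (f (s n) (p + h) - f (s n) p - (a (s n) * fst h + b (s n) * snd h)) \<le> 32 * C / r\<^sup>2 * (norm h)\<^sup>2" for n
      using ab(3)[of "s n"] h unfolding quadratic_at_def by blast
    ultimately show "cmod (g (p + h) - g p - (fst l * fst h + snd l * snd h)) \<le> 32 * C / r\<^sup>2 * (norm h)\<^sup>2"
      by (intro LIMSEQ_le_const2) auto
  qed
  from quadratic_at_imp_has_derivative[OF this r(1) C0]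
  show "\<exists>a b. (g has_derivative (\<lambda>(u, v). a * u + b * v)) (at p)" by blast
qed

section \<open>Transfer functions\<close>

lemma orthonormal_combination_norm:
  fixes f :: "'k \<Rightarrow> 'j \<Rightarrow> complex"
  assumes S: "finite S" and on: "\<And>k m. k \<in> S \<Longrightarrow> m \<in> S \<Longrightarrow> (\<Sum>j\<in>J. f k j * cnj (f m j)) = (if k = m then 1 else 0)"
  shows "(\<Sum>j\<in>J. (cmod (\<Sum>k\<in>S. a k * f k j))\<^sup>2) = (\<Sum>k\<in>S. (cmod (a k))\<^sup>2)"
proof -
  have "complex_of_real (\<Sum>j\<in>J. (cmod (\<Sum>k\<in>S. a k * f k j))\<^sup>2) = (\<Sum>j\<in>J. \<Sum>k\<in>S. \<Sum>m\<in>S. a k * cnj (a m) * (f k j * cnj (f m j)))"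
    unfolding of_real_sum complex_norm_square cnj_sum sum_product
    by (intro sum.cong refl) (simp add: mult_ac)
  also have "\<dots> = (\<Sum>k\<in>S. \<Sum>m\<in>S. \<Sum>j\<in>J. a k * cnj (a m) * (f k j * cnj (f m j)))"
    by (subst sum.swap) (intro sum.cong refl sum.swap)
  also have "\<dots> = (\<Sum>k\<in>S. \<Sum>m\<in>S. if m = k then a k * cnj (a k) else 0)"
    unfolding sum_distrib_left[symmetric] by (intro sum.cong refl) (auto simp: on)
  also have "\<dots> = (\<Sum>k\<in>S. a k * cnj (a k))"
    unfolding sum.delta[OF S] by (intro sum.cong refl) simp
  also have "\<dots> = complex_of_real (\<Sum>k\<in>S. (cmod (a k))\<^sup>2)"
    by (simp only: of_real_sum complex_norm_square)
  finally show ?thesis by (simp only: of_real_eq_iff)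
qed

lemma bessel_inequality:
  fixes f :: "'k \<Rightarrow> 'i \<Rightarrow> complex"
  assumes S: "finite S" and on: "\<And>k m. k \<in> S \<Longrightarrow> m \<in> S \<Longrightarrow> (\<Sum>i\<in>I. f k i * cnj (f m i)) = (if k = m then 1 else 0)"
  shows "(\<Sum>k\<in>S. (cmod (\<Sum>i\<in>I. z i * cnj (f k i)))\<^sup>2) \<le> (\<Sum>i\<in>I. (cmod (z i))\<^sup>2)"
proof -
  define a where "a = (\<lambda>k. \<Sum>i\<in>I. z i * cnj (f k i))"
  define g where "g = (\<lambda>i. \<Sum>k\<in>S. a k * f k i)"
  have gg: "(\<Sum>i\<in>I. (cmod (g i))\<^sup>2) = (\<Sum>k\<in>S. (cmod (a k))\<^sup>2)"
    unfolding g_def by (rule orthonormal_combination_norm[OF S on])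
  have "(\<Sum>i\<in>I. z i * cnj (g i)) = (\<Sum>k\<in>S. cnj (a k) * (\<Sum>i\<in>I. z i * cnj (f k i)))"
    unfolding g_def cnj_sum sum_distrib_left by (subst sum.swap) (intro sum.cong refl, simp add: mult_ac)
  also have "\<dots> = of_real (\<Sum>k\<in>S. (cmod (a k))\<^sup>2)"
    unfolding of_real_sum complex_norm_square a_def[symmetric] by (intro sum.cong refl) (simp add: a_def mult.commute)
  finally have zg: "Re (\<Sum>i\<in>I. z i * cnj (g i)) = (\<Sum>k\<in>S. (cmod (a k))\<^sup>2)" by simp
  have "0 \<le> (\<Sum>i\<in>I. (cmod (z i - g i))\<^sup>2)" by (intro sum_nonneg) simp
  also have "\<dots> = (\<Sum>i\<in>I. (cmod (z i))\<^sup>2 - 2 * Re (z i * cnj (g i)) + (cmod (g i))\<^sup>2)"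
  proof (intro sum.cong refl)
    fix i show "(cmod (z i - g i))\<^sup>2 = (cmod (z i))\<^sup>2 - 2 * Re (z i * cnj (g i)) + (cmod (g i))\<^sup>2"
      unfolding cmod_power2 by (simp add: power2_eq_square algebra_simps)
  qed
  also have "\<dots> = (\<Sum>i\<in>I. (cmod (z i))\<^sup>2) - 2 * Re (\<Sum>i\<in>I. z i * cnj (g i)) + (\<Sum>i\<in>I. (cmod (g i))\<^sup>2)"
    unfolding Re_sum by (simp only: sum.distrib sum_subtractf sum_distrib_left)
  finally show ?thesis unfolding gg zg by (simp add: a_def)
qed

text \<open>Two families of vectors with the same Gram matrix are related by an isometry of their
  spans. Orthonormalizing both with the same coefficients, possible because the Gram matrix is
  definite, gives bases that correspond to each other.\<close>

lemma gram_contraction: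
  fixes x :: "'i \<Rightarrow> 's \<Rightarrow> complex" and y :: "'j \<Rightarrow> 's \<Rightarrow> complex"
  assumes S: "finite S"
    and gram: "\<And>s t. s \<in> S \<Longrightarrow> t \<in> S \<Longrightarrow> (\<Sum>i\<in>I. x i s * cnj (x i t)) = (\<Sum>j\<in>J. y j s * cnj (y j t))"
    and pd: "\<And>c. \<exists>s\<in>S. c s \<noteq> 0 \<Longrightarrow> 0 < Re (hform S (\<lambda>s t. \<Sum>i\<in>I. x i s * cnj (x i t)) c c)"
  obtains U where "\<And>j s. j \<in> J \<Longrightarrow> s \<in> S \<Longrightarrow> (\<Sum>i\<in>I. U j i * x i s) = y j s"
    "\<And>z. (\<Sum>j\<in>J. (cmod (\<Sum>i\<in>I. U j i * z i))\<^sup>2) \<le> (\<Sum>i\<in>I. (cmod (z i))\<^sup>2)"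
proof -
  define L where "L = (\<lambda>s t. \<Sum>i\<in>I. x i s * cnj (x i t))"
  have hL: "hermitian_on S L" unfolding hermitian_on_def L_def by (simp add: mult.commute)
  have h0: "hermitian_on S (\<lambda>_ _. 0)" by (simp add: hermitian_on_def)
  obtain w e yy where sd: "simdiag S L (\<lambda>_ _. 0) w e yy"
    using simultaneous_diagonalization[OF S hL h0 pd[folded L_def]] by blast
  have Lw: "L s t = (\<Sum>k\<in>S. w k s * cnj (w k t))" if "s \<in> S" "t \<in> S" for s t
    using sd that unfolding simdiag_def by blast
  have dual: "(\<Sum>s\<in>S. w k s * e m s) = (if k = m then 1 else 0)" if "k \<in> S" "m \<in> S" for k m
    using sd that unfolding simdiag_def by blast
  have compl: "(\<Sum>k\<in>S. w k s * e k t) = (if s = t then 1 else 0)" if "s \<in> S" "t \<in> S" for s t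
    using sd that unfolding simdiag_def by blast
  have L_e: "(\<Sum>t\<in>S. cnj (e k t) * L s t) = w k s" if "s \<in> S" "k \<in> S" for s k
  proof -
    have "(\<Sum>t\<in>S. cnj (e k t) * L s t) = (\<Sum>t\<in>S. \<Sum>m\<in>S. w m s * cnj (w m t * e k t))"
      using that by (intro sum.cong refl) (simp add: Lw sum_distrib_left mult_ac)
    also have "\<dots> = (\<Sum>m\<in>S. \<Sum>t\<in>S. w m s * cnj (w m t * e k t))" by (rule sum.swap)
    also have "\<dots> = (\<Sum>m\<in>S. w m s * cnj (\<Sum>t\<in>S. w m t * e k t))"
      by (simp only: cnj_sum sum_distrib_left)
    also have "\<dots> = (\<Sum>m\<in>S. if m = k then w m s else 0)"
      using that by (intro sum.cong refl) (simp add: dual)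
    also have "\<dots> = w k s" unfolding sum.delta[OF S] using that by simp
    finally show ?thesis .
  qed
  define ex where "ex = (\<lambda>k i. \<Sum>s\<in>S. e k s * x i s)"
  define ey where "ey = (\<lambda>k j. \<Sum>s\<in>S. e k s * y j s)"
  have proj: "(\<Sum>i\<in>A. v i s * cnj (\<Sum>t\<in>S. e k t * v i t)) = w k s"
    if s: "s \<in> S" and k: "k \<in> S" and g: "\<And>t. t \<in> S \<Longrightarrow> (\<Sum>i\<in>A. v i s * cnj (v i t)) = L s t"
    for s k and A :: "'z set" and v
  proof -
    have "(\<Sum>i\<in>A. v i s * cnj (\<Sum>t\<in>S. e k t * v i t)) = (\<Sum>t\<in>S. cnj (e k t) * (\<Sum>i\<in>A. v i s * cnj (v i t)))"
      unfolding cnj_sum sum_distrib_left by (subst sum.swap) (intro sum.cong refl, simp add: mult_ac)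
    also have "\<dots> = (\<Sum>t\<in>S. cnj (e k t) * L s t)" by (intro sum.cong refl) (simp add: g)
    finally show ?thesis using L_e[OF s k] by simp
  qed
  have ortho: "(\<Sum>i\<in>A. (\<Sum>s\<in>S. e k s * v i s) * cnj (\<Sum>t\<in>S. e m t * v i t)) = (if k = m then 1 else 0)"
    if km: "k \<in> S" "m \<in> S" and g: "\<And>s t. s \<in> S \<Longrightarrow> t \<in> S \<Longrightarrow> (\<Sum>i\<in>A. v i s * cnj (v i t)) = L s t"
    for k m and A :: "'z set" and v
  proof -
    have "(\<Sum>i\<in>A. (\<Sum>s\<in>S. e k s * v i s) * cnj (\<Sum>t\<in>S. e m t * v i t))
       = (\<Sum>s\<in>S. e k s * (\<Sum>i\<in>A. v i s * cnj (\<Sum>t\<in>S. e m t * v i t)))"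
      unfolding sum_distrib_right sum_distrib_left
      by (subst sum.swap) (intro sum.cong refl, simp add: mult_ac sum_distrib_left)
    also have "\<dots> = (\<Sum>s\<in>S. w m s * e k s)"
      by (intro sum.cong refl) (simp only: proj[OF _ km(2) g] mult.commute)
    also have "\<dots> = (if k = m then 1 else 0)" using dual[OF km(2,1)] by auto
    finally show ?thesis .
  qed
  have gx: "(\<Sum>i\<in>I. x i s * cnj (x i t)) = L s t" for s t by (simp add: L_def)
  have gy: "(\<Sum>j\<in>J. y j s * cnj (y j t)) = L s t" if "s \<in> S" "t \<in> S" for s t
    using gram[OF that] by (simp add: L_def)
  \<comment> \<open>Partial isometry: \<open>ex k\<close> goes to \<open>ey k\<close> and the
    orthogonal complement to 0. Contractivity is Bessel's inequality followed by Parseval's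
    identity.\<close>
  define U where "U = (\<lambda>j i. \<Sum>k\<in>S. ey k j * cnj (ex k i))"
  have Uz: "(\<Sum>i\<in>I. U j i * z i) = (\<Sum>k\<in>S. (\<Sum>i\<in>I. z i * cnj (ex k i)) * ey k j)" for j z
    unfolding U_def sum_distrib_right by (subst sum.swap) (intro sum.cong refl, simp add: mult_ac)
  show thesis
  proof
    fix j s assume j: "j \<in> J" and s: "s \<in> S"
    have "(\<Sum>i\<in>I. U j i * x i s) = (\<Sum>k\<in>S. w k s * ey k j)"
      unfolding Uz by (intro sum.cong refl) (simp only: ex_def proj[OF s _ gx])
    also have "\<dots> = (\<Sum>k\<in>S. \<Sum>t\<in>S. (w k s * e k t) * y j t)"
      unfolding ey_def sum_distrib_left by (simp only: mult.assoc)
    also have "\<dots> = (\<Sum>t\<in>S. \<Sum>k\<in>S. (w k s * e k t) * y j t)" by (rule sum.swap)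
    also have "\<dots> = (\<Sum>t\<in>S. if t = s then y j t else 0)"
      unfolding sum_distrib_right[symmetric] by (intro sum.cong refl) (auto simp: compl s)
    also have "\<dots> = y j s" unfolding sum.delta[OF S] using s by simp
    finally show "(\<Sum>i\<in>I. U j i * x i s) = y j s" .
  next
    fix z
    have "(\<Sum>j\<in>J. (cmod (\<Sum>i\<in>I. U j i * z i))\<^sup>2) = (\<Sum>k\<in>S. (cmod (\<Sum>i\<in>I. z i * cnj (ex k i)))\<^sup>2)"
      unfolding Uz by (rule orthonormal_combination_norm[OF S]) (simp only: ey_def ortho[OF _ _ gy])
    also have "\<dots> \<le> (\<Sum>i\<in>I. (cmod (z i))\<^sup>2)"
      by (rule bessel_inequality[OF S]) (simp only: ex_def ortho[OF _ _ gx])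
    finally show "(\<Sum>j\<in>J. (cmod (\<Sum>i\<in>I. U j i * z i))\<^sup>2) \<le> (\<Sum>i\<in>I. (cmod (z i))\<^sup>2)" .
  qed
qed

text \<open>Transfer function \<open>F = a + b G (1 - d G)\<^sup>-\<^sup>1 c\<close> of a contractive colligation,
  with the inverse given by the Neumann series.\<close>

lemma transfer_function:
  fixes Q :: "'q set" and \<Lambda> :: "'l set" and g :: "'l \<Rightarrow> complex \<times> complex \<Rightarrow> complex"
  assumes Q: "finite Q" and \<Lambda>: "finite \<Lambda>" and op: "open \<Omega>"
    and g1: "\<And>l x. l \<in> \<Lambda> \<Longrightarrow> x \<in> \<Omega> \<Longrightarrow> cmod (g l x) < 1"
    and ghol: "\<And>l. l \<in> \<Lambda> \<Longrightarrow> holomorphic_on_C2 (g l) \<Omega>"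
    and contr: "\<And>p u. (cmod ((\<Sum>q\<in>Q. a q * p q) + (\<Sum>l\<in>\<Lambda>. b l * u l)))\<^sup>2 +
        (\<Sum>l\<in>\<Lambda>. (cmod ((\<Sum>q\<in>Q. c l q * p q) + (\<Sum>m\<in>\<Lambda>. d l m * u m)))\<^sup>2)
        \<le> (\<Sum>q\<in>Q. (cmod (p q))\<^sup>2) + (\<Sum>l\<in>\<Lambda>. (cmod (u l))\<^sup>2)"
  obtains F where "\<And>q. q \<in> Q \<Longrightarrow> holomorphic_on_C2 (F q) \<Omega>"
    "\<And>x. x \<in> \<Omega> \<Longrightarrow> (\<Sum>q\<in>Q. (cmod (F q x))\<^sup>2) \<le> 1"
    "\<And>x p v e. x \<in> \<Omega> \<Longrightarrow> (\<Sum>q\<in>Q. a q * p q) + (\<Sum>l\<in>\<Lambda>. b l * (g l x * v l)) = e \<Longrightarrow>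
       (\<And>l. l \<in> \<Lambda> \<Longrightarrow> (\<Sum>q\<in>Q. c l q * p q) + (\<Sum>m\<in>\<Lambda>. d l m * (g m x * v m)) = v l) \<Longrightarrow>
       (\<Sum>q\<in>Q. F q x * p q) = e"
proof -
  define N where "N = (\<lambda>u :: 'l \<Rightarrow> complex. \<Sum>l\<in>\<Lambda>. (cmod (u l))\<^sup>2)"
  define T where "T = (\<lambda>u l. \<Sum>m\<in>\<Lambda>. d l m * u m)"
  \<comment> \<open>V q t is the t-th partial Neumann sum for the column q of c. The increments
    decay like \<gamma>^t, since d is a contraction and multiplication by g shrinks by
    \<gamma>.\<close>
  define V where "V = (\<lambda>q t x. ((\<lambda>u l. c l q + (\<Sum>m\<in>\<Lambda>. d l m * (g m x * u m))) ^^ t) (\<lambda>_. 0))"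
  have V0: "V q 0 x l = 0" for q x l by (simp add: V_def)
  have VS: "V q (Suc t) x l = c l q + (\<Sum>m\<in>\<Lambda>. d l m * (g m x * V q t x m))" for q t x l
    by (simp add: V_def)
  have Tle: "N (T u) \<le> N u" for u
  proof -
    have "(\<Sum>l\<in>\<Lambda>. (cmod ((\<Sum>q\<in>Q. c l q * 0) + (\<Sum>m\<in>\<Lambda>. d l m * u m)))\<^sup>2) \<le> (\<Sum>q\<in>Q. (cmod 0)\<^sup>2) + (\<Sum>l\<in>\<Lambda>. (cmod (u l))\<^sup>2)"
      using contr[of "\<lambda>_. 0" u] by (rule order_trans[rotated]) simp
    then show ?thesis by (simp add: N_def T_def)
  qed
  have Gle: "N (\<lambda>l. g l x * u l) \<le> \<gamma>\<^sup>2 * N u" if "\<And>l. l \<in> \<Lambda> \<Longrightarrow> cmod (g l x) \<le> \<gamma>" for x u \<gamma>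
    unfolding N_def sum_distrib_left norm_mult power_mult_distrib
    using that by (intro sum_mono mult_right_mono power_mono) auto
  have c1: "N (\<lambda>l. c l q) \<le> 1" if q: "q \<in> Q" for q
  proof -
    define p where "p = (\<lambda>r. if r = q then 1 else 0 :: complex)"
    have cp: "(\<Sum>r\<in>Q. f r * p r) = f q" for f :: "'q \<Rightarrow> complex"
      unfolding p_def sum_delta_mult[OF Q] using q by simp
    have "(\<Sum>r\<in>Q. (cmod (p r))\<^sup>2) = (\<Sum>r\<in>Q. if r = q then 1 else 0)"
      by (intro sum.cong refl) (simp add: p_def)
    also have "\<dots> = 1" unfolding sum.delta[OF Q] using q by simp
    finally have p1: "(\<Sum>r\<in>Q. (cmod (p r))\<^sup>2) = 1" .
    have "(\<Sum>l\<in>\<Lambda>. (cmod ((\<Sum>q\<in>Q. c l q * p q) + (\<Sum>m\<in>\<Lambda>. d l m * 0)))\<^sup>2) \<le> (\<Sum>q\<in>Q. (cmod (p q))\<^sup>2) + (\<Sum>l\<in>\<Lambda>. (cmod 0)\<^sup>2)"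
      using contr[of p "\<lambda>_. 0"] by (rule order_trans[rotated]) simp
    then show ?thesis by (simp add: cp p1 N_def)
  qed
  have comp_le: "(cmod (u l))\<^sup>2 \<le> N u" if "l \<in> \<Lambda>" for u l
    unfolding N_def using \<Lambda> that by (intro member_le_sum) auto
  have VdN: "N (\<lambda>l. V q (Suc t) x l - V q t x l) \<le> (\<gamma>\<^sup>2) ^ t"
    if q: "q \<in> Q" and \<gamma>: "\<And>l. l \<in> \<Lambda> \<Longrightarrow> cmod (g l x) \<le> \<gamma>" for q t x \<gamma>
  proof (induction t)
    case 0
    have "N (\<lambda>l. V q (Suc 0) x l - V q 0 x l) = N (\<lambda>l. c l q)"
      by (simp add: VS V0)
    then show ?case using c1[OF q] by simp
  next
    case (Suc t)
    have "(\<lambda>l. V q (Suc (Suc t)) x l - V q (Suc t) x l) = T (\<lambda>m. g m x * (V q (Suc t) x m - V q t x m))"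
      unfolding T_def VS[of q "Suc t"] VS[of q t]
      by (rule ext) (simp add: sum_subtractf[symmetric] right_diff_distrib)
    then have "N (\<lambda>l. V q (Suc (Suc t)) x l - V q (Suc t) x l) \<le> N (\<lambda>m. g m x * (V q (Suc t) x m - V q t x m))"
      using Tle by simp
    also have "\<dots> \<le> \<gamma>\<^sup>2 * N (\<lambda>m. V q (Suc t) x m - V q t x m)" by (rule Gle[OF \<gamma>])
    also have "\<dots> \<le> \<gamma>\<^sup>2 * (\<gamma>\<^sup>2) ^ t" using Suc by (intro mult_left_mono) auto
    finally show ?case by simp
  qed
  have Vd: "cmod (V q (Suc t) x l - V q t x l) \<le> \<gamma> ^ t"
    if "q \<in> Q" "\<And>l. l \<in> \<Lambda> \<Longrightarrow> cmod (g l x) \<le> \<gamma>" "l \<in> \<Lambda>" "0 \<le> \<gamma>" for q t x \<gamma> l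
  proof -
    have "(cmod (V q (Suc t) x l - V q t x l))\<^sup>2 \<le> (\<gamma>\<^sup>2) ^ t"
      using comp_le[OF that(3), of "\<lambda>l. V q (Suc t) x l - V q t x l"] VdN[OF that(1,2), of t] by linarith
    also have "\<dots> = (\<gamma> ^ t)\<^sup>2" by (simp add: power_mult[symmetric] mult.commute)
    finally show ?thesis by (rule power2_le_imp_le) (use that in auto)
  qed
  have Vsum: "V q t x l = (\<Sum>s<t. V q (Suc s) x l - V q s x l)" for q t x l
    by (induction t) (simp_all add: V0)
  have Vbd: "cmod (V q t x l) \<le> 1 / (1 - \<gamma>)"
    if "q \<in> Q" "\<And>l. l \<in> \<Lambda> \<Longrightarrow> cmod (g l x) \<le> \<gamma>" "l \<in> \<Lambda>" "0 \<le> \<gamma>" "\<gamma> < 1" for q t x \<gamma> l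
  proof -
    have "cmod (V q t x l) \<le> (\<Sum>s<t. \<gamma> ^ s)"
      unfolding Vsum[of q t] using Vd[OF that(1-4)] by (intro sum_norm_le) auto
    also have "\<dots> \<le> (\<Sum>s. \<gamma> ^ s)"
      using that by (intro sum_le_suminf summable_geometric) auto
    also have "\<dots> = 1 / (1 - \<gamma>)" using that by (intro suminf_geometric) auto
    finally show ?thesis .
  qed
  have \<gamma>ex: "\<exists>\<gamma>. 0 \<le> \<gamma> \<and> \<gamma> < 1 \<and> (\<forall>l\<in>\<Lambda>. cmod (g l x) \<le> \<gamma>)" if x: "x \<in> \<Omega>" for x
  proof -
    define \<gamma> where "\<gamma> = Max (insert 0 ((\<lambda>l. cmod (g l x)) ` \<Lambda>))"
    have "\<gamma> \<in> insert 0 ((\<lambda>l. cmod (g l x)) ` \<Lambda>)" unfolding \<gamma>_def using \<Lambda> by (intro Max_in) auto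
    then have "\<gamma> < 1" using g1[OF _ x] by auto
    moreover have "0 \<le> \<gamma>" "\<forall>l\<in>\<Lambda>. cmod (g l x) \<le> \<gamma>"
      unfolding \<gamma>_def using \<Lambda> by (auto intro!: Max_ge)
    ultimately show ?thesis by blast
  qed
  define W where "W = (\<lambda>q x l. lim (\<lambda>t. V q t x l))"
  have Vlim: "(\<lambda>t. V q t x l) \<longlonglongrightarrow> W q x l" if q: "q \<in> Q" and x: "x \<in> \<Omega>" and l: "l \<in> \<Lambda>" for q x l
  proof -
    obtain \<gamma> where \<gamma>: "0 \<le> \<gamma>" "\<gamma> < 1" "\<And>l. l \<in> \<Lambda> \<Longrightarrow> cmod (g l x) \<le> \<gamma>" using \<gamma>ex[OF x] by blast
    have "summable (\<lambda>s. V q (Suc s) x l - V q s x l)"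
      by (rule summable_comparison_test'[OF summable_geometric[of \<gamma>], of 0])
        (use \<gamma> Vd[OF q \<gamma>(3) l \<gamma>(1)] in auto)
    then have "(\<lambda>t. \<Sum>s<t. V q (Suc s) x l - V q s x l) \<longlonglongrightarrow> (\<Sum>s. V q (Suc s) x l - V q s x l)"
      by (rule summable_LIMSEQ)
    then have "convergent (\<lambda>t. V q t x l)" unfolding Vsum[symmetric] convergent_def by blast
    then show ?thesis unfolding W_def by (rule convergent_LIMSEQ_iff[THEN iffD1])
  qed
  have Wfix: "W q x l = c l q + (\<Sum>m\<in>\<Lambda>. d l m * (g m x * W q x m))" if q: "q \<in> Q" and x: "x \<in> \<Omega>" and l: "l \<in> \<Lambda>" for q x l
  proof (rule LIMSEQ_unique)
    show "(\<lambda>t. V q (Suc t) x l) \<longlonglongrightarrow> W q x l" by (rule LIMSEQ_Suc[OF Vlim[OF that]])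
    show "(\<lambda>t. V q (Suc t) x l) \<longlonglongrightarrow> c l q + (\<Sum>m\<in>\<Lambda>. d l m * (g m x * W q x m))"
      unfolding VS by (intro tendsto_intros Vlim q x)
  qed
  have Vhol: "holomorphic_on_C2 (\<lambda>x. V q t x l) \<Omega>" for q t l
  proof (induction t arbitrary: l)
    case 0
    then show ?case by (simp add: V0 holomorphic_on_C2_const)
  next
    case (Suc t)
    show ?case unfolding VS
      by (intro holomorphic_on_C2_add holomorphic_on_C2_sum holomorphic_on_C2_mult holomorphic_on_C2_const ghol Suc op)
  qed
  have Whol: "holomorphic_on_C2 (\<lambda>x. W q x l) \<Omega>" if q: "q \<in> Q" and l: "l \<in> \<Lambda>" for q l
  proof (rule holomorphic_on_C2_pointwise_limit[OF Vhol op Vlim[OF q _ l]])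
    fix p assume p: "p \<in> \<Omega>"
    obtain \<gamma> where \<gamma>: "0 \<le> \<gamma>" "\<gamma> < 1" "\<And>l. l \<in> \<Lambda> \<Longrightarrow> cmod (g l p) \<le> \<gamma>" using \<gamma>ex[OF p] by blast
    \<comment> \<open>The midpoint leaves room for g to vary: by continuity all |g l| stay below
      \<gamma>' near p, which makes the bounds on the iterates locally uniform.\<close>
    define \<gamma>' where "\<gamma>' = (1 + \<gamma>) / 2"
    have \<gamma>': "0 \<le> \<gamma>'" "\<gamma>' < 1" "\<gamma> < \<gamma>'" using \<gamma> by (auto simp: \<gamma>'_def)
    have "\<forall>l\<in>\<Lambda>. \<forall>\<^sub>F x in nhds p. cmod (g l x) < \<gamma>'"
    proof
      fix l assume l: "l \<in> \<Lambda>"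
      have "continuous_on \<Omega> (\<lambda>x. cmod (g l x))"
        by (intro continuous_intros holomorphic_on_C2_continuous ghol l op)
      then have "isCont (\<lambda>x. cmod (g l x)) p" using op p continuous_on_eq_continuous_at by blast
      then have "((\<lambda>x. cmod (g l x)) \<longlongrightarrow> cmod (g l p)) (nhds p)"
        using tendsto_at_iff_tendsto_nhds[of "\<lambda>x. cmod (g l x)" p] by (simp add: continuous_at)
      moreover have "cmod (g l p) < \<gamma>'" using \<gamma>(3)[OF l] \<gamma>' by simp
      ultimately show "\<forall>\<^sub>F x in nhds p. cmod (g l x) < \<gamma>'"
        by (rule order_tendstoD(2))
    qed
    then have "\<forall>\<^sub>F x in nhds p. \<forall>l\<in>\<Lambda>. cmod (g l x) < \<gamma>'" using \<Lambda> by (simp add: eventually_ball_finite)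
    moreover have "\<forall>\<^sub>F x in nhds p. x \<in> \<Omega>" using op p by (rule eventually_nhds_in_open)
    ultimately have "\<forall>\<^sub>F x in nhds p. x \<in> \<Omega> \<and> (\<forall>l\<in>\<Lambda>. cmod (g l x) < \<gamma>')" by eventually_elim blast
    then obtain r where r: "0 < r" "\<And>x. dist x p < r \<Longrightarrow> x \<in> \<Omega> \<and> (\<forall>l\<in>\<Lambda>. cmod (g l x) < \<gamma>')"
      unfolding eventually_nhds_metric by blast
    have "ball p r \<subseteq> \<Omega>" using r(2) by (auto simp: dist_commute)
    moreover have "\<forall>x\<in>ball p r. \<forall>t. cmod (V q t x l) \<le> 1 / (1 - \<gamma>')"
    proof (intro ballI allI)
      fix x t assume "x \<in> ball p r"
      then have "\<And>l. l \<in> \<Lambda> \<Longrightarrow> cmod (g l x) \<le> \<gamma>'" using r(2)[of x] by (auto simp: dist_commute less_imp_le)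
      from Vbd[OF q this l \<gamma>'(1,2)] show "cmod (V q t x l) \<le> 1 / (1 - \<gamma>')" .
    qed
    ultimately show "\<exists>r>0. \<exists>C. ball p r \<subseteq> \<Omega> \<and> (\<forall>x\<in>ball p r. \<forall>n. cmod (V q n x l) \<le> C)"
      using r(1) by blast
  qed
  define F where "F = (\<lambda>q x. a q + (\<Sum>l\<in>\<Lambda>. b l * (g l x * W q x l)))"
  define Wp where "Wp = (\<lambda>p x l. \<Sum>q\<in>Q. p q * W q x l)"
  have Fp: "(\<Sum>q\<in>Q. F q x * p q) = (\<Sum>q\<in>Q. a q * p q) + (\<Sum>l\<in>\<Lambda>. b l * (g l x * Wp p x l))" for x p
  proof -
    have "(\<Sum>q\<in>Q. F q x * p q) = (\<Sum>q\<in>Q. a q * p q) + (\<Sum>q\<in>Q. \<Sum>l\<in>\<Lambda>. b l * (g l x * (p q * W q x l)))"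
      unfolding F_def distrib_right sum.distrib sum_distrib_right by (simp add: mult_ac)
    also have "(\<Sum>q\<in>Q. \<Sum>l\<in>\<Lambda>. b l * (g l x * (p q * W q x l))) = (\<Sum>l\<in>\<Lambda>. b l * (g l x * Wp p x l))"
      unfolding Wp_def sum_distrib_left by (rule sum.swap)
    finally show ?thesis .
  qed
  have Wpfix: "(\<Sum>q\<in>Q. c l q * p q) + (\<Sum>m\<in>\<Lambda>. d l m * (g m x * Wp p x m)) = Wp p x l" if x: "x \<in> \<Omega>" and l: "l \<in> \<Lambda>" for x p l
  proof -
    have "Wp p x l = (\<Sum>q\<in>Q. p q * c l q + (\<Sum>m\<in>\<Lambda>. d l m * (g m x * (p q * W q x m))))"
      unfolding Wp_def
    proof (intro sum.cong refl)
      fix q assume q: "q \<in> Q"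
      show "p q * W q x l = p q * c l q + (\<Sum>m\<in>\<Lambda>. d l m * (g m x * (p q * W q x m)))"
        by (subst Wfix[OF q x l]) (simp add: distrib_left sum_distrib_left mult_ac)
    qed
    also have "\<dots> = (\<Sum>q\<in>Q. c l q * p q) + (\<Sum>q\<in>Q. \<Sum>m\<in>\<Lambda>. d l m * (g m x * (p q * W q x m)))"
      by (simp add: sum.distrib mult.commute)
    also have "(\<Sum>q\<in>Q. \<Sum>m\<in>\<Lambda>. d l m * (g m x * (p q * W q x m))) = (\<Sum>m\<in>\<Lambda>. d l m * (g m x * Wp p x m))"
      unfolding Wp_def sum_distrib_left by (rule sum.swap)
    finally show ?thesis by simp
  qed
  show thesis
  proof
    show "holomorphic_on_C2 (F q) \<Omega>" if "q \<in> Q" for q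
      unfolding F_def
      by (intro holomorphic_on_C2_add holomorphic_on_C2_sum holomorphic_on_C2_mult holomorphic_on_C2_const ghol Whol op that)
  next
    fix x assume x: "x \<in> \<Omega>"
    obtain \<gamma> where \<gamma>: "0 \<le> \<gamma>" "\<gamma> < 1" "\<And>l. l \<in> \<Lambda> \<Longrightarrow> cmod (g l x) \<le> \<gamma>" using \<gamma>ex[OF x] by blast
    \<comment> \<open>Feeding the conjugate of the row itself into the contraction gives X^2 \<le> X
      for its squared length X.\<close>
    define p where "p = (\<lambda>q. cnj (F q x))"
    define X where "X = (\<Sum>q\<in>Q. (cmod (F q x))\<^sup>2)"
    have "(\<Sum>q\<in>Q. F q x * p q) = of_real X" unfolding X_def p_def of_real_sum complex_norm_square ..
    then have FX: "(\<Sum>q\<in>Q. a q * p q) + (\<Sum>l\<in>\<Lambda>. b l * (g l x * Wp p x l)) = of_real X" unfolding Fp .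
    have "(cmod (of_real X))\<^sup>2 + N (Wp p x) \<le> (\<Sum>q\<in>Q. (cmod (p q))\<^sup>2) + N (\<lambda>l. g l x * Wp p x l)"
      using contr[of p "\<lambda>l. g l x * Wp p x l"] unfolding FX N_def by (simp add: Wpfix[OF x])
    also have "N (\<lambda>l. g l x * Wp p x l) \<le> \<gamma>\<^sup>2 * N (Wp p x)" by (rule Gle[OF \<gamma>(3)])
    also have "\<gamma>\<^sup>2 * N (Wp p x) \<le> 1 * N (Wp p x)"
      using \<gamma> by (intro mult_right_mono) (auto simp: N_def abs_square_le_1 intro!: sum_nonneg)
    finally have "(cmod (of_real X))\<^sup>2 \<le> (\<Sum>q\<in>Q. (cmod (p q))\<^sup>2)" by simp
    then have "X\<^sup>2 \<le> X" by (simp add: p_def X_def[symmetric])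
    have "X \<le> 1"
    proof (rule ccontr)
      assume "\<not> X \<le> 1"
      then have "X * 1 < X * X" by (intro mult_strict_left_mono) auto
      with \<open>X\<^sup>2 \<le> X\<close> show False by (simp add: power2_eq_square)
    qed
    then show "(\<Sum>q\<in>Q. (cmod (F q x))\<^sup>2) \<le> 1" by (simp add: X_def)
  next
    fix x p v e
    assume x: "x \<in> \<Omega>" and e: "(\<Sum>q\<in>Q. a q * p q) + (\<Sum>l\<in>\<Lambda>. b l * (g l x * v l)) = e"
      and v: "\<And>l. l \<in> \<Lambda> \<Longrightarrow> (\<Sum>q\<in>Q. c l q * p q) + (\<Sum>m\<in>\<Lambda>. d l m * (g m x * v m)) = v l"
    obtain \<gamma> where \<gamma>: "0 \<le> \<gamma>" "\<gamma> < 1" "\<And>l. l \<in> \<Lambda> \<Longrightarrow> cmod (g l x) \<le> \<gamma>" using \<gamma>ex[OF x] by blast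
    \<comment> \<open>Uniqueness of the state: the difference of two solutions is fixed by a map
      that strictly shrinks the norm, hence zero. Prescribed states therefore determine the
      output.\<close>
    define D where "D = (\<lambda>l. Wp p x l - v l)"
    have "D l = T (\<lambda>m. g m x * D m) l" if l: "l \<in> \<Lambda>" for l
    proof -
      have "D l = (\<Sum>m\<in>\<Lambda>. d l m * (g m x * Wp p x m)) - (\<Sum>m\<in>\<Lambda>. d l m * (g m x * v m))"
        unfolding D_def using Wpfix[OF x l, of p] v[OF l] by (metis add_diff_cancel_left)
      then show ?thesis by (simp add: T_def D_def right_diff_distrib sum_subtractf)
    qed
    then have "N D = N (T (\<lambda>m. g m x * D m))" unfolding N_def by (intro sum.cong refl) simp
    also have "\<dots> \<le> N (\<lambda>m. g m x * D m)" by (rule Tle)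
    also have "\<dots> \<le> \<gamma>\<^sup>2 * N D" by (rule Gle[OF \<gamma>(3)])
    finally have "(1 - \<gamma>\<^sup>2) * N D \<le> 0" by (simp add: algebra_simps)
    moreover have "0 < 1 - \<gamma>\<^sup>2" using \<gamma> by (simp add: power_less_one_iff)
    ultimately have "N D \<le> 0" by (simp add: mult_le_0_iff)
    then have "D l = 0" if "l \<in> \<Lambda>" for l using order_trans[OF comp_le[OF that, of D]] by fastforce
    then have "Wp p x l = v l" if "l \<in> \<Lambda>" for l using that by (simp add: D_def)
    then have "(\<Sum>l\<in>\<Lambda>. b l * (g l x * Wp p x l)) = (\<Sum>l\<in>\<Lambda>. b l * (g l x * v l))" by (intro sum.cong refl) simp
    then show "(\<Sum>q\<in>Q. F q x * p q) = e" unfolding Fp using e by simp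
  qed
qed

lemma holomorphic_on_C2_test_fun:
  assumes "t \<in> tests"
  shows "holomorphic_on_C2 (test_fun t) sym_bidisc"
proof -
  have Phi: "holomorphic_on_C2 (\<lambda>x. (2 * \<alpha> * snd x + - 1 * fst x) * inverse (2 + - \<alpha> * fst x)) sym_bidisc" if "cmod \<alpha> \<le> 1" for \<alpha>
  proof (intro holomorphic_on_C2_mult holomorphic_on_C2_add holomorphic_on_C2_inverse
      holomorphic_on_C2_const holomorphic_on_C2_fst holomorphic_on_C2_snd open_sym_bidisc)
    show "2 + - \<alpha> * fst x \<noteq> 0" if "x \<in> sym_bidisc" for x
      using Phi_denominator_nonzero[of "fst x" "snd x" \<alpha>] that \<open>cmod \<alpha> \<le> 1\<close> by simp
  qed
  have "t = (False, 1) \<or> (\<exists>\<alpha>. cmod \<alpha> \<le> 1 \<and> t = (True, \<alpha>))" using assms by (auto simp: tests_def)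
  then show ?thesis
  proof (elim disjE exE conjE)
    assume "t = (False, 1)"
    then have "test_fun t = (\<lambda>_. 0)" by (simp add: test_fun_def fun_eq_iff)
    then show ?thesis by (simp add: holomorphic_on_C2_const)
  next
    fix \<alpha> assume \<alpha>: "cmod \<alpha> \<le> 1" "t = (True, \<alpha>)"
    then have "test_fun t = (\<lambda>x. (2 * \<alpha> * snd x + - 1 * fst x) * inverse (2 + - \<alpha> * fst x))"
      by (simp add: test_fun_def Phi_def fun_eq_iff case_prod_beta divide_inverse)
    then show ?thesis using Phi[OF \<alpha>(1)] by simp
  qed
qed

lemma hform_gram:
  "hform S (\<lambda>s t. \<Sum>i\<in>I. x i s * cnj (x i t)) c c = of_real (\<Sum>i\<in>I. (cmod (\<Sum>s\<in>S. x i s * c s))\<^sup>2)"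
proof -
  have "hform S (\<lambda>s t. \<Sum>i\<in>I. x i s * cnj (x i t)) c c = (\<Sum>s\<in>S. \<Sum>t\<in>S. \<Sum>i\<in>I. x i s * c s * cnj (x i t * c t))"
    unfolding hform_def sum_distrib_right by (intro sum.cong refl) (simp add: mult_ac)
  also have "\<dots> = (\<Sum>s\<in>S. \<Sum>i\<in>I. \<Sum>t\<in>S. x i s * c s * cnj (x i t * c t))"
    by (intro sum.cong refl sum.swap)
  also have "\<dots> = (\<Sum>i\<in>I. \<Sum>s\<in>S. \<Sum>t\<in>S. x i s * c s * cnj (x i t * c t))" by (rule sum.swap)
  also have "\<dots> = of_real (\<Sum>i\<in>I. (cmod (\<Sum>s\<in>S. x i s * c s))\<^sup>2)"
    unfolding of_real_sum complex_norm_square cnj_sum sum_product ..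
  finally show ?thesis .
qed

text \<open>Moving negative terms across turns the decomposition into equality of two Gram matrices:
  (\<phi>, diagonal, g v) on the input side and (\<epsilon>, v) on the output side. The resulting
  contraction is a colligation whose transfer row F satisfies \<phi> F + sqrt \<eta> F_s =
  \<epsilon> at each s in S, so the error is at most sqrt \<eta>.\<close>

lemma agler_decomposition_imp_corona_approximation:
  fixes n :: nat and \<phi> :: "nat \<Rightarrow> complex \<times> complex \<Rightarrow> complex" and \<epsilon> \<eta> :: real
  assumes S: "finite S" "S \<subseteq> sym_bidisc" and \<eta>: "0 < \<eta>" and ps: "fst ` set ps \<subseteq> tests"
    and dec: "\<And>x y. x \<in> S \<Longrightarrow> y \<in> S \<Longrightarrow> (\<Sum>j=1..n. \<phi> j x * cnj (\<phi> j y)) - of_real (\<epsilon>\<^sup>2)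
        + (if x = y then of_real \<eta> else 0) = agler_sum ps x y"
  shows "\<exists>F. (\<forall>i\<in>{1..n}. holomorphic_on_C2 (F i) sym_bidisc) \<and>
    (\<forall>x\<in>sym_bidisc. (\<Sum>i=1..n. (cmod (F i x))\<^sup>2) \<le> 1) \<and>
    (\<forall>x\<in>S. cmod ((\<Sum>i=1..n. \<phi> i x * F i x) - of_real \<epsilon>) \<le> sqrt \<eta>)"
proof -
  define Q where "Q = {1..n} <+> S"
  define \<Lambda> where "\<Lambda> = {..<length ps}"
  define g where "g = (\<lambda>l. test_fun (fst (ps ! l)))"
  define v where "v = (\<lambda>l. snd (ps ! l))"
  \<comment> \<open>One extra input per point of S, nonzero only there, produces the diagonal \<eta>
    in the Gram matrix and makes it definite.\<close>
  define \<phi>' where "\<phi>' = (\<lambda>q s. case q of Inl j \<Rightarrow> \<phi> j s | Inr t \<Rightarrow> if t = s then complex_of_real (sqrt \<eta>) else 0)"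
  define x where "x = (\<lambda>i s. case i of Inl q \<Rightarrow> \<phi>' q s | Inr l \<Rightarrow> g l s * v l s)"
  \<comment> \<open>\<open>None\<close> is the scalar output \<epsilon>; \<open>Some l\<close> are
    the states.\<close>
  define y where "y = (\<lambda>j s. case j of None \<Rightarrow> complex_of_real \<epsilon> | Some l \<Rightarrow> v l s)"
  define J where "J = insert None (Some ` \<Lambda>)"
  have finQ: "finite Q" and fin\<Lambda>: "finite \<Lambda>" using S by (auto simp: Q_def \<Lambda>_def)
  have sumQ: "(\<Sum>q\<in>Q. h q) = (\<Sum>j=1..n. h (Inl j)) + (\<Sum>t\<in>S. h (Inr t))" for h :: "nat + complex \<times> complex \<Rightarrow> 'b::comm_monoid_add"
    unfolding Q_def using S by (simp add: sum.Plus)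
  have sumI: "(\<Sum>i\<in>Q <+> \<Lambda>. h i) = (\<Sum>q\<in>Q. h (Inl q)) + (\<Sum>l\<in>\<Lambda>. h (Inr l))" for h :: "(nat + complex \<times> complex) + nat \<Rightarrow> 'b::comm_monoid_add"
    using finQ fin\<Lambda> by (simp add: sum.Plus)
  have sumJ: "(\<Sum>j\<in>J. h j) = h None + (\<Sum>l\<in>\<Lambda>. h (Some l))" for h :: "nat option \<Rightarrow> 'b::comm_monoid_add"
  proof -
    have "(\<Sum>j\<in>J. h j) = h None + (\<Sum>j\<in>Some ` \<Lambda>. h j)"
      unfolding J_def using fin\<Lambda> by (intro sum.insert) auto
    then show ?thesis by (simp add: sum.reindex)
  qed
  have mem: "fst (ps ! l) \<in> tests" if "l \<in> \<Lambda>" for l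
    using ps that by (auto simp: \<Lambda>_def)
  have agler: "agler_sum ps s t = (\<Sum>l\<in>\<Lambda>. (1 - g l s * cnj (g l t)) * (v l s * cnj (v l t)))" for s t
    unfolding agler_sum_def \<Lambda>_def g_def v_def
    by (simp add: sum_list_sum_nth atLeast0LessThan case_prod_beta)
  have \<eta>sq: "complex_of_real (sqrt \<eta>) * complex_of_real (sqrt \<eta>) = of_real \<eta>"
    using \<eta> by (simp add: of_real_mult[symmetric] del: of_real_mult)
  have extra: "(\<Sum>t\<in>S. \<phi>' (Inr t) s * cnj (\<phi>' (Inr t) s')) = (if s = s' then of_real \<eta> else 0)" if "s \<in> S" for s s'
  proof -
    have "(\<Sum>t\<in>S. \<phi>' (Inr t) s * cnj (\<phi>' (Inr t) s')) = (\<Sum>t\<in>S. if t = s then (if s = s' then of_real \<eta> else 0) else 0)"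
      by (intro sum.cong refl) (auto simp: \<phi>'_def \<eta>sq)
    then show ?thesis unfolding sum.delta[OF S(1)] using that by simp
  qed
  have gram: "(\<Sum>i\<in>Q <+> \<Lambda>. x i s * cnj (x i t)) = (\<Sum>j\<in>J. y j s * cnj (y j t))" if st: "s \<in> S" "t \<in> S" for s t
  proof -
    have "(\<Sum>i\<in>Q <+> \<Lambda>. x i s * cnj (x i t)) = (\<Sum>j=1..n. \<phi> j s * cnj (\<phi> j t)) + (if s = t then of_real \<eta> else 0)
        + (\<Sum>l\<in>\<Lambda>. g l s * v l s * cnj (g l t * v l t))"
      unfolding sumI using extra[OF st(1), of t] by (simp add: sumQ x_def) (simp add: \<phi>'_def)
    also have "\<dots> = of_real (\<epsilon>\<^sup>2) + agler_sum ps s t + (\<Sum>l\<in>\<Lambda>. g l s * v l s * cnj (g l t * v l t))"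
      unfolding dec[OF st, symmetric] by simp
    also have "\<dots> = of_real (\<epsilon>\<^sup>2) + (\<Sum>l\<in>\<Lambda>. v l s * cnj (v l t))"
      unfolding agler add.assoc sum.distrib[symmetric]
      by (intro arg_cong2[where f = "(+)"] sum.cong refl) (simp add: algebra_simps)
    also have "\<dots> = (\<Sum>j\<in>J. y j s * cnj (y j t))"
      unfolding sumJ by (simp add: y_def power2_eq_square)
    finally show ?thesis .
  qed
  have pd: "0 < Re (hform S (\<lambda>s t. \<Sum>i\<in>Q <+> \<Lambda>. x i s * cnj (x i t)) c c)" if c: "\<exists>s\<in>S. c s \<noteq> 0" for c
  proof -
    obtain t where t: "t \<in> S" "c t \<noteq> 0" using c by blast
    have "(\<Sum>s\<in>S. x (Inl (Inr t)) s * c s) = (\<Sum>s\<in>S. c s * (if s = t then complex_of_real (sqrt \<eta>) else 0))"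
      by (intro sum.cong refl) (auto simp: x_def \<phi>'_def)
    also have "\<dots> = c t * of_real (sqrt \<eta>)" unfolding sum_delta_mult[OF S(1)] using t by simp
    finally have "(\<Sum>s\<in>S. x (Inl (Inr t)) s * c s) = c t * of_real (sqrt \<eta>)" .
    then have "0 < (cmod (\<Sum>s\<in>S. x (Inl (Inr t)) s * c s))\<^sup>2" using t \<eta> by simp
    moreover have "Inl (Inr t) \<in> Q <+> \<Lambda>" using t by (auto simp: Q_def)
    moreover have "finite (Q <+> \<Lambda>)" using finQ fin\<Lambda> by simp
    ultimately have "0 < (\<Sum>i\<in>Q <+> \<Lambda>. (cmod (\<Sum>s\<in>S. x i s * c s))\<^sup>2)"
      by (intro sum_pos2[of _ "Inl (Inr t)"]) auto
    then show ?thesis unfolding hform_gram by simp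
  qed
  obtain U where U: "\<And>j s. j \<in> J \<Longrightarrow> s \<in> S \<Longrightarrow> (\<Sum>i\<in>Q <+> \<Lambda>. U j i * x i s) = y j s"
    "\<And>z. (\<Sum>j\<in>J. (cmod (\<Sum>i\<in>Q <+> \<Lambda>. U j i * z i))\<^sup>2) \<le> (\<Sum>i\<in>Q <+> \<Lambda>. (cmod (z i))\<^sup>2)"
    using gram_contraction[OF S(1) gram pd] by blast
  define a where "a = (\<lambda>q. U None (Inl q))"
  define b where "b = (\<lambda>l. U None (Inr l))"
  define c where "c = (\<lambda>l q. U (Some l) (Inl q))"
  define d where "d = (\<lambda>l m. U (Some l) (Inr m))"
  have contr: "(cmod ((\<Sum>q\<in>Q. a q * p q) + (\<Sum>l\<in>\<Lambda>. b l * u l)))\<^sup>2 +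
        (\<Sum>l\<in>\<Lambda>. (cmod ((\<Sum>q\<in>Q. c l q * p q) + (\<Sum>m\<in>\<Lambda>. d l m * u m)))\<^sup>2)
        \<le> (\<Sum>q\<in>Q. (cmod (p q))\<^sup>2) + (\<Sum>l\<in>\<Lambda>. (cmod (u l))\<^sup>2)" for p u
    using U(2)[of "case_sum p u"] by (simp add: sumJ sumI a_def b_def c_def d_def)
  obtain F where F: "\<And>q. q \<in> Q \<Longrightarrow> holomorphic_on_C2 (F q) sym_bidisc"
    "\<And>x. x \<in> sym_bidisc \<Longrightarrow> (\<Sum>q\<in>Q. (cmod (F q x))\<^sup>2) \<le> 1"
    "\<And>x p v e. x \<in> sym_bidisc \<Longrightarrow> (\<Sum>q\<in>Q. a q * p q) + (\<Sum>l\<in>\<Lambda>. b l * (g l x * v l)) = e \<Longrightarrow>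
       (\<And>l. l \<in> \<Lambda> \<Longrightarrow> (\<Sum>q\<in>Q. c l q * p q) + (\<Sum>m\<in>\<Lambda>. d l m * (g m x * v m)) = v l) \<Longrightarrow>
       (\<Sum>q\<in>Q. F q x * p q) = e"
  proof (rule transfer_function[OF finQ fin\<Lambda> open_sym_bidisc _ _ contr, of g])
    show "cmod (g l x) < 1" if "l \<in> \<Lambda>" "x \<in> sym_bidisc" for l x
      unfolding g_def using test_fun_norm_less_one mem that by blast
    show "holomorphic_on_C2 (g l) sym_bidisc" if "l \<in> \<Lambda>" for l
      unfolding g_def using holomorphic_on_C2_test_fun mem that by blast
  qed blast
  show ?thesis
  proof (intro exI[of _ "\<lambda>i. F (Inl i)"] conjI ballI)
    fix i assume "i \<in> {1..n}"
    then show "holomorphic_on_C2 (F (Inl i)) sym_bidisc" by (intro F(1)) (auto simp: Q_def)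
  next
    fix s assume s: "s \<in> sym_bidisc"
    have "0 \<le> (\<Sum>t\<in>S. (cmod (F (Inr t) s))\<^sup>2)" by (intro sum_nonneg) auto
    then show "(\<Sum>i=1..n. (cmod (F (Inl i) s))\<^sup>2) \<le> 1" using F(2)[OF s] unfolding sumQ by simp
  next
    fix s assume s: "s \<in> S"
    then have sG: "s \<in> sym_bidisc" using S by blast
    have "(\<Sum>q\<in>Q. F q s * \<phi>' q s) = of_real \<epsilon>"
    proof (rule F(3)[OF sG, of "\<lambda>q. \<phi>' q s" "\<lambda>l. v l s"])
      show "(\<Sum>q\<in>Q. a q * \<phi>' q s) + (\<Sum>l\<in>\<Lambda>. b l * (g l s * v l s)) = of_real \<epsilon>"
        using U(1)[of None s] s unfolding sumI by (simp add: J_def x_def y_def a_def b_def)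
      show "(\<Sum>q\<in>Q. c l q * \<phi>' q s) + (\<Sum>m\<in>\<Lambda>. d l m * (g m s * v m s)) = v l s" if "l \<in> \<Lambda>" for l
        using U(1)[of "Some l" s] s that unfolding sumI by (simp add: J_def x_def y_def c_def d_def)
    qed
    moreover have "(\<Sum>t\<in>S. F (Inr t) s * \<phi>' (Inr t) s) = F (Inr s) s * of_real (sqrt \<eta>)"
    proof -
      have "(\<Sum>t\<in>S. F (Inr t) s * \<phi>' (Inr t) s) = (\<Sum>t\<in>S. F (Inr t) s * (if t = s then of_real (sqrt \<eta>) else 0))"
        by (intro sum.cong refl) (simp add: \<phi>'_def)
      also have "\<dots> = F (Inr s) s * of_real (sqrt \<eta>)" unfolding sum_delta_mult[OF S(1)] using s by simp
      finally show ?thesis .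
    qed
    ultimately have "(\<Sum>i=1..n. \<phi> i s * F (Inl i) s) + F (Inr s) s * of_real (sqrt \<eta>) = of_real \<epsilon>"
      unfolding sumQ by (simp add: \<phi>'_def mult.commute)
    then have "(\<Sum>i=1..n. \<phi> i s * F (Inl i) s) - of_real \<epsilon> = - (F (Inr s) s * of_real (sqrt \<eta>))"
      by (simp add: algebra_simps eq_neg_iff_add_eq_0)
    moreover have "cmod (F (Inr s) s) \<le> 1"
    proof -
      have "(cmod (F (Inr s) s))\<^sup>2 \<le> (\<Sum>q\<in>Q. (cmod (F q s))\<^sup>2)"
        using s finQ by (intro member_le_sum) (auto simp: Q_def)
      also have "\<dots> \<le> 1\<^sup>2" using F(2)[OF sG] by simp
      finally show ?thesis by (rule power2_le_imp_le) simp
    qed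
    ultimately show "cmod ((\<Sum>i=1..n. \<phi> i s * F (Inl i) s) - of_real \<epsilon>) \<le> sqrt \<eta>"
      using \<eta> mult_right_mono[of "cmod (F (Inr s) s)" 1 "sqrt \<eta>"] by (simp add: norm_mult)
  qed
qed

text \<open>A candidate solution is stored with its two partial derivatives as coordinates 0, 1, 2
  of D. Holomorphy then becomes a family of closed inequalities, so it survives Tychonoff's theorem
  together with the row bound.\<close>

lemma corona_solution_from_finite:
  fixes n :: nat and \<phi> :: "nat \<Rightarrow> complex \<times> complex \<Rightarrow> complex" and \<epsilon> :: real
  assumes fin: "\<And>S \<eta>. finite S \<Longrightarrow> S \<subseteq> sym_bidisc \<Longrightarrow> 0 < \<eta> \<Longrightarrow> \<exists>F.
    (\<forall>i\<in>{1..n}. holomorphic_on_C2 (F i) sym_bidisc) \<and>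
    (\<forall>x\<in>sym_bidisc. (\<Sum>i=1..n. (cmod (F i x))\<^sup>2) \<le> 1) \<and>
    (\<forall>x\<in>S. cmod ((\<Sum>i=1..n. \<phi> i x * F i x) - of_real \<epsilon>) \<le> \<eta>)"
  shows "\<exists>F. (\<forall>i\<in>{1..n}. holomorphic_on_C2 (F i) sym_bidisc) \<and>
    (\<forall>x\<in>sym_bidisc. (\<Sum>i=1..n. (cmod (F i x))\<^sup>2) \<le> 1) \<and>
    (\<forall>x\<in>sym_bidisc. (\<Sum>i=1..n. \<phi> i x * F i x) = of_real \<epsilon>)"
proof -
  let ?G = sym_bidisc
  have "\<forall>p\<in>?G. \<exists>r>0. ball p r \<subseteq> ?G" using open_sym_bidisc by (meson open_contains_ball)
  then obtain r where r: "\<And>p. p \<in> ?G \<Longrightarrow> 0 < r p" "\<And>p. p \<in> ?G \<Longrightarrow> ball p (r p) \<subseteq> ?G" by metis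
  \<comment> \<open>The radii are the Cauchy bounds for functions of modulus at most 1: every entry
    of a row of length at most 1 qualifies, and 4 / r bounds its partial derivatives.\<close>
  define Box where "Box = {D :: nat \<times> nat \<times> complex \<times> complex \<Rightarrow> complex. \<forall>q. D q \<in>
     (if fst (snd q) \<in> {1..n} \<and> snd (snd q) \<in> ?G then (if fst q = 0 then cball 0 1 else cball 0 (4 / r (snd (snd q)))) else {0})}"
  define Quad where "Quad = {D :: nat \<times> nat \<times> complex \<times> complex \<Rightarrow> complex. \<forall>q.
     (case q of (i, p, h) \<Rightarrow> i \<in> {1..n} \<and> p \<in> ?G \<and> norm h < r p / 2) \<longrightarrow>
     (case q of (i, p, h) \<Rightarrow> cmod (D (0, i, p + h) - D (0, i, p) - (D (1, i, p) * fst h + D (2, i, p) * snd h))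
        \<le> 32 * 1 / (r p)\<^sup>2 * (norm h)\<^sup>2)}"
  define Bd where "Bd = {D :: nat \<times> nat \<times> complex \<times> complex \<Rightarrow> complex. \<forall>p. p \<in> ?G \<longrightarrow> (\<Sum>i=1..n. (cmod (D (0, i, p)))\<^sup>2) \<le> 1}"
  define Eq where "Eq = (\<lambda>(p, \<eta>::real). {D :: nat \<times> nat \<times> complex \<times> complex \<Rightarrow> complex.
     cmod ((\<Sum>i=1..n. \<phi> i p * D (0, i, p)) - of_real \<epsilon>) \<le> \<eta>})"
  define K where "K = Box \<inter> Quad \<inter> Bd"
  have "compact Box" unfolding Box_def by (rule compact_dependent_product) auto
  moreover have "closed Quad" unfolding Quad_def
    by (rule closed_Collect_all_imp) (auto simp: case_prod_beta intro!: closed_Collect_le continuous_intros)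
  moreover have "closed Bd" unfolding Bd_def
    by (rule closed_Collect_all_imp) (auto intro!: closed_Collect_le continuous_intros)
  ultimately have "compact K" unfolding K_def by (intro compact_Int_closed)
  have EqD: "D \<in> Eq (p, \<eta>) \<longleftrightarrow> cmod ((\<Sum>i=1..n. \<phi> i p * D (0, i, p)) - of_real \<epsilon>) \<le> \<eta>" for D p \<eta>
    by (simp add: Eq_def)
  define I where "I = ?G \<times> {0 :: real<..}"
  have "K \<inter> (\<Inter>i\<in>I. Eq i) \<noteq> {}"
  proof (rule compact_imp_fip_image[OF \<open>compact K\<close>])
    fix i assume "i \<in> I"
    show "closed (Eq i)" unfolding Eq_def
      by (cases i) (auto intro!: closed_Collect_le continuous_intros)
  next
    fix J assume J: "finite J" "J \<subseteq> I"
    define S where "S = fst ` J"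
    define \<eta> where "\<eta> = Min (insert 1 (snd ` J))"
    have S: "finite S" "S \<subseteq> ?G" using J by (auto simp: S_def I_def)
    have "\<forall>e\<in>insert 1 (snd ` J). 0 < e" using J by (auto simp: I_def)
    then have \<eta>0: "0 < \<eta>" using J(1) unfolding \<eta>_def by (subst Min_gr_iff) auto
    have \<eta>J: "\<eta> \<le> e" if "(z, e) \<in> J" for z e
      unfolding \<eta>_def using J(1) that by (intro Min_le) force+
    obtain F where F: "\<And>i. i \<in> {1..n} \<Longrightarrow> holomorphic_on_C2 (F i) ?G"
      "\<And>x. x \<in> ?G \<Longrightarrow> (\<Sum>i=1..n. (cmod (F i x))\<^sup>2) \<le> 1"
      "\<And>x. x \<in> S \<Longrightarrow> cmod ((\<Sum>i=1..n. \<phi> i x * F i x) - of_real \<epsilon>) \<le> \<eta>"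
      using fin[OF S \<eta>0] by blast
    have F1: "cmod (F i x) \<le> 1" if i: "i \<in> {1..n}" and x: "x \<in> ?G" for i x
    proof -
      have "(cmod (F i x))\<^sup>2 \<le> (\<Sum>i=1..n. (cmod (F i x))\<^sup>2)" using i by (intro member_le_sum) auto
      also have "\<dots> \<le> 1\<^sup>2" using F(2)[OF x] by simp
      finally show ?thesis by (rule power2_le_imp_le) simp
    qed
    have "\<forall>i p. \<exists>a b. i \<in> {1..n} \<and> p \<in> ?G \<longrightarrow> cmod a \<le> 4 * 1 / r p \<and> cmod b \<le> 4 * 1 / r p \<and> quadratic_at (F i) p (r p) 1 a b"
    proof (intro allI)
      fix i p
      show "\<exists>a b. i \<in> {1..n} \<and> p \<in> ?G \<longrightarrow> cmod a \<le> 4 * 1 / r p \<and> cmod b \<le> 4 * 1 / r p \<and> quadratic_at (F i) p (r p) 1 a b"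
      proof (cases "i \<in> {1..n} \<and> p \<in> ?G")
        case True
        then have i: "i \<in> {1..n}" and p: "p \<in> ?G" by auto
        obtain a b where "cmod a \<le> 4 * 1 / r p" "cmod b \<le> 4 * 1 / r p" "quadratic_at (F i) p (r p) 1 a b"
          by (rule holomorphic_on_C2_imp_quadratic_at[OF F(1)[OF i] open_sym_bidisc r(1)[OF p] r(2)[OF p], of 1])
            (use F1[OF i] r(2)[OF p] in auto)
        then show ?thesis by blast
      qed auto
    qed
    then obtain a b where ab: "\<And>i p. i \<in> {1..n} \<Longrightarrow> p \<in> ?G \<Longrightarrow> cmod (a i p) \<le> 4 * 1 / r p"
      "\<And>i p. i \<in> {1..n} \<Longrightarrow> p \<in> ?G \<Longrightarrow> cmod (b i p) \<le> 4 * 1 / r p"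
      "\<And>i p. i \<in> {1..n} \<Longrightarrow> p \<in> ?G \<Longrightarrow> quadratic_at (F i) p (r p) 1 (a i p) (b i p)" by metis
    define D where "D = (\<lambda>(k::nat, i, p). if i \<in> {1..n} \<and> p \<in> ?G then (if k = 0 then F i p else if k = 1 then a i p else b i p) else 0)"
    have "D \<in> Box" unfolding Box_def D_def using F1 ab by (auto simp: case_prod_beta)
    moreover have "D \<in> Quad" unfolding Quad_def
    proof (rule CollectI, intro allI impI)
      fix q :: "nat \<times> (complex \<times> complex) \<times> complex \<times> complex"
      obtain i p h where q: "q = (i, p, h)" by (cases q)
      assume "case q of (i, p, h) \<Rightarrow> i \<in> {1..n} \<and> p \<in> ?G \<and> norm h < r p / 2"
      then have i: "i \<in> {1..n}" and p: "p \<in> ?G" and h: "norm h < r p / 2" by (auto simp: q)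
      have "p + h \<in> ball p (r p)" using h r(1)[OF p] by (simp add: dist_norm)
      then have ph: "p + h \<in> ?G" using r(2)[OF p] by blast
      have "cmod (F i (p + h) - F i p - (a i p * fst h + b i p * snd h)) \<le> 32 * 1 / (r p)\<^sup>2 * (norm h)\<^sup>2"
        using ab(3)[OF i p] h unfolding quadratic_at_def by blast
      then show "case q of (i, p, h) \<Rightarrow> cmod (D (0, i, p + h) - D (0, i, p) - (D (1, i, p) * fst h + D (2, i, p) * snd h))
        \<le> 32 * 1 / (r p)\<^sup>2 * (norm h)\<^sup>2"
        using i p ph by (simp add: q D_def)
    qed
    moreover have "D \<in> Bd" unfolding Bd_def using F(2) by (simp add: D_def)
    moreover have "D \<in> Eq i" if i: "i \<in> J" for i
    proof -
      obtain p e where ie: "i = (p, e)" by (cases i)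
      have p: "p \<in> S" using i ie by (force simp: S_def)
      then have pG: "p \<in> ?G" using S by blast
      have "(\<Sum>i=1..n. \<phi> i p * D (0, i, p)) = (\<Sum>i=1..n. \<phi> i p * F i p)"
        using pG by (intro sum.cong refl) (simp add: D_def)
      then show ?thesis unfolding ie EqD using F(3)[OF p] \<eta>J[of p e] i ie by simp
    qed
    ultimately show "K \<inter> (\<Inter>i\<in>J. Eq i) \<noteq> {}" unfolding K_def by blast
  qed
  then obtain D where D: "D \<in> K" "\<And>i. i \<in> I \<Longrightarrow> D \<in> Eq i" by blast
  define F where "F = (\<lambda>i p. D (0, i, p))"
  show ?thesis
  proof (intro exI[of _ F] conjI ballI)
    fix i assume i: "i \<in> {1..n}"
    show "holomorphic_on_C2 (F i) ?G"
    proof (rule holomorphic_on_C2I)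
      fix p assume p: "p \<in> ?G"
      have Q: "\<forall>q. (case q of (i, p, h) \<Rightarrow> i \<in> {1..n} \<and> p \<in> ?G \<and> norm h < r p / 2) \<longrightarrow>
         (case q of (i, p, h) \<Rightarrow> cmod (D (0, i, p + h) - D (0, i, p) - (D (1, i, p) * fst h + D (2, i, p) * snd h))
         \<le> 32 * 1 / (r p)\<^sup>2 * (norm h)\<^sup>2)"
        using D(1) unfolding K_def Quad_def by blast
      have "quadratic_at (F i) p (r p) 1 (D (1, i, p)) (D (2, i, p))"
        unfolding quadratic_at_def F_def
      proof (intro allI impI)
        fix h :: "complex \<times> complex" assume "norm h < r p / 2"
        then show "cmod (D (0, i, p + h) - D (0, i, p) - (D (1, i, p) * fst h + D (2, i, p) * snd h)) \<le> 32 * 1 / (r p)\<^sup>2 * (norm h)\<^sup>2"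
          using spec[OF Q, of "(i, p, h)"] i p by simp
      qed
      from quadratic_at_imp_has_derivative[OF this r(1)[OF p]]
      show "\<exists>a b. (F i has_derivative (\<lambda>(u, v). a * u + b * v)) (at p)" by auto
    qed
  next
    fix x assume "x \<in> ?G"
    then show "(\<Sum>i=1..n. (cmod (F i x))\<^sup>2) \<le> 1" using D(1) unfolding K_def Bd_def F_def by blast
  next
    fix x assume x: "x \<in> ?G"
    have "cmod ((\<Sum>i=1..n. \<phi> i x * F i x) - of_real \<epsilon>) \<le> 0"
    proof (rule field_le_epsilon)
      fix e :: real assume "0 < e"
      then have "D \<in> Eq (x, e)" using x by (intro D(2)) (auto simp: I_def)
      then show "cmod ((\<Sum>i=1..n. \<phi> i x * F i x) - of_real \<epsilon>) \<le> 0 + e" unfolding EqD F_def by simp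
    qed
    then show "(\<Sum>i=1..n. \<phi> i x * F i x) = of_real \<epsilon>" by simp
  qed
qed

section \<open>Approximation by symmetric polynomials\<close>

text \<open>Polynomials are generated by rules so that the functional calculus can be built by
  induction, without normal forms.\<close>

inductive_set poly2 :: "(complex \<times> complex \<Rightarrow> complex) set" where
  const: "(\<lambda>_. c) \<in> poly2"
| fst: "fst \<in> poly2"
| snd: "snd \<in> poly2"
| add: "f \<in> poly2 \<Longrightarrow> g \<in> poly2 \<Longrightarrow> (\<lambda>x. f x + g x) \<in> poly2"
| mult: "f \<in> poly2 \<Longrightarrow> g \<in> poly2 \<Longrightarrow> (\<lambda>x. f x * g x) \<in> poly2"

lemma poly2_sum: "(\<And>i. i \<in> A \<Longrightarrow> f i \<in> poly2) \<Longrightarrow> (\<lambda>x. \<Sum>i\<in>A. f i x) \<in> poly2"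
  by (induction A rule: infinite_finite_induct) (auto intro: poly2.intros)

lemma poly2_power: "f \<in> poly2 \<Longrightarrow> (\<lambda>x. f x ^ k) \<in> poly2"
  by (induction k) (auto intro: poly2.intros)

text \<open>Newton's recurrence: the k-th power sum is (z + w) times the previous one minus z w
  times the one before that.\<close>

lemma power_sum_symmetric: "\<exists>Q\<in>poly2. \<forall>z w. Q (z + w, z * w) = z ^ k + w ^ k"
proof (induction k rule: less_induct)
  case (less k)
  consider "k = 0" | "k = 1" | m where "k = Suc (Suc m)" by (metis One_nat_def not0_implies_Suc)
  then show ?case
  proof cases
    case 1
    then show ?thesis by (intro bexI[of _ "\<lambda>_. 2"] poly2.const) auto
  next
    case 2
    then show ?thesis by (intro bexI[of _ fst] poly2.fst) auto
  next
    case 3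
    obtain Q0 Q1 where Q: "Q0 \<in> poly2" "\<And>z w. Q0 (z + w, z * w) = z ^ m + w ^ m"
      "Q1 \<in> poly2" "\<And>z w. Q1 (z + w, z * w) = z ^ Suc m + w ^ Suc m"
      using less.IH[of m] less.IH[of "Suc m"] 3 by auto
    show ?thesis
    proof (intro bexI[of _ "\<lambda>x. fst x * Q1 x + (\<lambda>_. - 1) x * (snd x * Q0 x)"] allI)
      show "(\<lambda>x. fst x * Q1 x + (\<lambda>_. - 1) x * (snd x * Q0 x)) \<in> poly2"
        using Q by (intro poly2.intros)
      fix z w
      show "fst (z + w, z * w) * Q1 (z + w, z * w) + (\<lambda>_. - 1) (z + w, z * w) * (snd (z + w, z * w) * Q0 (z + w, z * w)) = z ^ k + w ^ k"
        unfolding Q 3 by (simp add: algebra_simps)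
    qed
  qed
qed

text \<open>Extracting the common power of z w leaves a power sum; the claim is symmetric in m and
  n.\<close>

lemma monomial_symmetric: "\<exists>Q\<in>poly2. \<forall>z w. Q (z + w, z * w) = z ^ m * w ^ n + w ^ m * z ^ n"
proof (induction m n rule: linorder_wlog)
  case (le m n)
  obtain Q where Q: "Q \<in> poly2" "\<And>z w. Q (z + w, z * w) = z ^ (n - m) + w ^ (n - m)"
    using power_sum_symmetric by blast
  have n: "n = m + (n - m)" using le by simp
  show ?case
  proof (intro bexI[of _ "\<lambda>x. snd x ^ m * Q x"] allI)
    show "(\<lambda>x. snd x ^ m * Q x) \<in> poly2" using Q by (intro poly2.mult poly2_power poly2.snd)
    fix z w
    show "snd (z + w, z * w) ^ m * Q (z + w, z * w) = z ^ m * w ^ n + w ^ m * z ^ n"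
      unfolding Q by (subst (1 2) n) (simp add: power_add power_mult_distrib algebra_simps)
  qed
next
  case (sym n m)
  then obtain Q where Q: "Q \<in> poly2" "\<And>z w. Q (z + w, z * w) = z ^ m * w ^ n + w ^ m * z ^ n" by blast
  then show ?case by (intro bexI[of _ Q]) (auto simp: mult.commute add.commute)
qed

text \<open>Lagrange interpolation at roots of unity: it reproduces monomials of degree less than \<open>M\<close>
  and has norm at most \<open>M\<close>, while the Taylor tail decays geometrically.\<close>

lemma roots_of_unity_orthogonality:
  fixes M i k :: nat
  assumes "i < M" "k < M"
  defines "\<omega> \<equiv> \<lambda>j. exp (2 * of_real pi * \<i> * of_nat j / of_nat M)"
  shows "(\<Sum>j<M. \<omega> j ^ i * inverse (\<omega> j) ^ k) = (if i = k then of_nat M else 0)"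
proof (cases "i = k")
  case True
  have "\<omega> j ^ k * inverse (\<omega> j) ^ k = 1" for j
    by (simp add: power_mult_distrib[symmetric] \<omega>_def)
  then show ?thesis using True by simp
next
  case False
  have M0: "M > 0" using assms by simp
  define z where "z = exp (2 * of_real pi * \<i> * of_int (int i - int k) / of_nat M)"
  have trm: "\<omega> j ^ i * inverse (\<omega> j) ^ k = z ^ j" for j
  proof -
    have "\<omega> j ^ i * inverse (\<omega> j) ^ k = exp (of_nat i * (2 * of_real pi * \<i> * of_nat j / of_nat M)) * exp (of_nat k * (- (2 * of_real pi * \<i> * of_nat j / of_nat M)))"
      by (simp only: \<omega>_def exp_minus[symmetric] exp_of_nat_mult[symmetric])
    also have "\<dots> = exp (of_nat j * (2 * of_real pi * \<i> * of_int (int i - int k) / of_nat M))"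
      unfolding exp_add[symmetric] by (rule arg_cong[of _ _ exp]) (simp add: algebra_simps diff_divide_distrib)
    finally show ?thesis by (simp only: z_def exp_of_nat_mult)
  qed
  have zM: "z ^ M = 1"
  proof -
    have "z ^ M = exp (of_nat M * (2 * of_real pi * \<i> * of_int (int i - int k) / of_nat M))"
      by (simp only: z_def exp_of_nat_mult)
    also have "\<dots> = exp (2 * of_int (int i - int k) * of_real pi * \<i>)"
      using M0 by (intro arg_cong[of _ _ exp]) (simp add: field_simps)
    also have "\<dots> = 1" by (simp only: exp_eq_1) (auto intro!: exI[of _ "int i - int k"])
    finally show ?thesis .
  qed
  have z1: "z \<noteq> 1"
  proof
    assume "z = 1"
    then obtain n :: int where "Im (2 * of_real pi * \<i> * of_int (int i - int k) / of_nat M) = of_int (2 * n) * pi"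
      unfolding z_def exp_eq_1 by blast
    then have "2 * pi * of_int (int i - int k) / of_nat M = of_int (2 * n) * pi"
      by (simp add: Im_divide_of_nat)
    then have "2 * pi * real_of_int (int i - int k) = 2 * pi * real_of_int (n * int M)" using M0 by (simp add: field_simps)
    then have "real_of_int (int i - int k) = real_of_int (n * int M)"
      by (subst (asm) mult_cancel_left) simp
    then have "int i - int k = n * int M" by (simp only: of_int_eq_iff)
    moreover have "\<bar>int i - int k\<bar> < int M" using assms by auto
    ultimately have "\<bar>n * int M\<bar> < 1 * int M" by simp
    then have "\<bar>n\<bar> < 1" unfolding abs_mult using M0 by simp
    then have "n = 0" by simp
    with \<open>int i - int k = n * int M\<close> False show False by simp
  qed
  have "(\<Sum>j<M. z ^ j) = 0" using geometric_sum[OF z1, of M] zM by simp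
  then show ?thesis unfolding trm using False by simp
qed

text \<open>Degree, nodes and coefficients depend only on R, C and \<delta>. The same scheme thus
  serves all slices of a function of two variables at once.\<close>

lemma interpolation_approximation:
  fixes R C \<delta> :: real
  assumes R: "1 < R" and C: "0 \<le> C" and \<delta>: "0 < \<delta>"
  obtains M :: nat and x :: "nat \<Rightarrow> complex" and c :: "nat \<Rightarrow> nat \<Rightarrow> complex" where
    "\<And>j. cmod (x j) = 1"
    "\<And>u z. u holomorphic_on ball 0 R \<Longrightarrow> (\<And>z. z \<in> ball 0 R \<Longrightarrow> cmod (u z) \<le> C) \<Longrightarrow> cmod z \<le> 1 \<Longrightarrow>
       cmod ((\<Sum>j<M. u (x j) * (\<Sum>k<M. c j k * z ^ k)) - u z) \<le> \<delta>"
    "\<And>j z. cmod z \<le> 1 \<Longrightarrow> cmod (\<Sum>k<M. c j k * z ^ k) \<le> 1"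
proof -
  \<comment> \<open>A radius strictly between 1 and R: the closed disc lies in the domain, and
    Cauchy's estimate there makes the Taylor coefficients decay like \<theta>^i with \<theta> <
    1.\<close>
  define \<rho> where "\<rho> = (1 + R) / 2"
  define \<theta> where "\<theta> = 1 / \<rho>"
  have \<rho>: "1 < \<rho>" "\<rho> < R" using R by (auto simp: \<rho>_def)
  have \<theta>: "0 < \<theta>" "\<theta> < 1" using \<rho> by (auto simp: \<theta>_def)
  have "(\<lambda>M. C / (1 - \<theta>) * (of_nat M * \<theta> ^ M + \<theta> ^ M)) \<longlonglongrightarrow> C / (1 - \<theta>) * (0 + 0)"
    using \<theta> by (intro tendsto_intros powser_times_n_limit_0 LIMSEQ_power_zero) auto
  then have "\<forall>\<^sub>F M in sequentially. C / (1 - \<theta>) * (of_nat M * \<theta> ^ M + \<theta> ^ M) < \<delta>"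
    using \<delta> by (intro order_tendstoD(2)[where a = \<delta>]) auto
  then obtain M0 where "\<And>M. M0 \<le> M \<Longrightarrow> C / (1 - \<theta>) * (of_nat M * \<theta> ^ M + \<theta> ^ M) < \<delta>"
    unfolding eventually_sequentially by blast
  then obtain M :: nat where M: "0 < M" "C / (1 - \<theta>) * (of_nat M * \<theta> ^ M + \<theta> ^ M) < \<delta>"
    by (metis le_add2 zero_less_Suc add_Suc)
  define x where "x = (\<lambda>j::nat. exp (2 * of_real pi * \<i> * of_nat j / of_nat M))"
  \<comment> \<open>Coefficients of the Lagrange polynomials for roots of unity: the j-th one is the
    mean of (z / x j)^k over k < M, hence bounded by 1 on the disc.\<close>
  define c where "c = (\<lambda>j k. inverse (x j) ^ k / of_nat M)"
  have x1: "cmod (x j) = 1" for j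
    by (simp add: x_def norm_exp_eq_Re)
  have Lbd: "cmod (\<Sum>k<M. c j k * z ^ k) \<le> 1" if "cmod z \<le> 1" for j z
  proof -
    have "cmod (\<Sum>k<M. c j k * z ^ k) \<le> (\<Sum>k<M. 1 / of_nat M)"
      using that x1 by (intro sum_norm_le) (auto simp: c_def norm_mult norm_divide norm_power norm_inverse power_le_one divide_right_mono)
    then show ?thesis using M by simp
  qed
  have repro: "(\<Sum>j<M. x j ^ i * (\<Sum>k<M. c j k * z ^ k)) = z ^ i" if "i < M" for i z
  proof -
    have "(\<Sum>j<M. x j ^ i * (\<Sum>k<M. c j k * z ^ k)) = (\<Sum>j<M. \<Sum>k<M. x j ^ i * inverse (x j) ^ k * (z ^ k / of_nat M))"
      by (simp add: c_def sum_distrib_left mult_ac)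
    also have "\<dots> = (\<Sum>k<M. (\<Sum>j<M. x j ^ i * inverse (x j) ^ k) * (z ^ k / of_nat M))"
      unfolding sum_distrib_right by (rule sum.swap)
    also have "\<dots> = (\<Sum>k<M. if k = i then z ^ k else 0)"
      unfolding x_def using roots_of_unity_orthogonality[OF that] M(1) by (intro sum.cong refl) auto
    also have "\<dots> = z ^ i" using that by simp
    finally show ?thesis .
  qed
  show thesis
  proof (rule that[of x c M])
    fix u z assume u: "u holomorphic_on ball 0 R" and uC: "\<And>z. z \<in> ball 0 R \<Longrightarrow> cmod (u z) \<le> C" and z: "cmod z \<le> 1"
    define b where "b = (\<lambda>i. (deriv ^^ i) u 0 / fact i)"
    have bbd: "cmod (b i) \<le> C * \<theta> ^ i" for i
    proof -
      have "cmod ((deriv ^^ i) u 0) \<le> fact i * C / \<rho> ^ i"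
      proof (rule Cauchy_inequality)
        show "u holomorphic_on ball 0 \<rho>" using u \<rho> by (rule_tac holomorphic_on_subset) auto
        show "continuous_on (cball 0 \<rho>) u"
          using u \<rho> by (intro holomorphic_on_imp_continuous_on holomorphic_on_subset[OF u]) auto
        show "cmod (u w) \<le> C" if "norm (0 - w) = \<rho>" for w using uC[of w] that \<rho> by auto
      qed (use \<rho> in auto)
      then show ?thesis by (simp add: b_def norm_divide field_simps \<theta>_def power_divide)
    qed
    have ser: "(\<lambda>i. b i * w ^ i) sums u w" if "cmod w \<le> 1" for w
      using holomorphic_power_series[OF u, of w] that R by (simp add: b_def)
    define P where "P = (\<lambda>w. \<Sum>i<M. b i * w ^ i)"
    have tail: "cmod (u w - P w) \<le> C * \<theta> ^ M / (1 - \<theta>)" if w: "cmod w \<le> 1" for w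
    proof -
      have "(\<lambda>i. b (i + M) * w ^ (i + M)) sums (u w - P w)"
        unfolding P_def using sums_split_initial_segment[OF ser[OF w], of M] by simp
      moreover have "norm (b (i + M) * w ^ (i + M)) \<le> C * \<theta> ^ M * \<theta> ^ i" for i
      proof -
        have "norm (b (i + M) * w ^ (i + M)) \<le> C * \<theta> ^ (i + M) * 1"
          unfolding norm_mult norm_power using bbd[of "i + M"] w C \<theta> by (intro mult_mono) (auto simp: power_le_one)
        then show ?thesis by (simp add: power_add mult_ac)
      qed
      moreover have "(\<lambda>i. C * \<theta> ^ M * \<theta> ^ i) sums (C * \<theta> ^ M * (1 / (1 - \<theta>)))"
        using \<theta> by (intro sums_mult geometric_sums) auto
      ultimately have "norm (u w - P w) \<le> C * \<theta> ^ M * (1 / (1 - \<theta>))"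
        using norm_suminf_le[of "\<lambda>i. b (i + M) * w ^ (i + M)" "\<lambda>i. C * \<theta> ^ M * \<theta> ^ i"]
        unfolding sums_iff by simp
      then show ?thesis by simp
    qed
    have TP: "(\<Sum>j<M. P (x j) * (\<Sum>k<M. c j k * z ^ k)) = P z"
    proof -
      have "(\<Sum>j<M. P (x j) * (\<Sum>k<M. c j k * z ^ k)) = (\<Sum>j<M. \<Sum>i<M. b i * (x j ^ i * (\<Sum>k<M. c j k * z ^ k)))"
        unfolding P_def sum_distrib_right by (simp only: mult.assoc)
      also have "\<dots> = (\<Sum>i<M. b i * (\<Sum>j<M. x j ^ i * (\<Sum>k<M. c j k * z ^ k)))"
        unfolding sum_distrib_left[of "b _"] by (rule sum.swap)
      also have "\<dots> = P z" unfolding P_def by (intro sum.cong refl) (simp add: repro)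
      finally show ?thesis .
    qed
    have "(\<Sum>j<M. u (x j) * (\<Sum>k<M. c j k * z ^ k)) - u z
       = (\<Sum>j<M. (u (x j) - P (x j)) * (\<Sum>k<M. c j k * z ^ k)) - (u z - P z)"
      unfolding left_diff_distrib sum_subtractf TP by simp
    also have "cmod \<dots> \<le> (\<Sum>j<M. C * \<theta> ^ M / (1 - \<theta>)) + C * \<theta> ^ M / (1 - \<theta>)"
    proof (rule order_trans[OF norm_triangle_ineq4], rule add_mono[OF sum_norm_le tail[OF z]])
      fix j
      have "cmod (u (x j) - P (x j)) * cmod (\<Sum>k<M. c j k * z ^ k) \<le> C * \<theta> ^ M / (1 - \<theta>) * 1"
        using tail[of "x j"] x1 Lbd[OF z, of j] C \<theta> by (intro mult_mono) auto
      then show "cmod ((u (x j) - P (x j)) * (\<Sum>k<M. c j k * z ^ k)) \<le> C * \<theta> ^ M / (1 - \<theta>)"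
        by (simp add: norm_mult)
    qed
    also have "\<dots> = C / (1 - \<theta>) * (of_nat M * \<theta> ^ M + \<theta> ^ M)" by (simp add: algebra_simps)
    also have "\<dots> \<le> \<delta>" using M by simp
    finally show "cmod ((\<Sum>j<M. u (x j) * (\<Sum>k<M. c j k * z ^ k)) - u z) \<le> \<delta>" .
  qed (use x1 Lbd in auto)
qed

text \<open>The dilated function, written in the roots z and w, extends holomorphically in each root
  beyond the unit disc, so it can be interpolated one variable at a time. Symmetrizing the result
  makes it a polynomial in sum and product.\<close>

lemma sym_bidisc_polynomial_approximation:
  assumes F: "holomorphic_on_C2 F sym_bidisc" and FC: "\<And>x. x \<in> sym_bidisc \<Longrightarrow> cmod (F x) \<le> C"
    and r: "0 < r" "r < 1" and \<delta>: "0 < \<delta>"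
  obtains Q where "Q \<in> poly2"
    "\<And>z w. cmod z \<le> 1 \<Longrightarrow> cmod w \<le> 1 \<Longrightarrow>
       cmod (Q (z + w, z * w) - F (of_real r * (z + w), of_real (r\<^sup>2) * (z * w))) \<le> \<delta>"
proof -
  define g where "g = (\<lambda>z w :: complex. F (of_real r * (z + w), of_real (r\<^sup>2) * (z * w)))"
  have C0: "0 \<le> C"
  proof -
    have "(0, 0) \<in> sym_bidisc" by (auto simp: mem_sym_bidisc_iff)
    then show ?thesis using FC norm_ge_zero order_trans by blast
  qed
  have mem: "(of_real r * (z + w), of_real (r\<^sup>2) * (z * w)) \<in> sym_bidisc" if "cmod z < 1 / r" "cmod w \<le> 1" for z w
  proof -
    have "of_real r * z \<in> ball 0 1" "of_real r * w \<in> ball 0 1"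
    proof -
      have "r * cmod z < r * (1 / r)" using that r by (intro mult_strict_left_mono)
      moreover have "r * cmod w \<le> r * 1" using that r by (intro mult_left_mono) auto
      moreover have "r * (1 / r) = 1" using r by simp
      ultimately have "r * cmod z < 1" "r * cmod w < 1" using r(2) by linarith+
      then show "of_real r * z \<in> ball 0 1" "of_real r * w \<in> ball 0 1" using r by (simp_all add: norm_mult)
    qed
    moreover have "of_real r * (z + w) = of_real r * z + of_real r * w"
      "of_real (r\<^sup>2) * (z * w) = (of_real r * z) * (of_real r * w)"
      by (auto simp: algebra_simps power2_eq_square)
    ultimately show ?thesis unfolding sym_bidisc_def by blast
  qed
  have sym: "g z w = g w z" for z w by (simp add: g_def add.commute mult.commute)
  have gC: "cmod (g z w) \<le> C" if "cmod z < 1 / r" "cmod w \<le> 1" for z w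
    unfolding g_def by (rule FC[OF mem[OF that]])
  have ghol: "(\<lambda>z. g z w) holomorphic_on ball 0 (1 / r)" if w: "cmod w \<le> 1" for w
    unfolding holomorphic_on_def
  proof
    fix z :: complex assume z: "z \<in> ball 0 (1 / r)"
    define p q where "p = (of_real r * w, 0 :: complex)" and "q = (of_real r :: complex, of_real (r\<^sup>2) * w)"
    have eq: "(of_real r * (z + w), of_real (r\<^sup>2) * (z * w)) = (fst p + z * fst q, snd p + z * snd q)" for z
      by (simp add: p_def q_def algebra_simps)
    have "(fst p + z * fst q, snd p + z * snd q) \<in> sym_bidisc" using mem[of z w] z w unfolding eq by simp
    then obtain a b where "(F has_derivative (\<lambda>(u, v). a * u + b * v)) (at (fst p + z * fst q, snd p + z * snd q))"
      using holomorphic_on_C2D[OF F open_sym_bidisc] by metis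
    from holomorphic_on_C2_line[OF this] show "(\<lambda>z. g z w) field_differentiable at z within ball 0 (1 / r)"
      unfolding g_def eq field_differentiable_def by (meson has_field_derivative_at_within)
  qed
  have R: "1 < 1 / r" using r by simp
  obtain M x c where A: "\<And>j. cmod (x j) = 1"
    "\<And>u z. u holomorphic_on ball 0 (1 / r) \<Longrightarrow> (\<And>z. z \<in> ball 0 (1 / r) \<Longrightarrow> cmod (u z) \<le> C) \<Longrightarrow> cmod z \<le> 1 \<Longrightarrow>
       cmod ((\<Sum>j<M. u (x j) * (\<Sum>k<M. c j k * z ^ k)) - u z) \<le> \<delta> / 2"
    "\<And>j z. cmod z \<le> 1 \<Longrightarrow> cmod (\<Sum>k<M. c j k * z ^ k) \<le> 1"
    by (rule interpolation_approximation[OF R C0, of "\<delta> / 2"]) (use \<delta> in auto)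
  \<comment> \<open>The second interpolation error is multiplied by up to M Lagrange polynomials of
    modulus at most 1, so it is chosen with M \<delta>' \<le> \<delta> / 2.\<close>
  define \<delta>' where "\<delta>' = \<delta> / (2 * (real M + 1))"
  have \<delta>': "0 < \<delta>'" "real M * \<delta>' \<le> \<delta> / 2" using \<delta> by (auto simp: \<delta>'_def field_simps)
  obtain M' x' c' where B: "\<And>j. cmod (x' j) = 1"
    "\<And>u z. u holomorphic_on ball 0 (1 / r) \<Longrightarrow> (\<And>z. z \<in> ball 0 (1 / r) \<Longrightarrow> cmod (u z) \<le> C) \<Longrightarrow> cmod z \<le> 1 \<Longrightarrow>
       cmod ((\<Sum>j<M'. u (x' j) * (\<Sum>k<M'. c' j k * z ^ k)) - u z) \<le> \<delta>'"
    by (rule interpolation_approximation[OF R C0 \<delta>'(1)]) auto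
  define L where "L = (\<lambda>j z. \<Sum>k<M. c j k * z ^ k)"
  define L' where "L' = (\<lambda>j z. \<Sum>k<M'. c' j k * z ^ k)"
  define P where "P = (\<lambda>z w. \<Sum>j<M. (\<Sum>i<M'. g (x j) (x' i) * L' i w) * L j z)"
  have approx: "cmod (P z w - g z w) \<le> \<delta>" if z: "cmod z \<le> 1" and w: "cmod w \<le> 1" for z w
  proof -
    have 1: "cmod ((\<Sum>j<M. g (x j) w * L j z) - g z w) \<le> \<delta> / 2"
      unfolding L_def by (rule A(2)[OF ghol[OF w] _ z]) (use gC w in auto)
    have 2: "cmod ((\<Sum>i<M'. g (x j) (x' i) * L' i w) - g (x j) w) \<le> \<delta>'" for j
    proof -
      \<comment> \<open>Symmetry of g lets holomorphy in the first variable serve for the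
        second.\<close>
      have "cmod ((\<Sum>i<M'. g (x' i) (x j) * L' i w) - g w (x j)) \<le> \<delta>'"
        unfolding L'_def by (rule B(2)[OF ghol _ w]) (use gC A(1) in auto)
      then show ?thesis by (simp only: sym[of "x j"])
    qed
    have "P z w - g z w = (\<Sum>j<M. ((\<Sum>i<M'. g (x j) (x' i) * L' i w) - g (x j) w) * L j z) + ((\<Sum>j<M. g (x j) w * L j z) - g z w)"
      unfolding P_def left_diff_distrib sum_subtractf by simp
    also have "cmod \<dots> \<le> (\<Sum>j<M. \<delta>') + \<delta> / 2"
    proof (rule order_trans[OF norm_triangle_ineq], rule add_mono[OF sum_norm_le 1])
      fix j
      have "cmod ((\<Sum>i<M'. g (x j) (x' i) * L' i w) - g (x j) w) * cmod (L j z) \<le> \<delta>' * 1"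
        using 2 A(3)[OF z] \<delta>' unfolding L_def by (intro mult_mono) auto
      then show "cmod (((\<Sum>i<M'. g (x j) (x' i) * L' i w) - g (x j) w) * L j z) \<le> \<delta>'" by (simp add: norm_mult)
    qed
    also have "\<dots> \<le> \<delta>" using \<delta>' by simp
    finally show ?thesis .
  qed
  have "\<exists>Q\<in>poly2. \<forall>z w. Q (z + w, z * w) = P z w + P w z"
  proof -
    obtain E where E: "\<And>m n. E m n \<in> poly2" "\<And>m n z w. E m n (z + w, z * w) = z ^ m * w ^ n + w ^ m * z ^ n"
      using monomial_symmetric by metis
    define Q where "Q = (\<lambda>x0. \<Sum>j<M. \<Sum>i<M'. \<Sum>k<M. \<Sum>l<M'. (\<lambda>_. g (x j) (x' i) * c' i l * c j k) x0 * E k l x0)"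
    have "Q \<in> poly2" unfolding Q_def by (intro poly2_sum poly2.mult poly2.const E)
    moreover have "Q (z + w, z * w) = P z w + P w z" for z w
    proof -
      have Pe: "P z w = (\<Sum>j<M. \<Sum>i<M'. \<Sum>k<M. \<Sum>l<M'. g (x j) (x' i) * c' i l * c j k * (z ^ k * w ^ l))" for z w
      proof -
        have "P z w = (\<Sum>j<M. \<Sum>i<M'. g (x j) (x' i) * (L' i w * L j z))"
          unfolding P_def sum_distrib_right by (simp only: mult.assoc)
        also have "\<dots> = (\<Sum>j<M. \<Sum>i<M'. g (x j) (x' i) * (\<Sum>k<M. \<Sum>l<M'. c' i l * w ^ l * (c j k * z ^ k)))"
          unfolding L_def L'_def sum_product by (subst sum.swap) (rule refl)
        finally show ?thesis by (simp only: sum_distrib_left mult_ac)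
      qed
      show ?thesis unfolding Q_def E Pe sum.distrib[symmetric] distrib_left[symmetric] ..
    qed
    ultimately show ?thesis by blast
  qed
  then obtain Q where Q: "Q \<in> poly2" "\<And>z w. Q (z + w, z * w) = P z w + P w z" by blast
  show thesis
  proof (rule that[of "\<lambda>x. (\<lambda>_. 1 / 2) x * Q x"])
    show "(\<lambda>x. (\<lambda>_. 1 / 2) x * Q x) \<in> poly2" by (intro poly2.mult poly2.const Q)
    fix z w :: complex assume zw: "cmod z \<le> 1" "cmod w \<le> 1"
    \<comment> \<open>The mean of P z w and P w z approximates g as well as P does, because g is
      symmetric.\<close>
    have "1 / 2 * Q (z + w, z * w) - g z w = 1 / 2 * ((P z w - g z w) + (P w z - g w z))"
      unfolding Q sym[of w z] by (simp add: field_simps)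
    also have "cmod \<dots> \<le> 1 / 2 * (\<delta> + \<delta>)"
      unfolding norm_mult using approx[OF zw] approx[OF zw(2,1)] norm_triangle_mono by fastforce
    finally show "cmod ((\<lambda>_. 1 / 2) (z + w, z * w) * Q (z + w, z * w) - F (of_real r * (z + w), of_real (r\<^sup>2) * (z * w))) \<le> \<delta>"
      by (simp add: g_def)
  qed
qed

text \<open>Functional calculus for the pencil \<open>diag s + t (\<eta> - diag p)\<close> together with the scalar \<open>\<eta>\<close>.\<close>

lemma poly2_pencil_calculus:
  fixes S :: "'a set" and s p :: "'a \<Rightarrow> complex" and t :: "'a \<Rightarrow> 'a \<Rightarrow> complex"
  assumes S: "finite S" and Q: "Q \<in> poly2"
  shows "\<exists>R :: complex \<Rightarrow> 'a \<Rightarrow> 'a \<Rightarrow> complex.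
    (\<forall>m i. (\<lambda>\<eta>. R \<eta> m i) holomorphic_on UNIV) \<and>
    (\<forall>i\<in>S. \<forall>m\<in>S. R (p i) m i = (if m = i then Q (s i, p i) else 0)) \<and>
    (\<forall>\<eta> \<sigma> w. (\<forall>i\<in>S. (\<Sum>m\<in>S. w m * ((if m = i then s i else 0) + t m i * (\<eta> - p i))) = \<sigma> * w i) \<longrightarrow>
       (\<forall>i\<in>S. (\<Sum>m\<in>S. w m * R \<eta> m i) = Q (\<sigma>, \<eta>) * w i))"
  using Q
proof (induction rule: poly2.induct)
  case (const c)
  have "(\<Sum>m\<in>S. w m * (if m = i then c else 0)) = c * w i" if "i \<in> S" for w i
    unfolding sum_delta_mult[OF S] using that by simp
  then show ?case
    by (intro exI[of _ "\<lambda>\<eta> m i. if m = i then c else 0"]) auto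
next
  case fst
  \<comment> \<open>At \<eta> = p i the i-th column of the pencil collapses to s i times the i-th
    unit vector. This interpolation condition on columns and the condition on left eigenvectors are
    both stable under sums and products.\<close>
  show ?case
    by (intro exI[of _ "\<lambda>\<eta> m i. (if m = i then s i else 0) + t m i * (\<eta> - p i)"])
      (auto intro!: holomorphic_intros)
next
  case snd
  have "(\<Sum>m\<in>S. w m * (if m = i then \<eta> else 0)) = \<eta> * w i" if "i \<in> S" for w i and \<eta> :: complex
    unfolding sum_delta_mult[OF S] using that by simp
  moreover have "(\<lambda>\<eta>. if m = i then \<eta> else 0) holomorphic_on UNIV" for m i :: 'a
    by (cases "m = i") (auto intro: holomorphic_intros)
  ultimately show ?case
    by (intro exI[of _ "\<lambda>\<eta> m i. if m = i then \<eta> else 0"]) auto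
next
  case (add f g)
  obtain A where A: "\<forall>m i. (\<lambda>\<eta>. A \<eta> m i) holomorphic_on UNIV"
    "\<forall>i\<in>S. \<forall>m\<in>S. A (p i) m i = (if m = i then f (s i, p i) else 0)"
    "\<forall>\<eta> \<sigma> w. (\<forall>i\<in>S. (\<Sum>m\<in>S. w m * ((if m = i then s i else 0) + t m i * (\<eta> - p i))) = \<sigma> * w i) \<longrightarrow>
       (\<forall>i\<in>S. (\<Sum>m\<in>S. w m * A \<eta> m i) = f (\<sigma>, \<eta>) * w i)" using add.IH(1) by (elim exE conjE)
  obtain B where B: "\<forall>m i. (\<lambda>\<eta>. B \<eta> m i) holomorphic_on UNIV"
    "\<forall>i\<in>S. \<forall>m\<in>S. B (p i) m i = (if m = i then g (s i, p i) else 0)"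
    "\<forall>\<eta> \<sigma> w. (\<forall>i\<in>S. (\<Sum>m\<in>S. w m * ((if m = i then s i else 0) + t m i * (\<eta> - p i))) = \<sigma> * w i) \<longrightarrow>
       (\<forall>i\<in>S. (\<Sum>m\<in>S. w m * B \<eta> m i) = g (\<sigma>, \<eta>) * w i)" using add.IH(2) by (elim exE conjE)
  show ?case
  proof (intro exI[of _ "\<lambda>\<eta> m i. A \<eta> m i + B \<eta> m i"] conjI allI ballI impI)
    show "(\<lambda>\<eta>. A \<eta> m i + B \<eta> m i) holomorphic_on UNIV" for m i
      using A(1) B(1) by (intro holomorphic_intros) auto
    show "A (p i) m i + B (p i) m i = (if m = i then f (s i, p i) + g (s i, p i) else 0)" if "i \<in> S" "m \<in> S" for i m
      using A(2) B(2) that by simp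
    fix \<eta> \<sigma> w i
    assume w: "\<forall>i\<in>S. (\<Sum>m\<in>S. w m * ((if m = i then s i else 0) + t m i * (\<eta> - p i))) = \<sigma> * w i" and i: "i \<in> S"
    have "(\<Sum>m\<in>S. w m * A \<eta> m i) = f (\<sigma>, \<eta>) * w i" "(\<Sum>m\<in>S. w m * B \<eta> m i) = g (\<sigma>, \<eta>) * w i"
      using A(3)[rule_format, OF bspec[OF w] i] B(3)[rule_format, OF bspec[OF w] i] by auto
    then show "(\<Sum>m\<in>S. w m * (A \<eta> m i + B \<eta> m i)) = (f (\<sigma>, \<eta>) + g (\<sigma>, \<eta>)) * w i"
      by (simp add: distrib_left distrib_right sum.distrib)
  qed
next
  case (mult f g)
  obtain A where A: "\<forall>m i. (\<lambda>\<eta>. A \<eta> m i) holomorphic_on UNIV"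
    "\<forall>i\<in>S. \<forall>m\<in>S. A (p i) m i = (if m = i then f (s i, p i) else 0)"
    "\<forall>\<eta> \<sigma> w. (\<forall>i\<in>S. (\<Sum>m\<in>S. w m * ((if m = i then s i else 0) + t m i * (\<eta> - p i))) = \<sigma> * w i) \<longrightarrow>
       (\<forall>i\<in>S. (\<Sum>m\<in>S. w m * A \<eta> m i) = f (\<sigma>, \<eta>) * w i)" using mult.IH(1) by (elim exE conjE)
  obtain B where B: "\<forall>m i. (\<lambda>\<eta>. B \<eta> m i) holomorphic_on UNIV"
    "\<forall>i\<in>S. \<forall>m\<in>S. B (p i) m i = (if m = i then g (s i, p i) else 0)"
    "\<forall>\<eta> \<sigma> w. (\<forall>i\<in>S. (\<Sum>m\<in>S. w m * ((if m = i then s i else 0) + t m i * (\<eta> - p i))) = \<sigma> * w i) \<longrightarrow>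
       (\<forall>i\<in>S. (\<Sum>m\<in>S. w m * B \<eta> m i) = g (\<sigma>, \<eta>) * w i)" using mult.IH(2) by (elim exE conjE)
  show ?case
  proof (intro exI[of _ "\<lambda>\<eta> m i. \<Sum>l\<in>S. A \<eta> m l * B \<eta> l i"] conjI allI ballI impI)
    show "(\<lambda>\<eta>. \<Sum>l\<in>S. A \<eta> m l * B \<eta> l i) holomorphic_on UNIV" for m i
      using A(1) B(1) by (intro holomorphic_intros) auto
    show "(\<Sum>l\<in>S. A (p i) m l * B (p i) l i) = (if m = i then f (s i, p i) * g (s i, p i) else 0)" if "i \<in> S" "m \<in> S" for i m
    proof -
      have "(\<Sum>l\<in>S. A (p i) m l * B (p i) l i) = (\<Sum>l\<in>S. A (p i) m l * (if l = i then g (s i, p i) else 0))"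
        using B(2) that by (intro sum.cong refl) simp
      also have "\<dots> = A (p i) m i * g (s i, p i)" unfolding sum_delta_mult[OF S] using that by simp
      finally show ?thesis using A(2) that by simp
    qed
    fix \<eta> \<sigma> w i
    assume w: "\<forall>i\<in>S. (\<Sum>m\<in>S. w m * ((if m = i then s i else 0) + t m i * (\<eta> - p i))) = \<sigma> * w i" and i: "i \<in> S"
    have wA: "(\<Sum>m\<in>S. w m * A \<eta> m l) = f (\<sigma>, \<eta>) * w l" if "l \<in> S" for l
      using A(3)[rule_format, OF bspec[OF w] that] by auto
    have wB: "(\<Sum>m\<in>S. w m * B \<eta> m i) = g (\<sigma>, \<eta>) * w i"
      using B(3)[rule_format, OF bspec[OF w] i] by auto
    have "(\<Sum>m\<in>S. w m * (\<Sum>l\<in>S. A \<eta> m l * B \<eta> l i)) = (\<Sum>l\<in>S. (\<Sum>m\<in>S. w m * A \<eta> m l) * B \<eta> l i)"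
      unfolding sum_distrib_left sum_distrib_right by (subst sum.swap) (simp only: mult.assoc)
    also have "\<dots> = (\<Sum>l\<in>S. f (\<sigma>, \<eta>) * (w l * B \<eta> l i))"
      by (intro sum.cong refl) (simp add: wA)
    also have "\<dots> = f (\<sigma>, \<eta>) * g (\<sigma>, \<eta>) * w i"
      unfolding sum_distrib_left[symmetric] wB by simp
    finally show "(\<Sum>m\<in>S. w m * (\<Sum>l\<in>S. A \<eta> m l * B \<eta> l i)) = f (\<sigma>, \<eta>) * g (\<sigma>, \<eta>) * w i" .
  qed
qed

section \<open>The Hardy space model\<close>

definition circ :: "real \<Rightarrow> complex" where
  "circ \<theta> = exp (2 * of_real pi * \<i> * of_real \<theta>)"

lemma norm_circ: "cmod (circ \<theta>) = 1"
  by (simp add: circ_def norm_exp_eq_Re)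

text \<open>On the circle cnj (u / (u - q)) = 1 / (1 - u cnj q), and the factor u in u / (u - p)
  cancels the one in d\<theta> = du / (2 pi \<i> u). What remains is Cauchy's formula for H u / (1 -
  u cnj q) at p.\<close>

lemma szego_integral:
  assumes H: "H holomorphic_on UNIV" and p: "cmod p < 1" and q: "cmod q < 1"
  shows "((\<lambda>\<theta>. H (circ \<theta>) * (circ \<theta> / (circ \<theta> - p)) * cnj (circ \<theta> / (circ \<theta> - q))) has_integral
    H p / (1 - p * cnj q)) {0..1}"
proof -
  define f where "f = (\<lambda>u. H u / (1 - u * cnj q))"
  have ne: "1 - u * cnj q \<noteq> 0" if "cmod u \<le> 1" for u
  proof
    assume "1 - u * cnj q = 0"
    then have "cmod (u * cnj q) = 1" by simp
    moreover have "cmod u * cmod q \<le> 1 * cmod q" using that by (intro mult_right_mono) auto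
    ultimately show False using q by (simp add: norm_mult)
  qed
  have "f holomorphic_on cball 0 1"
    unfolding f_def using ne by (intro holomorphic_intros holomorphic_on_subset[OF H]) auto
  from Cauchy_integral_circlepath_simple[OF this, of p] p
  have "((\<lambda>u. f u / (u - p)) has_contour_integral (2 * of_real pi * \<i> * f p)) (circlepath 0 1)" by simp
  then have "((\<lambda>\<theta>. f (circlepath 0 1 \<theta>) / (circlepath 0 1 \<theta> - p) * (2 * pi * \<i> * 1 * exp (2 * of_real pi * \<i> * \<theta>))) has_integral
     2 * of_real pi * \<i> * f p) {0..1}"
    unfolding has_contour_integral_def
    by (rule has_integral_eq[rotated]) (simp add: vector_derivative_circlepath01)
  then have "((\<lambda>\<theta>. (1 / (2 * of_real pi * \<i>)) * (f (circlepath 0 1 \<theta>) / (circlepath 0 1 \<theta> - p) * (2 * pi * \<i> * 1 * exp (2 * of_real pi * \<i> * \<theta>)))) has_integral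
     (1 / (2 * of_real pi * \<i>)) * (2 * of_real pi * \<i> * f p)) {0..1}"
    by (rule has_integral_mult_right)
  moreover have "(1 / (2 * of_real pi * \<i>)) * (f (circlepath 0 1 \<theta>) / (circlepath 0 1 \<theta> - p) * (2 * pi * \<i> * 1 * exp (2 * of_real pi * \<i> * \<theta>)))
     = H (circ \<theta>) * (circ \<theta> / (circ \<theta> - p)) * cnj (circ \<theta> / (circ \<theta> - q))" for \<theta> :: real
  proof -
    define e where "e = circ \<theta>"
    have e1: "cmod e = 1" by (simp add: e_def norm_circ)
    have ee: "e * cnj e = 1" using complex_norm_square[of e] e1 by simp
    have cp: "circlepath 0 1 \<theta> = e" by (simp add: circlepath e_def circ_def)
    have "e \<noteq> q" using e1 q by auto
    then have "cnj e - cnj q \<noteq> 0" by (metis complex_cnj_cancel_iff eq_iff_diff_eq_0)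
    then have "cnj (e / (e - q)) = 1 / (1 - e * cnj q)"
    proof -
      have "cnj e * (1 - e * cnj q) = cnj e - cnj q" using ee by (simp add: algebra_simps mult.assoc[symmetric])
      then show ?thesis using ne[of e] e1 \<open>cnj e - cnj q \<noteq> 0\<close> by (simp add: frac_eq_eq mult.commute)
    qed
    moreover have "(1 / (2 * of_real pi * \<i>)) * (Z * (2 * pi * \<i> * 1 * E)) = Z * E" for Z E :: complex
    proof -
      have cancel: "(1 / k) * (Z * (k * 1 * E)) = Z * E" if "k \<noteq> 0" for k :: complex using that by simp
      have eq: "complex_of_real (2 * pi) = 2 * complex_of_real pi" by simp
      show ?thesis unfolding eq by (rule cancel) simp
    qed
    moreover have "exp (2 * of_real pi * \<i> * \<theta>) = e" by (simp add: e_def circ_def)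
    ultimately show ?thesis unfolding cp e_def[symmetric] f_def by (simp only:) (simp add: mult_ac)
  qed
  moreover have "(1 / (2 * of_real pi * \<i>)) * (2 * of_real pi * \<i> * f p) = H p / (1 - p * cnj q)"
    by (simp add: f_def)
  ultimately show ?thesis by simp
qed

lemma sum_rank_one:
  fixes f :: "'a \<Rightarrow> complex"
  shows "(\<Sum>i\<in>S. \<Sum>j\<in>S. c * (f i * cnj (g j))) = c * ((\<Sum>i\<in>S. f i) * cnj (\<Sum>j\<in>S. g j))"
proof -
  have "(\<Sum>i\<in>S. f i) * cnj (\<Sum>j\<in>S. g j) = (\<Sum>i\<in>S. \<Sum>j\<in>S. f i * cnj (g j))"
    by (simp only: cnj_sum sum_product)
  then show ?thesis by (simp only: sum_distrib_left)
qed

text \<open>For |y| \<le> 2 write y = c + cnj c with c unimodular and distribute \<omega> to both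
  summands.\<close>

lemma symmetric_torus_point:
  fixes y :: real
  assumes "cmod \<omega> = 1" "\<bar>y\<bar> \<le> 2"
  obtains l1 l2 where "cmod l1 = 1" "cmod l2 = 1" "\<omega> * of_real y = l1 + l2" "\<omega>\<^sup>2 = l1 * l2"
proof
  define c where "c = cis (arccos (y / 2))"
  have "Re c = y / 2" using assms by (simp add: c_def cos_arccos)
  then have "c + cnj c = of_real y" by (simp add: complex_eq_iff)
  then show "\<omega> * of_real y = \<omega> * c + \<omega> * cnj c" by (simp add: distrib_left[symmetric])
  have "c * cnj c = 1" by (simp add: c_def cis_cnj cis_mult)
  then show "\<omega>\<^sup>2 = (\<omega> * c) * (\<omega> * cnj c)" by (simp add: power2_eq_square algebra_simps)
  show "cmod (\<omega> * c) = 1" "cmod (\<omega> * cnj c) = 1" using assms by (simp_all add: norm_mult c_def)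
qed

text \<open>The vectors \<open>\<eta> / (\<eta> - p i)\<close> realise \<open>K\<close> in a vector-valued Hardy space with fibre inner product
  \<open>L i j = (1 - p i cnj (p j)) K i j\<close>. On the circle the pencil is \<open>\<omega>\<close> times an \<open>L\<close>-selfadjoint operator of norm
  at most 2, \<open>\<omega>\<^sup>2 = \<eta>\<close>, so its joint spectrum with \<open>\<eta>\<close> lies in the image of the torus.\<close>

lemma gamma_contraction_von_neumann:
  fixes S :: "'a set" and s p :: "'a \<Rightarrow> complex" and K :: "'a \<Rightarrow> 'a \<Rightarrow> complex" and A :: "'b set"
  assumes S: "finite S" and p1: "\<And>i. i \<in> S \<Longrightarrow> cmod (p i) < 1"
    and Kh: "hermitian_on S K"
    and pd: "\<And>x. \<exists>i\<in>S. x i \<noteq> 0 \<Longrightarrow> 0 < Re (hform S (\<lambda>i j. (1 - p i * cnj (p j)) * K i j) x x)"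
    and gam: "\<And>\<alpha> x. cmod \<alpha> = 1 \<Longrightarrow> 0 \<le> Re (hform S (\<lambda>i j. (2 * (1 - p i * cnj (p j)) - \<alpha> * (s i - p i * cnj (s j))
        - cnj \<alpha> * (cnj (s j) - s i * cnj (p j))) * K i j) x x)"
    and Q: "\<And>a. a \<in> A \<Longrightarrow> Q a \<in> poly2"
    and bd: "\<And>l1 l2. cmod l1 = 1 \<Longrightarrow> cmod l2 = 1 \<Longrightarrow> (\<Sum>a\<in>A. (cmod (Q a (l1 + l2, l1 * l2)))\<^sup>2) \<le> c2"
  defines "y \<equiv> \<lambda>\<xi> i. \<Sum>a\<in>A. Q a (s i, p i) * \<xi> a i"
  shows "(2 - c2) * Re (hform S K (y \<xi>) (y \<xi>)) \<le> (\<Sum>a\<in>A. Re (hform S K (\<xi> a) (\<xi> a)))"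
proof -
  define L where "L = (\<lambda>i j. (1 - p i * cnj (p j)) * K i j)"
  define B where "B = (\<lambda>i j. (s i - p i * cnj (s j)) * K i j)"
  define C where "C = (\<lambda>i j. (cnj (s j) - s i * cnj (p j)) * K i j)"
  have Khj: "K j i = cnj (K i j)" if "i \<in> S" "j \<in> S" for i j
    using Kh that unfolding hermitian_on_def by blast
  have Lh: "hermitian_on S L"
    unfolding hermitian_on_def
  proof (intro ballI)
    fix i j assume "i \<in> S" "j \<in> S"
    from Khj[OF this] show "L j i = cnj (L i j)" by (simp add: L_def mult.commute)
  qed
  have BC: "cnj (B i j) = C j i" if "i \<in> S" "j \<in> S" for i j
    using Khj[OF that] by (simp add: B_def C_def algebra_simps)
  have "hermitian_on S (\<lambda>_ _. 0)" by (simp add: hermitian_on_def)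
  from simultaneous_diagonalization[OF S Lh this pd[folded L_def]]
  obtain w0 e0 y0 where sd0: "simdiag S L (\<lambda>_ _. 0) w0 e0 y0" by blast
  have L0: "L i j = (\<Sum>k\<in>S. w0 k i * cnj (w0 k j))" if "i \<in> S" "j \<in> S" for i j
    using sd0 that unfolding simdiag_def by blast
  have d0: "(\<Sum>i\<in>S. w0 k i * e0 m i) = (if k = m then 1 else 0)" if "k \<in> S" "m \<in> S" for k m
    using sd0 that unfolding simdiag_def by blast
  have c0: "(\<Sum>k\<in>S. w0 k i * e0 k j) = (if i = j then 1 else 0)" if "i \<in> S" "j \<in> S" for i j
    using sd0 that unfolding simdiag_def by blast
  \<comment> \<open>The solution of t L = C, with the inverse of L expressed through the dual basis.
    The pencil X then satisfies X L = B + \<eta> C, so the products with t need not be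
    computed.\<close>
  define t where "t = (\<lambda>m i. \<Sum>k\<in>S. e0 k m * (\<Sum>l\<in>S. C i l * cnj (e0 k l)))"
  have tL: "(\<Sum>m\<in>S. t m i * L m j) = C i j" if ij: "i \<in> S" "j \<in> S" for i j
  proof -
    have tw: "(\<Sum>m\<in>S. t m i * w0 k m) = (\<Sum>l\<in>S. C i l * cnj (e0 k l))" if k: "k \<in> S" for k
    proof -
      have "(\<Sum>m\<in>S. t m i * w0 k m) = (\<Sum>n\<in>S. (\<Sum>m\<in>S. w0 k m * e0 n m) * (\<Sum>l\<in>S. C i l * cnj (e0 n l)))"
        unfolding t_def sum_distrib_right by (subst sum.swap) (simp only: mult_ac sum_distrib_left)
      also have "\<dots> = (\<Sum>n\<in>S. if n = k then (\<Sum>l\<in>S. C i l * cnj (e0 n l)) else 0)"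
        using k by (intro sum.cong refl) (simp add: d0)
      also have "\<dots> = (\<Sum>l\<in>S. C i l * cnj (e0 k l))" unfolding sum.delta[OF S] using k by simp
      finally show ?thesis .
    qed
    have "(\<Sum>m\<in>S. t m i * L m j) = (\<Sum>m\<in>S. \<Sum>k\<in>S. t m i * w0 k m * cnj (w0 k j))"
      using ij by (intro sum.cong refl) (simp add: L0 sum_distrib_left mult_ac)
    also have "\<dots> = (\<Sum>k\<in>S. (\<Sum>m\<in>S. t m i * w0 k m) * cnj (w0 k j))"
      unfolding sum_distrib_right by (rule sum.swap)
    also have "\<dots> = (\<Sum>k\<in>S. \<Sum>l\<in>S. C i l * cnj (w0 k j * e0 k l))"
      by (intro sum.cong refl) (simp add: tw sum_distrib_right sum_distrib_left mult_ac)
    also have "\<dots> = (\<Sum>l\<in>S. C i l * cnj (\<Sum>k\<in>S. w0 k j * e0 k l))"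
      unfolding cnj_sum sum_distrib_left by (rule sum.swap)
    also have "\<dots> = (\<Sum>l\<in>S. if l = j then C i l else 0)"
      using ij by (intro sum.cong refl) (auto simp: c0)
    also have "\<dots> = C i j" unfolding sum.delta[OF S] using ij by simp
    finally show ?thesis .
  qed
  define X where "X = (\<lambda>\<eta> m i. (if m = i then s i else 0) + t m i * (\<eta> - p i))"
  have XL: "(\<Sum>m\<in>S. X \<eta> m i * L m j) = B i j + \<eta> * C i j" if ij: "i \<in> S" "j \<in> S" for \<eta> i j
  proof -
    have "(\<Sum>m\<in>S. X \<eta> m i * L m j) = (\<Sum>m\<in>S. if m = i then s i * L m j else 0) + (\<eta> - p i) * (\<Sum>m\<in>S. t m i * L m j)"
      unfolding sum_distrib_left sum.distrib[symmetric] by (intro sum.cong refl) (simp add: X_def algebra_simps)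
    also have "(\<Sum>m\<in>S. if m = i then s i * L m j else 0) = s i * L i j" unfolding sum.delta[OF S] using ij by simp
    also have "s i * L i j + (\<eta> - p i) * (\<Sum>m\<in>S. t m i * L m j) = B i j + \<eta> * C i j"
      unfolding tL[OF ij] by (simp add: L_def B_def C_def algebra_simps)
    finally show ?thesis .
  qed
  have "\<forall>a\<in>A. \<exists>R :: complex \<Rightarrow> 'a \<Rightarrow> 'a \<Rightarrow> complex.
    (\<forall>m i. (\<lambda>\<eta>. R \<eta> m i) holomorphic_on UNIV) \<and>
    (\<forall>i\<in>S. \<forall>m\<in>S. R (p i) m i = (if m = i then Q a (s i, p i) else 0)) \<and>
    (\<forall>\<eta> \<sigma> w. (\<forall>i\<in>S. (\<Sum>m\<in>S. w m * X \<eta> m i) = \<sigma> * w i) \<longrightarrow>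
       (\<forall>i\<in>S. (\<Sum>m\<in>S. w m * R \<eta> m i) = Q a (\<sigma>, \<eta>) * w i))"
    unfolding X_def by (intro ballI poly2_pencil_calculus S Q)
  from bchoice[OF this] obtain R where R: "\<forall>a\<in>A.
    (\<forall>m i. (\<lambda>\<eta>. R a \<eta> m i) holomorphic_on UNIV) \<and>
    (\<forall>i\<in>S. \<forall>m\<in>S. R a (p i) m i = (if m = i then Q a (s i, p i) else 0)) \<and>
    (\<forall>\<eta> \<sigma> w. (\<forall>i\<in>S. (\<Sum>m\<in>S. w m * X \<eta> m i) = \<sigma> * w i) \<longrightarrow>
       (\<forall>i\<in>S. (\<Sum>m\<in>S. w m * R a \<eta> m i) = Q a (\<sigma>, \<eta>) * w i))" by blast
  have R1: "(\<lambda>\<eta>. R a \<eta> m i) holomorphic_on UNIV" if "a \<in> A" for a m i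
    using R that by blast
  have R2: "R a (p i) m i = (if m = i then Q a (s i, p i) else 0)" if "a \<in> A" "i \<in> S" "m \<in> S" for a m i
    using R that by blast
  have R3: "(\<Sum>m\<in>S. w m * R a \<eta> m i) = Q a (\<sigma>, \<eta>) * w i"
    if "a \<in> A" "i \<in> S" "\<And>i. i \<in> S \<Longrightarrow> (\<Sum>m\<in>S. w m * X \<eta> m i) = \<sigma> * w i" for a i \<eta> \<sigma> w
    using R that by blast
  \<comment> \<open>The polynomial of the pencil, measured in the fibre form L. It is entire in
    \<eta> and at \<eta> = p i reduces to Q a (s i, p i) * L i j, the value that Cauchy's formula
    picks up.\<close>
  define H where "H = (\<lambda>a i j \<eta>. \<Sum>m\<in>S. R a \<eta> m i * L m j)"
  have Hhol: "H a i j holomorphic_on UNIV" if "a \<in> A" for a i j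
    unfolding H_def by (intro holomorphic_intros R1 that)
  have Hp: "H a i j (p i) = Q a (s i, p i) * L i j" if "a \<in> A" "i \<in> S" "j \<in> S" for a i j
  proof -
    have "H a i j (p i) = (\<Sum>m\<in>S. if m = i then Q a (s i, p i) * L m j else 0)"
      unfolding H_def using that by (intro sum.cong refl) (simp add: R2)
    then show ?thesis unfolding sum.delta[OF S] using that by simp
  qed
  have Lform: "hform S M x x = of_real (\<Sum>k\<in>S. (cmod (\<Sum>i\<in>S. w k i * x i))\<^sup>2)"
    if "\<And>i j. i \<in> S \<Longrightarrow> j \<in> S \<Longrightarrow> M i j = (\<Sum>k\<in>S. w k i * cnj (w k j))" for M x w
  proof -
    have "hform S M x x = (\<Sum>i\<in>S. \<Sum>j\<in>S. \<Sum>k\<in>S. w k i * x i * cnj (w k j * x j))"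
      unfolding hform_def by (intro sum.cong refl) (simp add: that sum_distrib_right sum_distrib_left mult_ac)
    also have "\<dots> = (\<Sum>i\<in>S. \<Sum>k\<in>S. \<Sum>j\<in>S. w k i * x i * cnj (w k j * x j))"
      by (intro sum.cong refl sum.swap)
    also have "\<dots> = (\<Sum>k\<in>S. \<Sum>i\<in>S. \<Sum>j\<in>S. w k i * x i * cnj (w k j * x j))" by (rule sum.swap)
    finally show ?thesis unfolding of_real_sum complex_norm_square cnj_sum sum_product .
  qed
  \<comment> \<open>In the eigenbasis the form is a sum of products q U cnj V, and |U| |q V| \<le>
    (|U|^2 + |q V|^2) / 2. Summing over a first brings in the row bound at each eigenvalue. An
    additive estimate is used because it can be integrated termwise.\<close>
  have pointwise: "Re (\<Sum>a\<in>A. \<Sum>i\<in>S. \<Sum>j\<in>S. H a i j \<eta> * u a i * cnj (v j))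
      \<le> 1 / 2 * ((\<Sum>a\<in>A. Re (hform S L (u a) (u a))) + c2 * Re (hform S L v v))"
    if \<eta>: "cmod \<eta> = 1" for \<eta> and u :: "'b \<Rightarrow> 'a \<Rightarrow> complex" and v
  proof -
    define \<omega> where "\<omega> = csqrt \<eta>"
    have \<omega>2: "\<omega>\<^sup>2 = \<eta>" by (simp add: \<omega>_def)
    have \<omega>1: "cmod \<omega> = 1" using \<eta> by (simp add: \<omega>_def norm_csqrt)
    have \<omega>\<omega>: "\<omega> * cnj \<omega> = 1" using complex_norm_square[of \<omega>] \<omega>1 by simp
    \<comment> \<open>Dividing B + \<eta> C by a square root of \<eta> makes it hermitian, since C
      is the adjoint of B.\<close>
    define Y where "Y = (\<lambda>i j. cnj \<omega> * B i j + \<omega> * C i j)"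
    have Yh: "hermitian_on S Y"
      unfolding hermitian_on_def
    proof (intro ballI)
      fix i j assume ij: "i \<in> S" "j \<in> S"
      show "Y j i = cnj (Y i j)"
        using BC[OF ij] BC[OF ij(2,1), symmetric] by (simp add: Y_def add.commute)
    qed
    obtain w e z where sd: "simdiag S L Y w e z"
      using simultaneous_diagonalization[OF S Lh Yh pd[folded L_def]] by blast
    have Lw: "L i j = (\<Sum>k\<in>S. w k i * cnj (w k j))" if "i \<in> S" "j \<in> S" for i j
      using sd that unfolding simdiag_def by blast
    have Yw: "Y i j = (\<Sum>k\<in>S. of_real (z k) * (w k i * cnj (w k j)))" if "i \<in> S" "j \<in> S" for i j
      using sd that unfolding simdiag_def by blast
    have dual: "(\<Sum>i\<in>S. w k i * e m i) = (if k = m then 1 else 0)" if "k \<in> S" "m \<in> S" for k m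
      using sd that unfolding simdiag_def by blast
    have Ye: "hform S (\<lambda>i j. 2 * L i j - of_real \<tau> * Y i j) (e n) (e n) = of_real (2 - \<tau> * z n)" if n: "n \<in> S" for n \<tau>
    proof -
      have "hform S (\<lambda>i j. 2 * L i j - of_real \<tau> * Y i j) (e n) (e n)
         = (\<Sum>i\<in>S. \<Sum>j\<in>S. \<Sum>k\<in>S. of_real (2 - \<tau> * z k) * (w k i * e n i * cnj (w k j * e n j)))"
        unfolding hform_def
      proof (intro sum.cong refl)
        fix i j assume ij: "i \<in> S" "j \<in> S"
        have "2 * L i j - of_real \<tau> * Y i j = (\<Sum>k\<in>S. of_real (2 - \<tau> * z k) * (w k i * cnj (w k j)))"
          unfolding Lw[OF ij] Yw[OF ij] sum_distrib_left sum_subtractf[symmetric]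
          by (intro sum.cong refl) (simp add: algebra_simps)
        then show "(2 * L i j - of_real \<tau> * Y i j) * e n i * cnj (e n j) = (\<Sum>k\<in>S. of_real (2 - \<tau> * z k) * (w k i * e n i * cnj (w k j * e n j)))"
          by (simp add: sum_distrib_right sum_distrib_left mult_ac)
      qed
      also have "\<dots> = (\<Sum>i\<in>S. \<Sum>k\<in>S. \<Sum>j\<in>S. of_real (2 - \<tau> * z k) * (w k i * e n i * cnj (w k j * e n j)))"
        by (intro sum.cong refl sum.swap)
      also have "\<dots> = (\<Sum>k\<in>S. \<Sum>i\<in>S. \<Sum>j\<in>S. of_real (2 - \<tau> * z k) * (w k i * e n i * cnj (w k j * e n j)))"
        by (rule sum.swap)
      also have "\<dots> = (\<Sum>k\<in>S. of_real (2 - \<tau> * z k) * ((\<Sum>i\<in>S. w k i * e n i) * cnj (\<Sum>j\<in>S. w k j * e n j)))"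
        by (intro sum.cong refl sum_rank_one)
      also have "\<dots> = (\<Sum>k\<in>S. if k = n then of_real (2 - \<tau> * z k) else 0)"
        using n by (intro sum.cong refl) (simp add: dual)
      also have "\<dots> = of_real (2 - \<tau> * z n)" unfolding sum.delta[OF S] using n by simp
      finally show ?thesis .
    qed
    \<comment> \<open>Taking \<alpha> = cnj \<omega> and \<alpha> = - cnj \<omega> in
      \<open>gam\<close> shows that 2 L - Y and 2 L + Y are positive, which bounds the relative
      eigenvalues.\<close>
    have z2: "\<bar>z n\<bar> \<le> 2" if n: "n \<in> S" for n
    proof -
      have "0 \<le> 2 - \<tau> * z n" if \<tau>: "\<tau> = 1 \<or> \<tau> = -1" for \<tau> :: real
      proof -
        have "cmod (of_real \<tau> * cnj \<omega>) = 1" using \<tau> \<omega>1 by (auto simp: norm_mult)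
        from gam[OF this, of "e n"]
        have "0 \<le> Re (hform S (\<lambda>i j. (2 * (1 - p i * cnj (p j)) - of_real \<tau> * cnj \<omega> * (s i - p i * cnj (s j))
          - cnj (of_real \<tau> * cnj \<omega>) * (cnj (s j) - s i * cnj (p j))) * K i j) (e n) (e n))" .
        also have "(\<lambda>i j. (2 * (1 - p i * cnj (p j)) - of_real \<tau> * cnj \<omega> * (s i - p i * cnj (s j))
          - cnj (of_real \<tau> * cnj \<omega>) * (cnj (s j) - s i * cnj (p j))) * K i j) = (\<lambda>i j. 2 * L i j - of_real \<tau> * Y i j)"
          by (intro ext) (simp add: L_def Y_def B_def C_def algebra_simps)
        finally show ?thesis unfolding Ye[OF n] by simp
      qed
      from this[of 1] this[of "-1"] show ?thesis by linarith
    qed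
    have eig: "(\<Sum>m\<in>S. w k m * X \<eta> m i) = (\<omega> * of_real (z k)) * w k i" if k: "k \<in> S" and i: "i \<in> S" for k i
    proof -
      \<comment> \<open>The residuals of the eigenvalue equations combine with the w k to 0, and the
        dual basis extracts each of them.\<close>
      define D where "D = (\<lambda>k. (\<Sum>m\<in>S. w k m * X \<eta> m i) - (\<omega> * of_real (z k)) * w k i)"
      have D0: "(\<Sum>k\<in>S. D k * cnj (w k j)) = 0" if j: "j \<in> S" for j
      proof -
        have "(\<Sum>k\<in>S. (\<Sum>m\<in>S. w k m * X \<eta> m i) * cnj (w k j)) = (\<Sum>m\<in>S. \<Sum>k\<in>S. X \<eta> m i * (w k m * cnj (w k j)))"
          unfolding sum_distrib_right by (subst sum.swap) (simp only: mult_ac)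
        also have "\<dots> = (\<Sum>m\<in>S. X \<eta> m i * L m j)"
          using j by (intro sum.cong refl) (simp add: Lw sum_distrib_left)
        also have "\<dots> = B i j + \<eta> * C i j" by (rule XL[OF i j])
        also have "\<dots> = \<omega> * Y i j"
        proof -
          have "\<omega> * Y i j = (\<omega> * cnj \<omega>) * B i j + \<omega>\<^sup>2 * C i j" by (simp add: Y_def algebra_simps power2_eq_square)
          then show ?thesis by (simp add: \<omega>\<omega> \<omega>2)
        qed
        also have "\<dots> = (\<Sum>k\<in>S. (\<omega> * of_real (z k)) * w k i * cnj (w k j))"
          unfolding Yw[OF i j] sum_distrib_left by (simp only: mult_ac)
        finally show ?thesis unfolding D_def left_diff_distrib sum_subtractf by simp
      qed
      have "0 = (\<Sum>j\<in>S. cnj (e k j) * (\<Sum>n\<in>S. D n * cnj (w n j)))" by (simp add: D0)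
      also have "\<dots> = (\<Sum>n\<in>S. D n * cnj (\<Sum>j\<in>S. w n j * e k j))"
        unfolding cnj_sum sum_distrib_left by (subst sum.swap) (intro sum.cong refl, simp add: mult_ac)
      also have "\<dots> = (\<Sum>n\<in>S. if n = k then D n else 0)"
        using k by (intro sum.cong refl) (simp add: dual)
      also have "\<dots> = D k" unfolding sum.delta[OF S] using k by simp
      finally show ?thesis by (simp add: D_def)
    qed
    define q where "q = (\<lambda>a k. Q a (\<omega> * of_real (z k), \<eta>))"
    define U where "U = (\<lambda>a k. \<Sum>i\<in>S. w k i * u a i)"
    define V where "V = (\<lambda>k. \<Sum>i\<in>S. w k i * v i)"
    have qbd: "(\<Sum>a\<in>A. (cmod (q a k))\<^sup>2) \<le> c2" if k: "k \<in> S" for k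
    proof -
      obtain l1 l2 where "cmod l1 = 1" "cmod l2 = 1" "\<omega> * of_real (z k) = l1 + l2" "\<omega>\<^sup>2 = l1 * l2"
        using symmetric_torus_point[OF \<omega>1 z2[OF k]] .
      then show ?thesis using bd[of l1 l2] by (simp add: q_def \<omega>2)
    qed
    have form: "(\<Sum>i\<in>S. \<Sum>j\<in>S. H a i j \<eta> * u a i * cnj (v j)) = (\<Sum>k\<in>S. q a k * U a k * cnj (V k))" if a: "a \<in> A" for a
    proof -
      have Hw: "H a i j \<eta> = (\<Sum>k\<in>S. q a k * w k i * cnj (w k j))" if ij: "i \<in> S" "j \<in> S" for i j
      proof -
        have "H a i j \<eta> = (\<Sum>m\<in>S. \<Sum>k\<in>S. (w k m * R a \<eta> m i) * cnj (w k j))"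
          unfolding H_def using ij by (intro sum.cong refl) (simp add: Lw sum_distrib_left mult_ac)
        also have "\<dots> = (\<Sum>k\<in>S. (\<Sum>m\<in>S. w k m * R a \<eta> m i) * cnj (w k j))"
          unfolding sum_distrib_right by (rule sum.swap)
        also have "\<dots> = (\<Sum>k\<in>S. q a k * w k i * cnj (w k j))"
          using R3[OF a ij(1) eig] by (intro sum.cong refl) (simp add: q_def)
        finally show ?thesis .
      qed
      have "(\<Sum>i\<in>S. \<Sum>j\<in>S. H a i j \<eta> * u a i * cnj (v j)) = (\<Sum>i\<in>S. \<Sum>j\<in>S. \<Sum>k\<in>S. q a k * (w k i * u a i * cnj (w k j * v j)))"
        by (intro sum.cong refl) (simp add: Hw sum_distrib_right sum_distrib_left mult_ac)
      also have "\<dots> = (\<Sum>i\<in>S. \<Sum>k\<in>S. \<Sum>j\<in>S. q a k * (w k i * u a i * cnj (w k j * v j)))"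
        by (intro sum.cong refl sum.swap)
      also have "\<dots> = (\<Sum>k\<in>S. \<Sum>i\<in>S. \<Sum>j\<in>S. q a k * (w k i * u a i * cnj (w k j * v j)))" by (rule sum.swap)
      also have "\<dots> = (\<Sum>k\<in>S. q a k * (U a k * cnj (V k)))"
        unfolding U_def V_def by (intro sum.cong refl sum_rank_one)
      finally show ?thesis by (simp only: mult.assoc)
    qed
    have "Re (\<Sum>a\<in>A. \<Sum>i\<in>S. \<Sum>j\<in>S. H a i j \<eta> * u a i * cnj (v j)) = (\<Sum>a\<in>A. \<Sum>k\<in>S. Re (q a k * U a k * cnj (V k)))"
      by (simp add: form)
    also have "\<dots> \<le> (\<Sum>a\<in>A. \<Sum>k\<in>S. 1 / 2 * ((cmod (U a k))\<^sup>2 + (cmod (q a k))\<^sup>2 * (cmod (V k))\<^sup>2))"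
    proof (intro sum_mono)
      fix a k
      have "Re (q a k * U a k * cnj (V k)) \<le> cmod (U a k) * (cmod (q a k) * cmod (V k))"
        using complex_Re_le_cmod[of "q a k * U a k * cnj (V k)"] by (simp add: norm_mult mult_ac)
      also have "\<dots> \<le> 1 / 2 * ((cmod (U a k))\<^sup>2 + (cmod (q a k) * cmod (V k))\<^sup>2)"
        using sum_squares_bound[of "cmod (U a k)" "cmod (q a k) * cmod (V k)"] by simp
      finally show "Re (q a k * U a k * cnj (V k)) \<le> 1 / 2 * ((cmod (U a k))\<^sup>2 + (cmod (q a k))\<^sup>2 * (cmod (V k))\<^sup>2)"
        by (simp add: power_mult_distrib)
    qed
    also have "\<dots> = 1 / 2 * ((\<Sum>a\<in>A. \<Sum>k\<in>S. (cmod (U a k))\<^sup>2) + (\<Sum>k\<in>S. (\<Sum>a\<in>A. (cmod (q a k))\<^sup>2) * (cmod (V k))\<^sup>2))"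
      unfolding sum_distrib_left[symmetric] sum.distrib sum_distrib_right
      by (subst sum.swap[of _ A S]) simp
    also have "\<dots> \<le> 1 / 2 * ((\<Sum>a\<in>A. \<Sum>k\<in>S. (cmod (U a k))\<^sup>2) + (\<Sum>k\<in>S. c2 * (cmod (V k))\<^sup>2))"
      using qbd by (intro mult_left_mono add_left_mono sum_mono mult_right_mono) auto
    also have "\<dots> = 1 / 2 * ((\<Sum>a\<in>A. Re (hform S L (u a) (u a))) + c2 * Re (hform S L v v))"
      by (simp add: Lform[OF Lw] U_def V_def sum_distrib_left)
    finally show ?thesis .
  qed
  define \<kappa> where "\<kappa> = (\<lambda>i \<theta>. circ \<theta> / (circ \<theta> - p i))"
  have pK: "L i j / (1 - p i * cnj (p j)) = K i j" if "i \<in> S" "j \<in> S" for i j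
  proof -
    have "cmod (p i * cnj (p j)) < 1"
      using p1[OF that(1)] p1[OF that(2)] mult_lt_one[of "cmod (p i)" "cmod (p j)"] by (simp add: norm_mult)
    then have "1 - p i * cnj (p j) \<noteq> 0" by auto
    then show ?thesis by (simp add: L_def)
  qed
  have intL: "((\<lambda>\<theta>. hform S L (\<lambda>i. x i * \<kappa> i \<theta>) (\<lambda>i. x i * \<kappa> i \<theta>)) has_integral hform S K x x) {0..1}" for x
  proof -
    have "((\<lambda>\<theta>. \<Sum>i\<in>S. \<Sum>j\<in>S. (x i * cnj (x j)) * (L i j * \<kappa> i \<theta> * cnj (\<kappa> j \<theta>))) has_integral
       (\<Sum>i\<in>S. \<Sum>j\<in>S. (x i * cnj (x j)) * (L i j / (1 - p i * cnj (p j))))) {0..1}"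
      unfolding \<kappa>_def by (intro has_integral_sum S has_integral_mult_right szego_integral p1 holomorphic_intros)
    moreover have "(\<Sum>i\<in>S. \<Sum>j\<in>S. (x i * cnj (x j)) * (L i j / (1 - p i * cnj (p j)))) = hform S K x x"
      unfolding hform_def by (intro sum.cong refl) (simp add: pK mult_ac)
    moreover have "(\<Sum>i\<in>S. \<Sum>j\<in>S. (x i * cnj (x j)) * (L i j * \<kappa> i \<theta> * cnj (\<kappa> j \<theta>))) = hform S L (\<lambda>i. x i * \<kappa> i \<theta>) (\<lambda>i. x i * \<kappa> i \<theta>)" for \<theta>
      unfolding hform_def by (intro sum.cong refl) (simp add: mult_ac)
    ultimately show ?thesis by simp
  qed
  \<comment> \<open>Cauchy's formula evaluates H a i j at p i. After division by 1 - p i cnj (p j)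
    the entry is Q a (s i, p i) * K i j, and the sum over a rebuilds y.\<close>
  have intH: "((\<lambda>\<theta>. \<Sum>a\<in>A. \<Sum>i\<in>S. \<Sum>j\<in>S. H a i j (circ \<theta>) * (\<xi> a i * \<kappa> i \<theta>) * cnj (y \<xi> j * \<kappa> j \<theta>)) has_integral hform S K (y \<xi>) (y \<xi>)) {0..1}"
  proof (cases "finite A")
    case A: True
    have "((\<lambda>\<theta>. \<Sum>a\<in>A. \<Sum>i\<in>S. \<Sum>j\<in>S. (\<xi> a i * cnj (y \<xi> j)) * (H a i j (circ \<theta>) * \<kappa> i \<theta> * cnj (\<kappa> j \<theta>))) has_integral
       (\<Sum>a\<in>A. \<Sum>i\<in>S. \<Sum>j\<in>S. (\<xi> a i * cnj (y \<xi> j)) * (H a i j (p i) / (1 - p i * cnj (p j))))) {0..1}"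
      unfolding \<kappa>_def by (intro has_integral_sum S A has_integral_mult_right szego_integral p1 Hhol)
    moreover have "(\<Sum>a\<in>A. \<Sum>i\<in>S. \<Sum>j\<in>S. (\<xi> a i * cnj (y \<xi> j)) * (H a i j (p i) / (1 - p i * cnj (p j)))) = hform S K (y \<xi>) (y \<xi>)"
    proof -
      have "(\<Sum>a\<in>A. \<Sum>i\<in>S. \<Sum>j\<in>S. (\<xi> a i * cnj (y \<xi> j)) * (H a i j (p i) / (1 - p i * cnj (p j))))
         = (\<Sum>a\<in>A. \<Sum>i\<in>S. \<Sum>j\<in>S. Q a (s i, p i) * \<xi> a i * (K i j * cnj (y \<xi> j)))"
      proof (intro sum.cong refl)
        fix a i j assume "a \<in> A" "i \<in> S" "j \<in> S"
        then have "H a i j (p i) / (1 - p i * cnj (p j)) = Q a (s i, p i) * K i j"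
          by (simp only: Hp pK times_divide_eq_right[symmetric])
        then show "(\<xi> a i * cnj (y \<xi> j)) * (H a i j (p i) / (1 - p i * cnj (p j))) = Q a (s i, p i) * \<xi> a i * (K i j * cnj (y \<xi> j))"
          by (simp only: mult_ac)
      qed
      also have "\<dots> = (\<Sum>i\<in>S. \<Sum>a\<in>A. \<Sum>j\<in>S. Q a (s i, p i) * \<xi> a i * (K i j * cnj (y \<xi> j)))" by (rule sum.swap)
      also have "\<dots> = (\<Sum>i\<in>S. y \<xi> i * (\<Sum>j\<in>S. K i j * cnj (y \<xi> j)))"
        by (intro sum.cong refl) (simp only: y_def sum_distrib_right sum_distrib_left[symmetric])
      also have "\<dots> = hform S K (y \<xi>) (y \<xi>)"
        unfolding hform_def sum_distrib_left by (intro sum.cong refl) (simp only: mult_ac)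
      finally show ?thesis .
    qed
    moreover have "(\<Sum>a\<in>A. \<Sum>i\<in>S. \<Sum>j\<in>S. (\<xi> a i * cnj (y \<xi> j)) * (H a i j (circ \<theta>) * \<kappa> i \<theta> * cnj (\<kappa> j \<theta>)))
       = (\<Sum>a\<in>A. \<Sum>i\<in>S. \<Sum>j\<in>S. H a i j (circ \<theta>) * (\<xi> a i * \<kappa> i \<theta>) * cnj (y \<xi> j * \<kappa> j \<theta>))" for \<theta>
      by (intro sum.cong refl) (simp add: mult_ac)
    ultimately show ?thesis by simp
  next
    case False
    then show ?thesis by (simp add: y_def hform_def)
  qed
  have re: "((\<lambda>\<theta>. Re (f \<theta>)) has_integral Re I) {0..1}" if "(f has_integral I) {0..1 :: real}" for f :: "real \<Rightarrow> complex" and I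
    using has_integral_linear[OF that bounded_linear_Re] by (simp add: comp_def)
  have "Re (hform S K (y \<xi>) (y \<xi>)) \<le> 1 / 2 * ((\<Sum>a\<in>A. Re (hform S K (\<xi> a) (\<xi> a))) + c2 * Re (hform S K (y \<xi>) (y \<xi>)))"
  proof (cases "finite A")
    case A: True
    show ?thesis
    proof (rule has_integral_le[OF re[OF intH]])
      show "((\<lambda>\<theta>. 1 / 2 * ((\<Sum>a\<in>A. Re (hform S L (\<lambda>i. \<xi> a i * \<kappa> i \<theta>) (\<lambda>i. \<xi> a i * \<kappa> i \<theta>))) +
          c2 * Re (hform S L (\<lambda>i. y \<xi> i * \<kappa> i \<theta>) (\<lambda>i. y \<xi> i * \<kappa> i \<theta>)))) has_integral
          1 / 2 * ((\<Sum>a\<in>A. Re (hform S K (\<xi> a) (\<xi> a))) + c2 * Re (hform S K (y \<xi>) (y \<xi>)))) {0..1}"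
        by (intro has_integral_mult_right has_integral_add has_integral_sum A re intL)
      fix \<theta> :: real
      show "Re (\<Sum>a\<in>A. \<Sum>i\<in>S. \<Sum>j\<in>S. H a i j (circ \<theta>) * (\<xi> a i * \<kappa> i \<theta>) * cnj (y \<xi> j * \<kappa> j \<theta>))
        \<le> 1 / 2 * ((\<Sum>a\<in>A. Re (hform S L (\<lambda>i. \<xi> a i * \<kappa> i \<theta>) (\<lambda>i. \<xi> a i * \<kappa> i \<theta>))) +
          c2 * Re (hform S L (\<lambda>i. y \<xi> i * \<kappa> i \<theta>) (\<lambda>i. y \<xi> i * \<kappa> i \<theta>)))"
        by (rule pointwise[OF norm_circ, of \<theta> "\<lambda>a i. \<xi> a i * \<kappa> i \<theta>" "\<lambda>i. y \<xi> i * \<kappa> i \<theta>"])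
    qed
  next
    case False
    then show ?thesis by (simp add: y_def hform_def)
  qed
  then show ?thesis by (simp add: algebra_simps)
qed

section \<open>The equivalences\<close>

text \<open>Dilation by r < 1 moves the closed torus image into the domain, where the row bound 1
  holds; r close to 1 hardly changes the values on the finite set Z. The error budget must keep the
  whole row close to 1, not only each entry.\<close>

lemma corona_polynomial_approximation:
  fixes A :: "'b set"
  assumes A: "finite A" and F: "\<And>a. a \<in> A \<Longrightarrow> holomorphic_on_C2 (F a) sym_bidisc"
    and F1: "\<And>x. x \<in> sym_bidisc \<Longrightarrow> (\<Sum>a\<in>A. (cmod (F a x))\<^sup>2) \<le> 1"
    and Z: "finite Z" "Z \<subseteq> sym_bidisc" and \<delta>: "0 < \<delta>"
  shows "\<exists>Q. (\<forall>a\<in>A. Q a \<in> poly2) \<and>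
    (\<forall>l1 l2. cmod l1 = 1 \<longrightarrow> cmod l2 = 1 \<longrightarrow> (\<Sum>a\<in>A. (cmod (Q a (l1 + l2, l1 * l2)))\<^sup>2) \<le> 1 + \<delta>) \<and>
    (\<forall>x\<in>Z. \<forall>a\<in>A. cmod (Q a x - F a x) \<le> \<delta>)"
proof -
  define N where "N = real (card A)"
  \<comment> \<open>With |F a| \<le> 1 and d \<le> 1 one has (|F a| + d)^2 \<le> |F a|^2 + 3 d, so
    the row gains at most 3 d card A \<le> \<delta>. The bound \<delta> / 2 leaves the other half
    for the dilation.\<close>
  define d where "d = min (\<delta> / 2) (min 1 (\<delta> / (3 * (N + 1))))"
  have N0: "0 \<le> N" by (simp add: N_def)
  have "d \<le> \<delta> / 2" unfolding d_def by (rule min.cobounded1)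
  moreover have "d \<le> 1" unfolding d_def by (simp add: min_le_iff_disj)
  moreover have "0 < d" using \<delta> N0 by (simp add: d_def)
  ultimately have d: "0 < d" "d \<le> \<delta> / 2" "d \<le> 1" by blast+
  have "d \<le> \<delta> / (3 * (N + 1))" by (simp add: d_def)
  then have "3 * (N + 1) * d \<le> \<delta>" using N0 by (simp add: field_simps)
  then have dN: "N * (3 * d) \<le> \<delta>" using d by (simp add: algebra_simps)
  have Fa1: "cmod (F a x) \<le> 1" if "a \<in> A" "x \<in> sym_bidisc" for a x
  proof -
    have "(cmod (F a x))\<^sup>2 \<le> (\<Sum>a\<in>A. (cmod (F a x))\<^sup>2)" using A that by (intro member_le_sum) auto
    also have "\<dots> \<le> 1\<^sup>2" using F1[OF that(2)] by simp
    finally show ?thesis by (rule power2_le_imp_le) simp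
  qed
  have "\<forall>q\<in>Z \<times> A. \<forall>\<^sub>F r in at_left (1::real).
      dist (F (snd q) (of_real r * fst (fst q), of_real (r\<^sup>2) * snd (fst q))) (F (snd q) (fst q)) < \<delta> / 2"
  proof
    fix q assume "q \<in> Z \<times> A"
    then obtain x a where q: "q = (x, a)" "x \<in> Z" "a \<in> A" by auto
    have "continuous_on sym_bidisc (F a)"
      by (rule holomorphic_on_C2_continuous[OF F[OF q(3)] open_sym_bidisc])
    then have "isCont (F a) x" using q Z open_sym_bidisc continuous_on_eq_continuous_at by blast
    moreover have "((\<lambda>r. (of_real r * fst x, of_real (r\<^sup>2) * snd x)) \<longlongrightarrow> (of_real 1 * fst x, of_real (1\<^sup>2) * snd x)) (at_left (1::real))"
      by (intro tendsto_intros)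
    then have "((\<lambda>r. (of_real r * fst x, of_real (r\<^sup>2) * snd x)) \<longlongrightarrow> x) (at_left (1::real))" by simp
    ultimately have "((\<lambda>r. F a (of_real r * fst x, of_real (r\<^sup>2) * snd x)) \<longlongrightarrow> F a x) (at_left (1::real))"
      by (rule isCont_tendsto_compose)
    then have "\<forall>\<^sub>F r in at_left (1::real). dist (F a (of_real r * fst x, of_real (r\<^sup>2) * snd x)) (F a x) < \<delta> / 2"
      by (rule tendstoD) (use \<delta> in simp)
    then show "\<forall>\<^sub>F r in at_left (1::real). dist (F (snd q) (of_real r * fst (fst q), of_real (r\<^sup>2) * snd (fst q))) (F (snd q) (fst q)) < \<delta> / 2"
      by (simp add: q)
  qed
  then have "\<forall>\<^sub>F r in at_left (1::real). \<forall>q\<in>Z \<times> A.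
      dist (F (snd q) (of_real r * fst (fst q), of_real (r\<^sup>2) * snd (fst q))) (F (snd q) (fst q)) < \<delta> / 2"
    using A Z by (intro eventually_ball_finite) auto
  moreover have "\<forall>\<^sub>F r in at_left (1::real). 0 < r \<and> r < 1"
    by (rule eventually_at_leftI[of 0]) auto
  ultimately have "\<forall>\<^sub>F r in at_left (1::real). (\<forall>q\<in>Z \<times> A.
      dist (F (snd q) (of_real r * fst (fst q), of_real (r\<^sup>2) * snd (fst q))) (F (snd q) (fst q)) < \<delta> / 2) \<and> 0 < r \<and> r < 1"
    by eventually_elim blast
  then obtain r where r: "0 < r" "r < 1" and rq: "\<forall>q\<in>Z \<times> A.
      dist (F (snd q) (of_real r * fst (fst q), of_real (r\<^sup>2) * snd (fst q))) (F (snd q) (fst q)) < \<delta> / 2"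
    using eventually_happens' trivial_limit_at_left_real by blast
  have rZ: "cmod (F a (of_real r * fst x, of_real (r\<^sup>2) * snd x) - F a x) < \<delta> / 2" if "x \<in> Z" "a \<in> A" for x a
    using bspec[OF rq, of "(x, a)"] that by (simp add: dist_norm)
  have "\<forall>a\<in>A. \<exists>Q. Q \<in> poly2 \<and> (\<forall>z w. cmod z \<le> 1 \<longrightarrow> cmod w \<le> 1 \<longrightarrow>
       cmod (Q (z + w, z * w) - F a (of_real r * (z + w), of_real (r\<^sup>2) * (z * w))) \<le> d)"
  proof
    fix a assume a: "a \<in> A"
    show "\<exists>Q. Q \<in> poly2 \<and> (\<forall>z w. cmod z \<le> 1 \<longrightarrow> cmod w \<le> 1 \<longrightarrow>
       cmod (Q (z + w, z * w) - F a (of_real r * (z + w), of_real (r\<^sup>2) * (z * w))) \<le> d)"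
      by (rule sym_bidisc_polynomial_approximation[OF F[OF a] Fa1[OF a] r d(1)]) blast+
  qed
  from bchoice[OF this] obtain Q where Q: "\<And>a. a \<in> A \<Longrightarrow> Q a \<in> poly2"
    "\<And>a z w. a \<in> A \<Longrightarrow> cmod z \<le> 1 \<Longrightarrow> cmod w \<le> 1 \<Longrightarrow>
       cmod (Q a (z + w, z * w) - F a (of_real r * (z + w), of_real (r\<^sup>2) * (z * w))) \<le> d" by blast
  show ?thesis
  proof (intro exI[of _ Q] conjI allI ballI impI)
    show "\<And>a. a \<in> A \<Longrightarrow> Q a \<in> poly2" by (rule Q(1))
  next
    fix l1 l2 :: complex assume l: "cmod l1 = 1" "cmod l2 = 1"
    define x where "x = (of_real r * (l1 + l2), of_real (r\<^sup>2) * (l1 * l2))"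
    have "of_real r * l1 \<in> ball 0 1" "of_real r * l2 \<in> ball 0 1" using l r by (auto simp: norm_mult)
    moreover have "x = (of_real r * l1 + of_real r * l2, (of_real r * l1) * (of_real r * l2))"
      by (simp add: x_def algebra_simps power2_eq_square)
    ultimately have x: "x \<in> sym_bidisc" unfolding sym_bidisc_def by blast
    have "(\<Sum>a\<in>A. (cmod (Q a (l1 + l2, l1 * l2)))\<^sup>2) \<le> (\<Sum>a\<in>A. (cmod (F a x))\<^sup>2 + 3 * d)"
    proof (rule sum_mono)
      fix a assume a: "a \<in> A"
      define f where "f = cmod (F a x)"
      have f: "0 \<le> f" "f \<le> 1" using Fa1[OF a x] by (auto simp: f_def)
      have "cmod (Q a (l1 + l2, l1 * l2)) \<le> f + d"
        using Q(2)[OF a, of l1 l2] l norm_triangle_ineq2[of "Q a (l1 + l2, l1 * l2)" "F a x"]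
        by (simp add: x_def f_def)
      then have "(cmod (Q a (l1 + l2, l1 * l2)))\<^sup>2 \<le> (f + d)\<^sup>2" by (intro power_mono) auto
      also have "\<dots> = f\<^sup>2 + 2 * (f * d) + d * d" by (simp add: power2_eq_square algebra_simps)
      also have "\<dots> \<le> f\<^sup>2 + 2 * (1 * d) + 1 * d"
        using f d by (intro add_mono mult_left_mono mult_right_mono) auto
      finally show "(cmod (Q a (l1 + l2, l1 * l2)))\<^sup>2 \<le> (cmod (F a x))\<^sup>2 + 3 * d" by (simp add: f_def)
    qed
    also have "\<dots> = (\<Sum>a\<in>A. (cmod (F a x))\<^sup>2) + N * (3 * d)" by (simp add: sum.distrib N_def)
    also have "\<dots> \<le> 1 + \<delta>" using F1[OF x] dN by simp
    finally show "(\<Sum>a\<in>A. (cmod (Q a (l1 + l2, l1 * l2)))\<^sup>2) \<le> 1 + \<delta>" .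
  next
    fix x a assume x: "x \<in> Z" and a: "a \<in> A"
    then have "x \<in> sym_bidisc" using Z by blast
    then obtain l1 l2 where l: "x = (l1 + l2, l1 * l2)" "cmod l1 < 1" "cmod l2 < 1"
      by (auto simp: sym_bidisc_def)
    have "cmod (Q a x - F a (of_real r * fst x, of_real (r\<^sup>2) * snd x)) \<le> d"
      using Q(2)[OF a, of l1 l2] l by simp
    moreover have "cmod (F a (of_real r * fst x, of_real (r\<^sup>2) * snd x) - F a x) < \<delta> / 2" by (rule rZ[OF x a])
    ultimately show "cmod (Q a x - F a x) \<le> \<delta>"
      using d(2) norm_triangle_ineq[of "Q a x - F a (of_real r * fst x, of_real (r\<^sup>2) * snd x)"
          "F a (of_real r * fst x, of_real (r\<^sup>2) * snd x) - F a x"] by simp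
  qed
qed

lemma hform_plus_diagonal:
  assumes "finite T"
  shows "hform T (\<lambda>i j. G i j * (k i j + (if i = j then of_real \<tau> else 0))) x x =
    hform T (\<lambda>i j. G i j * k i j) x x + of_real \<tau> * (\<Sum>i\<in>T. G i i * of_real ((cmod (x i))\<^sup>2))"
proof -
  have "hform T (\<lambda>i j. G i j * (k i j + (if i = j then of_real \<tau> else 0))) x x
     = hform T (\<lambda>i j. G i j * k i j + (if i = j then of_real \<tau> * G i i else 0)) x x"
    by (rule hform_cong) (auto simp: algebra_simps)
  then show ?thesis
    unfolding hform_matrix_add hform_diagonal[OF assms] by (simp add: sum_distrib_left mult.assoc)
qed

text \<open>With \<xi> a = \<phi> a x the combination y of the von Neumann inequality tends to
  \<epsilon> x by the corona identity. The limit reads \<epsilon>^2 <K x, x> \<le> sum of <K \<xi>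
  a, \<xi> a>, which is positivity of the kernel in (2).\<close>

lemma corona_solution_imp_positive:
  fixes n :: nat and \<phi> F :: "nat \<Rightarrow> complex \<times> complex \<Rightarrow> complex" and \<epsilon> :: real
  assumes F: "\<And>i. i \<in> {1..n} \<Longrightarrow> holomorphic_on_C2 (F i) sym_bidisc"
    and F1: "\<And>x. x \<in> sym_bidisc \<Longrightarrow> (\<Sum>i=1..n. (cmod (F i x))\<^sup>2) \<le> 1"
    and \<phi>F: "\<And>x. x \<in> sym_bidisc \<Longrightarrow> (\<Sum>i=1..n. \<phi> i x * F i x) = of_real \<epsilon>"
    and k: "k \<in> AK"
  shows "psd_on pentablock (\<lambda>z w. ((\<Sum>j=1..n. \<phi> j (snd z) * cnj (\<phi> j (snd w))) - of_real (\<epsilon>\<^sup>2)) * k z w)"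
  unfolding psd_on_iff
proof (intro allI impI)
  fix T assume T: "finite T \<and> T \<subseteq> pentablock"
  then have finT: "finite T" and TG: "\<And>i. i \<in> T \<Longrightarrow> snd i \<in> sym_bidisc" using snd_pentablock by auto
  define M where "M = (\<lambda>z w. (\<Sum>j=1..n. \<phi> j (snd (z :: complex \<times> complex \<times> complex)) * cnj (\<phi> j (snd (w :: complex \<times> complex \<times> complex)))) - complex_of_real (\<epsilon>\<^sup>2))"
  define s where "s = (\<lambda>i :: complex \<times> complex \<times> complex. fst (snd i))"
  define p where "p = (\<lambda>i :: complex \<times> complex \<times> complex. snd (snd i))"
  \<comment> \<open>Half of (2 - \<alpha> s i) cnj (2 - \<alpha> s j) (1 -
    \<open>Phi \<alpha>\<close> cnj \<open>Phi \<alpha>\<close>) for |\<alpha>| = 1: clearing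
    denominators makes the test linear in \<alpha> and cnj \<alpha>.\<close>
  define G where "G = (\<lambda>\<alpha> i j. 2 * (1 - p i * cnj (p j)) - \<alpha> * (s i - p i * cnj (s j)) - cnj \<alpha> * (cnj (s j) - s i * cnj (p j)))"
  have sp: "(s i, p i) \<in> sym_bidisc" if "i \<in> T" for i using TG[OF that] by (simp add: s_def p_def)
  have p1: "cmod (p i) < 1" if "i \<in> T" for i using sym_bidisc_bounds(2)[OF sp[OF that]] .
  have kT: "pos_on T k" using k T unfolding AK_def kernel_on_def psd_on_iff by blast
  have Gk: "0 \<le> Re (hform T (\<lambda>i j. G \<alpha> i j * k i j) x x)" if \<alpha>: "cmod \<alpha> = 1" for \<alpha> x
  proof -
    have "psd_on pentablock (\<lambda>z w. (1 - Phi \<alpha> (snd z) * cnj (Phi \<alpha> (snd w))) * k z w)"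
      using k \<alpha> unfolding AK_def by auto
    then have "pos_on T (\<lambda>z w. (1 - Phi \<alpha> (snd z) * cnj (Phi \<alpha> (snd w))) * k z w)"
      using T unfolding psd_on_iff by blast
    from pos_on_congruence[OF this, of "\<lambda>i. 2 - \<alpha> * s i"]
    have "hform T (\<lambda>z w. (2 - \<alpha> * s z) * cnj (2 - \<alpha> * s w) * ((1 - Phi \<alpha> (snd z) * cnj (Phi \<alpha> (snd w))) * k z w)) x x \<in> \<real>\<^sub>\<ge>\<^sub>0"
      unfolding pos_on_def by blast
    also have "hform T (\<lambda>z w. (2 - \<alpha> * s z) * cnj (2 - \<alpha> * s w) * ((1 - Phi \<alpha> (snd z) * cnj (Phi \<alpha> (snd w))) * k z w)) x x
       = hform T (\<lambda>i j. 2 * (G \<alpha> i j * k i j)) x x"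
    proof (rule hform_cong)
      fix i j assume ij: "i \<in> T" "j \<in> T"
      have num: "(2 - \<alpha> * s i) * Phi \<alpha> (snd i) = 2 * \<alpha> * p i - s i" if "i \<in> T" for i
        using Phi_denominator_nonzero[OF sp[OF that], of \<alpha>] \<alpha> by (simp add: Phi_def s_def p_def case_prod_beta)
      have one: "\<alpha> * cnj \<alpha> = 1" using complex_norm_square[of \<alpha>] \<alpha> by simp
      have "(2 - \<alpha> * s i) * cnj (2 - \<alpha> * s j) * (1 - Phi \<alpha> (snd i) * cnj (Phi \<alpha> (snd j)))
         = (2 - \<alpha> * s i) * cnj (2 - \<alpha> * s j) - ((2 - \<alpha> * s i) * Phi \<alpha> (snd i)) * cnj ((2 - \<alpha> * s j) * Phi \<alpha> (snd j))"
        by (simp add: algebra_simps)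
      also have "\<dots> = (2 - \<alpha> * s i) * (2 - cnj \<alpha> * cnj (s j)) - (2 * \<alpha> * p i - s i) * (2 * cnj \<alpha> * cnj (p j) - cnj (s j))"
        unfolding num[OF ij(1)] num[OF ij(2)] by simp
      also have "\<dots> = 2 * G \<alpha> i j"
      proof -
        have "a * b = 1 \<Longrightarrow> (2 - a * u) * (2 - b * v) - (2 * a * q - u) * (2 * b * q' - v)
          = 2 * (2 * (1 - q * q') - a * (u - q * v) - b * (v - u * q'))" for a b u v q q' :: complex
          by algebra
        from this[OF one] show ?thesis by (simp only: G_def)
      qed
      finally show "(2 - \<alpha> * s i) * cnj (2 - \<alpha> * s j) * ((1 - Phi \<alpha> (snd i) * cnj (Phi \<alpha> (snd j))) * k i j) = 2 * (G \<alpha> i j * k i j)"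
        by (simp only: mult.assoc[symmetric])
    qed auto
    finally show ?thesis unfolding hform_matrix_scale by (simp add: complex_nonneg_Reals_iff)
  qed
  \<comment> \<open>Nonnegative diagonal entries of G ensure that adding \<tau> to the diagonal of k
    does not spoil the inequality.\<close>
  have Gd: "0 \<le> Re (G \<alpha> i i)" if \<alpha>: "cmod \<alpha> = 1" and i: "i \<in> T" for \<alpha> i
  proof -
    have "cmod (s i - cnj (s i) * p i) + (cmod (p i))\<^sup>2 < 1" using sp[OF i] by (simp add: mem_sym_bidisc_iff)
    moreover have "Re (\<alpha> * (s i - cnj (s i) * p i)) \<le> cmod (s i - cnj (s i) * p i)"
      using complex_Re_le_cmod[of "\<alpha> * (s i - cnj (s i) * p i)"] \<alpha> by (simp add: norm_mult)
    ultimately have le: "Re (\<alpha> * (s i - cnj (s i) * p i)) \<le> 1 - (cmod (p i))\<^sup>2" by (smt (verit))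
    have "Re (G \<alpha> i i) = 2 * (1 - (cmod (p i))\<^sup>2) - 2 * Re (\<alpha> * (s i - cnj (s i) * p i))"
      unfolding G_def cmod_power2 by (simp add: power2_eq_square algebra_simps)
    then show ?thesis using mult_left_mono[OF le, of 2] by (simp only:) simp
  qed
  show "pos_on T (\<lambda>z w. ((\<Sum>j=1..n. \<phi> j (snd z) * cnj (\<phi> j (snd w))) - of_real (\<epsilon>\<^sup>2)) * k z w)"
    unfolding pos_on_def M_def[symmetric]
  proof
    fix x
    show "hform T (\<lambda>z w. ((\<Sum>j=1..n. \<phi> j (snd z) * cnj (\<phi> j (snd w))) - of_real (\<epsilon>\<^sup>2)) * k z w) x x \<in> \<real>\<^sub>\<ge>\<^sub>0"
    proof (rule nonneg_Reals_limit)
      fix \<tau> :: real assume \<tau>: "0 < \<tau>"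
      \<comment> \<open>Definiteness has to be forced: k itself may be degenerate on T.\<close>
      define K where "K = (\<lambda>i j. k i j + (if i = j then complex_of_real \<tau> else 0))"
      have Kh: "hermitian_on T K"
        unfolding K_def
        by (rule hermitian_on_add[OF pos_on_imp_hermitian[OF finT kT]]) (auto simp: hermitian_on_def)
      have Gsum: "Re (\<Sum>i\<in>T. H i * of_real ((cmod (x i))\<^sup>2)) = (\<Sum>i\<in>T. Re (H i) * (cmod (x i))\<^sup>2)" for H x
        by (simp del: of_real_power)
      have gam: "0 \<le> Re (hform T (\<lambda>i j. G \<alpha> i j * K i j) x x)" if \<alpha>: "cmod \<alpha> = 1" for \<alpha> x
      proof -
        have "0 \<le> (\<Sum>i\<in>T. Re (G \<alpha> i i) * (cmod (x i))\<^sup>2)" using Gd[OF \<alpha>] by (intro sum_nonneg) auto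
        then have "0 \<le> \<tau> * Re (\<Sum>i\<in>T. G \<alpha> i i * of_real ((cmod (x i))\<^sup>2))" unfolding Gsum using \<tau> by simp
        then show ?thesis unfolding K_def hform_plus_diagonal[OF finT] using Gk[OF \<alpha>, of x] by simp
      qed
      have pd: "0 < Re (hform T (\<lambda>i j. (1 - p i * cnj (p j)) * K i j) x x)" if nz: "\<exists>i\<in>T. x i \<noteq> 0" for x
      proof -
        \<comment> \<open>Averaging \<alpha> = 1 and \<alpha> = -1 cancels the linear terms, so
          admissibility of k already contains positivity of (1 - p cnj p) k.\<close>
        have "hform T (\<lambda>i j. G 1 i j * k i j + G (- 1) i j * k i j) x x = hform T (\<lambda>i j. 4 * ((1 - p i * cnj (p j)) * k i j)) x x"
          by (rule hform_cong) (auto simp: G_def algebra_simps)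
        from arg_cong[OF this, of Re] have "Re (hform T (\<lambda>i j. G 1 i j * k i j) x x) + Re (hform T (\<lambda>i j. G (- 1) i j * k i j) x x)
           = 4 * Re (hform T (\<lambda>i j. (1 - p i * cnj (p j)) * k i j) x x)"
          unfolding hform_matrix_add hform_matrix_scale by simp
        then have "0 \<le> Re (hform T (\<lambda>i j. (1 - p i * cnj (p j)) * k i j) x x)"
          using Gk[of 1 x] Gk[of "-1" x] by simp
        moreover have "0 < (\<Sum>i\<in>T. Re (1 - p i * cnj (p i)) * (cmod (x i))\<^sup>2)"
        proof -
          obtain j where j: "j \<in> T" "x j \<noteq> 0" using nz by blast
          have pos: "0 < Re (1 - p i * cnj (p i))" if "i \<in> T" for i
            using p1[OF that] unfolding complex_norm_square[symmetric] by (simp add: power_less_one_iff)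
          show ?thesis
          proof (rule sum_pos2[OF finT j(1)])
            show "0 < Re (1 - p j * cnj (p j)) * (cmod (x j))\<^sup>2" using pos[OF j(1)] j(2) by (intro mult_pos_pos) auto
            show "0 \<le> Re (1 - p i * cnj (p i)) * (cmod (x i))\<^sup>2" if "i \<in> T" for i
              using pos[OF that] by (intro mult_nonneg_nonneg) auto
          qed
        qed
        ultimately show ?thesis unfolding K_def hform_plus_diagonal[OF finT] using \<tau> Gsum[of "\<lambda>i. 1 - p i * cnj (p i)" x]
          by (simp add: add_nonneg_pos)
      qed
      \<comment> \<open>Each \<phi> a multiplies the test vector, so that summing Q a \<xi> a
        approximates the corona sum times x. The polynomial bounds 1 + 1 / (m + 1) make the factor 2
        - c2 tend to 1.\<close>
      define \<xi> where "\<xi> = (\<lambda>a i. \<phi> a (snd i) * x i)"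
      define \<Sigma> where "\<Sigma> = (\<Sum>a=1..n. Re (hform T K (\<xi> a) (\<xi> a)))"
      have "\<forall>m. \<exists>Q. (\<forall>a\<in>{1..n}. Q a \<in> poly2) \<and>
        (\<forall>l1 l2. cmod l1 = 1 \<longrightarrow> cmod l2 = 1 \<longrightarrow> (\<Sum>a=1..n. (cmod (Q a (l1 + l2, l1 * l2)))\<^sup>2) \<le> 1 + inverse (real (Suc m))) \<and>
        (\<forall>x\<in>snd ` T. \<forall>a\<in>{1..n}. cmod (Q a x - F a x) \<le> inverse (real (Suc m)))"
        by (intro allI corona_polynomial_approximation F F1) (use finT TG in auto)
      then obtain Q where Q: "\<And>m a. a \<in> {1..n} \<Longrightarrow> Q m a \<in> poly2"
        "\<And>m l1 l2. cmod l1 = 1 \<Longrightarrow> cmod l2 = 1 \<Longrightarrow> (\<Sum>a=1..n. (cmod (Q m a (l1 + l2, l1 * l2)))\<^sup>2) \<le> 1 + inverse (real (Suc m))"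
        "\<And>m x a. x \<in> snd ` T \<Longrightarrow> a \<in> {1..n} \<Longrightarrow> cmod (Q m a x - F a x) \<le> inverse (real (Suc m))"
        by metis
      define y where "y = (\<lambda>m i. \<Sum>a=1..n. Q m a (s i, p i) * \<xi> a i)"
      have vN: "(2 - (1 + inverse (real (Suc m)))) * Re (hform T K (y m) (y m)) \<le> \<Sigma>" for m
        unfolding y_def \<Sigma>_def
        by (rule gamma_contraction_von_neumann[OF finT p1 Kh pd gam[unfolded G_def] Q(1) Q(2)])
      have ylim: "(\<lambda>m. y m i) \<longlonglongrightarrow> of_real \<epsilon> * x i" if i: "i \<in> T" for i
      proof -
        have "(\<lambda>m. Q m a (s i, p i)) \<longlonglongrightarrow> F a (s i, p i)" if a: "a \<in> {1..n}" for a
        proof (rule LIM_zero_cancel, rule Lim_null_comparison[OF _ LIMSEQ_inverse_real_of_nat])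
          have "snd i = (s i, p i)" by (simp add: s_def p_def)
          then show "\<forall>\<^sub>F m in sequentially. norm (Q m a (s i, p i) - F a (s i, p i)) \<le> inverse (real (Suc m))"
            using Q(3)[of "(s i, p i)" a] i a by (intro always_eventually) (metis imageI)
        qed
        then have "(\<lambda>m. y m i) \<longlonglongrightarrow> (\<Sum>a=1..n. F a (s i, p i) * \<xi> a i)"
          unfolding y_def by (intro tendsto_intros)
        also have "(\<Sum>a=1..n. F a (s i, p i) * \<xi> a i) = (\<Sum>a=1..n. \<phi> a (s i, p i) * F a (s i, p i)) * x i"
          unfolding sum_distrib_right by (intro sum.cong refl) (simp add: \<xi>_def s_def p_def)
        finally show ?thesis unfolding \<phi>F[OF sp[OF i]] .
      qed
      have "(\<lambda>m. (2 - (1 + inverse (real (Suc m)))) * Re (hform T K (y m) (y m)))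
         \<longlonglongrightarrow> (2 - (1 + 0)) * Re (hform T K (\<lambda>i. of_real \<epsilon> * x i) (\<lambda>i. of_real \<epsilon> * x i))"
        unfolding hform_def by (intro tendsto_intros ylim LIMSEQ_inverse_real_of_nat)
      then have "(2 - (1 + 0)) * Re (hform T K (\<lambda>i. of_real \<epsilon> * x i) (\<lambda>i. of_real \<epsilon> * x i)) \<le> \<Sigma>"
        by (rule LIMSEQ_le_const2) (use vN in auto)
      moreover have "hform T K (\<lambda>i. of_real \<epsilon> * x i) (\<lambda>i. of_real \<epsilon> * x i) = of_real (\<epsilon>\<^sup>2) * hform T K x x"
        unfolding hform_scale_left hform_scale_right by (simp add: power2_eq_square)
      ultimately have main: "\<epsilon>\<^sup>2 * Re (hform T K x x) \<le> \<Sigma>" by simp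
      have split: "hform T (\<lambda>i j. M i j * K i j) x x = (\<Sum>a=1..n. hform T K (\<xi> a) (\<xi> a)) - of_real (\<epsilon>\<^sup>2) * hform T K x x"
      proof -
        have "(\<Sum>a=1..n. hform T K (\<xi> a) (\<xi> a)) = hform T (\<lambda>i j. (\<Sum>a=1..n. \<phi> a (snd i) * cnj (\<phi> a (snd j))) * K i j) x x"
        proof -
          have "(\<Sum>a=1..n. hform T K (\<xi> a) (\<xi> a)) = (\<Sum>i\<in>T. \<Sum>a=1..n. \<Sum>j\<in>T. K i j * \<xi> a i * cnj (\<xi> a j))"
            unfolding hform_def by (rule sum.swap)
          also have "\<dots> = (\<Sum>i\<in>T. \<Sum>j\<in>T. \<Sum>a=1..n. K i j * \<xi> a i * cnj (\<xi> a j))"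
            by (intro sum.cong refl sum.swap)
          also have "\<dots> = hform T (\<lambda>i j. (\<Sum>a=1..n. \<phi> a (snd i) * cnj (\<phi> a (snd j))) * K i j) x x"
            unfolding hform_def sum_distrib_right by (intro sum.cong refl) (simp add: \<xi>_def mult_ac)
          finally show ?thesis .
        qed
        then show ?thesis by (simp add: M_def left_diff_distrib hform_matrix_diff hform_matrix_scale del: of_real_power)
      qed
      have MKh: "hermitian_on T (\<lambda>i j. M i j * K i j)"
        unfolding hermitian_on_def
      proof (intro ballI)
        fix i j assume "i \<in> T" "j \<in> T"
        then have "K j i = cnj (K i j)" using Kh unfolding hermitian_on_def by blast
        moreover have "M j i = cnj (M i j)" by (simp add: M_def mult.commute)
        ultimately show "M j i * K j i = cnj (M i j * K i j)" by simp
      qed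
      have "0 \<le> Re (hform T (\<lambda>i j. M i j * K i j) x x)"
        unfolding split using main by (simp add: \<Sigma>_def del: of_real_power)
      then have "hform T (\<lambda>i j. M i j * K i j) x x \<in> \<real>\<^sub>\<ge>\<^sub>0"
        by (subst hform_hermitian_real[OF MKh]) (simp only: nonneg_Reals_of_real_iff)
      then show "hform T (\<lambda>z w. ((\<Sum>j=1..n. \<phi> j (snd z) * cnj (\<phi> j (snd w))) - of_real (\<epsilon>\<^sup>2)) * k z w) x x
         + of_real \<tau> * (\<Sum>i\<in>T. M i i * of_real ((cmod (x i))\<^sup>2)) \<in> \<real>\<^sub>\<ge>\<^sub>0"
        unfolding K_def hform_plus_diagonal[OF finT] M_def .
    qed
  qed
qed

text \<open>Multiplication by k pairs each of the three terms with its own admissibility condition: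
  \<xi> with \<open>JJ\<close>, nabla with \<open>jj\<close>, and \<delta> by a Schur
  product.\<close>

lemma agler_decomposition_imp_positive:
  assumes \<xi>: "positive_kernel_on pentablock \<xi>" and nabla: "positive_kernel_on pentablock nabla"
    and \<delta>: "psd_on pentablock \<delta>"
    and eq: "\<And>z w. z \<in> pentablock \<Longrightarrow> w \<in> pentablock \<Longrightarrow> M z w =
        \<xi> z w (\<lambda>\<alpha>. 1 - JJ z \<alpha> * cnj (JJ w \<alpha>)) + nabla z w (\<lambda>\<alpha>. 1 - jj z \<alpha> * cnj (jj w \<alpha>))
        + (1 - fst (snd z) * cnj (fst (snd w)) / 4) * \<delta> z w"
    and k: "k \<in> AK"
  shows "psd_on pentablock (\<lambda>z w. M z w * k z w)"
proof (rule psd_on_cong)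
  have kp: "psd_on pentablock (\<lambda>z w. (1 - fst (snd z) * cnj (fst (snd w)) / 4) * k z w)"
    "\<And>\<alpha>. \<alpha> \<in> cball 0 1 \<Longrightarrow> psd_on pentablock (\<lambda>z w. (1 - jj z \<alpha> * cnj (jj w \<alpha>)) * k z w)"
    "\<And>\<alpha>. \<alpha> \<in> cball 0 1 \<Longrightarrow> psd_on pentablock (\<lambda>z w. (1 - JJ z \<alpha> * cnj (JJ w \<alpha>)) * k z w)"
    using k unfolding AK_def jj_def JJ_def by (auto dest: bspec[of _ _ 0])
  have 1: "psd_on pentablock (\<lambda>z w. \<xi> z w (\<lambda>\<alpha>. 1 - JJ z \<alpha> * cnj (JJ w \<alpha>)) * k z w)"
    unfolding psd_on_iff
  proof (intro allI impI)
    fix S :: "(complex \<times> complex \<times> complex) set" assume S: "finite S \<and> S \<subseteq> pentablock"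
    show "pos_on S (\<lambda>z w. \<xi> z w (\<lambda>\<alpha>. 1 - JJ z \<alpha> * cnj (JJ w \<alpha>)) * k z w)"
      by (rule pos_on_functional_product[OF _ _ \<xi>])
        (use S kp(3) in \<open>auto simp: psd_on_iff intro!: C_disc_one_minus JJ_C_disc\<close>)
  qed
  have 2: "psd_on pentablock (\<lambda>z w. nabla z w (\<lambda>\<alpha>. 1 - jj z \<alpha> * cnj (jj w \<alpha>)) * k z w)"
    unfolding psd_on_iff
  proof (intro allI impI)
    fix S :: "(complex \<times> complex \<times> complex) set" assume S: "finite S \<and> S \<subseteq> pentablock"
    show "pos_on S (\<lambda>z w. nabla z w (\<lambda>\<alpha>. 1 - jj z \<alpha> * cnj (jj w \<alpha>)) * k z w)"
      by (rule pos_on_functional_product[OF _ _ nabla])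
        (use S kp(2) in \<open>auto simp: psd_on_iff intro!: C_disc_one_minus jj_C_disc\<close>)
  qed
  have 3: "psd_on pentablock (\<lambda>z w. \<delta> z w * ((1 - fst (snd z) * cnj (fst (snd w)) / 4) * k z w))"
    unfolding psd_on_iff
  proof (intro allI impI)
    fix S :: "(complex \<times> complex \<times> complex) set" assume S: "finite S \<and> S \<subseteq> pentablock"
    then have "finite S" by blast
    moreover have "pos_on S \<delta>" using \<delta> S unfolding psd_on_iff by blast
    moreover have "pos_on S (\<lambda>z w. (1 - fst (snd z) * cnj (fst (snd w)) / 4) * k z w)"
      using kp(1) S unfolding psd_on_iff by blast
    ultimately show "pos_on S (\<lambda>z w. \<delta> z w * ((1 - fst (snd z) * cnj (fst (snd w)) / 4) * k z w))"
      by (rule schur_product)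
  qed
  show "psd_on pentablock (\<lambda>z w. (\<xi> z w (\<lambda>\<alpha>. 1 - JJ z \<alpha> * cnj (JJ w \<alpha>)) * k z w
      + nabla z w (\<lambda>\<alpha>. 1 - jj z \<alpha> * cnj (jj w \<alpha>)) * k z w)
      + \<delta> z w * ((1 - fst (snd z) * cnj (fst (snd w)) / 4) * k z w))"
    by (intro psd_on_add 1 2 3)
qed (simp add: eq algebra_simps)

theorem theorem3p6:
  fixes n :: nat
    and \<phi> :: "nat \<Rightarrow> complex \<times> complex \<Rightarrow> complex"
    and \<epsilon> :: real
  assumes "1 \<le> n"
    and "\<forall>j\<in>{1..n}. \<phi> j \<in> H_infinity sym_bidisc"
    and "0 < \<epsilon>"
  shows
    "((\<exists>f :: nat \<Rightarrow> complex \<times> complex \<Rightarrow> complex.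
         (\<forall>i\<in>{1..n}. f i \<in> H_infinity sym_bidisc) \<and>
         (SUP z\<in>sym_bidisc. \<Sum>i=1..n. (cmod (f i z))\<^sup>2) \<le> 1 / \<epsilon>\<^sup>2 \<and>
         (\<forall>z\<in>sym_bidisc. (\<Sum>i=1..n. \<phi> i z * f i z) = 1))
      \<longleftrightarrow>
      (\<forall>k\<in>AK. psd_on pentablock
         (\<lambda>z w. ((\<Sum>j=1..n. \<phi> j (snd z) * cnj (\<phi> j (snd w))) - of_real (\<epsilon>\<^sup>2)) * k z w)))
     \<and>
     ((\<forall>k\<in>AK. psd_on pentablock
         (\<lambda>z w. ((\<Sum>j=1..n. \<phi> j (snd z) * cnj (\<phi> j (snd w))) - of_real (\<epsilon>\<^sup>2)) * k z w))
      \<longleftrightarrow>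
      (\<exists>\<xi> nabla \<delta>.
         positive_kernel_on pentablock \<xi> \<and> positive_kernel_on pentablock nabla \<and>
         psd_on pentablock \<delta> \<and>
         (\<forall>z\<in>pentablock. \<forall>w\<in>pentablock.
            (\<Sum>j=1..n. \<phi> j (snd z) * cnj (\<phi> j (snd w))) - of_real (\<epsilon>\<^sup>2) =
              \<xi> z w (\<lambda>\<alpha>. 1 - JJ z \<alpha> * cnj (JJ w \<alpha>))
            + nabla z w (\<lambda>\<alpha>. 1 - jj z \<alpha> * cnj (jj w \<alpha>))
            + (1 - fst (snd z) * cnj (fst (snd w)) / 4) * \<delta> z w)))"
    (is "(?corona \<longleftrightarrow> ?pos) \<and> (?pos \<longleftrightarrow> ?agler)")
proof -
  let ?G = sym_bidisc
  define M where "M = (\<lambda>x y. (\<Sum>j=1..n. \<phi> j x * cnj (\<phi> j y)) - complex_of_real (\<epsilon>\<^sup>2))"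
  have Mh: "M y x = cnj (M x y)" for x y by (simp add: M_def mult.commute)
  have "(0, 0) \<in> ?G" by (simp add: mem_sym_bidisc_iff)
  then have Gne: "?G \<noteq> {}" by blast
  have corona_pos: ?pos if ?corona
  proof
    fix k assume k: "k \<in> AK"
    obtain f where f: "\<And>i. i \<in> {1..n} \<Longrightarrow> f i \<in> H_infinity ?G"
      "(SUP z\<in>?G. \<Sum>i=1..n. (cmod (f i z))\<^sup>2) \<le> 1 / \<epsilon>\<^sup>2"
      "\<And>z. z \<in> ?G \<Longrightarrow> (\<Sum>i=1..n. \<phi> i z * f i z) = 1" using \<open>?corona\<close> by blast
    have "\<forall>i\<in>{1..n}. \<exists>B. \<forall>x\<in>?G. cmod (f i x) \<le> B"
      using f(1) by (auto simp: H_infinity_def bounded_iff)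
    from bchoice[OF this] obtain B where B: "\<And>i x. i \<in> {1..n} \<Longrightarrow> x \<in> ?G \<Longrightarrow> cmod (f i x) \<le> B i" by blast
    \<comment> \<open>The supremum bounds individual values only for a set bounded above;
      boundedness of each f i provides this.\<close>
    have "bdd_above ((\<lambda>z. \<Sum>i=1..n. (cmod (f i z))\<^sup>2) ` ?G)"
      by (rule bdd_aboveI2[where M = "\<Sum>i=1..n. (B i)\<^sup>2"]) (intro sum_mono power_mono B norm_ge_zero)
    then have sq: "(\<Sum>i=1..n. (cmod (f i x))\<^sup>2) \<le> 1 / \<epsilon>\<^sup>2" if "x \<in> ?G" for x
      using cSUP_upper[OF that] f(2) order_trans by blast
    show "psd_on pentablock (\<lambda>z w. ((\<Sum>j=1..n. \<phi> j (snd z) * cnj (\<phi> j (snd w))) - of_real (\<epsilon>\<^sup>2)) * k z w)"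
    \<comment> \<open>Scaling by \<epsilon> normalizes the row bound 1 / \<epsilon>^2 to 1 and the
      corona identity to \<epsilon>.\<close>
    proof (rule corona_solution_imp_positive[where F = "\<lambda>i x. (\<lambda>_. of_real \<epsilon>) x * f i x", OF _ _ _ k])
      show "holomorphic_on_C2 (\<lambda>x. (\<lambda>_. of_real \<epsilon>) x * f i x) ?G" if "i \<in> {1..n}" for i
        using f(1)[OF that] unfolding H_infinity_def
        by (intro holomorphic_on_C2_mult holomorphic_on_C2_const open_sym_bidisc) simp
      fix x assume x: "x \<in> ?G"
      have "(\<Sum>i=1..n. (cmod ((\<lambda>_. of_real \<epsilon>) x * f i x))\<^sup>2) = \<epsilon>\<^sup>2 * (\<Sum>i=1..n. (cmod (f i x))\<^sup>2)"
        by (simp add: norm_mult power_mult_distrib sum_distrib_left)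
      also have "\<dots> \<le> \<epsilon>\<^sup>2 * (1 / \<epsilon>\<^sup>2)" by (intro mult_left_mono sq x) simp
      also have "\<dots> = 1" using \<open>0 < \<epsilon>\<close> by simp
      finally show "(\<Sum>i=1..n. (cmod ((\<lambda>_. of_real \<epsilon>) x * f i x))\<^sup>2) \<le> 1" .
      have "(\<Sum>i=1..n. \<phi> i x * ((\<lambda>_. of_real \<epsilon>) x * f i x)) = of_real \<epsilon> * (\<Sum>i=1..n. \<phi> i x * f i x)"
        by (simp add: sum_distrib_left mult_ac)
      then show "(\<Sum>i=1..n. \<phi> i x * ((\<lambda>_. of_real \<epsilon>) x * f i x)) = of_real \<epsilon>" using f(3)[OF x] by simp
    qed
  qed
  have dec: "\<exists>ps. fst ` set ps \<subseteq> tests \<and> (\<forall>x\<in>S. \<forall>y\<in>S. M x y + (if x = y then of_real \<eta> else 0) = agler_sum ps x y)"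
    if ?pos "finite S" "S \<subseteq> ?G" "0 < \<eta>" for S \<eta>
  proof -
    have "psd_on pentablock (\<lambda>z w. M (snd z) (snd w) * k z w)" if "k \<in> AK" for k
      using \<open>?pos\<close> that unfolding M_def by blast
    from finite_agler_decomposition[OF Mh this that(2-4)] show ?thesis by metis
  qed
  have pos_corona: ?corona if ?pos
  proof -
    have "\<exists>F. (\<forall>i\<in>{1..n}. holomorphic_on_C2 (F i) ?G) \<and>
      (\<forall>x\<in>?G. (\<Sum>i=1..n. (cmod (F i x))\<^sup>2) \<le> 1) \<and>
      (\<forall>x\<in>?G. (\<Sum>i=1..n. \<phi> i x * F i x) = of_real \<epsilon>)"
    proof (rule corona_solution_from_finite)
      fix S and \<eta> :: real assume S: "finite S" "S \<subseteq> ?G" and \<eta>: "0 < \<eta>"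
      \<comment> \<open>A diagonal perturbation \<eta>^2 produces the error sqrt (\<eta>^2) =
        \<eta>.\<close>
      have \<eta>2: "0 < \<eta>\<^sup>2" using \<eta> by simp
      obtain ps where ps: "fst ` set ps \<subseteq> tests"
        "\<And>x y. x \<in> S \<Longrightarrow> y \<in> S \<Longrightarrow> M x y + (if x = y then of_real (\<eta>\<^sup>2) else 0) = agler_sum ps x y"
        using dec[OF \<open>?pos\<close> S \<eta>2] by blast
      show "\<exists>F. (\<forall>i\<in>{1..n}. holomorphic_on_C2 (F i) ?G) \<and>
        (\<forall>x\<in>?G. (\<Sum>i=1..n. (cmod (F i x))\<^sup>2) \<le> 1) \<and>
        (\<forall>x\<in>S. cmod ((\<Sum>i=1..n. \<phi> i x * F i x) - of_real \<epsilon>) \<le> \<eta>)"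
        using agler_decomposition_imp_corona_approximation[OF S \<eta>2 ps(1) ps(2)[unfolded M_def]] \<eta> by simp
    qed
    then obtain F where F: "\<And>i. i \<in> {1..n} \<Longrightarrow> holomorphic_on_C2 (F i) ?G"
      "\<And>x. x \<in> ?G \<Longrightarrow> (\<Sum>i=1..n. (cmod (F i x))\<^sup>2) \<le> 1"
      "\<And>x. x \<in> ?G \<Longrightarrow> (\<Sum>i=1..n. \<phi> i x * F i x) = of_real \<epsilon>" by blast
    define f where "f = (\<lambda>i x. (\<lambda>_. of_real (1 / \<epsilon>)) x * F i x)"
    have fsq: "(\<Sum>i=1..n. (cmod (f i x))\<^sup>2) \<le> 1 / \<epsilon>\<^sup>2" if x: "x \<in> ?G" for x
    proof -
      have "(\<Sum>i=1..n. (cmod (f i x))\<^sup>2) = (1 / \<epsilon>\<^sup>2) * (\<Sum>i=1..n. (cmod (F i x))\<^sup>2)"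
        by (simp add: f_def norm_mult norm_divide power_mult_distrib power_divide sum_divide_distrib)
      also have "\<dots> \<le> (1 / \<epsilon>\<^sup>2) * 1" by (intro mult_left_mono F(2) x) simp
      finally show ?thesis by simp
    qed
    have "f i \<in> H_infinity ?G" if i: "i \<in> {1..n}" for i
    proof -
      have "cmod (f i x) \<le> 1 / \<epsilon>" if x: "x \<in> ?G" for x
      proof -
        have "(cmod (f i x))\<^sup>2 \<le> (\<Sum>i=1..n. (cmod (f i x))\<^sup>2)" using i by (intro member_le_sum) auto
        also have "\<dots> \<le> (1 / \<epsilon>)\<^sup>2" using fsq[OF x] by (simp add: power_divide)
        finally show ?thesis by (rule power2_le_imp_le) (use \<open>0 < \<epsilon>\<close> in simp)
      qed
      then have "\<forall>y\<in>f i ` ?G. cmod y \<le> 1 / \<epsilon>" by blast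
      then have "bounded (f i ` ?G)" unfolding bounded_iff by blast
      moreover have "holomorphic_on_C2 (f i) ?G"
        unfolding f_def by (intro holomorphic_on_C2_mult holomorphic_on_C2_const open_sym_bidisc F(1) i)
      ultimately show ?thesis by (simp add: H_infinity_def)
    qed
    moreover have "(SUP z\<in>?G. \<Sum>i=1..n. (cmod (f i z))\<^sup>2) \<le> 1 / \<epsilon>\<^sup>2"
      by (rule cSUP_least[OF Gne fsq])
    moreover have "(\<Sum>i=1..n. \<phi> i x * f i x) = 1" if x: "x \<in> ?G" for x
    proof -
      have "(\<Sum>i=1..n. \<phi> i x * f i x) = of_real (1 / \<epsilon>) * (\<Sum>i=1..n. \<phi> i x * F i x)"
        unfolding f_def sum_distrib_left by (intro sum.cong refl) (simp only: mult_ac)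
      then show ?thesis using F(3)[OF x] \<open>0 < \<epsilon>\<close> by simp
    qed
    ultimately show ?corona by blast
  qed
  have pos_agler: ?agler if ?pos
  proof -
    obtain \<xi> nabla where "positive_kernel_on pentablock \<xi>" "positive_kernel_on pentablock nabla"
      "\<And>z w. z \<in> pentablock \<Longrightarrow> w \<in> pentablock \<Longrightarrow> M (snd z) (snd w) =
       \<xi> z w (\<lambda>\<alpha>. 1 - JJ z \<alpha> * cnj (JJ w \<alpha>)) + nabla z w (\<lambda>\<alpha>. 1 - jj z \<alpha> * cnj (jj w \<alpha>))"
      using agler_decomposition_on_pentablock[of M, OF dec[OF \<open>?pos\<close>]] by blast
    \<comment> \<open>\<delta> = 0 is a valid witness: 1 - s cnj s / 4 is the test at \<alpha> = 0,
      whose contribution nabla can carry as a point mass at 0.\<close>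
    moreover have "psd_on pentablock (\<lambda>_ _. 0)" by (simp add: psd_on_def)
    ultimately show ?agler
      by (intro exI[of _ \<xi>] exI[of _ nabla] exI[of _ "\<lambda>_ _. 0"]) (simp add: M_def)
  qed
  have agler_pos: ?pos if ?agler
  proof
    fix k assume k: "k \<in> AK"
    obtain \<xi> nabla \<delta> where *: "positive_kernel_on pentablock \<xi>" "positive_kernel_on pentablock nabla" "psd_on pentablock \<delta>"
      "\<forall>z\<in>pentablock. \<forall>w\<in>pentablock. (\<Sum>j=1..n. \<phi> j (snd z) * cnj (\<phi> j (snd w))) - of_real (\<epsilon>\<^sup>2) =
        \<xi> z w (\<lambda>\<alpha>. 1 - JJ z \<alpha> * cnj (JJ w \<alpha>)) + nabla z w (\<lambda>\<alpha>. 1 - jj z \<alpha> * cnj (jj w \<alpha>))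
        + (1 - fst (snd z) * cnj (fst (snd w)) / 4) * \<delta> z w" using \<open>?agler\<close> by (elim exE conjE)
    show "psd_on pentablock (\<lambda>z w. ((\<Sum>j=1..n. \<phi> j (snd z) * cnj (\<phi> j (snd w))) - of_real (\<epsilon>\<^sup>2)) * k z w)"
      by (rule agler_decomposition_imp_positive[OF *(1-3) _ k]) (use *(4) in blast)
  qed
  show ?thesis using corona_pos pos_corona pos_agler agler_pos by blast
qed

end
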